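(* Let $\alpha_1,\alpha_2\in\mathbb{R}$ satisfy $0<\alpha_2<\alpha_1<\frac{1}{1+\sqrt{3/2}}$ and $\alpha_1\alpha_2>\frac1{16}$, and let $\theta\in\mathbb{R}\setminus\frac{\pi}{2}\mathbb{Z}$ be arbitrary. Define $$A_1=\begin{pmatrix}\alpha_1&0\\0&\alpha_2\end{pmatrix}\otimes\begin{pmatrix}\cos\theta&-\sin\theta\\ \sin\theta&\cos\theta\end{pmatrix},\qquad A_2=\begin{pmatrix}\cos\theta&-\sin\theta\\ \sin\theta&\cos\theta\end{pmatrix}\otimes\begin{pmatrix}\alpha_1&0\\0&\alpha_2\end{pmatrix}$$ in $\mathrm{GL}_4(\mathbb{R})$, and let $(B_1,B_2,B_3,B_4):=(A_1,A_1,A_2,A_2)\in\mathrm{GL}_4(\mathbb{R})^4$. Then there exists $(v_1,\ldots,v_4)\in(\mathbb{R}^4)^4$ such that the iterated function system $(T_1,\ldots,T_4)$ on $\mathbb{R}^4$ defined by $T_ix:=B_ix+v_i$ satisfies the strong separation condition, has $1<\dim_{\mathsf{aff}}(B_1,\ldots,B_4)<2$, and admits two mutually singular measures $m_1=\Pi_*\mu_1$, $m_2=\Pi_*\mu_2$, where $\mu_1,\mu_2$ are shift-invariant Borel probability measures on $\Sigma_4$, such that $m_1$ and $m_2$ both have Hausdorff dimension equal to $\dim_{\mathsf{aff}}(B_1,\ldots,B_4)$ and each of $m_1,m_2$ is fully supported on the attractor of $(T_1,\ldots,T_4)$.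
   Context: Kronecker product: for matrices $A=[a_{ij}]$ and $B$, $A\otimes B$ is the block matrix whose $(i,j)$ block is $a_{ij}B$. Iterated function systems: an iterated function system on $\mathbb{R}^d$ is a tuple $(T_1,\ldots,T_N)$ of contractions of $\mathbb{R}^d$ with the Euclidean distance. Its attractor is the unique nonempty compact set $Z\subset\mathbb{R}^d$ with $Z=\bigcup_{i=1}^NT_iZ$. It satisfies the strong separation condition if there is a nonempty compact set $X\subseteq\mathbb{R}^d$ such that $T_1X,\ldots,T_NX$ are pairwise disjoint subsets of $X$. Coding: $\Sigma_N:=\{1,\ldots,N\}^{\mathbb{N}}$ with the infinite product topology; the shift is $\sigma[(x_k)_{k=1}^\infty]:=(x_{k+1})_{k=1}^\infty$, and shift-invariant means $\sigma$-invariant. The coding map $\Pi\colon\Sigma_N\to\mathbb{R}^d$ is $\Pi[(x_k)_{k=1}^\infty]:=\lim_{n\to\infty}T_{x_1}\cdots T_{x_n}v$ (independent of $v\in\mathbb{R}^d$); it is a continuous surjection onto the attractor. Singular value function: for $A\in\mathrm{GL}_d(\mathbb{R})$ let $\sigma_1(A)\geq\cdots\geq\sigma_d(A)$ be its singular values. For $s\geq0$ put $\varphi^s(A):=\sigma_1(A)\cdots\sigma_{\lfloor s\rfloor}(A)\,\sigma_{\lceil s\rceil}(A)^{s-\lfloor s\rfloor}$ if $0\leq s\leq d$ (the last factor being $1$ when $s$ is an integer), and $\varphi^s(A):=|\det A|^{s/d}$ if $s\geq d$. Affinity dimension: let $P_{\varphi^s}(B_1,\ldots,B_N):=\lim_{n\to\infty}\frac1n\log\sum_{i_1,\ldots,i_n=1}^N\varphi^s(B_{i_1}\cdots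 B_{i_n})$. If $\max_i\|B_i\|<1$ for some norm on $\mathbb{R}^d$, the function $s\mapsto P_{\varphi^s}(B_1,\ldots,B_N)$ has a unique zero in $[0,\infty)$, denoted $\dim_{\mathsf{aff}}(B_1,\ldots,B_N)$; this is also called the affinity dimension of the system $T_ix=B_ix+v_i$. Dimension of a measure: a Borel probability measure $m$ on $\mathbb{R}^d$ is exact-dimensional if $\lim_{r\to0}\frac{\log m(B_r(v))}{\log r}$ (with $B_r(v)$ the open Euclidean ball of centre $v$ and radius $r$) exists for $m$-a.e. $v$ and is $m$-a.e. constant; the almost sure value is called the dimension of $m$ and it coincides with the upper and lower Hausdorff dimensions of $m$. A measure on the attractor is fully supported if its support is the whole attractor. *)

theory Defs
  imports
    "HOL-Analysis.Analysis"
    "HOL-Probability.Probability"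
    "HOL-Computational_Algebra.Computational_Algebra"
begin

section \<open>Matrices\<close>

definition diag2 :: "real \<Rightarrow> real \<Rightarrow> real^2^2" where
  "diag2 a b = vector [vector [a, 0], vector [0, b]]"

definition rot2 :: "real \<Rightarrow> real^2^2" where
  "rot2 t = vector [vector [cos t, - sin t], vector [sin t, cos t]]"

definition kronecker :: "'a::times^'n^'m \<Rightarrow> 'a^'q^'p \<Rightarrow> 'a^('n \<times> 'q)^('m \<times> 'p)" where
  "kronecker A B = (\<chi> i j. A $ fst i $ fst j * B $ snd i $ snd j)"

text \<open>Row (or column) \<open>k\<close> of a matrix of order 4, seen as a block matrix with blocks of order 2:
  the first component is the index of the block, the second one the index inside the block.\<close>

definition block_index :: "4 \<Rightarrow> 2 \<times> 2" where
  "block_index k = (if k = 1 then (1, 1) else if k = 2 then (1, 2)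
                    else if k = 3 then (2, 1) else (2, 2))"

definition kronecker4 :: "'a::times^2^2 \<Rightarrow> 'a^2^2 \<Rightarrow> 'a^4^4" where
  "kronecker4 A B = (\<chi> i j. kronecker A B $ block_index i $ block_index j)"

lemma block_index_simps [simp]:
  "block_index 1 = (1, 1)" "block_index 2 = (1, 2)"
  "block_index 3 = (2, 1)" "block_index 4 = (2, 2)"
  by (simp_all add: block_index_def)

lemma kronecker4_mult:
  fixes A B C D :: "real^2^2"
  shows "kronecker4 A B ** kronecker4 C D = kronecker4 (A ** C) (B ** D)"
  by (simp add: vec_eq_iff matrix_matrix_mult_def kronecker4_def kronecker_def
      forall_4 sum_4 sum_2 algebra_simps)

lemma kronecker4_mat_1: "kronecker4 (mat 1) (mat 1) = (mat 1 :: real^4^4)"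
  by (simp add: vec_eq_iff mat_def kronecker4_def kronecker_def forall_4)

lemma invertible_kronecker4:
  fixes A B :: "real^2^2"
  assumes "invertible A" "invertible B"
  shows "invertible (kronecker4 A B)"
proof -
  obtain A' B' where "A ** A' = mat 1" "A' ** A = mat 1" "B ** B' = mat 1" "B' ** B = mat 1"
    using assms unfolding invertible_def by blast
  then show ?thesis
    unfolding invertible_def
    by (intro exI[of _ "kronecker4 A' B'"]) (simp add: kronecker4_mult kronecker4_mat_1)
qed

lemma invertible_diag2: "a \<noteq> 0 \<Longrightarrow> b \<noteq> 0 \<Longrightarrow> invertible (diag2 a b)"
  by (simp add: invertible_det_nz det_2 diag2_def)

lemma invertible_rot2: "invertible (rot2 t)"
  by (simp add: invertible_det_nz det_2 rot2_def flip: power2_eq_square)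

section \<open>Singular values, the singular value function and the affinity dimension\<close>

definition charpoly :: "real^'n^'n \<Rightarrow> real poly" where
  "charpoly M = det (\<chi> i j. (if i = j then [:0, 1:] else 0) - [:M $ i $ j:])"

text \<open>The square roots of the eigenvalues of \<open>transpose A ** A\<close>, repeated according to
  multiplicity, in decreasing order.\<close>

definition singular_values :: "real^'n^'n \<Rightarrow> real list" where
  "singular_values A =
     rev (sorted_list_of_multiset (image_mset sqrt (proots (charpoly (transpose A ** A)))))"

text \<open>Singular values are numbered from 1.\<close>

definition singular_value :: "real^'n^'n \<Rightarrow> nat \<Rightarrow> real" where
  "singular_value A k = singular_values A ! (k - 1)"

text \<open>Only meaningful for \<open>s \<ge> 0\<close>.\<close>

definition sv_function :: "real \<Rightarrow> real^'n^'n \<Rightarrow> real" where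
  "sv_function s A =
     (if s \<le> real CARD('n)
      then (\<Prod>k = 1..nat \<lfloor>s\<rfloor>. singular_value A k) *
           (if s \<in> \<int> then 1 else singular_value A (nat \<lceil>s\<rceil>) powr (s - of_int \<lfloor>s\<rfloor>))
      else \<bar>det A\<bar> powr (s / real CARD('n)))"

definition matrix_word :: "('i \<Rightarrow> real^'n^'n) \<Rightarrow> 'i list \<Rightarrow> real^'n^'n" where
  "matrix_word B w = foldr (\<lambda>i M. B i ** M) w (mat 1)"

definition sv_pressure :: "real \<Rightarrow> ('i::finite \<Rightarrow> real^'n^'n) \<Rightarrow> real" where
  "sv_pressure s B =
     lim (\<lambda>n. 1 / real n * ln (\<Sum>w | length w = n. sv_function s (matrix_word B w)))"

definition affinity_dimension :: "('i::finite \<Rightarrow> real^'n^'n) \<Rightarrow> real" where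
  "affinity_dimension B = (THE s. 0 \<le> s \<and> sv_pressure s B = 0)"

section \<open>Iterated function systems\<close>

definition iterated_function_system :: "('i::finite \<Rightarrow> real^'n \<Rightarrow> real^'n) \<Rightarrow> bool" where
  "iterated_function_system T \<longleftrightarrow> (\<forall>i. \<exists>c<1. c-lipschitz_on UNIV (T i))"

definition attractor :: "('i::finite \<Rightarrow> real^'n \<Rightarrow> real^'n) \<Rightarrow> (real^'n) set" where
  "attractor T = (THE Z. Z \<noteq> {} \<and> compact Z \<and> Z = (\<Union>i. T i ` Z))"

definition strong_separation :: "('i::finite \<Rightarrow> real^'n \<Rightarrow> real^'n) \<Rightarrow> bool" where
  "strong_separation T \<longleftrightarrow>
     (\<exists>X. X \<noteq> {} \<and> compact X \<and> (\<forall>i. T i ` X \<subseteq> X) \<and> disjoint_family (\<lambda>i. T i ` X))"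

text \<open>Infinite words over \<open>'i\<close> are functions \<open>nat \<Rightarrow> 'i\<close>, with letters numbered from 0.\<close>

definition word_topology :: "(nat \<Rightarrow> 'i) topology" where
  "word_topology = product_topology (\<lambda>_. discrete_topology UNIV) UNIV"

definition word_borel :: "(nat \<Rightarrow> 'i) measure" where
  "word_borel = sigma UNIV {U. openin word_topology U}"

definition word_shift :: "(nat \<Rightarrow> 'i) \<Rightarrow> nat \<Rightarrow> 'i" where
  "word_shift x = (\<lambda>k. x (Suc k))"

definition shift_invariant_prob :: "(nat \<Rightarrow> 'i) measure \<Rightarrow> bool" where
  "shift_invariant_prob \<mu> \<longleftrightarrow>
     prob_space \<mu> \<and> sets \<mu> = sets word_borel \<and>
     (\<forall>A\<in>sets \<mu>. emeasure \<mu> (word_shift -` A) = emeasure \<mu> A)"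

text \<open>For an iterated function system the limit does not depend on the starting point,
  which is taken to be 0.\<close>

definition coding_map :: "('i \<Rightarrow> real^'n \<Rightarrow> real^'n) \<Rightarrow> (nat \<Rightarrow> 'i) \<Rightarrow> real^'n" where
  "coding_map T x = lim (\<lambda>n. foldr (\<lambda>k. T (x k)) [0..<n] 0)"

section \<open>Measures on Euclidean space\<close>

definition mutually_singular :: "'a measure \<Rightarrow> 'a measure \<Rightarrow> bool" where
  "mutually_singular M N \<longleftrightarrow>
     sets M = sets N \<and> (\<exists>A\<in>sets M. emeasure M A = 0 \<and> emeasure N (space N - A) = 0)"

definition has_local_dimension :: "(real^'n) measure \<Rightarrow> real^'n \<Rightarrow> real \<Rightarrow> bool" where
  "has_local_dimension m v D \<longleftrightarrow>
     ((\<lambda>r. ln (measure m (ball v r)) / ln r) \<longlongrightarrow> D) (at_right 0)"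

definition exact_dimensional :: "(real^'n) measure \<Rightarrow> bool" where
  "exact_dimensional m \<longleftrightarrow> (\<exists>D. AE v in m. has_local_dimension m v D)"

definition measure_dimension :: "(real^'n) measure \<Rightarrow> real" where
  "measure_dimension m = (THE D. AE v in m. has_local_dimension m v D)"

definition measure_support :: "(real^'n) measure \<Rightarrow> (real^'n) set" where
  "measure_support m = {x. \<forall>U. open U \<longrightarrow> x \<in> U \<longrightarrow> emeasure m U > 0}"

end

theory Submission
  imports Defs "HOL-Real_Asymp.Real_Asymp"
begin

text \<open>Write a product of the matrices as \<open>kronecker4 X Y\<close>.  For \<open>1 \<le> s \<le> 2\<close> the singular value function is the
  maximum of \<open>\<Phi> = \<parallel>X\<parallel>\<^sup>s \<parallel>Y\<parallel>\<^bsup>2-s\<^esup> (det Y)\<^bsup>s-1\<^esup>\<close> and of the potential obtained by exchanging \<open>X\<close> and \<open>Y\<close>.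
  Both are submultiplicative and quasimultiplicative, and exchanging the letters 1, 2 with 3, 4 maps one to the
  other, so at the affinity dimension both have pressure zero and an ergodic Gibbs measure.  The two measures
  weigh long powers of \<open>A\<^sub>1\<close> differently, hence are distinct, hence mutually singular.  By Borel-Cantelli a
  cylinder of typical large length has, up to a polynomial factor, the full measure allowed by the singular
  value function.  This bounds the local dimension from above, for every choice of translations, by cutting the
  image of a cylinder into slabs.  It is bounded from below for almost every choice of translations near the
  vertices of a tetrahedron, by transversality (the norms are less than 1/2); there strong separation holds.\<close>

section \<open>Cylinders and measures on words\<close>

text \<open>Neither Gibbs measure is comparable with the singular value function: each is comparable
  with one potential only, which on some words is exponentially smaller than the maximum. Of the two
  bounds relating measure and maximum, the upper one is free and feeds transversality; the lower one
  can hold only almost everywhere. It does so because the other potential has bounded sums over the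
  words of each length, so the words on which it exceeds \<open>n ^ 2\<close> times the first have
  mass \<open>O(1 / n ^ 2)\<close>. Polynomial losses disappear after division by
  \<open>ln r\<close>. The numerical hypotheses: there are \<open>4 ^ n\<close> words of length
  \<open>n\<close>, with norms at least
  \<open>sqrt (\<alpha>\<^sub>1 * \<alpha>\<^sub>2) ^ n\<close>, so
  \<open>\<alpha>\<^sub>1 * \<alpha>\<^sub>2 > 1/16\<close> makes the pressure positive at 1, while
  \<open>\<alpha>\<^sub>1 < 1/2\<close> makes it negative at 2. The number
  \<open>1 / (1 + sqrt (3/2))\<close> is the radius at which four equal balls, inside the unit ball
  and centred at the vertices of a regular tetrahedron inscribed in the sphere of radius
  \<open>1 - \<alpha>\<^sub>1\<close>, begin to touch.\<close>

definition cyl :: "'i list \<Rightarrow> (nat \<Rightarrow> 'i) set" where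
  "cyl w = {x. map x [0..<length w] = w}"

lemma cyl_iff: "x \<in> cyl w \<longleftrightarrow> map x [0..<length w] = w"
  by (simp add: cyl_def)

lemma in_cyl_prefix [simp]: "x \<in> cyl (map x [0..<n])"
  by (simp add: cyl_iff)

lemma cyl_Nil [simp]: "cyl [] = UNIV"
  by (auto simp: cyl_iff)

lemma cyl_iff_nth: "x \<in> cyl w \<longleftrightarrow> (\<forall>k<length w. x k = w ! k)"
  unfolding cyl_iff list_eq_iff_nth_eq by simp

lemma cyl_append: "x \<in> cyl (u @ v) \<longleftrightarrow> x \<in> cyl u \<and> (\<lambda>k. x (length u + k)) \<in> cyl v"
proof -
  have "map x [0..<length u + length v] = map x [0..<length u] @ map (\<lambda>k. x (length u + k)) [0..<length v]"
    by (rule nth_equalityI) (auto simp: nth_append)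
  then show ?thesis
    by (simp add: cyl_iff append_eq_append_conv)
qed

lemma cyl_disjoint: "length u = length v \<Longrightarrow> u \<noteq> v \<Longrightarrow> cyl u \<inter> cyl v = {}"
  by (metis cyl_iff disjoint_iff)

lemma cyl_subset_length:
  assumes "x \<in> cyl u" "x \<in> cyl v" "length u \<le> length v"
  shows "cyl v \<subseteq> cyl u"
  using assms by (auto simp: cyl_iff_nth)

lemma openin_word_cyl: "openin word_topology (cyl w)"
proof -
  have "openin word_topology (Pi\<^sub>E UNIV (\<lambda>k. if k < length w then {w ! k} else (UNIV :: 'a set)))"
    unfolding word_topology_def
    by (rule product_topology_basis) (auto intro: finite_subset[of _ "{..<length w}"])
  also have "(Pi\<^sub>E UNIV (\<lambda>k. if k < length w then {w ! k} else (UNIV :: 'a set))) = cyl w"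
    by (auto simp: cyl_iff_nth PiE_iff Pi_iff split: if_splits)
  finally show ?thesis .
qed

lemma open_word_contains_cyl:
  assumes "openin word_topology U" "x \<in> U"
  shows "\<exists>n. cyl (map x [0..<n]) \<subseteq> U"
proof -
  have "\<exists>V. finite {i \<in> UNIV. V i \<noteq> topspace (discrete_topology (UNIV :: 'a set))} \<and>
      (\<forall>i\<in>UNIV. openin (discrete_topology UNIV) (V i)) \<and> x \<in> Pi\<^sub>E UNIV V \<and> Pi\<^sub>E UNIV V \<subseteq> U"
    by (rule bspec[OF assms(1)[unfolded word_topology_def openin_product_topology_alt] assms(2)])
  then obtain V where "finite {i \<in> UNIV. V i \<noteq> topspace (discrete_topology (UNIV :: 'a set))}"
    and xV: "x \<in> Pi\<^sub>E UNIV V" and VU: "Pi\<^sub>E UNIV V \<subseteq> U"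
    by (elim exE conjE)
  then have fin: "finite {i. V i \<noteq> (UNIV :: 'a set)}"
    by simp
  obtain n where n: "\<And>i. V i \<noteq> UNIV \<Longrightarrow> i < n"
    using fin by (metis (mono_tags, lifting) finite_nat_set_iff_bounded mem_Collect_eq)
  have "cyl (map x [0..<n]) \<subseteq> Pi\<^sub>E UNIV V"
  proof
    fix y assume "y \<in> cyl (map x [0..<n])"
    then have "y k = x k" if "k < n" for k using that by (simp add: cyl_iff_nth)
    then have "y k \<in> V k" for k using n[of k] xV by (cases "V k = UNIV") (auto simp: PiE_iff)
    then show "y \<in> Pi\<^sub>E UNIV V" by (auto simp: PiE_iff)
  qed
  with VU show ?thesis by blast
qed

lemma space_word_borel [simp]: "space word_borel = UNIV"
  by (simp add: word_borel_def)

text \<open>There are only countably many finite words, so every open set is a countable union of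
  cylinders; this reduces measurability to conditions on finitely many letters.\<close>

lemma sets_word_borel: "sets (word_borel :: (nat \<Rightarrow> 'i::finite) measure) = sigma_sets UNIV (range cyl)"
proof -
  have 1: "U \<in> sigma_sets UNIV (range cyl)" if U: "openin word_topology U" for U :: "(nat \<Rightarrow> 'i) set"
  proof -
    have "U = \<Union>(cyl ` {w. cyl w \<subseteq> U})"
      using open_word_contains_cyl[OF U] by auto (meson in_cyl_prefix)
    moreover have "\<Union>(cyl ` {w. cyl w \<subseteq> U}) \<in> sigma_sets UNIV (range cyl)"
      by (rule sigma_sets_UNION) auto
    ultimately show ?thesis by simp
  qed
  show ?thesis
    unfolding word_borel_def
  proof (subst sets_measure_of, simp, rule antisym)
    show "sigma_sets UNIV {U :: (nat \<Rightarrow> 'i) set. openin word_topology U} \<subseteq> sigma_sets UNIV (range cyl)"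
      using 1 by (intro sigma_sets_mono) auto
    show "sigma_sets UNIV (range cyl) \<subseteq> sigma_sets UNIV {U :: (nat \<Rightarrow> 'i) set. openin word_topology U}"
      by (intro sigma_sets_mono') (auto simp: openin_word_cyl)
  qed
qed

lemma sets_cyl [measurable]: "cyl (w :: 'i::finite list) \<in> sets word_borel"
  by (auto simp: sets_word_borel)

lemma finite_words [simp]: "finite {w :: 'i::finite list. length w = n}"
  using finite_lists_length_eq[of "UNIV :: 'i set" n] by simp

lemma measurable_prefix:
  "(\<lambda>x. map x [0..<n]) \<in> measurable word_borel (count_space (UNIV :: 'i::finite list set))"
proof -
  have "(\<lambda>x. map x [0..<n]) -` {w} = (if length w = n then cyl w else {})" for w :: "'i list"
    by (auto simp: cyl_iff)
  then show ?thesis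
    by (simp add: measurable_count_space_eq2_countable)
qed

lemma measurable_word_component:
  "(\<lambda>x. x k) \<in> measurable word_borel (count_space (UNIV :: 'i::finite set))"
proof -
  have "(\<lambda>x. last (map x [0..<Suc k])) \<in> measurable word_borel (count_space (UNIV :: 'i set))"
    by (rule measurable_compose[OF measurable_prefix]) simp
  then show ?thesis by simp
qed

text \<open>Identifies the Borel sets with the product \<sigma>-algebra, the one that carries the
  Ionescu-Tulcea measure in \<open>word_extension\<close>.\<close>

lemma sets_word_borel_PiM:
  "sets (word_borel :: (nat \<Rightarrow> 'i::finite) measure) = sets (PiM UNIV (\<lambda>_. count_space UNIV))"
proof (rule antisym)
  have "cyl w \<in> sets (PiM UNIV (\<lambda>_. count_space UNIV))" for w :: "'i list"
  proof -
    have "cyl w = prod_emb UNIV (\<lambda>_. count_space UNIV) {0..<length w} (PiE {0..<length w} (\<lambda>k. {w ! k}))"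
      by (auto simp: cyl_iff_nth prod_emb_def PiE_iff)
    also have "\<dots> \<in> sets (PiM UNIV (\<lambda>_. count_space UNIV))"
      by (rule sets_PiM_I) auto
    finally show ?thesis .
  qed
  then show "sets (word_borel :: (nat \<Rightarrow> 'i) measure) \<subseteq> sets (PiM UNIV (\<lambda>_. count_space UNIV))"
    unfolding sets_word_borel
    using sets.top[of "PiM UNIV (\<lambda>_::nat. count_space (UNIV :: 'i set))"]
    by (intro sets.sigma_sets_subset'[of _ "PiM UNIV (\<lambda>_. count_space UNIV)"]) (auto simp: space_PiM)
  have "(\<lambda>x. x) \<in> measurable word_borel (PiM UNIV (\<lambda>_. count_space (UNIV :: 'i set)))"
    by (rule measurable_PiM_single') (auto simp: measurable_word_component)
  then show "sets (PiM UNIV (\<lambda>_. count_space UNIV)) \<subseteq> sets (word_borel :: (nat \<Rightarrow> 'i) measure)"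
    by (auto dest!: measurable_sets simp: space_PiM)
qed

text \<open>Two cylinders are nested or disjoint, so together with the empty set they form a
  generator stable under intersection.\<close>

lemma word_measure_eqI:
  fixes M N :: "(nat \<Rightarrow> 'i::finite) measure"
  assumes "prob_space M" "sets M = sets word_borel" "sets N = sets word_borel"
    and eq: "\<And>w. emeasure M (cyl w) = emeasure N (cyl w)"
  shows "M = N"
proof -
  interpret prob_space M by fact
  have "emeasure M UNIV < top" using emeasure_space_1 sets_eq_imp_space_eq[OF assms(2)] by simp
  show ?thesis
  proof (rule measure_eqI_generator_eq[where E = "insert {} (range cyl)" and \<Omega> = UNIV and A = "\<lambda>_. UNIV"])
    show "Int_stable (insert {} (range (cyl :: 'i list \<Rightarrow> _)))"
    proof (rule Int_stableI)
      fix a b :: "(nat \<Rightarrow> 'i) set" assume "a \<in> insert {} (range cyl)" "b \<in> insert {} (range cyl)"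
      then consider "a \<inter> b = {}" | u v where "a = cyl u" "b = cyl v" "cyl u \<inter> cyl v \<noteq> {}" by auto
      then show "a \<inter> b \<in> insert {} (range cyl)"
      proof cases
        case 2
        then obtain x where x: "x \<in> cyl u" "x \<in> cyl v" by auto
        have "cyl u \<inter> cyl v = cyl v \<or> cyl u \<inter> cyl v = cyl u"
          using cyl_subset_length[OF x] cyl_subset_length[OF x(2,1)] by (metis Int_absorb1 Int_absorb2 nat_le_linear)
        with 2 show ?thesis by auto
      qed auto
    qed
    show "sets M = sigma_sets UNIV (insert {} (range cyl))" "sets N = sigma_sets UNIV (insert {} (range cyl))"
      unfolding assms sets_word_borel
      by (intro sigma_sets_eqI; blast intro: sigma_sets.Empty sigma_sets.Basic)+
    show "range (\<lambda>_::nat. UNIV) \<subseteq> insert {} (range (cyl :: 'i list \<Rightarrow> _))" 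
      by (metis cyl_Nil image_subset_iff insertCI rangeI)
  qed (use eq \<open>emeasure M UNIV < top\<close> in auto)
qed

text \<open>Kolmogorov extension, obtained from the Ionescu-Tulcea theorem: the letters are drawn
  one after the other with conditional probabilities \<open>m (w @ [a]) / m w\<close>.\<close>

lemma word_extension:
  fixes m :: "'i::finite list \<Rightarrow> real"
  assumes m0: "m [] = 1" and nn: "\<And>w. 0 \<le> m w" and cons: "\<And>w. (\<Sum>i\<in>UNIV. m (w @ [i])) = m w"
  shows "\<exists>\<mu>. prob_space \<mu> \<and> sets \<mu> = sets word_borel \<and> (\<forall>w. emeasure \<mu> (cyl w) = ennreal (m w))"
proof -
  \<comment> \<open>After a word of weight 0 no conditional law exists; any kernel does there, since
    all extensions of the word have weight 0 as well.\<close>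
  define K where "K w = (if m w = 0 then return_pmf (undefined :: 'i) else embed_pmf (\<lambda>a. m (w @ [a]) / m w))" for w
  have pmf_K: "m w * pmf (K w) a = m (w @ [a])" for w a
  proof (cases "m w = 0")
    case True
    then have "m (w @ [a]) = 0" using cons[of w] nn by (auto simp: sum_nonneg_eq_0_iff)
    with True show ?thesis by simp
  next
    case False
    have "pmf (embed_pmf (\<lambda>a. m (w @ [a]) / m w)) a = m (w @ [a]) / m w"
    proof (rule pmf_embed_pmf)
      show "(\<integral>\<^sup>+ x. ennreal (m (w @ [x]) / m w) \<partial>count_space UNIV) = 1"
        using False nn by (simp add: nn_integral_count_space_finite sum_ennreal sum_divide_distrib[symmetric] cons)
    qed (use nn in auto)
    with False show ?thesis by (simp add: K_def)
  qed
  define P where "P n x = measure_pmf (K (map x [0..<n]))" for n and x :: "nat \<Rightarrow> 'i"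
  let ?M = "\<lambda>_::nat. count_space (UNIV :: 'i set)"
  have PiM_fin: "PiM {0..<n} ?M = count_space (PiE {0..<n} (\<lambda>_. UNIV))" for n
    by (rule count_space_PiM_finite) auto
  interpret IT: Ionescu_Tulcea P ?M
  proof (rule Ionescu_Tulcea.intro)
    show "P i \<in> PiM {0..<i} ?M \<rightarrow>\<^sub>M subprob_algebra (count_space UNIV)" for i
      unfolding PiM_fin by (auto simp: P_def space_subprob_algebra measure_pmf.subprob_space_axioms)
    show "prob_space (P i x)" for i x by (simp add: P_def measure_pmf.prob_space_axioms)
  qed
  \<comment> \<open>The finite-dimensional counterpart of \<open>cyl w\<close>: functions on the
    first \<open>length w\<close> indices only, extended by \<open>undefined\<close>.\<close>
  define R where "R w = {x \<in> PiE {0..<length w} (\<lambda>_. UNIV). map x [0..<length w] = w}" for w :: "'i list"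
  have R_sets: "R w \<in> sets (PiM {0..<length w} ?M)" for w
    unfolding PiM_fin by (auto simp: R_def)
  have undef: "(\<lambda>_. undefined) \<in> space (PiM {0..<0} ?M)" by simp
  have C: "emeasure (IT.C 0 (length w) (\<lambda>_. undefined)) (R w) = ennreal (m w)" for w
  proof (induction w rule: rev_induct)
    case Nil
    then show ?case by (simp add: R_def m0 PiM_empty)
  next
    case (snoc a w)
    let ?n = "length w" and ?C = "IT.C 0 (length w) (\<lambda>_. undefined)"
    have setsC: "sets ?C = sets (PiM {0..<?n} ?M)" using IT.sets_C[OF undef, of ?n] by simp
    have spC: "space ?C = PiE {0..<?n} (\<lambda>_. UNIV)" using IT.space_C[OF undef, of ?n] by (simp add: space_PiM)
    have Rs: "R (w @ [a]) \<in> sets (PiM {0..<Suc ?n} ?M)" using R_sets[of "w @ [a]"] by simp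
    have "emeasure (IT.C 0 (length (w @ [a])) (\<lambda>_. undefined)) (R (w @ [a])) =
        (\<integral>\<^sup>+ x. emeasure (IT.eP ?n x) (R (w @ [a])) \<partial>?C)"
      using Rs IT.measurable_eP[of ?n] spC
      by (simp, subst emeasure_bind[where N = "PiM {0..<Suc ?n} ?M"])
         (auto simp: measurable_cong_sets[OF setsC refl])
    also have "\<dots> = (\<integral>\<^sup>+ x. ennreal (pmf (K w) a) * indicator (R w) x \<partial>?C)"
    proof (rule nn_integral_cong)
      fix x assume "x \<in> space ?C"
      then have x: "x \<in> space (PiM {0..<?n} ?M)" by (simp add: spC space_PiM)
      have "emeasure (IT.eP ?n x) (R (w @ [a])) = emeasure (P ?n x) ((\<lambda>y. x(?n := y)) -` R (w @ [a]))"
        using IT.emeasure_eP[OF x Rs] by simp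
      also have "(\<lambda>y. x(?n := y)) -` R (w @ [a]) = (if x \<in> R w then {a} else {})"
        using x by (auto simp: R_def space_PiM PiE_iff extensional_def)
      also have "emeasure (P ?n x) \<dots> = ennreal (pmf (K w) a) * indicator (R w) x"
        by (auto simp: P_def R_def emeasure_pmf_single)
      finally show "emeasure (IT.eP ?n x) (R (w @ [a])) = ennreal (pmf (K w) a) * indicator (R w) x" .
    qed
    also have "\<dots> = ennreal (pmf (K w) a) * emeasure ?C (R w)"
      using R_sets[of w] setsC by (intro nn_integral_cmult_indicator) auto
    also have "\<dots> = ennreal (m (w @ [a]))"
      by (simp add: snoc pmf_K[symmetric] ennreal_mult' nn mult.commute)
    finally show ?case .
  qed
  have "emeasure IT.PF.lim (cyl w) = ennreal (m w)" for w
  proof -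
    have restr: "map (restrict x {0..<length w}) [0..<length w] = map x [0..<length w]" for x :: "nat \<Rightarrow> 'i"
      by simp
    have "IT.PF.emb UNIV {0..<length w} (R w) = cyl w"
      by (simp add: prod_emb_def R_def cyl_def) (simp only: restr)
    then have "emeasure IT.PF.lim (cyl w) = emeasure (IT.CI {0..<length w}) (R w)"
      using IT.lim[OF _ R_sets, of w] by simp
    also have "\<dots> = emeasure (IT.C 0 (length w) (\<lambda>_. undefined)) (R w)"
      using IT.emeasure_CI[OF order.refl R_sets, of w] 
      by (simp add: R_def prod_emb_def space_PiM) (auto intro!: arg_cong2[where f = emeasure])
    finally show ?thesis by (simp add: C)
  qed
  moreover have "sets IT.PF.lim = sets word_borel"
    by (simp add: sets_word_borel_PiM)
  moreover from calculation have "prob_space IT.PF.lim"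
    by (intro prob_spaceI) (simp add: m0 space_PiM flip: cyl_Nil)
  ultimately show ?thesis by blast
qed

lemma measure_split_cyl:
  fixes \<mu> :: "(nat \<Rightarrow> 'i::finite) measure"
  assumes "finite_measure \<mu>" and s: "sets \<mu> = sets word_borel" and B: "B \<in> sets word_borel"
  shows "measure \<mu> B = (\<Sum>w | length w = n. measure \<mu> (B \<inter> cyl w))"
proof -
  interpret finite_measure \<mu> by fact
  have "B = (\<Union>w\<in>{w. length w = n}. B \<inter> cyl w)"
    by (force intro: in_cyl_prefix[of _ n])
  moreover have "measure \<mu> (\<Union>w\<in>{w. length w = n}. B \<inter> cyl w) = (\<Sum>w | length w = n. measure \<mu> (B \<inter> cyl w))"
    using B by (intro finite_measure_finite_Union)
      (auto simp: s disjoint_family_on_def dest: cyl_disjoint)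
  ultimately show ?thesis by simp
qed

section \<open>Sums over all words of a given length\<close>

lemma sum_words_Suc:
  fixes f :: "'i::finite list \<Rightarrow> 'b::comm_monoid_add"
  shows "(\<Sum>w | length w = Suc n. f w) = (\<Sum>i\<in>UNIV. \<Sum>w | length w = n. f (i # w))"
proof -
  have "(\<Sum>w | length w = Suc n. f w) = (\<Sum>(i, w) \<in> UNIV \<times> {w. length w = n}. f (i # w))"
    by (rule sum.reindex_bij_witness[of _ "\<lambda>(i, w). i # w" "\<lambda>w. (hd w, tl w)"]) (auto simp: length_Suc_conv)
  then show ?thesis by (simp add: sum.cartesian_product)
qed

lemma sum_words_append:
  fixes f :: "'i::finite list \<Rightarrow> 'b::comm_monoid_add"
  shows "(\<Sum>w | length w = n + m. f w) = (\<Sum>u | length u = n. \<Sum>v | length v = m. f (u @ v))"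
proof -
  have "(\<Sum>w | length w = n + m. f w) = (\<Sum>(u, v) \<in> {u. length u = n} \<times> {v. length v = m}. f (u @ v))"
    by (rule sum.reindex_bij_witness[of _ "\<lambda>(u, v). u @ v" "\<lambda>w. (take n w, drop n w)"]) auto
  then show ?thesis by (simp add: sum.cartesian_product)
qed

lemma sum_words_snoc:
  fixes f :: "'i::finite list \<Rightarrow> 'b::comm_monoid_add"
  shows "(\<Sum>w | length w = Suc n. f w) = (\<Sum>w | length w = n. \<Sum>i\<in>UNIV. f (w @ [i]))"
proof -
  have "(\<Sum>v | length v = Suc 0. g v) = (\<Sum>i\<in>UNIV. g [i])" for g :: "'i list \<Rightarrow> 'b"
    by (simp add: sum_words_Suc)
  then show ?thesis
    using sum_words_append[of f n "Suc 0"] by simp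
qed

section \<open>Gibbs measures of quasimultiplicative potentials\<close>

text \<open>The bounds on the sums say more than pressure zero: subexponential growth or decay is
  excluded too, and without that no probability measure could be comparable with
  \<open>\<Phi>\<close> on all cylinders. The connecting word \<open>k\<close> is needed because
  \<open>\<Phi> (u @ v)\<close> itself may be far below \<open>\<Phi> u * \<Phi> v\<close>.\<close>

locale word_potential =
  fixes \<Phi> :: "'i::finite list \<Rightarrow> real" and C c :: real and K :: nat
  assumes pos: "\<Phi> w > 0"
    and submult: "\<Phi> (u @ v) \<le> \<Phi> u * \<Phi> v"
    and sum_ge: "1 \<le> (\<Sum>w | length w = n. \<Phi> w)"
    and sum_le: "(\<Sum>w | length w = n. \<Phi> w) \<le> C"
    and c_pos: "0 < c"
    and quasimult: "\<exists>k. length k \<le> K \<and> c * \<Phi> u * \<Phi> v \<le> \<Phi> (u @ k @ v)"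
begin

lemma C_ge_1: "1 \<le> C"
  using sum_ge[of 0] sum_le[of 0] by linarith

text \<open>The connecting word depends on \<open>u\<close> and \<open>v\<close>; summing over all
  short words removes that dependence, so that the inequality can be summed over \<open>u\<close>
  and \<open>v\<close>.\<close>

lemma quasimult_sum: "c * \<Phi> u * \<Phi> v \<le> (\<Sum>l\<le>K. \<Sum>k | length k = l. \<Phi> (u @ k @ v))"
proof -
  obtain k where k: "length k \<le> K" "c * \<Phi> u * \<Phi> v \<le> \<Phi> (u @ k @ v)" using quasimult by blast
  have "\<Phi> (u @ k @ v) \<le> (\<Sum>k' | length k' = length k. \<Phi> (u @ k' @ v))"
    by (rule member_le_sum) (auto intro: less_imp_le pos)
  also have "\<dots> \<le> (\<Sum>l\<le>K. \<Sum>k | length k = l. \<Phi> (u @ k @ v))"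
    by (rule member_le_sum[where f = "\<lambda>l. \<Sum>k | length k = l. \<Phi> (u @ k @ v)"])
       (use k in \<open>auto intro!: sum_nonneg simp: less_imp_le[OF pos]\<close>)
  finally show ?thesis using k by simp
qed

definition c1 where "c1 = c / (real (Suc K) * C)"

lemma c1_pos: "0 < c1"
  using c_pos C_ge_1 by (simp add: c1_def)

text \<open>After inserting a connecting word of length \<open>l\<close> the prefix has length
  \<open>n + l\<close>. Its first \<open>l\<close> letters are split off by submultiplicativity at
  the cost of a factor at most \<open>C\<close>; with the \<open>K + 1\<close> possible values of
  \<open>l\<close> this explains \<open>c1\<close>.\<close>

lemma left_sum_ge: "c1 * \<Phi> w \<le> (\<Sum>a | length a = n. \<Phi> (a @ w))"
proof -
  have "c * 1 * \<Phi> w \<le> (\<Sum>a | length a = n. c * \<Phi> a * \<Phi> w)"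
    unfolding sum_distrib_left[symmetric] sum_distrib_right[symmetric]
    using sum_ge[of n] c_pos pos[of w] by (intro mult_right_mono mult_left_mono) auto
  also have "\<dots> \<le> (\<Sum>a | length a = n. \<Sum>l\<le>K. \<Sum>k | length k = l. \<Phi> (a @ k @ w))"
    by (intro sum_mono quasimult_sum)
  also have "\<dots> = (\<Sum>l\<le>K. \<Sum>a | length a = n + l. \<Phi> (a @ w))"
    by (subst sum.swap) (simp add: sum_words_append)
  also have "\<dots> = (\<Sum>l\<le>K. \<Sum>k | length k = l. \<Sum>a | length a = n. \<Phi> (k @ a @ w))"
    by (subst add.commute) (simp add: sum_words_append)
  also have "\<dots> \<le> (\<Sum>l\<le>K. \<Sum>k | length k = l. \<Sum>a | length a = n. \<Phi> k * \<Phi> (a @ w))"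
    by (intro sum_mono submult)
  also have "\<dots> = (\<Sum>l\<le>K. (\<Sum>k | length k = l. \<Phi> k) * (\<Sum>a | length a = n. \<Phi> (a @ w)))"
    by (simp add: sum_product)
  also have "\<dots> \<le> (\<Sum>l\<le>K. C * (\<Sum>a | length a = n. \<Phi> (a @ w)))"
    by (intro sum_mono mult_right_mono sum_le sum_nonneg less_imp_le pos)
  also have "\<dots> = real (Suc K) * C * (\<Sum>a | length a = n. \<Phi> (a @ w))" by simp
  finally have "c * \<Phi> w \<le> real (Suc K) * C * (\<Sum>v | length v = n. \<Phi> (v @ w))" by simp
  moreover have "0 < real (Suc K) * C" using C_ge_1 by (intro mult_pos_pos) auto
  ultimately show ?thesis by (simp add: c1_def pos_divide_le_eq mult_ac del: of_nat_Suc)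
qed

lemma right_sum_ge: "c1 * \<Phi> w \<le> (\<Sum>b | length b = n. \<Phi> (w @ b))"
proof -
  have "c * \<Phi> w * 1 \<le> (\<Sum>b | length b = n. c * \<Phi> w * \<Phi> b)"
    unfolding sum_distrib_left[symmetric]
    using sum_ge[of n] c_pos pos[of w] by (intro mult_left_mono) auto
  also have "\<dots> \<le> (\<Sum>b | length b = n. \<Sum>l\<le>K. \<Sum>k | length k = l. \<Phi> (w @ k @ b))"
    by (intro sum_mono quasimult_sum)
  also have "\<dots> = (\<Sum>l\<le>K. \<Sum>k | length k = l. \<Sum>b | length b = n. \<Phi> (w @ k @ b))"
    by (subst sum.swap[of _ "{..K}"]) (intro sum.cong refl sum.swap)
  also have "\<dots> = (\<Sum>l\<le>K. \<Sum>b | length b = l + n. \<Phi> (w @ b))"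
    by (simp add: sum_words_append)
  also have "\<dots> = (\<Sum>l\<le>K. \<Sum>b | length b = n. \<Sum>k | length k = l. \<Phi> ((w @ b) @ k))"
    by (subst add.commute) (simp add: sum_words_append)
  also have "\<dots> \<le> (\<Sum>l\<le>K. \<Sum>b | length b = n. \<Sum>k | length k = l. \<Phi> (w @ b) * \<Phi> k)"
    by (intro sum_mono submult)
  also have "\<dots> = (\<Sum>l\<le>K. (\<Sum>b | length b = n. \<Phi> (w @ b)) * (\<Sum>k | length k = l. \<Phi> k))"
    by (simp add: sum_product)
  also have "\<dots> \<le> (\<Sum>l\<le>K. (\<Sum>b | length b = n. \<Phi> (w @ b)) * C)"
    by (intro sum_mono mult_left_mono sum_le sum_nonneg less_imp_le pos)
  also have "\<dots> = real (Suc K) * C * (\<Sum>b | length b = n. \<Phi> (w @ b))" by simp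
  finally have "c * \<Phi> w \<le> real (Suc K) * C * (\<Sum>v | length v = n. \<Phi> (w @ v))" by simp
  moreover have "0 < real (Suc K) * C" using C_ge_1 by (intro mult_pos_pos) auto
  ultimately show ?thesis by (simp add: c1_def pos_divide_le_eq mult_ac del: of_nat_Suc)
qed

text \<open>The total weight of the words of length \<open>k + length w + m\<close> in which
  \<open>w\<close> occurs at position \<open>k\<close>.\<close>

definition A where "A k m w = (\<Sum>a | length a = k. \<Sum>b | length b = m. \<Phi> (a @ w @ b))"

lemma A_ge: "c1 * c1 * \<Phi> w \<le> A k m w"
proof -
  have "c1 * (c1 * \<Phi> w) \<le> c1 * (\<Sum>a | length a = k. \<Phi> (a @ w))"
    using c1_pos left_sum_ge by (intro mult_left_mono) auto
  also have "\<dots> \<le> A k m w"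
    unfolding A_def sum_distrib_left
    using right_sum_ge[of "_ @ w" m] by (intro sum_mono) simp
  finally show ?thesis by (simp add: mult.assoc)
qed

lemma A_le: "A k m w \<le> C * C * \<Phi> w"
proof -
  have "A k m w \<le> (\<Sum>a | length a = k. \<Sum>b | length b = m. \<Phi> a * (\<Phi> w * \<Phi> b))"
    unfolding A_def
    by (intro sum_mono order_trans[OF submult] mult_left_mono submult less_imp_le pos)
  also have "\<dots> = \<Phi> w * ((\<Sum>a | length a = k. \<Phi> a) * (\<Sum>b | length b = m. \<Phi> b))"
    by (subst sum_product, simp only: sum_distrib_left mult.left_commute[of "\<Phi> _" "\<Phi> w"])
  also have "\<dots> \<le> \<Phi> w * (C * C)"
    using C_ge_1 by (intro mult_left_mono mult_mono sum_le sum_nonneg less_imp_le pos) auto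
  finally show ?thesis by (simp add: mult_ac)
qed

lemma A_pos: "0 < A k m w"
  by (rule less_le_trans[OF _ A_ge]) (simp add: c1_pos pos)

lemma A_snoc: "(\<Sum>i\<in>UNIV. A k m (w @ [i])) = A k (Suc m) w"
  unfolding A_def sum_words_Suc by (subst sum.swap) simp

lemma A_Cons: "(\<Sum>i\<in>UNIV. A k m (i # w)) = A (Suc k) m w"
  unfolding A_def sum_words_snoc by (subst sum.swap) simp

lemma A_Nil: "A k m [] = (\<Sum>w | length w = k + m. \<Phi> w)"
  by (simp add: A_def sum_words_append)

definition Z where "Z n = (\<Sum>w | length w = n. \<Phi> w)"

lemma Z_bounds: "1 \<le> Z n" "Z n \<le> C"
  using sum_ge sum_le by (auto simp: Z_def)

text \<open>Averaging over the position of \<open>w\<close> in a long word makes the weights asymptotically shift-invariant; a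
  cluster point in \<open>n\<close> is a consistent family of cylinder measures.\<close>

definition M where "M n w = (\<Sum>k<n. A k (2 * n - k - length w) w) / (real n * Z (2 * n))"

lemma M_bounds:
  assumes "0 < n"
  shows "c1 * c1 / C * \<Phi> w \<le> M n w" "M n w \<le> C * C * \<Phi> w"
proof -
  let ?S = "\<Sum>k<n. A k (2 * n - k - length w) w"
  have 1: "real n * (c1 * c1 * \<Phi> w) \<le> ?S"
    using sum_bounded_below[of "{..<n}" "c1 * c1 * \<Phi> w"] A_ge by simp
  have 2: "?S \<le> real n * (C * C * \<Phi> w)"
    using sum_bounded_above[of "{..<n}" _ "C * C * \<Phi> w"] A_le by simp
  have p: "0 < c1 * c1 * \<Phi> w" by (simp add: c1_pos pos)
  have "c1 * c1 / C * \<Phi> w = real n * (c1 * c1 * \<Phi> w) / (real n * C)"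
    using assms by simp
  also have "\<dots> \<le> ?S / (real n * Z (2 * n))"
    using 1 p assms Z_bounds[of "2 * n"] C_ge_1
    by (intro frac_le mult_left_mono mult_pos_pos) (auto intro!: sum_nonneg simp: less_imp_le[OF A_pos])
  finally show "c1 * c1 / C * \<Phi> w \<le> M n w" by (simp add: M_def)
  have "M n w \<le> real n * (C * C * \<Phi> w) / (real n * 1)"
    unfolding M_def using 2 assms Z_bounds[of "2 * n"] C_ge_1 pos[of w]
    by (intro frac_le mult_left_mono mult_nonneg_nonneg) auto
  then show "M n w \<le> C * C * \<Phi> w" using assms by simp
qed

lemma M_Nil: "0 < n \<Longrightarrow> M n [] = 1"
  using Z_bounds[of "2 * n"] by (simp add: M_def A_Nil flip: Z_def)

lemma M_snoc:
  assumes "length w < n" shows "(\<Sum>i\<in>UNIV. M n (w @ [i])) = M n w"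
proof -
  have "(\<Sum>i\<in>UNIV. \<Sum>k<n. A k (2 * n - k - length (w @ [i])) (w @ [i])) = (\<Sum>k<n. A k (2 * n - k - length w) w)"
  proof (subst sum.swap, intro sum.cong refl)
    fix k assume "k \<in> {..<n}"
    \<comment> \<open>Natural subtraction is harmless here: the long word has length
      \<open>2 * n\<close> but \<open>k < n\<close>, which leaves room for \<open>w\<close> as long
      as \<open>length w < n\<close>.\<close>
    then have "2 * n - k - length w = Suc (2 * n - k - Suc (length w))" using assms by auto
    then show "(\<Sum>i\<in>UNIV. A k (2 * n - k - length (w @ [i])) (w @ [i])) = A k (2 * n - k - length w) w"
      by (simp add: A_snoc)
  qed
  then show ?thesis by (simp add: M_def flip: sum_divide_distrib)
qed

text \<open>Prepending a letter moves the occurrence of \<open>w\<close> by one position, so the two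
  sums over positions differ by their end terms only; the average divides these by
  \<open>n\<close>.\<close>

lemma M_Cons:
  assumes "length w < n" shows "\<bar>(\<Sum>i\<in>UNIV. M n (i # w)) - M n w\<bar> \<le> C * C * \<Phi> w / real n"
proof -
  let ?f = "\<lambda>k. A k (2 * n - k - length w) w"
  have "(\<Sum>i\<in>UNIV. \<Sum>k<n. A k (2 * n - k - length (i # w)) (i # w)) = (\<Sum>k<n. ?f (Suc k))"
    by (subst sum.swap, intro sum.cong refl) (simp add: A_Cons)
  also have "\<dots> = (\<Sum>k<n. ?f k) + ?f n - ?f 0"
    using sum.lessThan_Suc_shift[of ?f n] sum.lessThan_Suc[of ?f n] by simp
  finally have "(\<Sum>i\<in>UNIV. M n (i # w)) - M n w = (?f n - ?f 0) / (real n * Z (2 * n))"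
    by (simp add: M_def flip: sum_divide_distrib diff_divide_distrib)
  also have "\<bar>\<dots>\<bar> \<le> (C * C * \<Phi> w) / (real n * 1)"
    unfolding abs_divide
  proof (rule frac_le)
    show "\<bar>?f n - ?f 0\<bar> \<le> C * C * \<Phi> w"
      using A_pos[of n "2 * n - n - length w" w] A_pos[of 0 "2 * n - 0 - length w" w] 
        A_le[of n "2 * n - n - length w" w] A_le[of 0 "2 * n - 0 - length w" w] by linarith
  qed (use assms Z_bounds[of "2 * n"] C_ge_1 pos[of w] in auto)
  finally show ?thesis by simp
qed

text \<open>\<open>M_bounds\<close> confines all weights to a product of compact intervals over the
  countable set of words, where a subsequence converges pointwise. Both Gibbs bounds survive the
  limit, and the defect of shift invariance in \<open>M_Cons\<close> is of order
  \<open>1 / n\<close>.\<close>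

lemma gibbs_weights:
  obtains m :: "'i list \<Rightarrow> real" and c' C' where "0 < c'" "m [] = 1"
    "\<And>w. c' * \<Phi> w \<le> m w" "\<And>w. m w \<le> C' * \<Phi> w"
    "\<And>w. (\<Sum>i\<in>UNIV. m (w @ [i])) = m w" "\<And>w. (\<Sum>i\<in>UNIV. m (i # w)) = m w"
proof -
  define S where "S = Pi\<^sub>E UNIV (\<lambda>w :: 'i list. {0 .. C * C * \<Phi> w})"
  have "compactin (product_topology (\<lambda>_. euclidean) UNIV) S"
    unfolding S_def compactin_PiE by simp
  then have "seq_compact S"
    by (simp add: euclidean_product_topology compact_eq_seq_compact_metric)
  \<comment> \<open>The index is \<open>Suc n\<close> because \<open>M_bounds\<close> requires a
    positive one.\<close>
  moreover have "M (Suc n) \<in> S" for n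
    using M_bounds[of "Suc n"] order_trans[OF less_imp_le M_bounds(1)[of "Suc n"]] c1_pos C_ge_1 pos
    by (simp add: S_def PiE_iff)
  ultimately obtain m r where r: "strict_mono r" and lim: "(\<lambda>n. M (Suc (r n))) \<longlonglongrightarrow> m"
    by (force elim!: seq_compactE simp: o_def)
  have lim_w: "(\<lambda>n. M (Suc (r n)) w) \<longlonglongrightarrow> m w" for w
  proof (rule isCont_tendsto_compose[of m "\<lambda>x. x w", OF _ lim])
    show "isCont (\<lambda>x :: 'i list \<Rightarrow> real. x w) m"
      by (metis UNIV_I continuous_on_eq_continuous_at continuous_on_product_coordinates open_UNIV)
  qed
  have large: "\<forall>\<^sub>F n in sequentially. N < Suc (r n)" for N
    using filterlim_subseq[OF r] by (auto simp: filterlim_at_top eventually_mono less_Suc_eq_le)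
  show ?thesis
  proof (rule that[of "c1 * c1 / C" m "C * C"])
    show "0 < c1 * c1 / C" using c1_pos C_ge_1 by simp
    show "m [] = 1" using lim_w[of "[]"] by (simp add: M_Nil LIMSEQ_const_iff)
    show "c1 * c1 / C * \<Phi> w \<le> m w" for w
      by (rule LIMSEQ_le_const[OF lim_w]) (use M_bounds in blast)
    show "m w \<le> C * C * \<Phi> w" for w
      by (rule LIMSEQ_le_const2[OF lim_w]) (use M_bounds in blast)
    show "(\<Sum>i\<in>UNIV. m (w @ [i])) = m w" for w
    proof (rule LIMSEQ_unique)
      show "(\<lambda>n. \<Sum>i\<in>UNIV. M (Suc (r n)) (w @ [i])) \<longlonglongrightarrow> (\<Sum>i\<in>UNIV. m (w @ [i]))"
        by (intro tendsto_sum lim_w)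
      show "(\<lambda>n. \<Sum>i\<in>UNIV. M (Suc (r n)) (w @ [i])) \<longlonglongrightarrow> m w"
        by (rule Lim_transform_eventually[OF lim_w])
           (use large[of "length w"] M_snoc in \<open>auto elim!: eventually_mono\<close>)
    qed
    show "(\<Sum>i\<in>UNIV. m (i # w)) = m w" for w
    proof -
      have "(\<lambda>n. (\<Sum>i\<in>UNIV. M (Suc (r n)) (i # w)) - M (Suc (r n)) w) \<longlonglongrightarrow> 0"
      proof (rule tendsto_rabs_zero_cancel,
          rule tendsto_sandwich[of "\<lambda>_. 0" _ _ "\<lambda>n. C * C * \<Phi> w / real (Suc (r n))"])
        show "\<forall>\<^sub>F n in sequentially. \<bar>(\<Sum>i\<in>UNIV. M (Suc (r n)) (i # w)) - M (Suc (r n)) w\<bar> \<le> C * C * \<Phi> w / real (Suc (r n))"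
          using large[of "length w"] M_Cons by (auto elim!: eventually_mono simp del: of_nat_Suc)
        have "(\<lambda>n. C * C * \<Phi> w * inverse (real (Suc n))) \<longlonglongrightarrow> C * C * \<Phi> w * 0"
          by (intro tendsto_mult tendsto_const LIMSEQ_inverse_real_of_nat)
        from LIMSEQ_subseq_LIMSEQ[OF this r]
        show "(\<lambda>n. C * C * \<Phi> w / real (Suc (r n))) \<longlonglongrightarrow> 0" by (simp add: o_def divide_inverse)
      qed auto
      moreover have "(\<lambda>n. (\<Sum>i\<in>UNIV. M (Suc (r n)) (i # w)) - M (Suc (r n)) w) \<longlonglongrightarrow> (\<Sum>i\<in>UNIV. m (i # w)) - m w"
        by (intro tendsto_sum tendsto_diff lim_w)
      ultimately show ?thesis using LIMSEQ_unique by force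
    qed
  qed
qed

end

section \<open>Ergodicity and mutual singularity\<close>

lemma vimage_shift_cyl: "word_shift -` cyl w = (\<Union>i. cyl (i # w))"
  by (force simp: cyl_iff_nth word_shift_def nth_Cons less_Suc_eq_0_disj)

lemma measurable_word_shift:
  assumes "sets M = sets word_borel"
  shows "word_shift \<in> measurable M (word_borel :: (nat \<Rightarrow> 'i::finite) measure)"
proof -
  have "word_shift \<in> measurable M (sigma UNIV (range (cyl :: 'i list \<Rightarrow> _)))"
    using sets_eq_imp_space_eq[OF assms]
    by (intro measurable_measure_of) (auto simp: vimage_shift_cyl assms)
  moreover have "sets (sigma UNIV (range (cyl :: 'i list \<Rightarrow> _))) = sets word_borel"
    by (simp add: sets_word_borel)
  ultimately show ?thesis
    using measurable_cong_sets[OF refl] by blast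
qed

lemma shift_invariant_distr:
  assumes "shift_invariant_prob \<mu>"
  shows "distr \<mu> \<mu> word_shift = (\<mu> :: (nat \<Rightarrow> 'i::finite) measure)"
proof (rule measure_eqI)
  fix A assume "A \<in> sets (distr \<mu> \<mu> word_shift)"
  with assms show "emeasure (distr \<mu> \<mu> word_shift) A = emeasure \<mu> A"
    using measurable_word_shift[of \<mu>] sets_eq_imp_space_eq[of \<mu> word_borel]
    by (subst emeasure_distr) (auto simp: shift_invariant_prob_def cong: measurable_cong_sets)
qed simp

lemma AE_shift:
  assumes "shift_invariant_prob \<mu>" "AE x in \<mu>. P x"
  shows "AE x in \<mu>. P (word_shift (x :: nat \<Rightarrow> 'i::finite))"
proof -
  have "word_shift \<in> measurable \<mu> \<mu>"
    using measurable_word_shift[of \<mu>] assms(1) by (auto simp: shift_invariant_prob_def cong: measurable_cong_sets)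
  moreover have "AE x in distr \<mu> \<mu> word_shift. P x"
    using assms shift_invariant_distr by metis
  ultimately show ?thesis by (rule AE_distrD)
qed

lemma shift_invariantI:
  fixes \<mu> :: "(nat \<Rightarrow> 'i::finite) measure"
  assumes "prob_space \<mu>" and s: "sets \<mu> = sets word_borel"
    and inv: "\<And>w. emeasure \<mu> (cyl w) = (\<Sum>i\<in>UNIV. emeasure \<mu> (cyl (i # w)))"
  shows "shift_invariant_prob \<mu>"
proof -
  interpret prob_space \<mu> by fact
  have sp: "space \<mu> = UNIV" using sets_eq_imp_space_eq[OF s] by simp
  have m: "word_shift \<in> measurable \<mu> word_borel" by (rule measurable_word_shift[OF s])
  have "distr \<mu> word_borel word_shift = \<mu>"
  proof (rule word_measure_eqI)
    show "prob_space (distr \<mu> word_borel word_shift)" by (rule prob_space_distr[OF m])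
    fix w :: "'i list"
    have "cyl (i # w) \<inter> cyl (j # w) = {}" if "i \<noteq> j" for i j
      using that by (intro cyl_disjoint) auto
    then have "emeasure \<mu> (word_shift -` cyl w) = (\<Sum>i\<in>UNIV. emeasure \<mu> (cyl (i # w)))"
      unfolding vimage_shift_cyl
      by (intro sum_emeasure[symmetric]) (auto simp: s disjoint_family_on_def)
    then show "emeasure (distr \<mu> word_borel word_shift) (cyl w) = emeasure \<mu> (cyl w)"
      using inv[of w] by (simp add: emeasure_distr m sp)
  qed (simp_all add: s)
  then have "emeasure \<mu> (word_shift -` A) = emeasure \<mu> A" if "A \<in> sets \<mu>" for A
    using that by (metis emeasure_distr m s sp inf_top.right_neutral)
  then show ?thesis by (simp add: shift_invariant_prob_def s prob_space_axioms)
qed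

text \<open>The sets that can be approximated in measure by sets depending on finitely many letters
  form a \<sigma>-algebra containing the cylinders.\<close>

lemma word_approx:
  fixes \<mu> :: "(nat \<Rightarrow> 'i::finite) measure"
  assumes "prob_space \<mu>" and s: "sets \<mu> = sets word_borel" and "B \<in> sets word_borel" and "0 < \<epsilon>"
  shows "\<exists>n S. measure \<mu> (sym_diff B {x. map x [0..<n] \<in> S}) < \<epsilon>"
proof -
  interpret prob_space \<mu> by fact
  have sp: "space \<mu> = UNIV" using sets_eq_imp_space_eq[OF s] by simp
  define E where "E n S = {x :: nat \<Rightarrow> 'i. map x [0..<n] \<in> S}" for n S
  have E_sets [simp]: "E n S \<in> sets \<mu>" for n S
    using measurable_sets[OF measurable_prefix, of S n] by (simp add: E_def vimage_def s)
  \<comment> \<open>A condition on \<open>n\<close> letters is also one on more letters; this brings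
    two approximations to a common length.\<close>
  have E_lift: "\<exists>S'. E n S = E m S'" if "n \<le> m" for n m S
    by (rule exI[of _ "{w. take n w \<in> S}"]) (use that in \<open>simp add: E_def take_map\<close>)
  have E_Un: "\<exists>l S''. E n S \<union> E m S' = E l S''" for n m S S'
  proof -
    obtain T T' where "E n S = E (max n m) T" "E m S' = E (max n m) T'"
      using E_lift[of n "max n m" S] E_lift[of m "max n m" S'] by auto
    then have "E n S \<union> E m S' = E (max n m) (T \<union> T')" by (auto simp: E_def)
    then show ?thesis by blast
  qed
  define G where "G B \<longleftrightarrow> B \<in> sets \<mu> \<and> (\<forall>\<epsilon>>0. \<exists>n S. measure \<mu> (sym_diff B (E n S)) < \<epsilon>)" for B
  have G_Un: "G (A \<union> B)" if GA: "G A" and GB: "G B" for A B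
    unfolding G_def
  proof (intro conjI allI impI)
    have [simp]: "A \<in> sets \<mu>" "B \<in> sets \<mu>" using GA GB by (auto simp: G_def)
    show "A \<union> B \<in> sets \<mu>" by (intro sets.Un) simp_all
    fix \<epsilon> :: real assume "0 < \<epsilon>"
    then have "0 < \<epsilon> / 2" by simp
    then obtain n S m S' where *: "measure \<mu> (sym_diff A (E n S)) < \<epsilon> / 2" "measure \<mu> (sym_diff B (E m S')) < \<epsilon> / 2"
      using GA GB unfolding G_def by blast
    obtain l S'' where l: "E n S \<union> E m S' = E l S''" using E_Un by blast
    have "measure \<mu> (sym_diff (A \<union> B) (E l S'')) \<le> measure \<mu> (sym_diff A (E n S) \<union> sym_diff B (E m S'))"
      unfolding l[symmetric] by (intro finite_measure_mono sets.Un sets.Diff) auto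
    also have "\<dots> \<le> measure \<mu> (sym_diff A (E n S)) + measure \<mu> (sym_diff B (E m S'))"
      by (intro measure_Un_le sets.Un sets.Diff) auto
    also have "\<dots> < \<epsilon>" using * by simp
    finally show "\<exists>n S. measure \<mu> (sym_diff (A \<union> B) (E n S)) < \<epsilon>" by blast
  qed
  have G_cyl: "G (cyl w)" for w
  proof -
    have "E (length w) {w} = cyl w" by (auto simp: E_def cyl_def)
    then show ?thesis unfolding G_def s by (metis Diff_cancel Un_empty measure_empty sets_cyl)
  qed
  have G_empty: "G {}"
  proof -
    have "E 0 {} = {}" by (simp add: E_def)
    then show ?thesis unfolding G_def by (metis Diff_cancel Un_empty measure_empty sets.empty_sets)
  qed
  have "G B" if "B \<in> sigma_sets UNIV (range cyl)" for B
    using that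
  proof (induction rule: sigma_sets.induct)
    case (Compl a)
    have "sym_diff (UNIV - a) (E n (-S)) = sym_diff a (E n S)" for n S by (auto simp: E_def)
    with Compl show ?case unfolding G_def by (metis sets.compl_sets sp)
  next
    case (Union a)
    \<comment> \<open>By continuity from below a countable union is within
      \<open>\<epsilon> / 2\<close> of a finite one, and finite unions are covered by
      \<open>G_Un\<close>.\<close>
    have fin: "G (\<Union>i<n. a i)" for n
      by (induction n) (use Union G_empty G_Un in \<open>auto simp: lessThan_Suc\<close>)
    have a_sets: "a i \<in> sets \<mu>" for i using Union by (auto simp: G_def)
    show ?case
      unfolding G_def
    proof (intro conjI allI impI)
      show "(\<Union>i. a i) \<in> sets \<mu>" using a_sets by auto
      have [simp]: "(\<Union>i<n. a i) \<in> sets \<mu>" "(\<Union>i. a i) \<in> sets \<mu>" for n using a_sets by auto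
      fix \<epsilon> :: real assume "0 < \<epsilon>"
      have "(\<lambda>n. measure \<mu> (\<Union>i<n. a i)) \<longlonglongrightarrow> measure \<mu> (\<Union>n. \<Union>i<n. a i)"
        using a_sets by (intro finite_Lim_measure_incseq) (auto simp: incseq_def intro: less_le_trans intro!: bexI)
      also have "(\<Union>n. \<Union>i<n. a i) = (\<Union>i. a i)" by auto
      finally obtain n where n: "\<bar>measure \<mu> (\<Union>i<n. a i) - measure \<mu> (\<Union>i. a i)\<bar> < \<epsilon> / 2"
        using \<open>0 < \<epsilon>\<close> by (metis LIMSEQ_D dual_order.refl half_gt_zero real_norm_def)
      obtain m S where m: "measure \<mu> (sym_diff (\<Union>i<n. a i) (E m S)) < \<epsilon> / 2"
        using fin[of n] \<open>0 < \<epsilon>\<close> unfolding G_def by (meson half_gt_zero)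
      have "measure \<mu> ((\<Union>i. a i) - (\<Union>i<n. a i)) = measure \<mu> (\<Union>i. a i) - measure \<mu> (\<Union>i<n. a i)"
        using a_sets by (intro finite_measure_Diff) auto
      moreover have "measure \<mu> (sym_diff (\<Union>i. a i) (E m S)) \<le> measure \<mu> (((\<Union>i. a i) - (\<Union>i<n. a i)) \<union> sym_diff (\<Union>i<n. a i) (E m S))"
        using a_sets by (intro finite_measure_mono sets.Un sets.Diff) auto
      moreover have "\<dots> \<le> measure \<mu> ((\<Union>i. a i) - (\<Union>i<n. a i)) + measure \<mu> (sym_diff (\<Union>i<n. a i) (E m S))"
        using a_sets by (intro measure_Un_le sets.Un sets.Diff) auto
      ultimately have "measure \<mu> (sym_diff (\<Union>i. a i) (E m S)) < \<epsilon>" using m n by linarith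
      then show "\<exists>n S. measure \<mu> (sym_diff (\<Union>i. a i) (E n S)) < \<epsilon>" by blast
    qed
  qed (use G_cyl G_empty in auto)
  then have "G B" using assms(3) by (simp add: sets_word_borel)
  then show ?thesis using \<open>0 < \<epsilon>\<close> by (simp add: G_def E_def)
qed

text \<open>Invariance is asked only up to null sets, because the density level set in
  \<open>shift_ergodic_mutually_singular\<close> is known to be invariant only in that
  sense.\<close>

definition shift_ergodic :: "(nat \<Rightarrow> 'i) measure \<Rightarrow> bool" where
  "shift_ergodic \<mu> \<longleftrightarrow>
     (\<forall>A\<in>sets \<mu>. (AE x in \<mu>. word_shift x \<in> A \<longleftrightarrow> x \<in> A) \<longrightarrow> measure \<mu> A = 0 \<or> measure \<mu> A = 1)"

text \<open>The hypothesis is a weak mixing bound between cylinders.  Approximating first the invariant set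
  and then its complement by unions of cylinders gives \<open>\<mu> A * \<mu> (- A) = 0\<close>.\<close>

lemma shift_ergodicI:
  fixes \<mu> :: "(nat \<Rightarrow> 'i::finite) measure"
  assumes inv: "shift_invariant_prob \<mu>" and "0 < c"
    and mix: "\<And>u v. c * measure \<mu> (cyl u) * measure \<mu> (cyl v)
                \<le> (\<Sum>l\<le>K. \<Sum>k | length k = l. measure \<mu> (cyl (u @ k @ v)))"
  shows "shift_ergodic \<mu>"
  unfolding shift_ergodic_def
proof (intro ballI impI)
  have s: "sets \<mu> = sets word_borel" and ps: "prob_space \<mu>" using inv by (auto simp: shift_invariant_prob_def)
  interpret prob_space \<mu> by fact
  have sp: "space \<mu> = UNIV" using sets_eq_imp_space_eq[OF s] by simp
  fix A assume A: "A \<in> sets \<mu>" and A_inv: "AE x in \<mu>. word_shift x \<in> A \<longleftrightarrow> x \<in> A"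
  have sh: "word_shift ^^ n = (\<lambda>x k. x (n + k))" for n
    by (induction n) (auto simp: word_shift_def fun_eq_iff)
  have meas [measurable]: "(word_shift ^^ n) \<in> measurable \<mu> \<mu>" for n
    using measurable_word_shift[OF s] s by (induction n) (auto simp: measurable_cong_sets[OF refl s] intro: measurable_comp)
  have A_inv_n: "AE x in \<mu>. (word_shift ^^ n) x \<in> A \<longleftrightarrow> x \<in> A" for n
  proof (induction n)
    case (Suc n)
    from AE_shift[OF inv Suc] A_inv show ?case by eventually_elim (simp add: funpow_swap1)
  qed simp
  have inv_n: "measure \<mu> ((word_shift ^^ n) -` B) = measure \<mu> B" if "B \<in> sets \<mu>" for n B
  proof (induction n)
    case (Suc n)
    have "(word_shift ^^ n) -` B \<in> sets \<mu>" using measurable_sets[OF meas that, of n] by (simp add: sp)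
    then have "measure \<mu> (word_shift -` ((word_shift ^^ n) -` B)) = measure \<mu> ((word_shift ^^ n) -` B)"
      using inv by (simp add: shift_invariant_prob_def measure_def)
    moreover have "(word_shift ^^ Suc n) -` B = word_shift -` ((word_shift ^^ n) -` B)"
      by (simp only: funpow_Suc_right vimage_comp)
    ultimately show ?case by (simp only: Suc)
  qed simp
  have E_sets: "{x. map x [0..<n] \<in> S} \<in> sets \<mu>" for n S
    using measurable_sets[OF measurable_prefix, of S n] by (simp add: vimage_def s)
  have E_meas: "measure \<mu> (C \<inter> {x. map x [0..<n] \<in> S}) = (\<Sum>w | length w = n \<and> w \<in> S. measure \<mu> (C \<inter> cyl w))"
    if "C \<in> sets \<mu>" for C n S
  proof -
    have "measure \<mu> (C \<inter> {x. map x [0..<n] \<in> S}) = (\<Sum>w | length w = n. measure \<mu> (C \<inter> {x. map x [0..<n] \<in> S} \<inter> cyl w))"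
      using that E_sets s by (intro measure_split_cyl) (auto simp: finite_measure_axioms)
    also have "\<dots> = (\<Sum>w | length w = n. if w \<in> S then measure \<mu> (C \<inter> cyl w) else 0)"
    proof (intro sum.cong refl)
      fix w :: "'i list" assume "w \<in> {w. length w = n}"
      then have "map x [0..<n] = w" if "x \<in> cyl w" for x using that by (simp add: cyl_iff)
      then have "C \<inter> {x. map x [0..<n] \<in> S} \<inter> cyl w = (if w \<in> S then C \<inter> cyl w else {})"
        by auto
      then show "measure \<mu> (C \<inter> {x. map x [0..<n] \<in> S} \<inter> cyl w) = (if w \<in> S then measure \<mu> (C \<inter> cyl w) else 0)" by simp
    qed
    also have "\<dots> = (\<Sum>w | length w = n \<and> w \<in> S. measure \<mu> (C \<inter> cyl w))"
      by (subst sum.inter_filter[symmetric]) simp_all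
    finally show ?thesis .
  qed
  \<comment> \<open>The mixing bound with the second cylinder replaced by \<open>A\<close>: a union
    of cylinders close to \<open>A\<close> is pulled back by \<open>length u + l\<close> shifts, and
    it stays close to \<open>A\<close> because both \<open>\<mu>\<close> and \<open>A\<close> are
    invariant.\<close>
  have cyl_A: "c * measure \<mu> (cyl u) * measure \<mu> A \<le> real (Suc K) * measure \<mu> (cyl u \<inter> A)" for u
  proof (rule field_le_epsilon)
    fix e :: real assume "0 < e"
    \<comment> \<open>The errors made below add up to
      \<open>(c + real (Suc K)) * \<epsilon>\<close>, that is, to \<open>e\<close>.\<close>
    define \<epsilon> where "\<epsilon> = e / (c + real (Suc K))"
    have "0 < \<epsilon>" using \<open>0 < e\<close> \<open>0 < c\<close> by (simp add: \<epsilon>_def)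
    then obtain n S where nS: "measure \<mu> (sym_diff A {x. map x [0..<n] \<in> S}) < \<epsilon>"
      using word_approx[OF ps s A[unfolded s]] by blast
    define E where "E = {x :: nat \<Rightarrow> 'i. map x [0..<n] \<in> S}"
    have E: "E \<in> sets \<mu>" unfolding E_def by (rule E_sets)
    have "c * measure \<mu> (cyl u) * measure \<mu> E = (\<Sum>v | length v = n \<and> v \<in> S. c * measure \<mu> (cyl u) * measure \<mu> (cyl v))"
      using E_meas[of UNIV n S] sp sets.top[of \<mu>] by (simp add: E_def sum_distrib_left)
    also have "\<dots> \<le> (\<Sum>v | length v = n \<and> v \<in> S. \<Sum>l\<le>K. \<Sum>k | length k = l. measure \<mu> (cyl (u @ k @ v)))"
      by (intro sum_mono mix)
    also have "\<dots> = (\<Sum>l\<le>K. \<Sum>v | length v = n \<and> v \<in> S. \<Sum>k | length k = l. measure \<mu> (cyl (u @ k @ v)))"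
      by (rule sum.swap)
    also have "\<dots> = (\<Sum>l\<le>K. measure \<mu> (cyl u \<inter> (word_shift ^^ (length u + l)) -` E))"
    proof (intro sum.cong refl)
      fix l
      have m: "(word_shift ^^ (length u + l)) -` B \<in> sets \<mu>" if "B \<in> sets \<mu>" for B
        using measurable_sets[OF meas that] by (simp add: sp)
      have "(\<Sum>k | length k = l. measure \<mu> (cyl (u @ k @ v))) = measure \<mu> (cyl u \<inter> (word_shift ^^ (length u + l)) -` cyl v)" for v
      proof -
        have "measure \<mu> (cyl u \<inter> (word_shift ^^ (length u + l)) -` cyl v) =
          (\<Sum>w | length w = length u + l. measure \<mu> (cyl u \<inter> (word_shift ^^ (length u + l)) -` cyl v \<inter> cyl w))"
          using m[of "cyl v"] s by (intro measure_split_cyl) (auto simp: finite_measure_axioms)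
        also have "\<dots> = (\<Sum>w | length w = length u. \<Sum>k | length k = l. measure \<mu> (cyl u \<inter> (word_shift ^^ (length u + l)) -` cyl v \<inter> cyl (w @ k)))"
          by (rule sum_words_append)
        also have "\<dots> = (\<Sum>w | length w = length u. if w = u then \<Sum>k | length k = l. measure \<mu> (cyl (u @ k @ v)) else 0)"
        proof (intro sum.cong refl)
          fix w :: "'i list" assume w: "w \<in> {w. length w = length u}"
          show "(\<Sum>k | length k = l. measure \<mu> (cyl u \<inter> (word_shift ^^ (length u + l)) -` cyl v \<inter> cyl (w @ k))) =
            (if w = u then \<Sum>k | length k = l. measure \<mu> (cyl (u @ k @ v)) else 0)"
          proof (cases "w = u")
            case True
            have "cyl u \<inter> (word_shift ^^ (length u + l)) -` cyl v \<inter> cyl (u @ k) = cyl (u @ k @ v)" if "length k = l" for k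
              using that by (auto simp: cyl_append sh add.assoc)
            with True show ?thesis by simp
          next
            case False
            then have "cyl u \<inter> (word_shift ^^ (length u + l)) -` cyl v \<inter> cyl (w @ k) = {}" for k
              using w cyl_disjoint[of u w] by (auto simp: cyl_append)
            with False show ?thesis by simp
          qed
        qed
        finally show ?thesis by simp
      qed
      moreover have "E = (\<Union>v\<in>{v. length v = n \<and> v \<in> S}. cyl v)"
      proof (intro set_eqI iffI)
        fix x assume "x \<in> E"
        then show "x \<in> (\<Union>v\<in>{v. length v = n \<and> v \<in> S}. cyl v)"
          by (intro UN_I[of "map x [0..<n]"]) (auto simp: E_def)
      next
        fix x assume "x \<in> (\<Union>v\<in>{v. length v = n \<and> v \<in> S}. cyl v)"
        then obtain v where "length v = n" "v \<in> S" "x \<in> cyl v" by auto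
        then show "x \<in> E" unfolding E_def by (metis cyl_iff mem_Collect_eq)
      qed
      then have "cyl u \<inter> (word_shift ^^ (length u + l)) -` E = (\<Union>v\<in>{v. length v = n \<and> v \<in> S}. cyl u \<inter> (word_shift ^^ (length u + l)) -` cyl v)"
        by (simp only: vimage_UN Int_UN_distrib)
      moreover have "measure \<mu> \<dots> = (\<Sum>v | length v = n \<and> v \<in> S. measure \<mu> (cyl u \<inter> (word_shift ^^ (length u + l)) -` cyl v))"
      proof (rule finite_measure_finite_Union)
        show "finite {v. length v = n \<and> v \<in> S}" by (rule finite_subset[OF _ finite_words[of n]]) auto
        show "disjoint_family_on (\<lambda>v. cyl u \<inter> (word_shift ^^ (length u + l)) -` cyl v) {v. length v = n \<and> v \<in> S}"
          unfolding disjoint_family_on_def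
        proof (intro ballI impI)
          fix a b assume "a \<in> {v. length v = n \<and> v \<in> S}" "b \<in> {v. length v = n \<and> v \<in> S}" "a \<noteq> b"
          then have "cyl a \<inter> cyl b = {}" by (intro cyl_disjoint) auto
          then show "(cyl u \<inter> (word_shift ^^ (length u + l)) -` cyl a) \<inter> (cyl u \<inter> (word_shift ^^ (length u + l)) -` cyl b) = {}"
            by blast
        qed
        show "(\<lambda>v. cyl u \<inter> (word_shift ^^ (length u + l)) -` cyl v) ` {v. length v = n \<and> v \<in> S} \<subseteq> sets \<mu>"
          by (intro image_subsetI sets.Int m) (simp_all add: s)
      qed
      ultimately show "(\<Sum>v | length v = n \<and> v \<in> S. \<Sum>k | length k = l. measure \<mu> (cyl (u @ k @ v))) =
        measure \<mu> (cyl u \<inter> (word_shift ^^ (length u + l)) -` E)" by simp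
    qed
    also have "\<dots> \<le> (\<Sum>l\<le>K. measure \<mu> (cyl u \<inter> A) + \<epsilon>)"
    proof (rule sum_mono)
      fix l
      let ?s = "(word_shift ^^ (length u + l))"
      have m: "?s -` B \<in> sets \<mu>" if "B \<in> sets \<mu>" for B
        using measurable_sets[OF meas that] by (simp add: sp)
      have "measure \<mu> (cyl u \<inter> ?s -` E) \<le> measure \<mu> (cyl u \<inter> ?s -` A \<union> ?s -` (sym_diff A E))"
        using m A E s by (intro finite_measure_mono sets.Un sets.Diff) auto
      also have "\<dots> \<le> measure \<mu> (cyl u \<inter> ?s -` A) + measure \<mu> (?s -` (sym_diff A E))"
        using m A E s by (intro measure_Un_le sets.Un sets.Diff) auto
      also have "measure \<mu> (?s -` (sym_diff A E)) = measure \<mu> (sym_diff A E)"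
        using A E by (intro inv_n sets.Un sets.Diff)
      also have "\<dots> < \<epsilon>" using nS by (simp add: E_def)
      also have "measure \<mu> (cyl u \<inter> ?s -` A) = measure \<mu> (cyl u \<inter> A)"
        using A_inv_n[of "length u + l"] m[OF A] A s
        by (intro finite_measure_eq_AE) (auto elim: eventually_mono)
      finally show "measure \<mu> (cyl u \<inter> ?s -` E) \<le> measure \<mu> (cyl u \<inter> A) + \<epsilon>" by simp
    qed
    also have "\<dots> = real (Suc K) * measure \<mu> (cyl u \<inter> A) + real (Suc K) * \<epsilon>" by (simp add: algebra_simps)
    finally have 1: "c * measure \<mu> (cyl u) * measure \<mu> E \<le> real (Suc K) * measure \<mu> (cyl u \<inter> A) + real (Suc K) * \<epsilon>" .
    have "measure \<mu> A \<le> measure \<mu> (E \<union> sym_diff A E)" using A E by (intro finite_measure_mono sets.Un sets.Diff) auto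
    also have "\<dots> \<le> measure \<mu> E + measure \<mu> (sym_diff A E)" using A E by (intro measure_Un_le sets.Un sets.Diff) auto
    finally have "measure \<mu> A \<le> measure \<mu> E + \<epsilon>" using nS by (simp add: E_def)
    then have "c * measure \<mu> (cyl u) * measure \<mu> A \<le> c * measure \<mu> (cyl u) * measure \<mu> E + c * measure \<mu> (cyl u) * \<epsilon>"
      using \<open>0 < c\<close> by (simp flip: distrib_left add: mult_left_mono)
    also have "c * measure \<mu> (cyl u) * \<epsilon> \<le> c * 1 * \<epsilon>"
      using \<open>0 < c\<close> \<open>0 < \<epsilon>\<close> by (intro mult_right_mono mult_left_mono) auto
    finally have "c * measure \<mu> (cyl u) * measure \<mu> A \<le> real (Suc K) * measure \<mu> (cyl u \<inter> A) + (c + real (Suc K)) * \<epsilon>"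
      using 1 by (simp add: algebra_simps)
    also have "(c + real (Suc K)) * \<epsilon> = e" using \<open>0 < c\<close> by (simp add: \<epsilon>_def)
    finally show "c * measure \<mu> (cyl u) * measure \<mu> A \<le> real (Suc K) * measure \<mu> (cyl u \<inter> A) + e" .
  qed
  have A': "- A \<in> sets \<mu>" using sets.compl_sets[OF A] sp by (simp add: Compl_eq_Diff_UNIV)
  have "c * measure \<mu> A * (1 - measure \<mu> A) \<le> 0"
  proof (rule field_le_epsilon)
    fix e :: real assume "0 < e"
    define \<epsilon> where "\<epsilon> = e / (c + real (Suc K))"
    have "0 < \<epsilon>" using \<open>0 < e\<close> \<open>0 < c\<close> by (simp add: \<epsilon>_def)
    then obtain n S where nS: "measure \<mu> (sym_diff (- A) {x. map x [0..<n] \<in> S}) < \<epsilon>"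
      using word_approx[OF ps s A'[unfolded s]] by blast
    define E where "E = {x :: nat \<Rightarrow> 'i. map x [0..<n] \<in> S}"
    have E: "E \<in> sets \<mu>" unfolding E_def by (rule E_sets)

    have "c * measure \<mu> E * measure \<mu> A = (\<Sum>v | length v = n \<and> v \<in> S. c * measure \<mu> (cyl v) * measure \<mu> A)"
      using E_meas[of UNIV n S] sp sets.top[of \<mu>] by (simp add: E_def sum_distrib_left sum_distrib_right)
    also have "\<dots> \<le> (\<Sum>v | length v = n \<and> v \<in> S. real (Suc K) * measure \<mu> (A \<inter> cyl v))"
      using cyl_A by (intro sum_mono) (simp add: Int_commute)
    also have "\<dots> = real (Suc K) * measure \<mu> (A \<inter> E)"
      using E_meas[OF A, of n S] by (simp add: E_def sum_distrib_left)
    \<comment> \<open>\<open>E\<close> approximates the complement of \<open>A\<close>, hence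
      \<open>A \<inter> E\<close> lies in the error set.\<close>
    also have "\<dots> \<le> real (Suc K) * measure \<mu> (sym_diff (- A) E)"
      using A' E by (intro mult_left_mono finite_measure_mono sets.Un sets.Diff) auto
    also have "\<dots> \<le> real (Suc K) * \<epsilon>" using nS by (intro mult_left_mono) (auto simp: E_def)
    finally have 1: "c * measure \<mu> E * measure \<mu> A \<le> real (Suc K) * \<epsilon>" .
    have "1 - measure \<mu> A = measure \<mu> (- A)" using prob_compl[OF A] sp by (simp add: Compl_eq_Diff_UNIV)
    also have "\<dots> \<le> measure \<mu> (E \<union> sym_diff (- A) E)" using A' E by (intro finite_measure_mono sets.Un sets.Diff) auto
    also have "\<dots> \<le> measure \<mu> E + measure \<mu> (sym_diff (- A) E)" using A' E by (intro measure_Un_le sets.Un sets.Diff) auto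
    finally have "1 - measure \<mu> A \<le> measure \<mu> E + \<epsilon>" using nS by (simp add: E_def)
    then have "c * measure \<mu> A * (1 - measure \<mu> A) \<le> c * measure \<mu> A * measure \<mu> E + c * measure \<mu> A * \<epsilon>"
      using \<open>0 < c\<close> by (simp flip: distrib_left add: mult_left_mono)
    also have "c * measure \<mu> A * \<epsilon> \<le> c * 1 * \<epsilon>"
      using \<open>0 < c\<close> \<open>0 < \<epsilon>\<close> by (intro mult_right_mono mult_left_mono) auto
    finally have "c * measure \<mu> A * (1 - measure \<mu> A) \<le> (c + real (Suc K)) * \<epsilon>"
      using 1 by (simp add: algebra_simps)
    also have "(c + real (Suc K)) * \<epsilon> = e" using \<open>0 < c\<close> by (simp add: \<epsilon>_def)
    finally show "c * measure \<mu> A * (1 - measure \<mu> A) \<le> 0 + e" by simp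
  qed
  then show "measure \<mu> A = 0 \<or> measure \<mu> A = 1"
    using \<open>0 < c\<close> prob_le_1[of A] measure_nonneg[of \<mu> A] by (auto simp: mult_le_0_iff)
qed

text \<open>The density of \<open>\<mu>\<close> with respect to \<open>\<mu> + \<nu>\<close>
  compares the two measures by one number: above 1/2 the first one outweighs the second.\<close>

definition sum_measure :: "'a measure \<Rightarrow> 'a measure \<Rightarrow> 'a measure" where
  "sum_measure M N = measure_of (space M) (sets M) (\<lambda>A. emeasure M A + emeasure N A)"

lemma sum_measure_simps [simp]:
  "space (sum_measure M N) = space M" "sets (sum_measure M N) = sets M"
  by (simp_all add: sum_measure_def)

lemma emeasure_sum_measure:
  assumes "sets N = sets M" "A \<in> sets M"
  shows "emeasure (sum_measure M N) A = emeasure M A + emeasure N A"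
proof (rule emeasure_measure_of[OF sum_measure_def])
  show "countably_additive (sets (sum_measure M N)) (\<lambda>A. emeasure M A + emeasure N A)"
    using assms(1)
    by (auto simp: countably_additive_def suminf_emeasure suminf_add[OF summableI summableI, symmetric])
qed (use assms in \<open>auto simp: positive_def dest: sets.sets_into_space\<close>)

text \<open>Let \<open>A\<close> be the set where \<open>\<mu>\<close> has density above 1/2 with
  respect to \<open>\<rho> = \<mu> + \<nu>\<close>; on it \<open>\<mu>\<close> outweighs
  \<open>\<nu>\<close>, off it \<open>\<mu>\<close> is at most \<open>\<nu>\<close>. This set is
  invariant up to null sets, so ergodicity gives it measure 0 or 1. If \<open>\<mu> A = 0\<close> or
  \<open>\<nu> A = 1\<close>, one measure is dominated by the other on every set, and two
  probabilities so related coincide.\<close>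

lemma shift_ergodic_mutually_singular:
  fixes \<mu> \<nu> :: "(nat \<Rightarrow> 'i::finite) measure"
  assumes inv: "shift_invariant_prob \<mu>" "shift_invariant_prob \<nu>"
    and erg: "shift_ergodic \<mu>" "shift_ergodic \<nu>" and ne: "\<mu> \<noteq> \<nu>"
  shows "\<exists>A\<in>sets word_borel. emeasure \<mu> A = 0 \<and> emeasure \<nu> (UNIV - A) = 0"
proof -
  have s: "sets \<mu> = sets word_borel" "sets \<nu> = sets word_borel" using inv by (auto simp: shift_invariant_prob_def)
  have sp [simp]: "space \<mu> = UNIV" "space \<nu> = UNIV" using sets_eq_imp_space_eq[OF s(1)] sets_eq_imp_space_eq[OF s(2)] by simp_all
  interpret M: prob_space \<mu> using inv by (auto simp: shift_invariant_prob_def)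
  interpret N: prob_space \<nu> using inv by (auto simp: shift_invariant_prob_def)
  have eqI: "\<mu> = \<nu>" if le: "\<And>B. B \<in> sets word_borel \<Longrightarrow> emeasure \<mu> B \<le> emeasure \<nu> B"
  proof (rule measure_eqI)
    fix B assume "B \<in> sets \<mu>"
    then have B: "B \<in> sets word_borel" "UNIV - B \<in> sets word_borel" using s sets.compl_sets[of B \<mu>] by auto
    have "measure \<mu> B \<le> measure \<nu> B" "measure \<mu> (UNIV - B) \<le> measure \<nu> (UNIV - B)"
      using le[OF B(1)] le[OF B(2)] by (auto simp: M.emeasure_eq_measure N.emeasure_eq_measure)
    then have "measure \<mu> B = measure \<nu> B"
      using M.prob_compl[of B] N.prob_compl[of B] B s by simp
    then show "emeasure \<mu> B = emeasure \<nu> B" by (simp add: M.emeasure_eq_measure N.emeasure_eq_measure)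
  qed (simp add: s)
  define \<rho> where "\<rho> = sum_measure \<mu> \<nu>"
  have s\<rho> [simp]: "sets \<rho> = sets word_borel" "space \<rho> = UNIV" by (simp_all add: \<rho>_def s)
  have \<rho>: "emeasure \<rho> B = emeasure \<mu> B + emeasure \<nu> B" if "B \<in> sets word_borel" for B
    unfolding \<rho>_def using that s by (intro emeasure_sum_measure) auto
  interpret R: finite_measure \<rho>
    by (rule finite_measureI) (simp add: \<rho> M.emeasure_eq_measure N.emeasure_eq_measure sets.top[of word_borel, simplified])
  have "absolutely_continuous \<rho> \<mu>"
    unfolding absolutely_continuous_def using s by (auto simp: null_sets_def \<rho>)
  then obtain f where f [measurable]: "f \<in> borel_measurable \<rho>" and dens: "density \<rho> f = \<mu>"
    using R.Radon_Nikodym s by auto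
  have em: "emeasure \<mu> B = (\<integral>\<^sup>+x\<in>B. f x \<partial>\<rho>)" if "B \<in> sets word_borel" for B
    using that unfolding dens[symmetric] by (subst emeasure_density) auto
  define A where "A = {x. f x > 1/2}"
  have A: "A \<in> sets word_borel" using measurable_sets[OF f, of "{1/2<..}"] by (simp add: A_def vimage_def)
  have shift: "word_shift -` B \<in> sets word_borel" if "B \<in> sets word_borel" for B :: "(nat \<Rightarrow> 'i) set"
    using measurable_sets[OF measurable_word_shift[OF refl] that] by simp
  have inv\<rho>: "emeasure \<rho> (word_shift -` A) = emeasure \<rho> A"
    using inv A shift by (simp add: \<rho> shift_invariant_prob_def)
  have inv\<mu>: "emeasure \<mu> (word_shift -` A) = emeasure \<mu> A"
    using inv A by (simp add: shift_invariant_prob_def)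
  let ?B1 = "A - word_shift -` A" and ?B2 = "word_shift -` A - A"
  have B: "?B1 \<in> sets word_borel" "?B2 \<in> sets word_borel" "A \<inter> word_shift -` A \<in> sets word_borel" 
    using A shift by auto
  have diff_eq: "emeasure \<kappa> ?B1 = emeasure \<kappa> ?B2"
    if "finite_measure \<kappa>" "sets \<kappa> = sets word_borel" "emeasure \<kappa> (word_shift -` A) = emeasure \<kappa> A" for \<kappa>
  proof -
    interpret finite_measure \<kappa> by fact
    have "measure \<kappa> A = measure \<kappa> (A \<inter> word_shift -` A) + measure \<kappa> ?B1"
      using finite_measure_Diff'[of A "word_shift -` A"] A shift that by simp
    moreover have "measure \<kappa> (word_shift -` A) = measure \<kappa> (A \<inter> word_shift -` A) + measure \<kappa> ?B2"
      using finite_measure_Diff'[of "word_shift -` A" A] A shift that by (simp add: Int_commute)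
    moreover have "measure \<kappa> (word_shift -` A) = measure \<kappa> A" using that by (simp add: measure_def)
    ultimately show ?thesis by (simp add: emeasure_eq_measure)
  qed
  \<comment> \<open>What leaves \<open>A\<close> under the shift and what enters it have equal
    \<open>\<rho>\<close>-measure and equal \<open>\<mu>\<close>-measure by invariance, but the
    density is above 1/2 on the first part and at most 1/2 on the second.\<close>
  have B1_null: "emeasure \<rho> ?B1 = 0"
  proof (rule ccontr)
    assume nz: "emeasure \<rho> ?B1 \<noteq> 0"
    have "(\<integral>\<^sup>+x. (1/2::ennreal) * indicator ?B1 x \<partial>\<rho>) < (\<integral>\<^sup>+x. f x * indicator ?B1 x \<partial>\<rho>)"
    proof (rule nn_integral_less)
      show "(\<lambda>x. (1/2::ennreal) * indicator ?B1 x) \<in> borel_measurable \<rho>" "(\<lambda>x. f x * indicator ?B1 x) \<in> borel_measurable \<rho>"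
        by (intro borel_measurable_times_ennreal borel_measurable_indicator f borel_measurable_const; simp add: B)+
      show "(\<integral>\<^sup>+x. (1/2::ennreal) * indicator ?B1 x \<partial>\<rho>) \<noteq> \<infinity>"
        using B by (simp add: nn_integral_cmult_indicator ennreal_mult_eq_top_iff ennreal_divide_eq_top_iff R.emeasure_finite)
      show "AE x in \<rho>. (1/2::ennreal) * indicator ?B1 x \<le> f x * indicator ?B1 x"
        by (auto simp: A_def not_less split: split_indicator)
      show "\<not> (AE x in \<rho>. f x * indicator ?B1 x \<le> (1/2::ennreal) * indicator ?B1 x)"
      proof
        assume "AE x in \<rho>. f x * indicator ?B1 x \<le> (1/2::ennreal) * indicator ?B1 x"
        then have "AE x in \<rho>. x \<notin> ?B1"
          by eventually_elim (auto simp: A_def not_le[symmetric] split: split_indicator_asm)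
        then have "?B1 \<in> null_sets \<rho>" using B by (subst AE_iff_null_sets) auto
        then show False using nz by auto
      qed
    qed
    also have "\<dots> = (\<integral>\<^sup>+x. f x * indicator ?B2 x \<partial>\<rho>)"
      using diff_eq[OF M.finite_measure_axioms s(1) inv\<mu>] em B by simp
    also have "\<dots> \<le> (\<integral>\<^sup>+x. (1/2::ennreal) * indicator ?B2 x \<partial>\<rho>)"
      by (rule nn_integral_mono) (auto simp: A_def not_less split: split_indicator)
    also have "\<dots> = 1/2 * emeasure \<rho> ?B2" using B by (simp add: nn_integral_cmult_indicator)
    also have "\<dots> = (\<integral>\<^sup>+x. (1/2::ennreal) * indicator ?B1 x \<partial>\<rho>)"
      using diff_eq[OF R.finite_measure_axioms s\<rho>(1) inv\<rho>] B by (simp add: nn_integral_cmult_indicator)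
    finally show False by simp
  qed
  then have B2_null: "emeasure \<rho> ?B2 = 0"
    using diff_eq[OF R.finite_measure_axioms s\<rho>(1) inv\<rho>] by simp
  have AE_inv: "AE x in \<kappa>. word_shift x \<in> A \<longleftrightarrow> x \<in> A"
    if "sets \<kappa> = sets word_borel" "emeasure \<kappa> ?B1 = 0" "emeasure \<kappa> ?B2 = 0" for \<kappa>
  proof -
    have "?B1 \<in> null_sets \<kappa>" "?B2 \<in> null_sets \<kappa>" using that B by auto
    from AE_not_in[OF this(1)] AE_not_in[OF this(2)] show ?thesis by eventually_elim auto
  qed
  have null: "emeasure \<mu> ?B1 = 0" "emeasure \<mu> ?B2 = 0" "emeasure \<nu> ?B1 = 0" "emeasure \<nu> ?B2 = 0"
    using B1_null B2_null \<rho>[OF B(1)] \<rho>[OF B(2)] by auto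
  have dich: "measure \<mu> A = 0 \<or> measure \<mu> A = 1" "measure \<nu> A = 0 \<or> measure \<nu> A = 1"
    using erg AE_inv[OF s(1) null(1,2)] AE_inv[OF s(2) null(3,4)] A s by (auto simp: shift_ergodic_def)
  have half: "(1/2::ennreal) * (ennreal a + ennreal b) = ennreal (1/2 * (a + b))" if "0 \<le> a" "0 \<le> b" for a b
  proof -
    have "(1/2::ennreal) = ennreal (1/2)" using divide_ennreal[of 1 2] by simp
    then show ?thesis using that by (simp only: ennreal_plus[symmetric] ennreal_mult[symmetric])
  qed
  have on_A: "emeasure \<nu> B \<le> emeasure \<mu> B" if "B \<subseteq> A" "B \<in> sets word_borel" for B
  proof -
    have "1/2 * emeasure \<rho> B = (\<integral>\<^sup>+x. (1/2::ennreal) * indicator B x \<partial>\<rho>)" using that by (simp add: nn_integral_cmult_indicator)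
    also have "\<dots> \<le> emeasure \<mu> B" unfolding em[OF that(2)]
      using that(1) by (intro nn_integral_mono) (auto simp: A_def not_less split: split_indicator)
    finally have "ennreal (1/2 * (measure \<mu> B + measure \<nu> B)) \<le> ennreal (measure \<mu> B)"
      using that by (simp only: \<rho> M.emeasure_eq_measure N.emeasure_eq_measure half measure_nonneg)
    then show ?thesis by (simp add: M.emeasure_eq_measure N.emeasure_eq_measure)
  qed
  have off_A: "emeasure \<mu> B \<le> emeasure \<nu> B" if "B \<inter> A = {}" "B \<in> sets word_borel" for B
  proof -
    have "emeasure \<mu> B \<le> (\<integral>\<^sup>+x. (1/2::ennreal) * indicator B x \<partial>\<rho>)" unfolding em[OF that(2)]
      using that(1) by (intro nn_integral_mono) (auto simp: A_def not_less split: split_indicator)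
    also have "\<dots> = 1/2 * emeasure \<rho> B" using that by (simp add: nn_integral_cmult_indicator)
    finally have "ennreal (measure \<mu> B) \<le> ennreal (1/2 * (measure \<mu> B + measure \<nu> B))"
      using that by (simp only: \<rho> M.emeasure_eq_measure N.emeasure_eq_measure half measure_nonneg)
    then show ?thesis by (simp add: M.emeasure_eq_measure N.emeasure_eq_measure)
  qed
  have split: "emeasure \<kappa> B = emeasure \<kappa> (B \<inter> A)" 
    if "emeasure \<kappa> (UNIV - A) = 0" "sets \<kappa> = sets word_borel" "B \<in> sets word_borel" for \<kappa> B
  proof -
    have "UNIV - A \<in> null_sets \<kappa>" using that A sets.compl_sets[of A word_borel] by auto
    from AE_not_in[OF this] show ?thesis using that A by (intro emeasure_eq_AE) auto
  qed
  have split': "emeasure \<kappa> B = emeasure \<kappa> (B - A)" 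
    if "emeasure \<kappa> A = 0" "sets \<kappa> = sets word_borel" "B \<in> sets word_borel" for \<kappa> B
  proof -
    have "A \<in> null_sets \<kappa>" using that A by auto
    from AE_not_in[OF this] show ?thesis using that A by (intro emeasure_eq_AE) auto
  qed
  have "measure \<mu> A \<noteq> 0"
  proof
    assume "measure \<mu> A = 0"
    then have z: "emeasure \<mu> A = 0" by (simp add: M.emeasure_eq_measure)
    have "emeasure \<mu> B \<le> emeasure \<nu> B" if B: "B \<in> sets word_borel" for B
    proof -
      have "emeasure \<mu> B = emeasure \<mu> (B - A)" by (rule split'[OF z s(1) B])
      also have "\<dots> \<le> emeasure \<nu> (B - A)" using A B by (intro off_A) auto
      also have "\<dots> \<le> emeasure \<nu> B" using B s by (intro emeasure_mono) auto
      finally show ?thesis .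
    qed
    with ne eqI show False by blast
  qed
  with dich have 1: "measure \<mu> A = 1" by blast
  have "measure \<nu> A \<noteq> 1"
  proof
    assume "measure \<nu> A = 1"
    then have z: "emeasure \<nu> (UNIV - A) = 0" using N.prob_compl[of A] A s by (simp add: N.emeasure_eq_measure)
    have "emeasure \<nu> B \<le> emeasure \<mu> B" if B: "B \<in> sets word_borel" for B
    proof -
      have "emeasure \<nu> B = emeasure \<nu> (B \<inter> A)" by (rule split[OF z s(2) B])
      also have "\<dots> \<le> emeasure \<mu> (B \<inter> A)" using A B by (intro on_A) auto
      also have "\<dots> \<le> emeasure \<mu> B" using B s by (intro emeasure_mono) auto
      finally show ?thesis .
    qed
    then have "emeasure \<mu> B \<le> emeasure \<nu> B" if B: "B \<in> sets word_borel" for B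
    proof -
      have B': "UNIV - B \<in> sets word_borel" using sets.compl_sets[OF B] by simp
      have "emeasure \<nu> (UNIV - B) \<le> emeasure \<mu> (UNIV - B)"
        using \<open>\<And>B. B \<in> sets word_borel \<Longrightarrow> emeasure \<nu> B \<le> emeasure \<mu> B\<close>[OF B'] .
      then show ?thesis
        using M.prob_compl[of B] N.prob_compl[of B] B s by (simp add: M.emeasure_eq_measure N.emeasure_eq_measure)
    qed
    with ne eqI show False by blast
  qed
  with dich have 2: "measure \<nu> A = 0" by blast
  show ?thesis
  proof (intro bexI[of _ "UNIV - A"] conjI)
    show "emeasure \<mu> (UNIV - A) = 0" using 1 M.prob_compl[of A] A s by (simp add: M.emeasure_eq_measure)
    show "emeasure \<nu> (UNIV - (UNIV - A)) = 0" using 2 by (simp add: N.emeasure_eq_measure Diff_Diff_Int)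
    show "UNIV - A \<in> sets word_borel" using sets.compl_sets[OF A] by simp
  qed
qed

section \<open>Matrices of order 2 and their Kronecker products\<close>

lemma norm_real2: "norm (z :: real^2) = sqrt ((z$1)\<^sup>2 + (z$2)\<^sup>2)"
  by (simp add: norm_eq_sqrt_inner inner_vec_def sum_2 power2_eq_square)

lemma norm_real4: "norm (z :: real^4) = sqrt ((z$1)\<^sup>2 + (z$2)\<^sup>2 + (z$3)\<^sup>2 + (z$4)\<^sup>2)"
  by (simp add: norm_eq_sqrt_inner inner_vec_def sum_4 power2_eq_square)

lemma diag2_nth [simp]: "diag2 a b $ 1 $ 1 = a" "diag2 a b $ 1 $ 2 = 0" "diag2 a b $ 2 $ 1 = 0" "diag2 a b $ 2 $ 2 = b"
  by (simp_all add: diag2_def)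

lemma rot2_nth [simp]: "rot2 t $ 1 $ 1 = cos t" "rot2 t $ 1 $ 2 = - sin t" "rot2 t $ 2 $ 1 = sin t" "rot2 t $ 2 $ 2 = cos t"
  by (simp_all add: rot2_def)

lemma diag2_mult_vec: "diag2 a b *v z = vector [a * z $ 1, b * z $ 2]"
  by (simp add: vec_eq_iff forall_2 matrix_vector_mult_def sum_2)

lemma rot2_mult_vec: "rot2 t *v z = vector [cos t * z $ 1 - sin t * z $ 2, sin t * z $ 1 + cos t * z $ 2]"
  by (simp add: vec_eq_iff forall_2 matrix_vector_mult_def sum_2)

lemma rot2_add: "rot2 s ** rot2 t = rot2 (s + t)"
  by (simp add: vec_eq_iff forall_2 matrix_matrix_mult_def sum_2 cos_add sin_add)

lemma rot2_0 [simp]: "rot2 0 = mat 1"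
  by (simp add: vec_eq_iff forall_2 mat_def)

lemma diag2_mult: "diag2 a b ** diag2 c d = diag2 (a * c) (b * d)"
  by (simp add: vec_eq_iff forall_2 matrix_matrix_mult_def sum_2)

lemma diag2_1 [simp]: "diag2 1 1 = mat 1"
  by (simp add: vec_eq_iff forall_2 mat_def)

lemma det_diag2 [simp]: "det (diag2 a b) = a * b"
  by (simp add: det_2)

lemma det_rot2 [simp]: "det (rot2 t) = 1"
  by (simp add: det_2 flip: power2_eq_square)

lemma norm_rot2 [simp]: "norm (rot2 t *v z) = norm z"
proof -
  have "(cos t * x - sin t * y)\<^sup>2 + (sin t * x + cos t * y)\<^sup>2 = x\<^sup>2 + y\<^sup>2" for x y
  proof -
    have "(cos t * x - sin t * y)\<^sup>2 + (sin t * x + cos t * y)\<^sup>2 = ((sin t)\<^sup>2 + (cos t)\<^sup>2) * (x\<^sup>2 + y\<^sup>2)"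
      by algebra
    then show ?thesis by simp
  qed
  then show ?thesis by (simp add: norm_real2 rot2_mult_vec)
qed

definition opn :: "real^2^2 \<Rightarrow> real" where
  "opn X = onorm ((*v) X)"

lemma opn_nonneg: "0 \<le> opn X"
  by (simp add: opn_def onorm_pos_le)

lemma norm_le_opn: "norm (X *v z) \<le> opn X * norm z"
  by (simp add: opn_def onorm)

lemma opn_leI: "(\<And>z. norm (X *v z) \<le> b * norm z) \<Longrightarrow> opn X \<le> b"
  unfolding opn_def by (rule onorm_le)

lemma opn_mult: "opn (X ** Y) \<le> opn X * opn Y"
proof (rule opn_leI)
  fix z
  have "norm (X *v (Y *v z)) \<le> opn X * (opn Y * norm z)"
    using norm_le_opn[of X "Y *v z"] mult_left_mono[OF norm_le_opn[of Y z] opn_nonneg[of X]] by linarith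
  then show "norm ((X ** Y) *v z) \<le> opn X * opn Y * norm z"
    by (simp add: matrix_vector_mul_assoc mult.assoc)
qed

lemma norm_diag2_le: "\<bar>b\<bar> \<le> a \<Longrightarrow> norm (diag2 a b *v z) \<le> a * norm z"
proof -
  assume "\<bar>b\<bar> \<le> a"
  then have "(b * z$2)\<^sup>2 \<le> (a * z$2)\<^sup>2" 
    by (simp add: power_mult_distrib mult_right_mono abs_le_square_iff[symmetric])
  then have "norm (diag2 a b *v z) \<le> sqrt ((a * z$1)\<^sup>2 + (a * z$2)\<^sup>2)"
    by (simp add: norm_real2 diag2_mult_vec)
  also have "\<dots> = sqrt (a\<^sup>2 * ((z$1)\<^sup>2 + (z$2)\<^sup>2))" by (simp add: power_mult_distrib distrib_left)
  also have "\<dots> = a * norm z"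
    using \<open>\<bar>b\<bar> \<le> a\<close> by (simp add: norm_real2 real_sqrt_mult)
  finally show ?thesis .
qed

text \<open>In the conformal coordinates of the plane a matrix is \<open>z \<mapsto> E z + F (cnj z)\<close>, with singular values
  \<open>\<bar>E\<bar> + \<bar>F\<bar>\<close> and \<open>\<bar>E\<bar> - \<bar>F\<bar>\<close>; the angles are the half sum and half difference of the arguments.\<close>

lemma svd2:
  fixes X :: "real^2^2"
  assumes "det X > 0"
  obtains \<phi> \<psi> a b where "X = rot2 \<phi> ** diag2 a b ** rot2 \<psi>" "0 < b" "b \<le> a"
proof -
  define E F where "E = Complex ((X$1$1 + X$2$2) / 2) ((X$2$1 - X$1$2) / 2)"
    and "F = Complex ((X$1$1 - X$2$2) / 2) ((X$2$1 + X$1$2) / 2)"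
  define q r \<beta> \<gamma> where "q = cmod E" and "r = cmod F" and "\<beta> = Arg E" and "\<gamma> = Arg F"
  have E: "E = rcis q \<beta>" and F: "F = rcis r \<gamma>" by (simp_all add: q_def r_def \<beta>_def \<gamma>_def rcis_cmod_Arg)
  have *: "X$1$1 = q * cos \<beta> + r * cos \<gamma>" "X$2$2 = q * cos \<beta> - r * cos \<gamma>"
    "X$2$1 = q * sin \<beta> + r * sin \<gamma>" "X$1$2 = r * sin \<gamma> - q * sin \<beta>"
    using arg_cong[OF E, of Re] arg_cong[OF F, of Re] arg_cong[OF E, of Im] arg_cong[OF F, of Im]
    by (auto simp: E_def F_def)
  have "det X = q\<^sup>2 * ((sin \<beta>)\<^sup>2 + (cos \<beta>)\<^sup>2) - r\<^sup>2 * ((sin \<gamma>)\<^sup>2 + (cos \<gamma>)\<^sup>2)"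
    unfolding det_2 * by algebra
  then have "r\<^sup>2 < q\<^sup>2" using assms by simp
  moreover have "0 \<le> q" "0 \<le> r" by (simp_all add: q_def r_def)
  ultimately have "r < q" by (meson power2_less_imp_less)
  define \<phi> \<psi> where "\<phi> = (\<beta> + \<gamma>) / 2" and "\<psi> = (\<beta> - \<gamma>) / 2"
  have \<beta>: "\<beta> = \<phi> + \<psi>" and \<gamma>: "\<gamma> = \<phi> - \<psi>" by (simp_all add: \<phi>_def \<psi>_def field_simps)
  have "X = rot2 \<phi> ** diag2 (q + r) (q - r) ** rot2 \<psi>"
    by (simp add: vec_eq_iff forall_2 matrix_matrix_mult_def sum_2 *)
       (simp add: \<beta> \<gamma> cos_add sin_add cos_diff sin_diff algebra_simps)
  then show ?thesis using that[of \<phi> "q + r" "q - r" \<psi>] \<open>r < q\<close> \<open>0 \<le> r\<close> by auto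
qed

lemma opn_svd2:
  assumes "0 < b" "b \<le> a"
  shows "opn (rot2 \<phi> ** diag2 a b ** rot2 \<psi>) = a"
proof (rule antisym)
  let ?X = "rot2 \<phi> ** diag2 a b ** rot2 \<psi>"
  show "opn ?X \<le> a"
  proof (rule opn_leI)
    fix z :: "real^2"
    show "norm (?X *v z) \<le> a * norm z"
      using norm_diag2_le[of b a "rot2 \<psi> *v z"] assms by (simp add: matrix_vector_mul_assoc[symmetric])
  qed
  let ?v = "rot2 (- \<psi>) *v vector [1, 0]"
  have "?X *v ?v = rot2 \<phi> *v (diag2 a b *v vector [1, 0])"
    by (simp add: matrix_vector_mul_assoc matrix_mul_assoc[symmetric] rot2_add)
  then have "norm (?X *v ?v) = norm (diag2 a b *v vector [1, 0])" by simp
  also have "\<dots> = a" using assms by (simp add: norm_real2 diag2_mult_vec)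
  finally have "norm (?X *v ?v) = a" .
  moreover have "norm (vector [1, 0] :: real^2) = 1" by (simp add: norm_real2)
  then have "norm ?v = 1" by simp
  ultimately show "a \<le> opn ?X" using norm_le_opn[of ?X ?v] by simp
qed

lemma opn_rot2 [simp]: "opn (rot2 t) = 1"
  using opn_svd2[of 1 1 t 0] by simp

lemma opn_diag2: "0 < b \<Longrightarrow> b \<le> a \<Longrightarrow> opn (diag2 a b) = a"
  using opn_svd2[of b a 0 0] by simp

lemma opn_diag2': "0 < a \<Longrightarrow> a \<le> b \<Longrightarrow> opn (diag2 a b) = b"
proof -
  assume "0 < a" "a \<le> b"
  \<comment> \<open>Conjugation by a quarter turn exchanges the axes.\<close>
  moreover have "diag2 a b = rot2 (pi/2) ** diag2 b a ** rot2 (- (pi/2))"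
    by (simp add: vec_eq_iff forall_2 matrix_matrix_mult_def sum_2)
  ultimately show ?thesis using opn_svd2[of a b "pi/2" "- (pi/2)"] by simp
qed

lemma opn_det:
  assumes "det X > 0"
  shows "0 < opn X" "det X \<le> (opn X)\<^sup>2"
proof -
  obtain \<phi> \<psi> a b where X: "X = rot2 \<phi> ** diag2 a b ** rot2 \<psi>" "0 < b" "b \<le> a" using svd2[OF assms] .
  have "opn X = a" "det X = a * b" using X by (simp_all add: opn_svd2 det_mul)
  then show "0 < opn X" "det X \<le> (opn X)\<^sup>2" using X by (simp_all add: power2_eq_square)
qed

lemma opn_mult_rot2: "opn (X ** rot2 t) = opn X"
proof (rule antisym)
  show "opn (X ** rot2 t) \<le> opn X" using opn_mult[of X "rot2 t"] by simp
  have "X = (X ** rot2 t) ** rot2 (- t)" by (simp add: matrix_mul_assoc[symmetric] rot2_add)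
  then show "opn X \<le> opn (X ** rot2 t)" using opn_mult[of "X ** rot2 t" "rot2 (- t)"] by simp
qed

lemma opn_mult_diag2:
  assumes "0 < b" "b \<le> a"
  shows "b * opn X \<le> opn (X ** diag2 a b)" "opn (X ** diag2 a b) \<le> a * opn X"
proof -
  have "X = (X ** diag2 a b) ** diag2 (1 / a) (1 / b)"
    using assms by (simp add: matrix_mul_assoc[symmetric] diag2_mult)
  then have "opn X \<le> opn (X ** diag2 a b) * opn (diag2 (1 / a) (1 / b))" by (metis opn_mult)
  then show "b * opn X \<le> opn (X ** diag2 a b)"
    using assms by (simp add: opn_diag2' frac_le field_simps)
  show "opn (X ** diag2 a b) \<le> a * opn X"
    using opn_mult[of X "diag2 a b"] assms by (simp add: opn_diag2 mult.commute)
qed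

section \<open>Norms of products and scalar products of singular directions\<close>

definition unit2 :: "real \<Rightarrow> real^2" where "unit2 t = vector [cos t, sin t]"

lemma unit2_nth [simp]: "unit2 t $ 1 = cos t" "unit2 t $ 2 = sin t"
  by (simp_all add: unit2_def)

text \<open>\<open>unit2 p\<close> is the direction that \<open>X\<close> stretches most; the
  component of \<open>z\<close> along it alone already gives the bound.\<close>

lemma opn_left_vector:
  assumes "det X > 0"
  obtains p where "\<And>z. opn X * \<bar>unit2 p \<bullet> z\<bar> \<le> norm (X *v z)"
proof -
  obtain \<phi> \<psi> a b where X: "X = rot2 \<phi> ** diag2 a b ** rot2 \<psi>" "0 < b" "b \<le> a" using svd2[OF assms] .
  have "opn X * \<bar>unit2 (- \<psi>) \<bullet> z\<bar> \<le> norm (X *v z)" for z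
  proof -
    have "opn X * \<bar>unit2 (- \<psi>) \<bullet> z\<bar> = \<bar>(diag2 a b *v (rot2 \<psi> *v z)) $ 1\<bar>"
      using X by (simp add: opn_svd2 diag2_mult_vec rot2_mult_vec inner_vec_def sum_2 abs_mult)
    also have "\<dots> \<le> norm (diag2 a b *v (rot2 \<psi> *v z))" using component_le_norm_cart by blast
    also have "\<dots> = norm (X *v z)" by (simp add: X matrix_vector_mul_assoc[symmetric])
    finally show ?thesis .
  qed
  then show ?thesis by (rule that)
qed

lemma opn_right_vector:
  assumes "det X > 0"
  obtains v q where "norm v = 1" "X *v v = opn X *\<^sub>R unit2 q"
proof -
  obtain \<phi> \<psi> a b where X: "X = rot2 \<phi> ** diag2 a b ** rot2 \<psi>" "0 < b" "b \<le> a" using svd2[OF assms] .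
  show ?thesis
  proof (rule that[of "rot2 (- \<psi>) *v vector [1, 0]" \<phi>])
    have "norm (vector [1, 0] :: real^2) = 1" by (simp add: norm_real2)
    then show "norm (rot2 (- \<psi>) *v vector [1, 0]) = 1" by simp
    have "X *v (rot2 (- \<psi>) *v vector [1, 0]) = rot2 \<phi> *v (diag2 a b *v vector [1, 0])"
      by (simp add: X matrix_vector_mul_assoc matrix_mul_assoc[symmetric] rot2_add)
    moreover have "rot2 \<phi> *v (diag2 a b *v vector [1, 0]) = a *\<^sub>R unit2 \<phi>"
      by (simp add: vec_eq_iff forall_2 diag2_mult_vec rot2_mult_vec)
    moreover have "opn X = a" using X by (simp add: opn_svd2)
    ultimately show "X *v (rot2 (- \<psi>) *v vector [1, 0]) = opn X *\<^sub>R unit2 \<phi>" by simp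
  qed
qed

text \<open>The output direction \<open>unit2 q\<close> of \<open>Y\<close> is carried by
  \<open>M\<close> and measured along the direction \<open>unit2 p\<close> that \<open>X\<close>
  stretches most. Since \<open>p\<close> and \<open>q\<close> do not depend on \<open>M\<close>, the
  choice of a connecting word becomes a question about the scalar product.\<close>

lemma opn_connect:
  assumes "det X > 0" "det Y > 0"
  obtains p q where "\<And>M. opn X * opn Y * \<bar>unit2 p \<bullet> (M *v unit2 q)\<bar> \<le> opn (X ** M ** Y)"
proof -
  obtain p where p: "\<And>z. opn X * \<bar>unit2 p \<bullet> z\<bar> \<le> norm (X *v z)" using opn_left_vector[OF assms(1)] by blast
  obtain v q where q: "norm v = 1" "Y *v v = opn Y *\<^sub>R unit2 q" using opn_right_vector[OF assms(2)] .
  have "opn X * opn Y * \<bar>unit2 p \<bullet> (M *v unit2 q)\<bar> \<le> opn (X ** M ** Y)" for M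
  proof -
    have "opn X * opn Y * \<bar>unit2 p \<bullet> (M *v unit2 q)\<bar> = opn X * \<bar>unit2 p \<bullet> (M *v (Y *v v))\<bar>"
      by (simp add: q matrix_vector_mult_scaleR abs_mult opn_nonneg)
    also have "\<dots> \<le> norm (X *v (M *v (Y *v v)))" by (rule p)
    also have "\<dots> = norm ((X ** M ** Y) *v v)" by (simp add: matrix_vector_mul_assoc matrix_mul_assoc)
    also have "\<dots> \<le> opn (X ** M ** Y)" using norm_le_opn[of "X ** M ** Y" v] q by simp
    finally show ?thesis .
  qed
  then show ?thesis by (rule that)
qed

text \<open>If both cosines were below a third of \<open>\<bar>sin \<theta>\<bar>\<close>, the
  addition formula would give \<open>\<bar>sin t\<bar> < 2/3\<close> and
  \<open>\<bar>cos t\<bar> < 1/3\<close>, whose squares do not add up to 1.\<close>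

lemma cos_consecutive:
  fixes \<theta> t :: real
  assumes "sin \<theta> \<noteq> 0"
  shows "\<bar>sin \<theta>\<bar> / 3 \<le> \<bar>cos t\<bar> \<or> \<bar>sin \<theta>\<bar> / 3 \<le> \<bar>cos (t + \<theta>)\<bar>"
proof (rule ccontr)
  assume "\<not> ?thesis"
  then have 1: "\<bar>cos t\<bar> < \<bar>sin \<theta>\<bar> / 3" "\<bar>cos (t + \<theta>)\<bar> < \<bar>sin \<theta>\<bar> / 3" by auto
  have "sin t * sin \<theta> = cos t * cos \<theta> - cos (t + \<theta>)" by (simp add: cos_add)
  also have "\<bar>\<dots>\<bar> \<le> \<bar>cos t\<bar> * 1 + \<bar>cos (t + \<theta>)\<bar>"
    using mult_left_mono[OF abs_cos_le_one[of \<theta>], of "\<bar>cos t\<bar>"] by (simp add: abs_mult[symmetric])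
  finally have "\<bar>sin t\<bar> * \<bar>sin \<theta>\<bar> < (2 / 3) * \<bar>sin \<theta>\<bar>" using 1 by (simp add: abs_mult)
  then have "\<bar>sin t\<bar> < 2 / 3" using assms by simp
  then have "(sin t)\<^sup>2 < (2/3)\<^sup>2" by (metis abs_ge_zero power2_abs power_strict_mono zero_less_numeral)
  moreover have "\<bar>cos t\<bar> < 1 / 3" using 1(1) abs_sin_le_one[of \<theta>] by linarith
  then have "(cos t)\<^sup>2 < (1/3)\<^sup>2" by (metis abs_ge_zero power2_abs power_strict_mono zero_less_numeral)
  ultimately have "(sin t)\<^sup>2 + (cos t)\<^sup>2 < 1" by (simp add: power2_eq_square)
  then show False by simp
qed

lemma inner_rot2: "unit2 p \<bullet> (rot2 t *v z) = unit2 (p - t) \<bullet> z"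
  by (simp add: inner_vec_def sum_2 rot2_mult_vec cos_diff sin_diff algebra_simps)

lemma rot2_unit2: "rot2 t *v unit2 q = unit2 (q + t)"
  by (simp add: vec_eq_iff forall_2 rot2_mult_vec cos_add sin_add algebra_simps)

text \<open>Polar coordinates of the image vector; its length is at least the smaller singular value
  \<open>b\<close>.\<close>

lemma diag2_unit2:
  assumes "0 < b" "b \<le> a"
  obtains \<rho> q' where "b \<le> \<rho>" "diag2 a b *v unit2 q = \<rho> *\<^sub>R unit2 q'"
proof -
  have e: "Complex (a * cos q) (b * sin q) = rcis (cmod (Complex (a * cos q) (b * sin q))) (Arg (Complex (a * cos q) (b * sin q)))"
    by (simp add: rcis_cmod_Arg)
  let ?\<rho> = "cmod (Complex (a * cos q) (b * sin q))"
  have "(b * cos q)\<^sup>2 \<le> (a * cos q)\<^sup>2"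
    using assms by (simp add: power_mult_distrib mult_right_mono power_mono)
  moreover have "b\<^sup>2 = (b * cos q)\<^sup>2 + (b * sin q)\<^sup>2"
    by (simp add: power_mult_distrib flip: distrib_left)
  ultimately have "b\<^sup>2 \<le> (a * cos q)\<^sup>2 + (b * sin q)\<^sup>2" by linarith
  then have "b \<le> ?\<rho>" by (simp add: cmod_def real_le_rsqrt)
  moreover have "diag2 a b *v unit2 q = ?\<rho> *\<^sub>R unit2 (Arg (Complex (a * cos q) (b * sin q)))"
    using arg_cong[OF e, of Re] arg_cong[OF e, of Im] by (simp add: vec_eq_iff forall_2 diag2_mult_vec)
  ultimately show ?thesis by (rule that)
qed

lemma inner_diag2: "u \<bullet> (diag2 a b *v z) = (diag2 a b *v u) \<bullet> z"
  by (simp add: inner_vec_def sum_2 diag2_mult_vec)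

text \<open>\<open>diag2 (\<alpha> ^ L) (\<beta> ^ L)\<close> is \<open>\<alpha> ^ L\<close> times a
  matrix within \<open>\<epsilon>\<close> of the projection to the first axis. With both such
  factors replaced by projections the scalar product is \<open>cos p * cos t * cos q\<close>; the
  three remaining terms of the expansion are at most \<open>\<epsilon>\<close> each.\<close>

lemma connect_drd:
  assumes "0 < \<beta>" "\<beta> \<le> \<alpha>" and c: "0 \<le> c" "c \<le> \<bar>cos p\<bar>" "c \<le> \<bar>cos t\<bar>" "c \<le> \<bar>cos q\<bar>"
    and \<epsilon>: "(\<beta> / \<alpha>) ^ L \<le> \<epsilon>" "(\<beta> / \<alpha>) ^ N \<le> \<epsilon>" "\<epsilon> \<le> 1"
  shows "\<alpha> ^ L * \<alpha> ^ N * (c ^ 3 - 3 * \<epsilon>) \<le>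
    \<bar>unit2 p \<bullet> (diag2 (\<alpha> ^ L) (\<beta> ^ L) *v (rot2 t *v (diag2 (\<alpha> ^ N) (\<beta> ^ N) *v unit2 q)))\<bar>"
proof -
  define e f where "e = (\<beta> / \<alpha>) ^ L" and "f = (\<beta> / \<alpha>) ^ N"
  have ef: "0 \<le> e" "e \<le> \<epsilon>" "0 \<le> f" "f \<le> \<epsilon>" using assms by (auto simp: e_def f_def)
  have \<beta>L: "\<beta> ^ L = \<alpha> ^ L * e" and \<beta>N: "\<beta> ^ N = \<alpha> ^ N * f" using assms by (simp_all add: e_def f_def power_divide)
  define m r1 r2 r3 where "m = cos p * cos t * cos q" and "r1 = cos p * sin t * sin q"
    and "r2 = sin p * sin t * cos q" and "r3 = sin p * cos t * sin q"
  have "unit2 p \<bullet> (diag2 (\<alpha> ^ L) (\<beta> ^ L) *v (rot2 t *v (diag2 (\<alpha> ^ N) (\<beta> ^ N) *v unit2 q))) =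
    \<alpha> ^ L * \<alpha> ^ N * (m - f * r1 + e * r2 + e * f * r3)"
    by (simp add: inner_vec_def sum_2 diag2_mult_vec rot2_mult_vec \<beta>L \<beta>N m_def r1_def r2_def r3_def algebra_simps)
  moreover have "c ^ 3 - 3 * \<epsilon> \<le> \<bar>m - f * r1 + e * r2 + e * f * r3\<bar>"
  proof -
    have "c * c * c \<le> \<bar>cos p\<bar> * \<bar>cos t\<bar> * \<bar>cos q\<bar>" using c by (intro mult_mono) auto
    then have m: "c ^ 3 \<le> \<bar>m\<bar>" by (simp add: m_def abs_mult power3_eq_cube)
    have tri: "\<bar>x * y * z\<bar> \<le> 1" if "\<bar>x\<bar> \<le> 1" "\<bar>y\<bar> \<le> 1" "\<bar>z\<bar> \<le> 1" for x y z :: real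
      using that by (simp add: abs_mult mult_le_one)
    have r: "\<bar>r1\<bar> \<le> 1" "\<bar>r2\<bar> \<le> 1" "\<bar>r3\<bar> \<le> 1" unfolding r1_def r2_def r3_def by (intro tri; simp)+
    have "\<bar>f * r1\<bar> \<le> \<epsilon> * 1" unfolding abs_mult using r ef by (intro mult_mono) auto
    moreover have "\<bar>e * r2\<bar> \<le> \<epsilon> * 1" unfolding abs_mult using r ef by (intro mult_mono) auto
    moreover have "\<bar>e * f * r3\<bar> \<le> \<epsilon> * 1 * 1" unfolding abs_mult using r ef \<epsilon> by (intro mult_mono) auto
    ultimately show ?thesis using m by linarith
  qed
  ultimately show ?thesis
    using assms by (simp add: abs_mult mult_left_mono)
qed

lemma connect_d:
  assumes "0 < \<beta>" "\<beta> \<le> \<alpha>" and c: "0 \<le> c" "c \<le> \<bar>cos p\<bar>" "c \<le> \<bar>cos q\<bar>"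
    and \<epsilon>: "(\<beta> / \<alpha>) ^ M \<le> \<epsilon>"
  shows "\<alpha> ^ M * (c ^ 2 - \<epsilon>) \<le> \<bar>unit2 p \<bullet> (diag2 (\<alpha> ^ M) (\<beta> ^ M) *v unit2 q)\<bar>"
proof -
  define e where "e = (\<beta> / \<alpha>) ^ M"
  have e: "0 \<le> e" "e \<le> \<epsilon>" using assms by (auto simp: e_def)
  have \<beta>M: "\<beta> ^ M = \<alpha> ^ M * e" using assms by (simp add: e_def power_divide)
  have "unit2 p \<bullet> (diag2 (\<alpha> ^ M) (\<beta> ^ M) *v unit2 q) = \<alpha> ^ M * (cos p * cos q + e * (sin p * sin q))"
    by (simp add: inner_vec_def sum_2 diag2_mult_vec \<beta>M algebra_simps)
  moreover have "c ^ 2 - \<epsilon> \<le> \<bar>cos p * cos q + e * (sin p * sin q)\<bar>"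
  proof -
    have "c * c \<le> \<bar>cos p\<bar> * \<bar>cos q\<bar>" using c by (intro mult_mono) auto
    then have m: "c ^ 2 \<le> \<bar>cos p * cos q\<bar>" by (simp add: abs_mult power2_eq_square)
    have "\<bar>e * (sin p * sin q)\<bar> \<le> \<epsilon> * 1" unfolding abs_mult using e by (intro mult_mono mult_le_one) auto
    then show ?thesis using m by linarith
  qed
  ultimately show ?thesis
    using assms by (simp add: abs_mult mult_left_mono)
qed

section \<open>Matrix products along words\<close>

lemma matrix_word_Nil [simp]: "matrix_word B [] = mat 1"
  by (simp add: matrix_word_def)

lemma matrix_word_Cons [simp]: "matrix_word B (i # w) = B i ** matrix_word B w"
  by (simp add: matrix_word_def)

lemma matrix_word_append: "matrix_word B (u @ v) = matrix_word B u ** matrix_word B v"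
  by (induction u) (simp_all add: matrix_mul_assoc)

lemma matrix_word_map: "matrix_word B (map f w) = matrix_word (\<lambda>i. B (f i)) w"
  by (induction w) simp_all

lemma matrix_word_kronecker4:
  "matrix_word (\<lambda>i. kronecker4 (X i) (Y i)) w = kronecker4 (matrix_word X w) (matrix_word Y w :: real^2^2)"
  by (induction w) (simp_all add: kronecker4_mat_1 kronecker4_mult)

lemma matrix_word_replicate_diag2: "B i = diag2 a b \<Longrightarrow> matrix_word B (replicate n i) = diag2 (a ^ n) (b ^ n)"
  by (induction n) (simp_all add: diag2_mult)

lemma matrix_word_replicate_rot2: "B i = rot2 t \<Longrightarrow> matrix_word B (replicate n i) = rot2 (real n * t)"
  by (induction n) (simp_all add: rot2_add distrib_right)

section \<open>The two planar factors\<close>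

locale two_blocks =
  fixes \<alpha> \<beta> \<theta> :: real
  assumes \<beta>_pos: "0 < \<beta>" and \<beta>_less: "\<beta> < \<alpha>" and \<alpha>_less: "\<alpha> < 1" and sin_nz: "sin \<theta> \<noteq> 0"
begin

text \<open>A product along \<open>w\<close> is \<open>kronecker4 (X w) (Y w)\<close>, so the two
  planar products can be studied separately; only the common word couples them.\<close>

definition LX :: "4 \<Rightarrow> real^2^2" where "LX i = (if i = 1 \<or> i = 2 then diag2 \<alpha> \<beta> else rot2 \<theta>)"
definition LY :: "4 \<Rightarrow> real^2^2" where "LY i = (if i = 1 \<or> i = 2 then rot2 \<theta> else diag2 \<alpha> \<beta>)"

abbreviation "X w \<equiv> matrix_word LX w"
abbreviation "Y w \<equiv> matrix_word LY w"

lemma \<alpha>_pos: "0 < \<alpha>" using \<beta>_pos \<beta>_less by simp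

lemma det_LX: "\<alpha> * \<beta> \<le> det (LX i)" "det (LX i) \<le> 1" and det_LY: "\<alpha> * \<beta> \<le> det (LY i)" "det (LY i) \<le> 1"
  and det_LX_LY: "det (LX i) * det (LY i) = \<alpha> * \<beta>"
  using \<beta>_pos \<beta>_less \<alpha>_less by (auto simp: LX_def LY_def mult_le_one)

lemma det_L_pos: "0 < det (LX i)" "0 < det (LY i)"
  using \<beta>_pos \<beta>_less by (auto simp: LX_def LY_def)

lemma det_ge: "(\<alpha> * \<beta>) ^ length w \<le> det (X w)" "(\<alpha> * \<beta>) ^ length w \<le> det (Y w)"
  by (induction w) (use det_LX det_LY \<alpha>_pos \<beta>_pos in \<open>auto simp: det_mul less_imp_le[OF det_L_pos(1)] less_imp_le[OF det_L_pos(2)] intro!: mult_mono\<close>)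

lemma det_le: "det (X w) \<le> 1" "det (Y w) \<le> 1"
proof (induction w)
  case (Cons i w)
  have "0 \<le> det (X w)" "0 \<le> det (Y w)"
    using det_ge[of w] \<alpha>_pos \<beta>_pos by (meson less_imp_le mult_pos_pos order_trans zero_less_power)+
  with Cons show "det (X (i # w)) \<le> 1" "det (Y (i # w)) \<le> 1"
    using det_LX[of i] det_LY[of i] by (auto simp: det_mul intro!: mult_le_one)
qed simp_all

lemma det_pos: "0 < det (X w)" "0 < det (Y w)"
  using det_ge[of w] \<alpha>_pos \<beta>_pos by (meson less_le_trans mult_pos_pos zero_less_power)+

lemma det_prod: "det (X w) * det (Y w) = (\<alpha> * \<beta>) ^ length w"
proof (induction w)
  case (Cons i w)
  have "det (X (i # w)) * det (Y (i # w)) = (det (LX i) * det (LY i)) * (det (X w) * det (Y w))"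
    by (simp add: det_mul)
  then show ?case by (simp add: Cons det_LX_LY)
qed simp

lemma opn_pos: "0 < opn (X w)" "0 < opn (Y w)"
  using opn_det(1) det_pos by auto

lemma opn_mat_1 [simp]: "opn (mat 1) = 1"
  using opn_rot2[of 0] by simp

lemma opn_LX_LY: "opn (LX i) * opn (LY i) = \<alpha>" "opn (LX i) \<le> 1" "opn (LY i) \<le> 1"
  using \<beta>_pos \<beta>_less \<alpha>_less by (auto simp: LX_def LY_def opn_diag2)

lemma opn_prod_le: "opn (X w) * opn (Y w) \<le> \<alpha> ^ length w"
proof (induction w)
  case (Cons i w)
  have "opn (X (i # w)) * opn (Y (i # w)) \<le> (opn (LX i) * opn (X w)) * (opn (LY i) * opn (Y w))"
    using opn_mult[of "LX i" "X w"] opn_mult[of "LY i" "Y w"] opn_nonneg by (simp add: mult_mono)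
  also have "\<dots> = (opn (LX i) * opn (LY i)) * (opn (X w) * opn (Y w))" by simp
  also have "\<dots> \<le> \<alpha> * \<alpha> ^ length w" using Cons \<alpha>_pos by (simp add: opn_LX_LY)
  finally show ?case by simp
qed simp

lemma opn_le_1: "opn (X w) \<le> 1" "opn (Y w) \<le> 1"
proof (induction w)
  case (Cons i w)
  have "opn (LX i) * opn (X w) \<le> 1" "opn (LY i) * opn (Y w) \<le> 1"
    using Cons opn_LX_LY[of i] by (auto intro!: mult_le_one simp: opn_nonneg)
  then show "opn (X (i # w)) \<le> 1" "opn (Y (i # w)) \<le> 1"
    using opn_mult[of "LX i" "X w"] opn_mult[of "LY i" "Y w"] by simp_all
qed simp_all

text \<open>The connecting word is \<open>r\<^sup>j d\<^sup>L r\<^sup>M d\<^sup>N r\<^sup>P\<close>, where \<open>d = 1\<close> and \<open>r = 3\<close>.  Long runs of the diagonal factor are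
  nearly of rank one, and every exponent is chosen among two consecutive values, so that the relevant
  scalar products stay away from 0 by \<open>cos_consecutive\<close>.\<close>

lemma quasimultiplicative:
  obtains K c where "0 < c" "c \<le> 1"
    "\<And>u v. \<exists>k. length k \<le> K \<and> c * (opn (X u) * opn (X v)) \<le> opn (X (u @ k @ v))
                          \<and> c * (opn (Y u) * opn (Y v)) \<le> opn (Y (u @ k @ v))"
proof -
  define c where "c = \<bar>sin \<theta>\<bar> / 3"
  have c: "0 < c" "c \<le> 1 / 3" using sin_nz abs_sin_le_one[of \<theta>] by (simp_all add: c_def)
  \<comment> \<open>Half of the main term \<open>c ^ 3\<close> survives the error
    \<open>3 * \<epsilon>\<close> of \<open>connect_drd\<close>.\<close>
  define \<epsilon> where "\<epsilon> = c ^ 3 / 6"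
  have c3: "c ^ 3 \<le> c ^ 2" "c ^ 3 \<le> 1" "0 < c ^ 3"
    using c by (auto intro: power_decreasing power_le_one)
  have \<epsilon>: "0 < \<epsilon>" "\<epsilon> \<le> 1" "c ^ 3 - 3 * \<epsilon> = c ^ 3 / 2" "c ^ 3 / 2 \<le> c ^ 2 - \<epsilon>"
    using c3 unfolding \<epsilon>_def by linarith+
  have "0 \<le> \<beta> / \<alpha>" "\<beta> / \<alpha> < 1" using \<beta>_pos \<beta>_less by auto
  then obtain n where n: "(\<beta> / \<alpha>) ^ n < \<epsilon>" using real_arch_pow_inv[OF \<epsilon>(1)] by blast
  have le_\<epsilon>: "(\<beta> / \<alpha>) ^ m \<le> \<epsilon>" if "n \<le> m" for m
    using power_decreasing[OF that, of "\<beta> / \<alpha>"] n \<open>0 \<le> \<beta> / \<alpha>\<close> \<open>\<beta> / \<alpha> < 1\<close> by simp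
  have choose: "\<exists>m. n0 \<le> m \<and> m \<le> Suc n0 \<and> c \<le> \<bar>cos (t + real m * \<theta>)\<bar>" for n0 t
    using cos_consecutive[OF sin_nz, of "t + real n0 * \<theta>"]
    by (auto simp: c_def algebra_simps intro: exI[of _ n0] exI[of _ "Suc n0"])
  have choose': "\<exists>m. n0 \<le> m \<and> m \<le> Suc n0 \<and> c \<le> \<bar>cos (t - real m * \<theta>)\<bar>" for n0 t
    using choose[of n0 "- t"] by (metis add.commute cos_minus minus_diff_eq uminus_add_conv_diff)
  obtain M where M: "n \<le> M" "M \<le> Suc n" "c \<le> \<bar>cos (0 + real M * \<theta>)\<bar>" using choose[of n 0] by blast
  \<comment> \<open>\<open>\<beta> * \<beta>\<close> accounts for the outer diagonal factors of the
    second block, whose exponents are at most 1; the two factors \<open>\<alpha> ^ Suc n\<close> for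
    the long runs; \<open>c ^ 3 / 2\<close> for the scalar product.\<close>
  define \<kappa> where "\<kappa> = \<beta> * \<beta> * \<alpha> ^ Suc n * \<alpha> ^ Suc n * (c ^ 3 / 2)"
  have \<kappa>: "0 < \<kappa>" using \<alpha>_pos \<beta>_pos c by (simp add: \<kappa>_def)
  have \<alpha>_pow: "\<alpha> ^ Suc n \<le> \<alpha> ^ m" if "m \<le> Suc n" for m
    using that \<alpha>_pos \<alpha>_less by (intro power_decreasing) auto
  have pow_le1: "\<alpha> ^ m \<le> 1" for m using \<alpha>_pos \<alpha>_less by (simp add: power_le_one)
  have "\<exists>k. length k \<le> 3 * Suc n + 2 \<and> \<kappa> * (opn (X u) * opn (X v)) \<le> opn (X (u @ k @ v))
                          \<and> \<kappa> * (opn (Y u) * opn (Y v)) \<le> opn (Y (u @ k @ v))" for u v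
  proof -
    obtain p q where pq: "\<And>Q. opn (X u) * opn (X v) * \<bar>unit2 p \<bullet> (Q *v unit2 q)\<bar> \<le> opn (X u ** Q ** X v)"
      using opn_connect[OF det_pos(1) det_pos(1)] by blast
    obtain p2 q2 where pq2: "\<And>Q. opn (Y u) * opn (Y v) * \<bar>unit2 p2 \<bullet> (Q *v unit2 q2)\<bar> \<le> opn (Y u ** Q ** Y v)"
      using opn_connect[OF det_pos(2) det_pos(2)] by blast
    \<comment> \<open>The order of the choices matters. In the first block \<open>j\<close>,
      \<open>M\<close>, \<open>P\<close> are exponents of rotations, so \<open>j\<close> and
      \<open>P\<close> are chosen for it. In the second block they turn \<open>p2\<close> and
      \<open>q2\<close> into \<open>p3\<close> and \<open>q3\<close>; the exponents \<open>L\<close>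
      and \<open>N\<close>, which belong to rotations only there, are chosen afterwards.\<close>
    obtain j where j: "j \<le> Suc 0" "c \<le> \<bar>cos (p - real j * \<theta>)\<bar>" using choose'[of 0 p] by auto
    obtain P where P: "P \<le> Suc 0" "c \<le> \<bar>cos (q + real P * \<theta>)\<bar>" using choose[of 0 q] by auto
    have small: "0 < \<beta> ^ m" "\<beta> ^ m \<le> \<alpha> ^ m" "m \<le> Suc 0 \<Longrightarrow> \<beta> \<le> \<beta> ^ m" for m
      using \<beta>_pos \<beta>_less \<alpha>_less by (auto intro!: power_mono simp: le_Suc_eq)
    obtain \<rho> p3 where p3: "\<beta> ^ j \<le> \<rho>" "diag2 (\<alpha> ^ j) (\<beta> ^ j) *v unit2 p2 = \<rho> *\<^sub>R unit2 p3"
      using diag2_unit2[OF small(1,2)] by blast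
    obtain \<rho>' q3 where q3: "\<beta> ^ P \<le> \<rho>'" "diag2 (\<alpha> ^ P) (\<beta> ^ P) *v unit2 q2 = \<rho>' *\<^sub>R unit2 q3"
      using diag2_unit2[OF small(1,2)] by blast
    have \<rho>: "\<beta> \<le> \<rho>" "\<beta> \<le> \<rho>'" using small(3)[OF j(1)] small(3)[OF P(1)] p3 q3 by auto
    obtain L where L: "n \<le> L" "L \<le> Suc n" "c \<le> \<bar>cos (p3 - real L * \<theta>)\<bar>" using choose'[of n p3] by blast
    obtain N where N: "n \<le> N" "N \<le> Suc n" "c \<le> \<bar>cos (q3 + real N * \<theta>)\<bar>" using choose[of n q3] by blast
    define k :: "4 list" where "k = replicate j 3 @ replicate L 1 @ replicate M 3 @ replicate N 1 @ replicate P 3"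
    have Xk: "X k = rot2 (real j * \<theta>) ** (diag2 (\<alpha> ^ L) (\<beta> ^ L) ** (rot2 (real M * \<theta>) ** (diag2 (\<alpha> ^ N) (\<beta> ^ N) ** rot2 (real P * \<theta>))))"
      by (simp add: k_def matrix_word_append matrix_word_replicate_diag2[of LX 1 \<alpha> \<beta>] matrix_word_replicate_rot2[of LX 3 \<theta>] LX_def)
    have Yk: "Y k = diag2 (\<alpha> ^ j) (\<beta> ^ j) ** (rot2 (real L * \<theta>) ** (diag2 (\<alpha> ^ M) (\<beta> ^ M) ** (rot2 (real N * \<theta>) ** diag2 (\<alpha> ^ P) (\<beta> ^ P))))"
      by (simp add: k_def matrix_word_append matrix_word_replicate_diag2[of LY 3 \<alpha> \<beta>] matrix_word_replicate_rot2[of LY 1 \<theta>] LY_def)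
    have "\<kappa> \<le> \<alpha> ^ Suc n * \<alpha> ^ Suc n * (c ^ 3 / 2)"
    proof -
      have "\<beta> * \<beta> \<le> 1" using \<beta>_pos \<beta>_less \<alpha>_less by (intro mult_le_one) auto
      moreover have "0 \<le> \<alpha> ^ Suc n * \<alpha> ^ Suc n * (c ^ 3 / 2)" using \<alpha>_pos c by simp
      ultimately have "(\<beta> * \<beta>) * (\<alpha> ^ Suc n * \<alpha> ^ Suc n * (c ^ 3 / 2)) \<le> \<alpha> ^ Suc n * \<alpha> ^ Suc n * (c ^ 3 / 2)"
        using mult_right_mono[of "\<beta> * \<beta>" 1] by simp
      then show ?thesis by (simp add: \<kappa>_def mult_ac)
    qed
    also have "\<dots> \<le> \<alpha> ^ L * \<alpha> ^ N * (c ^ 3 - 3 * \<epsilon>)"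
      using \<alpha>_pow[OF L(2)] \<alpha>_pow[OF N(2)] \<alpha>_pos c unfolding \<epsilon>(3) by (intro mult_right_mono mult_mono) auto
    also have "\<dots> \<le> \<bar>unit2 (p - real j * \<theta>) \<bullet> (diag2 (\<alpha> ^ L) (\<beta> ^ L) *v (rot2 (real M * \<theta>) *v (diag2 (\<alpha> ^ N) (\<beta> ^ N) *v unit2 (q + real P * \<theta>))))\<bar>"
      using \<beta>_pos \<beta>_less c j M P L N \<epsilon> by (intro connect_drd) (auto intro: le_\<epsilon>)
    also have "\<dots> = \<bar>unit2 p \<bullet> (X k *v unit2 q)\<bar>"
      by (simp add: Xk inner_rot2 rot2_unit2 matrix_vector_mul_assoc[symmetric])
    finally have 1: "\<kappa> \<le> \<bar>unit2 p \<bullet> (X k *v unit2 q)\<bar>" .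
    have "\<kappa> = \<beta> * \<beta> * (\<alpha> ^ Suc n * (\<alpha> ^ Suc n * (c ^ 3 / 2)))" by (simp add: \<kappa>_def)
    also have "\<dots> \<le> \<beta> * \<beta> * (\<alpha> ^ M * (c ^ 2 - \<epsilon>))"
    proof (intro mult_left_mono mult_mono)
      show "\<alpha> ^ Suc n * (c ^ 3 / 2) \<le> c ^ 2 - \<epsilon>"
        using mult_right_mono[OF pow_le1[of "Suc n"], of "c ^ 3 / 2"] c3(3)
        by (intro order_trans[OF _ \<epsilon>(4)]) simp
    qed (use \<alpha>_pow[OF M(2)] \<alpha>_pos \<beta>_pos c \<epsilon> in auto)
    also have "\<dots> \<le> \<rho> * \<rho>' * \<bar>unit2 (p3 - real L * \<theta>) \<bullet> (diag2 (\<alpha> ^ M) (\<beta> ^ M) *v unit2 (q3 + real N * \<theta>))\<bar>"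
    proof (intro mult_mono)
      show "\<alpha> ^ M * (c\<^sup>2 - \<epsilon>) \<le> \<bar>unit2 (p3 - real L * \<theta>) \<bullet> (diag2 (\<alpha> ^ M) (\<beta> ^ M) *v unit2 (q3 + real N * \<theta>))\<bar>"
        using \<beta>_pos \<beta>_less c L N M by (intro connect_d) (auto intro: le_\<epsilon>)
      have "0 \<le> c\<^sup>2 - \<epsilon>" using \<epsilon>(4) c by (smt (verit) divide_nonneg_nonneg zero_le_power)
      then show "0 \<le> \<alpha> ^ M * (c\<^sup>2 - \<epsilon>)" using \<alpha>_pos by simp
    qed (use \<rho> \<beta>_pos in auto)
    also have "\<dots> = \<bar>unit2 p2 \<bullet> (Y k *v unit2 q2)\<bar>"
    proof -
      have "unit2 p2 \<bullet> (Y k *v unit2 q2) = \<rho> * (\<rho>' * (unit2 (p3 - real L * \<theta>) \<bullet> (diag2 (\<alpha> ^ M) (\<beta> ^ M) *v unit2 (q3 + real N * \<theta>))))"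
        by (simp add: Yk inner_diag2[of "unit2 p2"] p3 q3 inner_rot2 rot2_unit2 matrix_vector_mult_scaleR matrix_vector_mul_assoc[symmetric])
      then show ?thesis using \<rho> \<beta>_pos by (simp add: abs_mult)
    qed
    finally have 2: "\<kappa> \<le> \<bar>unit2 p2 \<bullet> (Y k *v unit2 q2)\<bar>" .
    have "\<kappa> * (opn (X u) * opn (X v)) \<le> opn (X (u @ k @ v))"
      using pq[of "X k"] mult_left_mono[OF 1, of "opn (X u) * opn (X v)"] opn_nonneg
      by (simp add: matrix_word_append matrix_mul_assoc mult_ac)
    moreover have "\<kappa> * (opn (Y u) * opn (Y v)) \<le> opn (Y (u @ k @ v))"
      using pq2[of "Y k"] mult_left_mono[OF 2, of "opn (Y u) * opn (Y v)"] opn_nonneg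
      by (simp add: matrix_word_append matrix_mul_assoc mult_ac)
    moreover have "length k \<le> 3 * Suc n + 2" using j P L M N by (simp add: k_def)
    ultimately show ?thesis by blast
  qed
  moreover have "\<kappa> \<le> 1"
  proof -
    \<comment> \<open>For two empty words the inequality bounds \<open>\<kappa>\<close> by the norm
      of a connecting word, which is at most 1.\<close>
    have "\<kappa> * (opn (X []) * opn (X [])) \<le> 1"
      using calculation[of "[]" "[]"] opn_le_1 by (meson order_trans)
    then show ?thesis by simp
  qed
  ultimately show ?thesis using \<kappa> that by blast
qed

text \<open>Between consecutive integers, and beyond 4, the singular value function is a function of
  this kind or the larger of two of them. Having the exponents as parameters gives
  submultiplicativity and the lower bounds once for all cases.\<close>

definition pot :: "real \<Rightarrow> real \<Rightarrow> real \<Rightarrow> real \<Rightarrow> 4 list \<Rightarrow> real" where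
  "pot p q e f w = opn (X w) powr p * opn (Y w) powr q * det (X w) powr e * det (Y w) powr f"

lemma pot_pos: "0 < pot p q e f w"
  using opn_pos[of w] det_pos[of w] by (simp add: pot_def)

lemma pot_submult:
  assumes "0 \<le> p" "0 \<le> q"
  shows "pot p q e f (u @ v) \<le> pot p q e f u * pot p q e f v"
proof -
  have "opn (X (u @ v)) powr p \<le> opn (X u) powr p * opn (X v) powr p"
    using opn_mult[of "X u" "X v"] assms opn_nonneg
    by (simp add: matrix_word_append powr_mult[symmetric] powr_mono2)
  moreover have "opn (Y (u @ v)) powr q \<le> opn (Y u) powr q * opn (Y v) powr q"
    using opn_mult[of "Y u" "Y v"] assms opn_nonneg
    by (simp add: matrix_word_append powr_mult[symmetric] powr_mono2)
  moreover have "det (X (u @ v)) powr e = det (X u) powr e * det (X v) powr e"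
    using det_pos by (simp add: matrix_word_append det_mul powr_mult less_imp_le)
  moreover have "det (Y (u @ v)) powr f = det (Y u) powr f * det (Y v) powr f"
    using det_pos by (simp add: matrix_word_append det_mul powr_mult less_imp_le)
  ultimately have "pot p q e f (u @ v) \<le> (opn (X u) powr p * opn (X v) powr p) * (opn (Y u) powr q * opn (Y v) powr q) *
      (det (X u) powr e * det (X v) powr e) * (det (Y u) powr f * det (Y v) powr f)"
    unfolding pot_def by (intro mult_mono) auto
  then show ?thesis by (simp add: pot_def mult_ac)
qed

lemma pot_quasimult:
  assumes "0 \<le> p" "0 \<le> q" "0 \<le> e" "0 \<le> f"
  obtains K c where "0 < c" "\<And>u v. \<exists>k. length k \<le> K \<and> c * pot p q e f u * pot p q e f v \<le> pot p q e f (u @ k @ v)"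
proof -
  obtain K c where c: "0 < c" "c \<le> 1" and
    qm: "\<And>u v. \<exists>k. length k \<le> K \<and> c * (opn (X u) * opn (X v)) \<le> opn (X (u @ k @ v))
                          \<and> c * (opn (Y u) * opn (Y v)) \<le> opn (Y (u @ k @ v))"
    by (rule quasimultiplicative) blast
  \<comment> \<open>Bounds the determinants of a connecting word from below; determinants are
    multiplicative, so a bound on its length suffices.\<close>
  define \<delta> where "\<delta> = (\<alpha> * \<beta>) ^ K"
  have \<delta>: "0 < \<delta>" using \<alpha>_pos \<beta>_pos by (simp add: \<delta>_def)
  define c' where "c' = c powr p * c powr q * \<delta> powr e * \<delta> powr f"
  have "\<exists>k. length k \<le> K \<and> c' * pot p q e f u * pot p q e f v \<le> pot p q e f (u @ k @ v)" for u v
  proof -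
    obtain k where k: "length k \<le> K" "c * (opn (X u) * opn (X v)) \<le> opn (X (u @ k @ v))"
       "c * (opn (Y u) * opn (Y v)) \<le> opn (Y (u @ k @ v))" using qm by blast
    have 1: "c powr p * (opn (X u) powr p * opn (X v) powr p) \<le> opn (X (u @ k @ v)) powr p"
      using powr_mono2[OF assms(1) _ k(2)] c opn_nonneg by (simp add: powr_mult)
    have 2: "c powr q * (opn (Y u) powr q * opn (Y v) powr q) \<le> opn (Y (u @ k @ v)) powr q"
      using powr_mono2[OF assms(2) _ k(3)] c opn_nonneg by (simp add: powr_mult)
    have "\<delta> \<le> (\<alpha> * \<beta>) ^ length k"
      unfolding \<delta>_def using k \<alpha>_pos \<beta>_pos \<beta>_less \<alpha>_less by (intro power_decreasing mult_le_one) auto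
    then have "\<delta> \<le> det (X k)" "\<delta> \<le> det (Y k)" using det_ge[of k] by auto
    then have 3: "\<delta> * (det (X u) * det (X v)) \<le> det (X (u @ k @ v))" "\<delta> * (det (Y u) * det (Y v)) \<le> det (Y (u @ k @ v))"
      using det_pos[of u] det_pos[of v] \<delta> by (simp_all add: matrix_word_append det_mul mult_left_mono mult_right_mono mult_ac)
    have 4: "\<delta> powr e * (det (X u) powr e * det (X v) powr e) \<le> det (X (u @ k @ v)) powr e"
      using powr_mono2[OF assms(3) _ 3(1)] \<delta> det_pos by (simp add: powr_mult less_imp_le)
    have 5: "\<delta> powr f * (det (Y u) powr f * det (Y v) powr f) \<le> det (Y (u @ k @ v)) powr f"
      using powr_mono2[OF assms(4) _ 3(2)] \<delta> det_pos by (simp add: powr_mult less_imp_le)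
    have "(c powr p * (opn (X u) powr p * opn (X v) powr p)) * (c powr q * (opn (Y u) powr q * opn (Y v) powr q)) *
       (\<delta> powr e * (det (X u) powr e * det (X v) powr e)) * (\<delta> powr f * (det (Y u) powr f * det (Y v) powr f)) \<le> pot p q e f (u @ k @ v)"
      unfolding pot_def by (intro mult_mono 1 2 4 5) auto
    then have "c' * pot p q e f u * pot p q e f v \<le> pot p q e f (u @ k @ v)"
      by (simp add: c'_def pot_def mult_ac)
    with k show ?thesis by blast
  qed
  moreover have "0 < c'" using c \<delta> by (simp add: c'_def)
  ultimately show ?thesis using that by blast
qed

end

section \<open>Singular values and pressure\<close>

lemma poly_det:
  fixes M :: "'a::comm_ring_1 poly^'n^'n"
  shows "poly (det M) x = det (\<chi> i j. poly (M $ i $ j) x)"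
  by (simp add: det_def poly_sum poly_prod of_int_poly)

lemma poly_charpoly: "poly (charpoly M) x = det (mat x - M)"
proof -
  have "(\<chi> i j. poly ((if i = j then [:0, 1:] else 0) - [:M $ i $ j:]) x) = mat x - M"
    by (simp add: vec_eq_iff mat_def)
  then show ?thesis by (simp add: charpoly_def poly_det)
qed

lemma charpoly_orthogonal_conj:
  fixes M Q :: "real^'n^'n"
  assumes "orthogonal_matrix Q"
  shows "charpoly (transpose Q ** M ** Q) = charpoly M"
proof (rule poly_ext)
  fix x
  have Q: "transpose Q ** Q = mat 1" using assms by (simp add: orthogonal_matrix)
  have "mat x - transpose Q ** M ** Q = transpose Q ** (mat x - M) ** Q"
  proof -
    have "transpose Q ** mat x ** Q = mat x"
    proof -
      have "transpose Q ** mat x = x *\<^sub>R transpose Q"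
        by (simp add: vec_eq_iff matrix_matrix_mult_def mat_def if_distrib cong: if_cong)
      moreover have "(x *\<^sub>R transpose Q) ** Q = x *\<^sub>R (transpose Q ** Q)"
        by (simp add: vec_eq_iff matrix_matrix_mult_def sum_distrib_left mult.assoc)
      moreover have "x *\<^sub>R mat 1 = (mat x :: real^'n^'n)" by (simp add: vec_eq_iff mat_def)
      ultimately show ?thesis using Q by simp
    qed
    then show ?thesis
      by (simp add: vec_eq_iff matrix_matrix_mult_def sum_distrib_right sum_subtractf left_diff_distrib right_diff_distrib)
  qed
  then have "det (mat x - transpose Q ** M ** Q) = det (transpose Q ** Q) * det (mat x - M)"
    by (simp add: det_mul)
  then show "poly (charpoly (transpose Q ** M ** Q)) x = poly (charpoly M) x"
    by (simp add: poly_charpoly Q)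
qed

definition diag4 :: "real \<Rightarrow> real \<Rightarrow> real \<Rightarrow> real \<Rightarrow> real^4^4" where
  "diag4 a b c d = (\<chi> i j. if i = j then (if i = 1 then a else if i = 2 then b else if i = 3 then c else d) else 0)"

lemma kronecker4_diag2: "kronecker4 (diag2 a b) (diag2 c d) = diag4 (a * c) (a * d) (b * c) (b * d)"
  by (simp add: vec_eq_iff forall_4 kronecker4_def kronecker_def diag4_def)

lemma diag4_mult: "diag4 a b c d ** diag4 a' b' c' d' = diag4 (a * a') (b * b') (c * c') (d * d')"
  by (simp add: vec_eq_iff forall_4 diag4_def matrix_matrix_mult_def sum_4)

lemma transpose_diag4: "transpose (diag4 a b c d) = diag4 a b c d"
  by (simp add: vec_eq_iff forall_4 diag4_def transpose_def)

lemma diag4_mult_vec: "(diag4 a b c d *v z) $ 1 = a * z $ 1" "(diag4 a b c d *v z) $ 2 = b * z $ 2"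
   "(diag4 a b c d *v z) $ 3 = c * z $ 3" "(diag4 a b c d *v z) $ 4 = d * z $ 4"
  by (simp_all add: diag4_def matrix_vector_mult_def sum_4)

lemma charpoly_diag4: "charpoly (diag4 a b c d) = [:-a, 1:] * [:-b, 1:] * [:-c, 1:] * [:-d, 1:]"
proof (rule poly_ext)
  fix x
  have "det (mat x - diag4 a b c d) = prod (\<lambda>i. (mat x - diag4 a b c d) $ i $ i) UNIV"
    by (rule det_diagonal) (auto simp: diag4_def mat_def)
  also have "\<dots> = (x - a) * (x - b) * (x - c) * (x - d)"
    unfolding UNIV_4 by (simp add: diag4_def mat_def)
  finally show "poly (charpoly (diag4 a b c d)) x = poly ([:-a, 1:] * [:-b, 1:] * [:-c, 1:] * [:-d, 1:]) x"
    by (simp add: poly_charpoly algebra_simps)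
qed

lemma transpose_kronecker4: "transpose (kronecker4 A B) = kronecker4 (transpose A) (transpose B :: real^2^2)"
  by (simp add: vec_eq_iff transpose_def kronecker4_def kronecker_def)

lemma transpose_rot2: "transpose (rot2 t) = rot2 (- t)"
  by (simp add: vec_eq_iff forall_2 transpose_def)

lemma orthogonal_kronecker4_rot2: "orthogonal_matrix (kronecker4 (rot2 s) (rot2 t))"
  by (simp add: orthogonal_matrix transpose_kronecker4 transpose_rot2 kronecker4_mult rot2_add kronecker4_mat_1)

lemma norm_orthogonal_matrix: "orthogonal_matrix (Q :: real^'n^'n) \<Longrightarrow> norm (Q *v z) = norm z"
  by (metis matrix_of_matrix_vector_mul matrix_vector_mul_linear orthogonal_transformation_matrix orthogonal_transformation_norm)

lemma kronecker4_svd: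
  assumes "X = rot2 \<phi> ** diag2 a b ** rot2 \<psi>" "Y = rot2 \<phi>' ** diag2 a' b' ** rot2 \<psi>'"
  shows "kronecker4 X Y = kronecker4 (rot2 \<phi>) (rot2 \<phi>') ** diag4 (a * a') (a * b') (b * a') (b * b') ** kronecker4 (rot2 \<psi>) (rot2 \<psi>')"
  by (simp add: assms kronecker4_mult flip: kronecker4_diag2)

text \<open>Orthogonal factors change the Gram matrix only by conjugation, so its eigenvalues are
  the squares of the products of planar singular values. Only the extreme products have a fixed
  place in the order; the two mixed ones need \<open>max\<close> and \<open>min\<close>, and this
  maximum is the origin of the two potentials.\<close>

lemma singular_values_kronecker4:
  assumes "X = rot2 \<phi> ** diag2 a b ** rot2 \<psi>" "0 < b" "b \<le> a"
    and "Y = rot2 \<phi>' ** diag2 a' b' ** rot2 \<psi>'" "0 < b'" "b' \<le> a'"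
  shows "singular_values (kronecker4 X Y) = [a * a', max (a * b') (b * a'), min (a * b') (b * a'), b * b']"
proof -
  let ?U = "kronecker4 (rot2 \<phi>) (rot2 \<phi>')" and ?V = "kronecker4 (rot2 \<psi>) (rot2 \<psi>')"
  let ?D = "diag4 (a * a') (a * b') (b * a') (b * b')"
  have A: "kronecker4 X Y = ?U ** ?D ** ?V" by (rule kronecker4_svd[OF assms(1,4)])
  have U: "transpose ?U ** ?U = mat 1" using orthogonal_kronecker4_rot2 by (simp add: orthogonal_matrix)
  have "transpose (kronecker4 X Y) ** kronecker4 X Y = transpose ?V ** (?D ** (transpose ?U ** ?U) ** ?D) ** ?V"
    by (simp only: A matrix_transpose_mul transpose_diag4 matrix_mul_assoc)
  then have e: "transpose (kronecker4 X Y) ** kronecker4 X Y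
      = transpose ?V ** diag4 ((a * a')\<^sup>2) ((a * b')\<^sup>2) ((b * a')\<^sup>2) ((b * b')\<^sup>2) ** ?V"
    by (simp add: U diag4_mult power2_eq_square)
  have "charpoly (transpose (kronecker4 X Y) ** kronecker4 X Y)
      = [:- ((a * a')\<^sup>2), 1:] * [:- ((a * b')\<^sup>2), 1:] * [:- ((b * a')\<^sup>2), 1:] * [:- ((b * b')\<^sup>2), 1:]"
    unfolding e charpoly_orthogonal_conj[OF orthogonal_kronecker4_rot2] charpoly_diag4 ..
  then have "proots (charpoly (transpose (kronecker4 X Y) ** kronecker4 X Y)) = {#(a * a')\<^sup>2, (a * b')\<^sup>2, (b * a')\<^sup>2, (b * b')\<^sup>2#}"
    by (simp only: proots_mult mult_eq_0_iff pCons_eq_0_iff one_neq_zero simp_thms proots_linear_factor) simp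
  then have "image_mset sqrt (proots (charpoly (transpose (kronecker4 X Y) ** kronecker4 X Y))) = {#a * a', a * b', b * a', b * b'#}"
    using assms by (simp add: real_sqrt_abs abs_mult)
  also have "\<dots> = mset [b * b', min (a * b') (b * a'), max (a * b') (b * a'), a * a']"
    by (simp add: min_def max_def)
  finally have "singular_values (kronecker4 X Y) = rev (sort [b * b', min (a * b') (b * a'), max (a * b') (b * a'), a * a'])"
    unfolding singular_values_def by (simp only: sorted_list_of_multiset_mset)
  moreover have "sorted [b * b', min (a * b') (b * a'), max (a * b') (b * a'), a * a']"
    using mult_right_mono[OF assms(3), of b'] mult_right_mono[OF assms(3), of a'] mult_left_mono[OF assms(6), of a] mult_left_mono[OF assms(6), of b] mult_mono[OF assms(3,6)] assms
    by (auto simp: le_max_iff_disj min_le_iff_disj)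
  ultimately show ?thesis by (simp only: sorted_sort_id) simp
qed

lemma det_kronecker4:
  assumes "det X > 0" "det (Y::real^2^2) > 0"
  shows "\<bar>det (kronecker4 X Y)\<bar> = (det X * det Y)\<^sup>2"
proof -
  obtain \<phi> \<psi> a b where X: "X = rot2 \<phi> ** diag2 a b ** rot2 \<psi>" "0 < b" "b \<le> a" using svd2[OF assms(1)] .
  obtain \<phi>' \<psi>' a' b' where Y: "Y = rot2 \<phi>' ** diag2 a' b' ** rot2 \<psi>'" "0 < b'" "b' \<le> a'" using svd2[OF assms(2)] .
  have d: "det (diag4 p q r s) = p * q * r * s" for p q r s
  proof -
    have "det (diag4 p q r s) = prod (\<lambda>i. diag4 p q r s $ i $ i) UNIV"
      by (rule det_diagonal) (auto simp: diag4_def)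
    then show ?thesis unfolding UNIV_4 by (simp add: diag4_def)
  qed
  have o: "\<bar>det (kronecker4 (rot2 s) (rot2 t))\<bar> = 1" for s t
    using det_orthogonal_matrix[OF orthogonal_kronecker4_rot2[of s t]] by auto
  have "\<bar>det (kronecker4 X Y)\<bar> = \<bar>(a * a') * (a * b') * (b * a') * (b * b')\<bar>"
    unfolding kronecker4_svd[OF X(1) Y(1)] by (simp add: det_mul abs_mult o d)
  also have "\<dots> = (det X * det Y)\<^sup>2" using X Y by (simp add: det_mul abs_mult power2_eq_square)
  finally show ?thesis .
qed

text \<open>The mixed products of singular values are written as \<open>a * e / b\<close> and
  \<open>b * d / a\<close>: norms and determinants behave well under matrix products, single smaller
  singular values do not.\<close>

lemma sv_function_kronecker4:
  fixes X Y :: "real^2^2"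
  assumes "det X > 0" "det Y > 0"
  defines "a \<equiv> opn X" and "b \<equiv> opn Y" and "d \<equiv> det X" and "e \<equiv> det Y"
  shows "0 \<le> s \<Longrightarrow> s \<le> 1 \<Longrightarrow> sv_function s (kronecker4 X Y) = (a * b) powr s"
    and "1 \<le> s \<Longrightarrow> s \<le> 2 \<Longrightarrow> sv_function s (kronecker4 X Y) = (a * b) * (max (a * e / b) (b * d / a)) powr (s - 1)"
    and "2 \<le> s \<Longrightarrow> s \<le> 3 \<Longrightarrow> sv_function s (kronecker4 X Y) =
           (a * b) * max (a * e / b) (b * d / a) * (min (a * e / b) (b * d / a)) powr (s - 2)"
    and "3 \<le> s \<Longrightarrow> s \<le> 4 \<Longrightarrow> sv_function s (kronecker4 X Y) = (a * b) * (d * e) * (d * e / (a * b)) powr (s - 3)"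
    and "4 < s \<Longrightarrow> sv_function s (kronecker4 X Y) = (d * e) powr (s / 2)"
proof -
  obtain \<phi> \<psi> p q where X: "X = rot2 \<phi> ** diag2 p q ** rot2 \<psi>" "0 < q" "q \<le> p" using svd2[OF assms(1)] .
  obtain \<phi>' \<psi>' p' q' where Y: "Y = rot2 \<phi>' ** diag2 p' q' ** rot2 \<psi>'" "0 < q'" "q' \<le> p'" using svd2[OF assms(2)] .
  have ab: "a = p" "b = p'" "d = p * q" "e = p' * q'"
    using X Y by (simp_all add: a_def b_def d_def e_def opn_svd2 det_mul)
  have pos: "0 < p" "0 < p'" using X Y by auto
  have m: "a * e / b = p * q'" "b * d / a = q * p'" "d * e / (a * b) = q * q'" using pos by (simp_all add: ab)
  have sv: "singular_value (kronecker4 X Y) (Suc 0) = a * b" "singular_value (kronecker4 X Y) 2 = max (a * e / b) (b * d / a)"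
      "singular_value (kronecker4 X Y) 3 = min (a * e / b) (b * d / a)" "singular_value (kronecker4 X Y) 4 = d * e / (a * b)"
    unfolding m unfolding singular_value_def singular_values_kronecker4[OF X Y] by (simp_all add: ab)
  have mm: "max (a * e / b) (b * d / a) * min (a * e / b) (b * d / a) = d * e"
    using pos by (simp add: m max_def min_def) (simp add: ab)
  have svpos: "0 < a * b" "0 < max (a * e / b) (b * d / a)" "0 < min (a * e / b) (b * d / a)" "0 < d * e / (a * b)"
    using X Y pos by (auto simp: m ab less_max_iff_disj)
  have ivl: "{Suc 0..Suc (Suc 0)} = {1, 2::nat}" "{Suc 0..Suc (Suc (Suc 0))} = {1, 2, 3::nat}" "{Suc 0..Suc (Suc (Suc (Suc 0)))} = {1, 2, 3, 4::nat}"
    by auto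
  have sv_pos: "0 < singular_value (kronecker4 X Y) (Suc n)" if "n \<le> 3" for n
  proof -
    have "n = 0 \<or> n = 1 \<or> n = 2 \<or> n = 3" using that by linarith
    then show ?thesis using svpos sv by (auto simp: eval_nat_numeral)
  qed
  \<comment> \<open>One formula on the closed interval, although the definition treats integers
    separately: at \<open>s = n\<close> the last factor is a power with exponent 0, and at
    \<open>s = n + 1\<close> it has exponent 1.\<close>
  have main: "sv_function s (kronecker4 X Y) = (\<Prod>i = 1..n. singular_value (kronecker4 X Y) i) * singular_value (kronecker4 X Y) (Suc n) powr (s - real n)"
    if "real n \<le> s" "s \<le> real n + 1" "n \<le> 3" for n
  proof (cases "s = real n + 1")
    case True
    with sv_pos[of n] that show ?thesis
      by (simp add: sv_function_def nat_add_distrib)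
  next
    case False
    then have fl: "\<lfloor>s\<rfloor> = int n" using that by linarith
    show ?thesis
    proof (cases "s = real n")
      case True
      with sv_pos[of n] that show ?thesis by (simp add: sv_function_def)
    next
      case ne: False
      then have "\<lceil>s\<rceil> = int n + 1" using that False by linarith
      moreover have "s \<notin> \<int>" using fl ne by (metis Ints_cases floor_of_int of_int_of_nat_eq)
      ultimately show ?thesis using that fl False by (simp add: sv_function_def nat_add_distrib)
    qed
  qed
  show "0 \<le> s \<Longrightarrow> s \<le> 1 \<Longrightarrow> sv_function s (kronecker4 X Y) = (a * b) powr s"
    using main[of 0] by (simp add: sv)
  show "1 \<le> s \<Longrightarrow> s \<le> 2 \<Longrightarrow> sv_function s (kronecker4 X Y) = (a * b) * (max (a * e / b) (b * d / a)) powr (s - 1)"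
    using main[of 1] sv by (simp add: numeral_2_eq_2)
  show "2 \<le> s \<Longrightarrow> s \<le> 3 \<Longrightarrow> sv_function s (kronecker4 X Y) =
           (a * b) * max (a * e / b) (b * d / a) * (min (a * e / b) (b * d / a)) powr (s - 2)"
    using main[of 2] sv by (simp add: numeral_3_eq_3 numeral_2_eq_2 ivl)
  show "3 \<le> s \<Longrightarrow> s \<le> 4 \<Longrightarrow> sv_function s (kronecker4 X Y) = (a * b) * (d * e) * (d * e / (a * b)) powr (s - 3)"
    using main[of 3] sv mm by (simp add: numeral_3_eq_3 numeral_2_eq_2 ivl eval_nat_numeral mult_ac)
  show "4 < s \<Longrightarrow> sv_function s (kronecker4 X Y) = (d * e) powr (s / 2)"
  proof -
    assume "4 < s"
    have "0 < d * e" using assms by (simp add: d_def e_def)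
    then have "((d * e)\<^sup>2) powr (s / 4) = (d * e) powr (s / 2)" by (simp add: powr_powr flip: powr_numeral)
    with \<open>4 < s\<close> show ?thesis
      using det_kronecker4[OF assms(1,2)] by (simp add: sv_function_def d_def e_def)
  qed
qed

section \<open>Subadditive sequences and elementary inequalities\<close>

lemma subadditive_mult_le:
  fixes f :: "nat \<Rightarrow> real"
  assumes "\<And>m n. f (m + n) \<le> f m + f n"
  shows "f (Suc k * n) \<le> real (Suc k) * f n"
proof (induction k)
  case (Suc k)
  have "f (Suc (Suc k) * n) \<le> f n + f (Suc k * n)" using assms[of n "Suc k * n"] by simp
  with Suc show ?case by (simp add: algebra_simps)
qed simp

text \<open>Fekete's lemma; the linear lower bound keeps the infimum of \<open>f n / n\<close>
  finite.\<close>

lemma subadditive_convergent: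
  fixes f :: "nat \<Rightarrow> real"
  assumes sub: "\<And>m n. f (m + n) \<le> f m + f n" and lower: "\<And>n. c * real n \<le> f n"
  shows "convergent (\<lambda>n. f n / real n)"
proof -
  define L where "L = (INF n\<in>{1..}. f n / real n)"
  have bdd: "bdd_below ((\<lambda>n. f n / real n) ` {1..})"
    using lower by (intro bdd_belowI2[of _ c]) (auto simp: pos_le_divide_eq)
  have L_le: "L \<le> f n / real n" if "1 \<le> n" for n
    unfolding L_def using that by (intro cINF_lower[OF bdd]) auto
  have "(\<lambda>n. f n / real n) \<longlonglongrightarrow> L"
  proof (rule LIMSEQ_I)
    fix e :: real assume "0 < e"
    then obtain m where m: "1 \<le> m" "f m / real m < L + e / 2"
      using cInf_lessD[of "(\<lambda>n. f n / real n) ` {1..}" "L + e / 2"] by (auto simp: L_def)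
    \<comment> \<open>With \<open>n = q * m + r\<close> and \<open>r < m\<close>, this bounds
      everything that depends on \<open>r\<close>, uniformly in \<open>n\<close>.\<close>
    define R where "R = (\<Sum>r<m. \<bar>f r\<bar>) + real m * \<bar>L + e / 2\<bar>"
    obtain N where N: "R / (e / 2) < real N" using reals_Archimedean2 by blast
    have "norm (f n / real n - L) < e" if n: "max 1 N \<le> n" for n
    proof -
      have *: "f (q * m + r) \<le> real q * f m + f r" for q r
      proof (cases q)
        case (Suc k)
        then show ?thesis using sub[of "q * m" r] subadditive_mult_le[of f k m, OF sub] by simp
      qed simp
      let ?q = "n div m" and ?r = "n mod m"
      have qr: "real n = real ?q * real m + real ?r"
        by (metis div_mult_mod_eq of_nat_add of_nat_mult)
      have "f n \<le> real ?q * f m + f ?r" using *[of ?q ?r] by simp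
      moreover have "real ?q * f m \<le> real ?q * (real m * (L + e / 2))"
        using m by (intro mult_left_mono) (auto simp: pos_divide_less_eq mult.commute)
      moreover have "real ?q * (real m * (L + e / 2)) = real n * (L + e / 2) - real ?r * (L + e / 2)"
        by (subst qr) (simp add: algebra_simps)
      moreover have "- (real ?r * (L + e / 2)) \<le> real m * \<bar>L + e / 2\<bar>"
      proof -
        have "- (real ?r * (L + e / 2)) \<le> real ?r * \<bar>L + e / 2\<bar>"
          by (metis abs_ge_minus_self abs_mult abs_of_nat)
        also have "\<dots> \<le> real m * \<bar>L + e / 2\<bar>" using m by (intro mult_right_mono) (auto intro: less_imp_le)
        finally show ?thesis .
      qed
      moreover have "\<bar>f ?r\<bar> \<le> (\<Sum>r<m. \<bar>f r\<bar>)"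
        using m by (intro member_le_sum) auto
      ultimately have "f n \<le> real n * (L + e / 2) + R" unfolding R_def by linarith
      then have "f n / real n \<le> L + e / 2 + R / real n" using n by (simp add: field_simps)
      moreover have "R / real n < e / 2"
      proof -
        have "R / (e / 2) < real n" using N n by linarith
        then show ?thesis using n \<open>0 < e\<close> by (simp add: field_simps)
      qed
      moreover have "L \<le> f n / real n" using n by (intro L_le) simp
      ultimately show ?thesis unfolding real_norm_def abs_less_iff by linarith
    qed
    then show "\<exists>no. \<forall>n\<ge>no. norm (f n / real n - L) < e" by blast
  qed
  then show ?thesis by (rule convergentI)
qed

text \<open>By subadditivity \<open>f n / n\<close> is at least its limit along the multiples of
  \<open>n\<close>. This turns a growth rate of zero into a bound for every single
  \<open>n\<close>.\<close>

lemma subadditive_nonneg: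
  fixes f :: "nat \<Rightarrow> real"
  assumes sub: "\<And>m n. f (m + n) \<le> f m + f n" and lim: "(\<lambda>n. f n / real n) \<longlonglongrightarrow> 0"
  shows "0 \<le> f n"
proof (cases "n = 0")
  case True
  then show ?thesis using sub[of 0 0] by simp
next
  case False
  have "strict_mono (\<lambda>k. Suc k * n)" using False by (intro strict_monoI) simp
  from LIMSEQ_subseq_LIMSEQ[OF lim this] have "(\<lambda>k. f (Suc k * n) / real (Suc k * n)) \<longlonglongrightarrow> 0" by (simp add: o_def)
  then have "0 \<le> f n / real n"
  proof (rule LIMSEQ_le_const2, intro exI[of _ 0] allI impI)
    fix k
    have "f (Suc k * n) / real (Suc k * n) \<le> (real (Suc k) * f n) / real (Suc k * n)"
      by (intro divide_right_mono subadditive_mult_le sub) simp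
    also have "\<dots> = f n / real n" by (subst of_nat_mult, rule mult_divide_mult_cancel_left) simp
    finally show "f (Suc k * n) / real (Suc k * n) \<le> f n / real n" .
  qed
  with False show ?thesis by (simp add: zero_le_divide_iff)
qed

lemma powr_power_commute: "0 \<le> x \<Longrightarrow> (x powr a) ^ n = (x ^ n) powr (a :: real)"
  by (induction n) (simp_all add: powr_mult)

text \<open>Since \<open>t \<le> 1\<close>, the larger of the two products puts the full power on
  the larger number. A product of a maximum and a minimum is not visibly submultiplicative, a
  maximum of products is.\<close>

lemma max_mult_min_powr:
  fixes u v t :: real
  assumes "0 < u" "0 < v" "t \<le> 1"
  shows "max u v * min u v powr t = max (u * v powr t) (v * u powr t)"
proof -
  have *: "y * x powr t \<le> x * y powr t" if "0 < y" "y \<le> x" for x y :: real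
  proof -
    have "y * x powr t = (y powr (1 - t) * y powr t) * x powr t" using that by (simp flip: powr_add)
    also have "\<dots> \<le> (x powr (1 - t) * y powr t) * x powr t"
      using that assms by (intro mult_right_mono powr_mono2) auto
    also have "\<dots> = (x powr (1 - t) * x powr t) * y powr t" by simp
    also have "\<dots> = x * y powr t" using that by (simp flip: powr_add)
    finally show ?thesis .
  qed
  show ?thesis using *[of u v] *[of v u] assms by (cases "u \<le> v") (auto simp: max_def min_def)
qed

lemma sum_submult_le:
  fixes f :: "'i::finite list \<Rightarrow> real"
  assumes "\<And>u v. f (u @ v) \<le> f u * f v"
  shows "(\<Sum>w | length w = n + m. f w) \<le> (\<Sum>w | length w = n. f w) * (\<Sum>w | length w = m. f w)"
  unfolding sum_words_append sum_product by (intro sum_mono assms)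

lemma max_submult:
  fixes a b c d :: real
  assumes "0 < a" "0 < b" "0 < c" "0 < d" "x \<le> a * b" "y \<le> c * d"
  shows "max x y \<le> max a c * max b d"
proof -
  have "a * b \<le> max a c * max b d" "c * d \<le> max a c * max b d" using assms by (auto intro!: mult_mono)
  with assms show ?thesis by auto
qed

lemma words_nonempty: "{w :: 'i list. length w = n} \<noteq> {}"
  using length_replicate[of n undefined] by blast

section \<open>The singular value function in terms of the two planar factors\<close>

context two_blocks
begin

definition LB :: "4 \<Rightarrow> real^4^4" where "LB i = kronecker4 (LX i) (LY i)"
definition sv :: "real \<Rightarrow> 4 list \<Rightarrow> real" where "sv s w = sv_function s (matrix_word LB w)"

lemma matrix_word_LB: "matrix_word LB w = kronecker4 (X w) (Y w)"
  using matrix_word_kronecker4[of LX LY w] by (simp add: LB_def[abs_def])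

definition s1 where "s1 w = opn (X w) * opn (Y w)"
text \<open>With singular values \<open>a \<ge> b\<close> of \<open>X w\<close> and
  \<open>a' \<ge> b'\<close> of \<open>Y w\<close> this is \<open>a * b'\<close>, as
  \<open>b' = det (Y w) / opn (Y w)\<close>; likewise \<open>s2Y\<close> is
  \<open>b * a'\<close>.\<close>

definition s2X where "s2X w = opn (X w) * det (Y w) / opn (Y w)"
definition s2Y where "s2Y w = opn (Y w) * det (X w) / opn (X w)"
definition s2 where "s2 w = max (s2X w) (s2Y w)"

lemma s_pos: "0 < s1 w" "0 < s2X w" "0 < s2Y w" "0 < s2 w"
  using opn_pos[of w] det_pos[of w] by (auto simp: s1_def s2X_def s2Y_def s2_def less_max_iff_disj)

lemma s2X_s2Y: "s2X w * s2Y w = det (X w) * det (Y w)"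
  using opn_pos[of w] by (simp add: s2X_def s2Y_def)

lemma sv_eq_0_1: "0 \<le> s \<Longrightarrow> s \<le> 1 \<Longrightarrow> sv s w = pot s s 0 0 w"
  using opn_pos[of w] det_pos[of w]
  by (simp add: sv_def matrix_word_LB sv_function_kronecker4(1)[OF det_pos] pot_def powr_mult less_imp_le)

lemma sv_eq_1_2': "1 \<le> s \<Longrightarrow> s \<le> 2 \<Longrightarrow> sv s w = s1 w * s2 w powr (s - 1)"
  by (simp add: sv_def matrix_word_LB sv_function_kronecker4(2)[OF det_pos] s1_def s2_def s2X_def s2Y_def)

text \<open>All sides are positive monomials in the norms and determinants, so comparing logarithms
  suffices.\<close>

lemma pot_eq: "s1 w * s2X w powr (s - 1) = pot s (2 - s) 0 (s - 1) w" "s1 w * s2Y w powr (s - 1) = pot (2 - s) s (s - 1) 0 w"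
  using opn_pos[of w] det_pos[of w]
  by (subst ln_inj_iff[symmetric]; simp add: s1_def s2X_def s2Y_def pot_def ln_mult ln_div ln_powr algebra_simps)+

lemma sv_eq_1_2:
  assumes "1 \<le> s" "s \<le> 2" shows "sv s w = max (pot s (2 - s) 0 (s - 1) w) (pot (2 - s) s (s - 1) 0 w)"
proof -
  have "s2 w powr (s - 1) = max (s2X w powr (s - 1)) (s2Y w powr (s - 1))"
    using s_pos[of w] assms powr_mono2[of "s - 1" "s2X w" "s2Y w"] powr_mono2[of "s - 1" "s2Y w" "s2X w"]
    by (auto simp: s2_def max_def less_imp_le)
  then have "sv s w = max (s1 w * s2X w powr (s - 1)) (s1 w * s2Y w powr (s - 1))"
    using s_pos[of w] assms by (simp add: sv_eq_1_2' max_mult_distrib_left less_imp_le)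
  then show ?thesis by (simp only: pot_eq)
qed

lemma sv_eq_2_3':
  assumes "2 \<le> s" "s \<le> 3" shows "sv s w = s1 w * s2 w * min (s2X w) (s2Y w) powr (s - 2)"
  using assms by (simp add: sv_def matrix_word_LB sv_function_kronecker4(3)[OF det_pos] s1_def s2_def s2X_def s2Y_def)

lemma sv_eq_2_3:
  assumes "2 \<le> s" "s \<le> 3" shows "sv s w = max (pot (4 - s) (s - 2) (s - 2) 1 w) (pot (s - 2) (4 - s) 1 (s - 2) w)"
proof -
  have "sv s w = s1 w * (max (s2X w) (s2Y w) * min (s2X w) (s2Y w) powr (s - 2))"
    by (simp only: sv_eq_2_3'[OF assms] s2_def mult.assoc)
  also have "\<dots> = s1 w * max (s2X w * s2Y w powr (s - 2)) (s2Y w * s2X w powr (s - 2))"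
    using s_pos[of w] assms by (subst max_mult_min_powr) auto
  also have "\<dots> = max (s1 w * (s2X w * s2Y w powr (s - 2))) (s1 w * (s2Y w * s2X w powr (s - 2)))"
    using s_pos[of w] by (simp only: max_mult_distrib_left less_imp_le if_True)
  finally have "sv s w = max (s1 w * (s2X w * s2Y w powr (s - 2))) (s1 w * (s2Y w * s2X w powr (s - 2)))" .
  moreover have "s1 w * (s2X w * s2Y w powr (s - 2)) = pot (4 - s) (s - 2) (s - 2) 1 w"
    using opn_pos[of w] det_pos[of w]
    by (subst ln_inj_iff[symmetric]; simp add: s1_def s2X_def s2Y_def pot_def ln_mult ln_div ln_powr algebra_simps)
  moreover have "s1 w * (s2Y w * s2X w powr (s - 2)) = pot (s - 2) (4 - s) 1 (s - 2) w"
    using opn_pos[of w] det_pos[of w]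
    by (subst ln_inj_iff[symmetric]; simp add: s1_def s2X_def s2Y_def pot_def ln_mult ln_div ln_powr algebra_simps)
  ultimately show ?thesis by simp
qed

lemma sv_eq_3_4':
  assumes "3 \<le> s" "s \<le> 4" shows "sv s w = s1 w * (det (X w) * det (Y w)) * (det (X w) * det (Y w) / s1 w) powr (s - 3)"
  using assms by (simp add: sv_def matrix_word_LB sv_function_kronecker4(4)[OF det_pos] s1_def)

lemma sv_eq_3_4:
  assumes "3 \<le> s" "s \<le> 4" shows "sv s w = pot (4 - s) (4 - s) (s - 2) (s - 2) w"
  unfolding sv_eq_3_4'[OF assms]
  using opn_pos[of w] det_pos[of w]
  by (subst ln_inj_iff[symmetric]; simp add: s1_def pot_def ln_mult ln_div ln_powr algebra_simps)

lemma sv_eq_4':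
  assumes "4 < s" shows "sv s w = (det (X w) * det (Y w)) powr (s / 2)"
  using assms by (simp add: sv_def matrix_word_LB sv_function_kronecker4(5)[OF det_pos])

lemma sv_eq_4:
  assumes "4 < s" shows "sv s w = pot 0 0 (s / 2) (s / 2) w"
  unfolding sv_eq_4'[OF assms]
  using opn_pos[of w] det_pos[of w] by (simp add: pot_def powr_mult less_imp_le)

lemma pot_ge:
  assumes "0 \<le> p" "0 \<le> q" "0 \<le> e" "0 \<le> f"
  shows "((\<alpha> * \<beta>) powr (p + q + e + f)) ^ length w \<le> pot p q e f w"
proof -
  let ?d = "(\<alpha> * \<beta>) ^ length w"
  have d: "0 < ?d" using \<alpha>_pos \<beta>_pos by simp
  have o: "x \<le> y" if "x \<le> y\<^sup>2" "0 < y" "y \<le> 1" for x y :: real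
    using that mult_left_le[of y y] unfolding power2_eq_square by linarith
  have 1: "?d \<le> opn (X w)" "?d \<le> opn (Y w)"
    using o[of _ "opn (X w)"] o[of _ "opn (Y w)"] det_ge[of w] opn_det(2)[OF det_pos(1), of w] opn_det(2)[OF det_pos(2), of w] opn_pos[of w] opn_le_1[of w]
    by (meson order_trans)+
  have "((\<alpha> * \<beta>) powr (p + q + e + f)) ^ length w = ?d powr (p + q + e + f)"
    using \<alpha>_pos \<beta>_pos by (intro powr_power_commute) simp
  also have "\<dots> = ?d powr p * ?d powr q * ?d powr e * ?d powr f" by (simp add: powr_add)
  also have "\<dots> \<le> pot p q e f w"
    unfolding pot_def using assms 1 det_ge[of w] d by (intro mult_mono powr_mono2) auto
  finally show ?thesis .
qed

text \<open>Stated for all \<open>s \<ge> 0\<close>, because the zero of the pressure has to be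
  unique on the whole half-line; on each interval of exponents the function is one potential or a
  maximum of two.\<close>

lemma sv_submult_lower:
  assumes "0 \<le> s"
  obtains \<delta> where "0 < \<delta>" "\<And>w. \<delta> ^ length w \<le> sv s w" "\<And>u v. sv s (u @ v) \<le> sv s u * sv s v" "\<And>w. 0 < sv s w"
proof -
  note result = that
  have powr_ab: "0 < (\<alpha> * \<beta>) powr t" for t using \<alpha>_pos \<beta>_pos by simp
  have single: thesis if "\<And>w. sv s w = pot p q e f w" "0 \<le> p" "0 \<le> q" "0 \<le> e" "0 \<le> f" for p q e f
    using that \<alpha>_pos \<beta>_pos by (intro result[of "(\<alpha> * \<beta>) powr (p + q + e + f)"])
      (simp_all add: powr_ab pot_ge pot_submult pot_pos)
  have double: thesis if eq: "\<And>w. sv s w = max (pot p q e f w) (pot p' q' e' f' w)"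
    and nn: "0 \<le> p" "0 \<le> q" "0 \<le> e" "0 \<le> f" "0 \<le> p'" "0 \<le> q'" for p q e f p' q' e' f'
  proof (rule result[of "(\<alpha> * \<beta>) powr (p + q + e + f)"])
    show "((\<alpha> * \<beta>) powr (p + q + e + f)) ^ length w \<le> sv s w" for w
      using pot_ge[OF nn(1-4), of w] by (simp add: eq le_max_iff_disj)
    show "sv s (u @ v) \<le> sv s u * sv s v" for u v
      unfolding eq by (intro max_submult pot_pos pot_submult nn)
    show "0 < sv s w" for w by (simp add: eq less_max_iff_disj pot_pos)
  qed (rule powr_ab)
  consider "s \<le> 1" | "1 \<le> s" "s \<le> 2" | "2 \<le> s" "s \<le> 3" | "3 \<le> s" "s \<le> 4" | "4 < s" by linarith
  then show thesis
  proof cases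
    case 1 then show thesis using assms by (intro single[OF sv_eq_0_1]) auto
  next
    case 2 then show thesis by (intro double[OF sv_eq_1_2]) auto
  next
    case 3 then show thesis by (intro double[OF sv_eq_2_3]) auto
  next
    case 4 then show thesis by (intro single[OF sv_eq_3_4]) auto
  next
    case 5 then show thesis by (intro single[OF sv_eq_4]) auto
  qed
qed

definition Zs :: "real \<Rightarrow> nat \<Rightarrow> real" where "Zs s n = (\<Sum>w | length w = n. sv s w)"

lemma Zs_pos: "0 \<le> s \<Longrightarrow> 0 < Zs s n"
  unfolding Zs_def by (metis finite_words sum_pos sv_submult_lower words_nonempty)

text \<open>Fekete's lemma applied to \<open>ln (Zs s n)\<close> shows that the \<open>lim\<close>
  in \<open>sv_pressure\<close> is a genuine limit.\<close>

lemma pressure_tendsto: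
  assumes "0 \<le> s"
  shows "(\<lambda>n. ln (Zs s n) / real n) \<longlonglongrightarrow> sv_pressure s LB"
proof -
  obtain \<delta> where \<delta>: "0 < \<delta>" "\<And>w. \<delta> ^ length w \<le> sv s w" "\<And>u v. sv s (u @ v) \<le> sv s u * sv s v" "\<And>w. 0 < sv s w"
    using sv_submult_lower[OF assms] by metis
  have Z: "0 < Zs s n" for n by (rule Zs_pos[OF assms])
  have "convergent (\<lambda>n. ln (Zs s n) / real n)"
  proof (rule subadditive_convergent)
    fix m n
    have "Zs s (m + n) \<le> Zs s m * Zs s n" unfolding Zs_def by (rule sum_submult_le) (rule \<delta>)
    then have "ln (Zs s (m + n)) \<le> ln (Zs s m * Zs s n)" using Z by simp
    then show "ln (Zs s (m + n)) \<le> ln (Zs s m) + ln (Zs s n)" using Z[of m] Z[of n] by (simp add: ln_mult)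
  next
    fix n
    have "\<delta> ^ n \<le> sv s (replicate n undefined)" using \<delta>(2)[of "replicate n undefined"] by simp
    also have "\<dots> \<le> Zs s n" unfolding Zs_def using \<delta>(4) by (intro member_le_sum) (auto intro: less_imp_le)
    finally have "ln (\<delta> ^ n) \<le> ln (Zs s n)" using \<delta>(1) Z by simp
    then show "ln \<delta> * real n \<le> ln (Zs s n)" using \<delta>(1) by (simp add: ln_realpow mult.commute)
  qed
  then show ?thesis
    by (simp add: convergent_LIMSEQ_iff sv_pressure_def Zs_def sv_def mult.commute divide_inverse)
qed

lemma pressure_le:
  assumes "0 \<le> s" "0 < r" "0 < C" and le: "\<And>n. Zs s n \<le> C * r ^ n"
  shows "sv_pressure s LB \<le> ln r"
proof (rule LIMSEQ_le[OF pressure_tendsto[OF assms(1)]])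
  have "(\<lambda>n. ln C * inverse (real n) + ln r) \<longlonglongrightarrow> ln C * 0 + ln r"
    by (intro tendsto_intros lim_inverse_n)
  then show "(\<lambda>n. ln C * inverse (real n) + ln r) \<longlonglongrightarrow> ln r" by simp
  show "\<exists>N. \<forall>n\<ge>N. ln (Zs s n) / real n \<le> ln C * inverse (real n) + ln r"
  proof (intro exI[of _ 1] allI impI)
    fix n :: nat assume "1 \<le> n"
    have "ln (Zs s n) \<le> ln (C * r ^ n)" using le[of n] Zs_pos[OF assms(1), of n] by (smt (verit) ln_le_cancel_iff)
    also have "\<dots> = ln C + real n * ln r" using assms by (simp add: ln_mult ln_realpow)
    finally show "ln (Zs s n) / real n \<le> ln C * inverse (real n) + ln r"
      using \<open>1 \<le> n\<close> by (simp add: field_simps)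
  qed
qed

lemma pressure_ge:
  assumes "0 \<le> s" "0 < r" and ge: "\<And>n. r ^ n \<le> Zs s n"
  shows "ln r \<le> sv_pressure s LB"
proof (rule LIMSEQ_le_const[OF pressure_tendsto[OF assms(1)]], intro exI[of _ 1] allI impI)
  fix n :: nat assume "1 \<le> n"
  have "ln (r ^ n) \<le> ln (Zs s n)" using ge[of n] assms by (smt (verit) ln_le_cancel_iff zero_less_power)
  then show "ln r \<le> ln (Zs s n) / real n" using \<open>1 \<le> n\<close> assms by (simp add: ln_realpow field_simps)
qed

lemma s1_bounds: "s1 w \<le> \<alpha> ^ length w" "sqrt (\<alpha> * \<beta>) ^ length w \<le> s1 w"
proof -
  show "s1 w \<le> \<alpha> ^ length w" unfolding s1_def by (rule opn_prod_le)
  have "(sqrt (\<alpha> * \<beta>) ^ length w)\<^sup>2 = det (X w) * det (Y w)"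
    using \<alpha>_pos \<beta>_pos by (simp add: det_prod power_mult[symmetric] mult.commute[of _ 2]) (simp add: power_mult)
  also have "\<dots> \<le> (s1 w)\<^sup>2"
    unfolding s1_def power_mult_distrib using opn_det(2)[OF det_pos(1), of w] opn_det(2)[OF det_pos(2), of w] det_pos[of w]
    by (intro mult_mono) auto
  finally show "sqrt (\<alpha> * \<beta>) ^ length w \<le> s1 w" by (rule power2_le_imp_le) (rule less_imp_le[OF s_pos(1)])
qed

text \<open>The two mixed products multiply to \<open>(\<alpha> * \<beta>) ^ length w\<close>, hence
  the larger one is at least the square root of this.\<close>

lemma s2_bounds: "s2 w \<le> s1 w" "sqrt (\<alpha> * \<beta>) ^ length w \<le> s2 w" "\<beta> ^ length w \<le> s2 w"
proof -
  show "s2 w \<le> s1 w"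
    using opn_det(2)[OF det_pos(1), of w] opn_det(2)[OF det_pos(2), of w] opn_pos[of w]
    by (simp add: s2_def s2X_def s2Y_def s1_def field_simps power2_eq_square mult_mono mult_left_mono)
  have "(sqrt (\<alpha> * \<beta>) ^ length w)\<^sup>2 = s2X w * s2Y w"
    using \<alpha>_pos \<beta>_pos by (simp add: s2X_s2Y det_prod power_mult[symmetric] mult.commute[of _ 2]) (simp add: power_mult)
  also have "\<dots> \<le> (s2 w)\<^sup>2" using s_pos[of w] by (simp add: s2_def power2_eq_square mult_mono)
  finally show 1: "sqrt (\<alpha> * \<beta>) ^ length w \<le> s2 w" by (rule power2_le_imp_le) (rule less_imp_le[OF s_pos(4)])
  have "\<beta> \<le> sqrt (\<alpha> * \<beta>)" using \<beta>_pos \<beta>_less by (intro real_le_rsqrt) (simp add: power2_eq_square)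
  then have "\<beta> ^ length w \<le> sqrt (\<alpha> * \<beta>) ^ length w" using \<beta>_pos by (intro power_mono) auto
  with 1 show "\<beta> ^ length w \<le> s2 w" by simp
qed

lemma s1_le_1: "s1 w \<le> 1"
  using s1_bounds(1)[of w] power_le_one[of \<alpha> "length w"] \<alpha>_pos \<alpha>_less by simp

lemma det_le_s: "det (X w) * det (Y w) \<le> s1 w * s2 w" "det (X w) * det (Y w) \<le> (s1 w)\<^sup>2"
proof -
  have "det (X w) * det (Y w) = (sqrt (\<alpha> * \<beta>) ^ length w) * (sqrt (\<alpha> * \<beta>) ^ length w)"
    using \<alpha>_pos \<beta>_pos by (simp add: det_prod power_mult_distrib[symmetric])
  also have "\<dots> \<le> s1 w * s2 w" using s1_bounds(2) s2_bounds(2) s_pos(1)[of w] \<alpha>_pos \<beta>_pos by (intro mult_mono) auto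
  finally show 1: "det (X w) * det (Y w) \<le> s1 w * s2 w" .
  also have "\<dots> \<le> (s1 w)\<^sup>2" using s2_bounds(1)[of w] s_pos(1)[of w] by (simp add: power2_eq_square)
  finally show "det (X w) * det (Y w) \<le> (s1 w)\<^sup>2" .
qed

text \<open>All singular values are at most 1, so for \<open>s \<ge> 2\<close> the function is at
  most its value \<open>s1 w * s2 w\<close> at 2; an exponential bound at 2 then serves for all
  larger exponents.\<close>

lemma sv_le_2:
  assumes "2 \<le> s" shows "sv s w \<le> s1 w * s2 w"
proof -
  have dpos: "0 < det (X w) * det (Y w)" using det_pos[of w] by simp
  consider "s \<le> 3" | "3 \<le> s" "s \<le> 4" | "4 < s" by linarith
  then show ?thesis
  proof cases
    case 1
    have "min (s2X w) (s2Y w) \<le> s1 w" using s2_bounds(1)[of w] by (simp add: s2_def min_le_iff_disj)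
    then have "min (s2X w) (s2Y w) powr (s - 2) \<le> 1"
      using s1_le_1[of w] s_pos[of w] assms by (intro powr_le1) auto
    then show ?thesis using sv_eq_2_3'[OF assms 1, of w] s_pos[of w] by (simp add: mult_left_le)
  next
    case 2
    have 1: "det (X w) * det (Y w) / s1 w \<le> s1 w" using det_le_s(2)[of w] s_pos(1)[of w] by (simp add: pos_divide_le_eq power2_eq_square)
    have "0 \<le> det (X w) * det (Y w) / s1 w" using s_pos[of w] dpos by simp
    with 1 s1_le_1[of w] 2 have "(det (X w) * det (Y w) / s1 w) powr (s - 3) \<le> 1"
      by (intro powr_le1; linarith)
    then have "sv s w \<le> s1 w * (det (X w) * det (Y w))"
      using sv_eq_3_4'[OF 2, of w] s_pos[of w] dpos by (simp add: mult_left_le)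
    also have "\<dots> \<le> s1 w * s2 w"
    proof -
      have "s1 w * s2 w \<le> s2 w" using s1_le_1[of w] s_pos[of w] by (simp add: mult_left_le_one_le)
      then show ?thesis using det_le_s(1)[of w] s_pos(1)[of w] by (intro mult_left_mono) auto
    qed
    finally show ?thesis .
  next
    case 3
    have "det (X w) * det (Y w) \<le> 1" using det_le[of w] det_pos[of w] by (intro mult_le_one) auto
    then have "(det (X w) * det (Y w)) powr (s / 2) \<le> (det (X w) * det (Y w)) powr 1"
      using 3 dpos by (intro powr_mono') auto
    then show ?thesis using sv_eq_4'[OF 3, of w] det_le_s(1)[of w] dpos by simp
  qed
qed

text \<open>The \<open>4 ^ n\<close> words of length \<open>n\<close> each contribute at least
  \<open>sqrt (\<alpha> * \<beta>) ^ n\<close>, and \<open>4 * sqrt (\<alpha> * \<beta>) > 1\<close>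
  is the hypothesis on \<open>\<alpha> * \<beta>\<close>.\<close>

lemma pressure_pos_le_1:
  assumes "0 \<le> s" "s \<le> 1" "1/16 < \<alpha> * \<beta>" shows "0 < sv_pressure s LB"
proof -
  let ?r = "4 * sqrt (\<alpha> * \<beta>)"
  have "1/4 < sqrt (\<alpha> * \<beta>)" using assms(3) by (intro real_less_rsqrt) (simp add: power2_eq_square)
  then have "0 < ln ?r" by (intro ln_gt_zero) simp
  also have "ln ?r \<le> sv_pressure s LB"
  proof (rule pressure_ge)
    fix n
    have "sqrt (\<alpha> * \<beta>) ^ n \<le> sv s w" if "length w = n" for w
    proof -
      have "sqrt (\<alpha> * \<beta>) ^ n \<le> s1 w" using s1_bounds(2)[of w] that by simp
      also have "\<dots> = s1 w powr 1" using s_pos[of w] by simp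
      also have "\<dots> \<le> s1 w powr s" using assms s_pos[of w] s1_le_1[of w] by (intro powr_mono') auto
      also have "\<dots> = sv s w" using assms opn_pos[of w] det_pos[of w] by (simp add: sv_eq_0_1 pot_def s1_def powr_mult less_imp_le)
      finally show ?thesis .
    qed
    then have "(\<Sum>w::4 list | length w = n. sqrt (\<alpha> * \<beta>) ^ n) \<le> Zs s n" unfolding Zs_def by (intro sum_mono) simp
    moreover have "card {w :: 4 list. length w = n} = 4 ^ n" using card_lists_length_eq[of "UNIV :: 4 set" n] by simp
    ultimately show "?r ^ n \<le> Zs s n" by (simp add: power_mult_distrib)
  qed (use assms \<alpha>_pos \<beta>_pos in auto)
  finally show ?thesis .
qed

text \<open>At exponent 2 each of the two potentials has one-letter sum
  \<open>2 * \<alpha>\<^sup>2 + 2 * (\<alpha> * \<beta>)\<close>, two letters giving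
  \<open>\<alpha>\<^sup>2\<close> and two giving \<open>\<alpha> * \<beta>\<close>; this is below
  \<open>4 * \<alpha>\<^sup>2 < 1\<close>, and submultiplicativity makes the sums decay.\<close>

lemma pressure_neg_ge_2:
  assumes "2 \<le> s" "\<alpha> < 1/2" shows "sv_pressure s LB < 0"
proof -
  let ?r = "2 * \<alpha>\<^sup>2 + 2 * (\<alpha> * \<beta>)"
  have r: "0 < ?r" using \<alpha>_pos \<beta>_pos by (simp add: add_pos_pos)
  have pot_sum: "(\<Sum>w | length w = n. pot 2 0 0 1 w) \<le> ?r ^ n" "(\<Sum>w | length w = n. pot 0 2 1 0 w) \<le> ?r ^ n" for n
  proof (induction n)
    case 0
    have [simp]: "pot p q e f [] = 1" for p q e f by (simp add: pot_def)
    { case 1 then show ?case by simp next case 2 then show ?case by simp }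
  next
    case (Suc n)
    have one: "(\<Sum>w | length w = Suc 0. f w) = f [1] + f [2] + f [3] + f [4]" for f :: "4 list \<Rightarrow> real"
      by (simp add: sum_words_Suc sum_4)
    have f1: "(\<Sum>w | length w = Suc 0. pot 2 0 0 1 w) = ?r" "(\<Sum>w | length w = Suc 0. pot 0 2 1 0 w) = ?r"
      unfolding one using \<alpha>_pos \<beta>_pos \<beta>_less
      by (simp_all add: pot_def LX_def LY_def opn_diag2 det_mul powr_numeral)
    { case 1
      have "(\<Sum>w | length w = Suc n. pot 2 0 0 1 w) \<le> ?r * (\<Sum>w | length w = n. pot 2 0 0 1 w)"
        using sum_submult_le[of "pot 2 0 0 1" "Suc 0" n, OF pot_submult] unfolding f1 by simp
      also have "\<dots> \<le> ?r * ?r ^ n" using Suc(1) r by (intro mult_left_mono) auto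
      finally show ?case by simp
    next
      case 2
      have "(\<Sum>w | length w = Suc n. pot 0 2 1 0 w) \<le> ?r * (\<Sum>w | length w = n. pot 0 2 1 0 w)"
        using sum_submult_le[of "pot 0 2 1 0" "Suc 0" n, OF pot_submult] unfolding f1 by simp
      also have "\<dots> \<le> ?r * ?r ^ n" using Suc(2) r by (intro mult_left_mono) auto
      finally show ?case by simp
    }
  qed
  have "sv_pressure s LB \<le> ln ?r"
  proof (rule pressure_le[of s _ 2])
    fix n
    have "sv s w \<le> pot 2 0 0 1 w + pot 0 2 1 0 w" for w
    proof -
      have "sv s w \<le> s1 w * s2 w" by (rule sv_le_2[OF assms(1)])
      also have "\<dots> = sv 2 w" using sv_eq_1_2'[of 2 w] s_pos[of w] by simp
      also have "\<dots> \<le> pot 2 0 0 1 w + pot 0 2 1 0 w"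
        using sv_eq_1_2[of 2 w] pot_pos[of 2 0 0 1 w] pot_pos[of 0 2 1 0 w] by simp
      finally show ?thesis .
    qed
    then have "Zs s n \<le> (\<Sum>w | length w = n. pot 2 0 0 1 w) + (\<Sum>w | length w = n. pot 0 2 1 0 w)"
      unfolding Zs_def sum.distrib[symmetric] by (intro sum_mono)
    then show "Zs s n \<le> 2 * ?r ^ n" using pot_sum[of n] by linarith
  qed (use assms r in auto)
  also have "ln ?r < 0"
  proof -
    have "\<alpha> * \<beta> < \<alpha> * \<alpha>" using \<alpha>_pos \<beta>_less by simp
    moreover have "\<alpha> * \<alpha> < 1/2 * (1/2)" using assms \<alpha>_pos by (intro mult_strict_mono) auto
    ultimately have "?r < 1" by (simp add: power2_eq_square)
    then show ?thesis using r by simp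
  qed
  finally show ?thesis .
qed

text \<open>Passing from \<open>s\<close> to \<open>t\<close> multiplies each term by
  \<open>s2 w powr (t - s)\<close>, and \<open>s2 w\<close> lies between \<open>\<beta> ^ n\<close>
  and \<open>\<alpha> ^ n\<close>.\<close>

lemma pressure_Lipschitz:
  assumes "1 \<le> s" "s \<le> t" "t \<le> 2"
  shows "sv_pressure t LB \<le> sv_pressure s LB + (t - s) * ln \<alpha>" "sv_pressure s LB + (t - s) * ln \<beta> \<le> sv_pressure t LB"
proof -
  have sv: "sv t w = sv s w * s2 w powr (t - s)" for w
    using assms s_pos[of w] by (simp add: sv_eq_1_2' flip: powr_add)
  have svpos: "0 < sv s w" for w using assms by (simp add: sv_eq_1_2 pot_pos less_max_iff_disj)
  have pw: "(x powr (t - s)) ^ n = (x ^ n) powr (t - s)" if "0 < x" for x :: real and n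
    using that by (intro powr_power_commute) simp
  have up: "Zs t n \<le> Zs s n * (\<alpha> powr (t - s)) ^ n" for n
    unfolding Zs_def sum_distrib_right sv
  proof (rule sum_mono)
    fix w :: "4 list" assume "w \<in> {w. length w = n}"
    then have "s2 w \<le> \<alpha> ^ n" using s2_bounds(1)[of w] s1_bounds(1)[of w] by simp
    then show "sv s w * s2 w powr (t - s) \<le> sv s w * (\<alpha> powr (t - s)) ^ n"
      using s_pos[of w] svpos[of w] assms unfolding pw[OF \<alpha>_pos] by (intro mult_left_mono powr_mono2) auto
  qed
  have lo: "Zs s n * (\<beta> powr (t - s)) ^ n \<le> Zs t n" for n
    unfolding Zs_def sum_distrib_right sv
  proof (rule sum_mono)
    fix w :: "4 list" assume "w \<in> {w. length w = n}"
    then have "\<beta> ^ n \<le> s2 w" using s2_bounds(3)[of w] by simp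
    then show "sv s w * (\<beta> powr (t - s)) ^ n \<le> sv s w * s2 w powr (t - s)"
      using svpos[of w] assms \<beta>_pos unfolding pw[OF \<beta>_pos] by (intro mult_left_mono powr_mono2) auto
  qed
  have ln_eq: "ln (Zs s n * (x powr (t - s)) ^ n) / real n = ln (Zs s n) / real n + (t - s) * ln x" if "1 \<le> n" "0 < x" for x n
    using that Zs_pos[of s n] assms by (simp add: ln_mult ln_realpow ln_powr field_simps)
  have lim: "(\<lambda>n. ln (Zs s n) / real n + (t - s) * ln x) \<longlonglongrightarrow> sv_pressure s LB + (t - s) * ln x" for x
    using assms by (intro tendsto_intros pressure_tendsto) auto
  have pos: "0 < Zs s n" "0 < Zs t n" for n using assms by (auto intro: Zs_pos)
  show "sv_pressure t LB \<le> sv_pressure s LB + (t - s) * ln \<alpha>"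
  proof (rule LIMSEQ_le[OF pressure_tendsto lim], use assms in simp, intro exI[of _ 1] allI impI)
    fix n :: nat assume "1 \<le> n"
    have "ln (Zs t n) \<le> ln (Zs s n * (\<alpha> powr (t - s)) ^ n)" using up[of n] pos by (smt (verit) ln_le_cancel_iff)
    then show "ln (Zs t n) / real n \<le> ln (Zs s n) / real n + (t - s) * ln \<alpha>"
      unfolding ln_eq[OF \<open>1 \<le> n\<close> \<alpha>_pos, symmetric] by (intro divide_right_mono) auto
  qed
  show "sv_pressure s LB + (t - s) * ln \<beta> \<le> sv_pressure t LB"
  proof (rule LIMSEQ_le[OF lim pressure_tendsto], use assms in simp, intro exI[of _ 1] allI impI)
    fix n :: nat assume "1 \<le> n"
    have "0 < Zs s n * (\<beta> powr (t - s)) ^ n" using pos[of n] \<beta>_pos by simp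
    then have "ln (Zs s n * (\<beta> powr (t - s)) ^ n) \<le> ln (Zs t n)" using lo[of n] pos by (smt (verit) ln_le_cancel_iff)
    then show "ln (Zs s n) / real n + (t - s) * ln \<beta> \<le> ln (Zs t n) / real n"
      unfolding ln_eq[OF \<open>1 \<le> n\<close> \<beta>_pos, symmetric] by (intro divide_right_mono) auto
  qed
qed

text \<open>The intermediate value theorem and strict decrease on \<open>{1..2}\<close> give exactly
  one zero there; the sign of the pressure on \<open>{0..1}\<close> and beyond 2 excludes any
  other.\<close>

lemma affinity_dimension_LB:
  assumes "1/16 < \<alpha> * \<beta>" "\<alpha> < 1/2"
  shows "1 < affinity_dimension LB" "affinity_dimension LB < 2" "sv_pressure (affinity_dimension LB) LB = 0"
proof -
  have strict: "sv_pressure t LB < sv_pressure s LB" if "1 \<le> s" "s < t" "t \<le> 2" for s t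
  proof -
    have "(t - s) * ln \<alpha> < 0" using that \<alpha>_pos \<alpha>_less by (simp add: mult_pos_neg)
    then show ?thesis using pressure_Lipschitz(1)[of s t] that by simp
  qed
  have lip: "\<bar>sv_pressure t LB - sv_pressure s LB\<bar> \<le> - ln \<beta> * \<bar>t - s\<bar>" if "1 \<le> s" "s \<le> t" "t \<le> 2" for s t
  proof -
    have "(t - s) * ln \<alpha> \<le> 0" using that \<alpha>_pos \<alpha>_less by (intro mult_nonneg_nonpos) auto
    then show ?thesis using pressure_Lipschitz[OF that] that by (simp add: abs_le_iff algebra_simps)
  qed
  have "(- ln \<beta>)-lipschitz_on {1..2} (\<lambda>s. sv_pressure s LB)"
  proof (rule lipschitz_onI)
    fix s t :: real assume "s \<in> {1..2}" "t \<in> {1..2}"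
    then show "dist (sv_pressure s LB) (sv_pressure t LB) \<le> - ln \<beta> * dist s t"
      using lip[of s t] lip[of t s] by (cases "s \<le> t") (auto simp: dist_real_def abs_minus_commute)
  qed (use \<beta>_pos \<beta>_less \<alpha>_less in simp)
  then have "continuous_on {1..2} (\<lambda>s. sv_pressure s LB)" by (rule lipschitz_on_continuous_on)
  then obtain s where s: "1 \<le> s" "s \<le> 2" "sv_pressure s LB = 0"
    using IVT2'[of "\<lambda>s. sv_pressure s LB" 2 0 1] pressure_pos_le_1[of 1] pressure_neg_ge_2[of 2] assms by force
  have "s \<noteq> 1" "s \<noteq> 2" using s pressure_pos_le_1[of 1] pressure_neg_ge_2[of 2] assms by auto
  have "affinity_dimension LB = s"
    unfolding affinity_dimension_def
  proof (rule the_equality)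
    fix t assume t: "0 \<le> t \<and> sv_pressure t LB = 0"
    then have "1 < t" "t < 2" using pressure_pos_le_1[of t] pressure_neg_ge_2[of t] assms by force+
    then show "t = s" using strict[of s t] strict[of t s] s t by (metis less_imp_le linorder_cases less_irrefl)
  qed (use s in simp)
  with s \<open>s \<noteq> 1\<close> \<open>s \<noteq> 2\<close> show "1 < affinity_dimension LB" "affinity_dimension LB < 2" "sv_pressure (affinity_dimension LB) LB = 0"
    by auto
qed

end

text \<open>Through the two-sided Gibbs bounds the quasimultiplicativity of \<open>\<Phi>\<close>
  becomes the mixing bound that \<open>shift_ergodicI\<close> asks for.\<close>

lemma (in word_potential) gibbs_measure:
  obtains \<mu> c' C' where "shift_invariant_prob \<mu>" "shift_ergodic \<mu>" "0 < c'"
    "\<And>w. c' * \<Phi> w \<le> measure \<mu> (cyl w)" "\<And>w. measure \<mu> (cyl w) \<le> C' * \<Phi> w"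
proof -
  obtain m c' C' where m: "0 < c'" "m [] = 1" "\<And>w. c' * \<Phi> w \<le> m w" "\<And>w. m w \<le> C' * \<Phi> w"
    "\<And>w. (\<Sum>i\<in>UNIV. m (w @ [i])) = m w" "\<And>w. (\<Sum>i\<in>UNIV. m (i # w)) = m w"
    by (rule gibbs_weights) (rule that)
  have nn: "0 \<le> m w" for w
    using m(3)[of w] m(1) pos[of w] by (meson less_imp_le mult_pos_pos order_trans)
  obtain \<mu> where \<mu>: "prob_space \<mu>" "sets \<mu> = sets word_borel" "\<And>w. emeasure \<mu> (cyl w) = ennreal (m w)"
    using word_extension[OF m(2) nn m(5)] by blast
  have meas: "measure \<mu> (cyl w) = m w" for w using \<mu>(3)[of w] nn by (simp add: measure_def)
  have inv: "shift_invariant_prob \<mu>"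
    using \<mu> by (intro shift_invariantI) (simp_all add: sum_ennreal nn m(6))
  have "0 < C'" using m(1) m(3)[of "[]"] m(4)[of "[]"] pos[of "[]"]
    by (smt (verit) mult_pos_pos zero_less_mult_pos2)
  \<comment> \<open>\<open>c\<close> comes from quasimultiplicativity, \<open>c'\<close> from the
    lower Gibbs bound on the joined word, and \<open>C' * C'\<close> from the upper bounds on the
    two outer words.\<close>
  define \<delta> where "\<delta> = c' * c / (C' * C')"
  have "shift_ergodic \<mu>"
  proof (rule shift_ergodicI[OF inv, of \<delta> K])
    show "0 < \<delta>" using m c_pos \<open>0 < C'\<close> by (simp add: \<delta>_def)
    fix u v
    have "\<delta> * measure \<mu> (cyl u) * measure \<mu> (cyl v) = \<delta> * (m u * m v)" by (simp add: meas)
    also have "\<dots> \<le> \<delta> * ((C' * \<Phi> u) * (C' * \<Phi> v))"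
      using \<open>0 < \<delta>\<close> \<open>0 < C'\<close> pos[of u] pos[of v] m(4) nn by (intro mult_left_mono mult_mono) auto
    also have "\<dots> = c' * (c * \<Phi> u * \<Phi> v)" using \<open>0 < C'\<close> by (simp add: \<delta>_def field_simps)
    also have "\<dots> \<le> c' * (\<Sum>l\<le>K. \<Sum>k | length k = l. \<Phi> (u @ k @ v))"
      using m(1) quasimult_sum by (intro mult_left_mono) auto
    also have "\<dots> \<le> (\<Sum>l\<le>K. \<Sum>k | length k = l. m (u @ k @ v))"
      unfolding sum_distrib_left by (intro sum_mono m(3))
    finally show "\<delta> * measure \<mu> (cyl u) * measure \<mu> (cyl v) \<le> (\<Sum>l\<le>K. \<Sum>k | length k = l. measure \<mu> (cyl (u @ k @ v)))"
      by (simp add: meas)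
  qed
  with inv m(1,3,4) show ?thesis by (intro that[of \<mu> c' C']) (auto simp: meas)
qed

section \<open>The two Gibbs measures at the affinity dimension\<close>

context two_blocks
begin

definition swap_blocks :: "4 \<Rightarrow> 4" where "swap_blocks i = (if i = 1 then 3 else if i = 2 then 4 else if i = 3 then 1 else 2)"

lemma swap_blocks_swap_blocks [simp]: "swap_blocks (swap_blocks i) = i"
  using exhaust_4[of i] by (auto simp: swap_blocks_def)

lemma LX_swap_blocks: "LX (swap_blocks i) = LY i" "LY (swap_blocks i) = LX i"
  using exhaust_4[of i] by (auto simp: swap_blocks_def LX_def LY_def)

lemma pot_swap_blocks: "pot p q e f (map swap_blocks w) = pot q p f e w"
  by (simp add: pot_def matrix_word_map LX_swap_blocks)

lemma sum_pot_swap_blocks: "(\<Sum>w | length w = n. pot p q e f w) = (\<Sum>w | length w = n. pot q p f e w)"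
  by (rule sum.reindex_bij_witness[of _ "map swap_blocks" "map swap_blocks"]) (auto simp: pot_swap_blocks comp_def)

lemma pot_quasimult_ex:
  assumes "0 \<le> p" "0 \<le> q" "0 \<le> e" "0 \<le> f"
  shows "\<exists>K c. 0 < c \<and> (\<forall>u v. \<exists>k. length k \<le> K \<and> c * pot p q e f u * pot p q e f v \<le> pot p q e f (u @ k @ v))"
  by (rule pot_quasimult[OF assms]) blast

text \<open>Pressure zero says only that the sums are \<open>exp (o n)\<close>. Submultiplicativity
  makes \<open>ln (z n)\<close> subadditive, and quasimultiplicativity makes
  \<open>- ln (y * z n)\<close> subadditive for a constant \<open>y\<close>; both have growth rate
  0, so \<open>subadditive_nonneg\<close> bounds \<open>z n\<close> from below and from
  above.\<close>

lemma critical_sums: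
  assumes s: "1 \<le> s" "s \<le> 2" and zero: "sv_pressure s LB = 0"
  obtains D where "\<And>n. 1 \<le> (\<Sum>w | length w = n. pot s (2 - s) 0 (s - 1) w)"
    "\<And>n. (\<Sum>w | length w = n. pot s (2 - s) 0 (s - 1) w) \<le> D"
proof -
  let ?\<Phi> = "pot s (2 - s) 0 (s - 1)"
  define z where "z n = (\<Sum>w | length w = n. ?\<Phi> w)" for n
  have z_pos: "0 < z n" for n
    unfolding z_def by (intro sum_pos pot_pos words_nonempty finite_words)
  have z_le: "z n \<le> Zs s n" for n
    unfolding z_def Zs_def by (intro sum_mono) (simp add: sv_eq_1_2[OF s])
  \<comment> \<open>The singular value function is at most the sum of the two potentials, and
    exchanging the blocks shows that their sums agree.\<close>
  have z_ge: "Zs s n \<le> 2 * z n" for n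
  proof -
    have "Zs s n \<le> (\<Sum>w | length w = n. ?\<Phi> w + pot (2 - s) s (s - 1) 0 w)"
      unfolding Zs_def using pot_pos by (intro sum_mono) (simp add: sv_eq_1_2[OF s] less_imp_le)
    also have "\<dots> = 2 * z n" by (simp add: sum.distrib z_def sum_pot_swap_blocks[of "2 - s" s])
    finally show ?thesis .
  qed
  have submult: "z (m + n) \<le> z m * z n" for m n
    unfolding z_def using s by (intro sum_submult_le pot_submult) auto
  have lim_ln: "(\<lambda>n. ln (x * z n) / real n) \<longlonglongrightarrow> 0" if x: "0 < x" for x
  proof (rule tendsto_sandwich[of "\<lambda>n. ln (x / 2) * inverse (real n) + ln (Zs s n) / real n" _ _ "\<lambda>n. ln x * inverse (real n) + ln (Zs s n) / real n"])
    have *: "(\<lambda>n. y * inverse (real n) + ln (Zs s n) / real n) \<longlonglongrightarrow> y * 0 + 0" for y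
      using s by (intro tendsto_intros lim_inverse_n) (simp add: pressure_tendsto[of s, unfolded zero])
    show "(\<lambda>n. ln (x / 2) * inverse (real n) + ln (Zs s n) / real n) \<longlonglongrightarrow> 0"
      "(\<lambda>n. ln x * inverse (real n) + ln (Zs s n) / real n) \<longlonglongrightarrow> 0" using *[of "ln (x / 2)"] *[of "ln x"] by simp_all
    have Zp: "0 < Zs s n" for n using s by (intro Zs_pos) simp
    have lo: "ln (x / 2) + ln (Zs s n) \<le> ln (x * z n)" for n
    proof -
      have "ln (x / 2) + ln (Zs s n) = ln (x / 2 * Zs s n)" using x Zp[of n] by (subst ln_mult) auto
      also have "\<dots> \<le> ln (x * z n)" using x z_ge[of n] z_pos[of n] Zp[of n] by (subst ln_le_cancel_iff) auto
      finally show ?thesis .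
    qed
    have hi: "ln (x * z n) \<le> ln x + ln (Zs s n)" for n
    proof -
      have "ln (x * z n) \<le> ln (x * Zs s n)" using x z_le[of n] z_pos[of n] Zp[of n] by (subst ln_le_cancel_iff) auto
      then show ?thesis using x Zp[of n] by (simp add: ln_mult)
    qed
    show "\<forall>\<^sub>F n in sequentially. ln (x / 2) * inverse (real n) + ln (Zs s n) / real n \<le> ln (x * z n) / real n"
    proof (intro always_eventually allI)
      fix n
      have "(ln (x / 2) + ln (Zs s n)) / real n \<le> ln (x * z n) / real n" by (intro divide_right_mono lo) simp
      then show "ln (x / 2) * inverse (real n) + ln (Zs s n) / real n \<le> ln (x * z n) / real n"
        by (simp only: divide_inverse distrib_right)
    qed
    show "\<forall>\<^sub>F n in sequentially. ln (x * z n) / real n \<le> ln x * inverse (real n) + ln (Zs s n) / real n"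
    proof (intro always_eventually allI)
      fix n
      have "ln (x * z n) / real n \<le> (ln x + ln (Zs s n)) / real n" by (intro divide_right_mono hi) simp
      then show "ln (x * z n) / real n \<le> ln x * inverse (real n) + ln (Zs s n) / real n"
        by (simp only: divide_inverse distrib_right)
    qed
  qed
  have ge1: "1 \<le> z n" for n
  proof -
    have "0 \<le> ln (z n)"
    proof (rule subadditive_nonneg)
      show "ln (z (m + n)) \<le> ln (z m) + ln (z n)" for m n
        using submult[of m n] z_pos[of m] z_pos[of n] z_pos[of "m + n"]
        by (subst ln_mult_pos[symmetric]) (auto simp: ln_le_cancel_iff)
      show "(\<lambda>n. ln (z n) / real n) \<longlonglongrightarrow> 0" using lim_ln[of 1] by simp
    qed
    then show ?thesis using z_pos[of n] by (simp add: ln_ge_zero_iff)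
  qed
  have ex: "\<exists>K c. 0 < c \<and> (\<forall>u v. \<exists>k. length k \<le> K \<and> c * ?\<Phi> u * ?\<Phi> v \<le> ?\<Phi> (u @ k @ v))"
    by (rule pot_quasimult_ex) (use s in auto)
  then obtain K c where c: "0 < c" "\<And>u v. \<exists>k. length k \<le> K \<and> c * ?\<Phi> u * ?\<Phi> v \<le> ?\<Phi> (u @ k @ v)"
    using ex by blast
  define D where "D = (\<Sum>l\<le>K. z l)"
  have D_pos: "0 < D" unfolding D_def using z_pos by (intro sum_pos) auto
  \<comment> \<open>Summing over all short connecting words costs at most the factor
    \<open>D\<close>, as \<open>z (n + l + m) \<le> z l * z (n + m)\<close>.\<close>
  have quasi: "c * (z n * z m) \<le> D * z (n + m)" for n m
  proof -
    have "c * ?\<Phi> u * ?\<Phi> v \<le> (\<Sum>l\<le>K. \<Sum>k | length k = l. ?\<Phi> (u @ k @ v))" for u v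
    proof -
      obtain k where k: "length k \<le> K" "c * ?\<Phi> u * ?\<Phi> v \<le> ?\<Phi> (u @ k @ v)" using c by blast
      have "?\<Phi> (u @ k @ v) \<le> (\<Sum>k' | length k' = length k. ?\<Phi> (u @ k' @ v))"
        by (rule member_le_sum) (auto intro: less_imp_le pot_pos)
      also have "\<dots> \<le> (\<Sum>l\<le>K. \<Sum>k | length k = l. ?\<Phi> (u @ k @ v))"
        by (rule member_le_sum[where f = "\<lambda>l. \<Sum>k | length k = l. ?\<Phi> (u @ k @ v)"])
           (use k in \<open>auto intro!: sum_nonneg simp: less_imp_le[OF pot_pos]\<close>)
      finally show ?thesis using k by simp
    qed
    then have "(\<Sum>u | length u = n. \<Sum>v | length v = m. c * ?\<Phi> u * ?\<Phi> v) \<le>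
        (\<Sum>u | length u = n. \<Sum>v | length v = m. \<Sum>l\<le>K. \<Sum>k | length k = l. ?\<Phi> (u @ k @ v))"
      by (intro sum_mono)
    also have "\<dots> = (\<Sum>l\<le>K. \<Sum>u | length u = n. \<Sum>k | length k = l. \<Sum>v | length v = m. ?\<Phi> (u @ k @ v))"
    proof -
      have "(\<Sum>v | length v = m. \<Sum>l\<le>K. \<Sum>k | length k = l. ?\<Phi> (u @ k @ v)) =
          (\<Sum>l\<le>K. \<Sum>k | length k = l. \<Sum>v | length v = m. ?\<Phi> (u @ k @ v))" for u
        by (subst sum.swap) (intro sum.cong refl sum.swap)
      then show ?thesis by (simp only: sum.swap[of _ "{..K}"])
    qed
    also have "\<dots> \<le> (\<Sum>l\<le>K. z l * (z (n + m)))"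
    proof (rule sum_mono)
      fix l
      have "(\<Sum>u | length u = n. \<Sum>k | length k = l. \<Sum>v | length v = m. ?\<Phi> (u @ k @ v)) = z (n + (l + m))"
        unfolding z_def sum_words_append by simp
      also have "\<dots> = z (l + (n + m))" by (simp add: ac_simps)
      also have "\<dots> \<le> z l * z (n + m)" by (rule submult)
      finally show "(\<Sum>u | length u = n. \<Sum>k | length k = l. \<Sum>v | length v = m. ?\<Phi> (u @ k @ v)) \<le> z l * z (n + m)" .
    qed
    also have "\<dots> = D * z (n + m)" by (simp add: D_def sum_distrib_right)
    also have "(\<Sum>u | length u = n. \<Sum>v | length v = m. c * ?\<Phi> u * ?\<Phi> v) = c * (z n * z m)"
      unfolding z_def sum_product by (simp add: sum_distrib_left mult.assoc)
    finally show ?thesis .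
  qed
  have "z n \<le> D / c" for n
  proof -
    define y where "y = c / D"
    have x: "0 < y" using c D_pos by (simp add: y_def)
    have "0 \<le> - ln (y * z n)"
    proof (rule subadditive_nonneg)
      show "- ln (y * z (m + n)) \<le> - ln (y * z m) + - ln (y * z n)" for m n
      proof -
        have "(y * z m) * (y * z n) = y * (c * (z m * z n) / D)" by (simp add: y_def)
        also have "\<dots> \<le> y * z (m + n)"
          using quasi[of m n] D_pos x by (intro mult_left_mono) (auto simp: pos_divide_le_eq mult.commute)
        finally have "ln ((y * z m) * (y * z n)) \<le> ln (y * z (m + n))"
          using x z_pos[of m] z_pos[of n] z_pos[of "m + n"] by (subst ln_le_cancel_iff) auto
        moreover have "ln ((y * z m) * (y * z n)) = ln (y * z m) + ln (y * z n)"
          using x z_pos[of m] z_pos[of n] by (intro ln_mult_pos mult_pos_pos)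
        ultimately show ?thesis by linarith
      qed
      show "(\<lambda>n. - ln (y * z n) / real n) \<longlonglongrightarrow> 0" using tendsto_minus[OF lim_ln[OF x]] by simp
    qed
    then have "y * z n \<le> 1" using mult_pos_pos[OF x z_pos[of n]] by (smt (verit) ln_gt_zero)
    then show ?thesis using c D_pos by (simp add: y_def field_simps)
  qed
  with ge1 show ?thesis unfolding z_def by (rule that)
qed

lemma pots_replicate:
  "pot p q e f (replicate n 1) = (\<alpha> ^ n) powr p * (\<alpha> ^ n * \<beta> ^ n) powr e"
proof -
  have "X (replicate n 1) = diag2 (\<alpha> ^ n) (\<beta> ^ n)" "Y (replicate n 1) = rot2 (real n * \<theta>)"
    by (rule matrix_word_replicate_diag2 matrix_word_replicate_rot2; simp add: LX_def LY_def)+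
  moreover have "opn (diag2 (\<alpha> ^ n) (\<beta> ^ n)) = \<alpha> ^ n"
    using \<beta>_pos \<beta>_less by (intro opn_diag2 power_mono) auto
  ultimately show ?thesis by (simp add: pot_def)
qed

lemma gibbs_measures:
  assumes "1/16 < \<alpha> * \<beta>" "\<alpha> < 1/2"
  defines "s \<equiv> affinity_dimension LB"
  obtains \<mu> \<nu> c C where "shift_invariant_prob \<mu>" "shift_invariant_prob \<nu>" "0 < c"
    "\<And>w. c * pot s (2 - s) 0 (s - 1) w \<le> measure \<mu> (cyl w)" "\<And>w. measure \<mu> (cyl w) \<le> C * pot s (2 - s) 0 (s - 1) w"
    "\<And>w. c * pot (2 - s) s (s - 1) 0 w \<le> measure \<nu> (cyl w)" "\<And>w. measure \<nu> (cyl w) \<le> C * pot (2 - s) s (s - 1) 0 w"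
    "\<exists>A\<in>sets word_borel. emeasure \<mu> A = 0 \<and> emeasure \<nu> (UNIV - A) = 0"
proof -
  have s: "1 < s" "s < 2" "sv_pressure s LB = 0" using affinity_dimension_LB[OF assms(1,2)] by (simp_all add: s_def)
  obtain D where D: "\<And>n. 1 \<le> (\<Sum>w | length w = n. pot s (2 - s) 0 (s - 1) w)"
    "\<And>n. (\<Sum>w | length w = n. pot s (2 - s) 0 (s - 1) w) \<le> D"
    using critical_sums[of s] s by auto
  have ex: "\<exists>K c. 0 < c \<and> (\<forall>u v. \<exists>k. length k \<le> K \<and> c * pot s (2 - s) 0 (s - 1) u * pot s (2 - s) 0 (s - 1) v \<le> pot s (2 - s) 0 (s - 1) (u @ k @ v))"
    by (rule pot_quasimult_ex) (use s in auto)
  have ex': "\<exists>K c. 0 < c \<and> (\<forall>u v. \<exists>k. length k \<le> K \<and> c * pot (2 - s) s (s - 1) 0 u * pot (2 - s) s (s - 1) 0 v \<le> pot (2 - s) s (s - 1) 0 (u @ k @ v))"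
    by (rule pot_quasimult_ex) (use s in auto)
  obtain K c where c: "0 < c" "\<And>u v. \<exists>k. length k \<le> K \<and> c * pot s (2 - s) 0 (s - 1) u * pot s (2 - s) 0 (s - 1) v \<le> pot s (2 - s) 0 (s - 1) (u @ k @ v)"
    using ex by blast
  obtain K' c' where c': "0 < c'" "\<And>u v. \<exists>k. length k \<le> K' \<and> c' * pot (2 - s) s (s - 1) 0 u * pot (2 - s) s (s - 1) 0 v \<le> pot (2 - s) s (s - 1) 0 (u @ k @ v)"
    using ex' by blast
  interpret P: word_potential "pot s (2 - s) 0 (s - 1)" D c K
    by (rule word_potential.intro) (use D c s in \<open>auto simp: pot_pos pot_submult\<close>)
  interpret Q: word_potential "pot (2 - s) s (s - 1) 0" D c' K'
    by (rule word_potential.intro) (use D c' s in \<open>auto simp: pot_pos pot_submult sum_pot_swap_blocks[of "2 - s" s]\<close>)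
  obtain \<mu> d E where \<mu>: "shift_invariant_prob \<mu>" "shift_ergodic \<mu>" "0 < d"
    "\<And>w. d * pot s (2 - s) 0 (s - 1) w \<le> measure \<mu> (cyl w)" "\<And>w. measure \<mu> (cyl w) \<le> E * pot s (2 - s) 0 (s - 1) w"
    by (rule P.gibbs_measure) (rule that)
  obtain \<nu> d' E' where \<nu>: "shift_invariant_prob \<nu>" "shift_ergodic \<nu>" "0 < d'"
    "\<And>w. d' * pot (2 - s) s (s - 1) 0 w \<le> measure \<nu> (cyl w)" "\<And>w. measure \<nu> (cyl w) \<le> E' * pot (2 - s) s (s - 1) 0 w"
    by (rule Q.gibbs_measure) (rule that)
  have "\<mu> \<noteq> \<nu>"
  proof
    assume eq: "\<mu> = \<nu>"
    \<comment> \<open>\<open>?r ^ n\<close> is the ratio of the two potentials on the word of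
      \<open>n\<close> letters 1. It tends to 0 because \<open>s > 1\<close> and
      \<open>\<beta> < \<alpha>\<close>, whereas equal measures would keep it above a positive
      constant.\<close>
    let ?r = "(\<beta> / \<alpha>) powr (s - 1)"
    have r: "0 < ?r" "?r < 1"
      using \<beta>_pos \<beta>_less s powr_less_mono2[of "s - 1" "\<beta> / \<alpha>" 1] by auto
    have "d \<le> E' * ?r ^ n" for n
    proof -
      let ?w = "replicate n (1::4)"
      have "pot (2 - s) s (s - 1) 0 ?w = ?r ^ n * pot s (2 - s) 0 (s - 1) ?w"
      proof -
        have "?r ^ n = ((\<beta> / \<alpha>) ^ n) powr (s - 1)" using \<beta>_pos \<beta>_less by (intro powr_power_commute) simp
        also have "\<dots> = (\<beta> ^ n) powr (s - 1) / (\<alpha> ^ n) powr (s - 1)"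
          using \<alpha>_pos \<beta>_pos by (simp add: power_divide powr_divide)
        finally show ?thesis
          unfolding pots_replicate using \<alpha>_pos \<beta>_pos
          by (simp add: powr_mult powr_diff powr_one powr_add[symmetric] field_simps power2_eq_square)
      qed
      then have "d * pot s (2 - s) 0 (s - 1) ?w \<le> (E' * ?r ^ n) * pot s (2 - s) 0 (s - 1) ?w"
        using order_trans[OF \<mu>(4)[of ?w, unfolded eq] \<nu>(5)[of ?w]] by (simp add: mult.assoc)
      then show ?thesis using pot_pos by (simp only: mult_le_cancel_right_pos)
    qed
    moreover have "(\<lambda>n. E' * ?r ^ n) \<longlonglongrightarrow> E' * 0" using r by (intro tendsto_intros LIMSEQ_realpow_zero) auto
    ultimately have "d \<le> E' * 0" by (intro LIMSEQ_le_const) auto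
    with \<mu>(3) show False by simp
  qed
  then obtain A where "A \<in> sets word_borel" "emeasure \<mu> A = 0" "emeasure \<nu> (UNIV - A) = 0"
    using shift_ergodic_mutually_singular[OF \<mu>(1) \<nu>(1) \<mu>(2) \<nu>(2)] by blast
  then have sing: "\<exists>A\<in>sets word_borel. emeasure \<mu> A = 0 \<and> emeasure \<nu> (UNIV - A) = 0" by blast
  have mm: "min d d' * pot p q e f w \<le> d * pot p q e f w" "min d d' * pot p q e f w \<le> d' * pot p q e f w"
    "E * pot p q e f w \<le> max E E' * pot p q e f w" "E' * pot p q e f w \<le> max E E' * pot p q e f w" for p q e f w
    using pot_pos[of p q e f w] by (auto intro!: mult_right_mono)
  show ?thesis
  proof (rule that[of \<mu> \<nu> "min d d'" "max E E'"])
    show "min d d' * pot s (2 - s) 0 (s - 1) w \<le> measure \<mu> (cyl w)" for w by (rule order_trans[OF mm(1) \<mu>(4)])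
    show "measure \<mu> (cyl w) \<le> max E E' * pot s (2 - s) 0 (s - 1) w" for w by (rule order_trans[OF \<mu>(5) mm(3)])
    show "min d d' * pot (2 - s) s (s - 1) 0 w \<le> measure \<nu> (cyl w)" for w by (rule order_trans[OF mm(2) \<nu>(4)])
    show "measure \<nu> (cyl w) \<le> max E E' * pot (2 - s) s (s - 1) 0 w" for w by (rule order_trans[OF \<nu>(5) mm(4)])
  qed (use \<mu> \<nu> sing in auto)
qed

end

section \<open>Coding maps of affine systems\<close>

locale contracting =
  fixes B :: "'i::finite \<Rightarrow> real^'n^'n" and lam :: real
  assumes lam: "0 < lam" "lam < 1" and contr: "norm (B i *v z) \<le> lam * norm z"
begin

lemma norm_matrix_word: "norm (matrix_word B w *v z) \<le> lam ^ length w * norm z"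
proof (induction w)
  case (Cons i w)
  have "norm (B i *v (matrix_word B w *v z)) \<le> lam * norm (matrix_word B w *v z)" by (rule contr)
  also have "\<dots> \<le> lam * (lam ^ length w * norm z)" using lam Cons by (intro mult_left_mono) auto
  finally show ?case by (simp add: matrix_vector_mul_assoc)
qed simp

definition term_of :: "('i \<Rightarrow> real^'n) \<Rightarrow> (nat \<Rightarrow> 'i) \<Rightarrow> nat \<Rightarrow> real^'n" where
  "term_of v x k = matrix_word B (map x [0..<k]) *v v (x k)"

text \<open>The coding map as a series. In this form the coded point is visibly linear in the
  translations, on which the transversality argument rests.\<close>

definition code :: "('i \<Rightarrow> real^'n) \<Rightarrow> (nat \<Rightarrow> 'i) \<Rightarrow> real^'n" where
  "code v x = (\<Sum>k. term_of v x k)"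

definition translation_bound :: "('i \<Rightarrow> real^'n) \<Rightarrow> real" where "translation_bound v = (\<Sum>i\<in>UNIV. norm (v i))"

lemma translation_bound: "norm (v i) \<le> translation_bound v"
  unfolding translation_bound_def by (rule member_le_sum) auto

lemma translation_bound_nonneg: "0 \<le> translation_bound v"
  by (simp add: translation_bound_def sum_nonneg)

lemma norm_term_of: "norm (v (x k)) \<le> b \<Longrightarrow> norm (term_of v x k) \<le> lam ^ k * b"
  unfolding term_of_def using norm_matrix_word[of "map x [0..<k]" "v (x k)"] lam
  by (smt (verit) length_map length_upt diff_zero mult_left_mono zero_le_power)

lemma summable_geometric_lam: "summable (\<lambda>k. lam ^ k * b)"
  using lam by (intro summable_mult2 summable_geometric) auto

lemma summable_norm_term_of: "summable (\<lambda>k. norm (term_of v x k))"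
proof (rule summable_comparison_test'[OF summable_geometric_lam[of "translation_bound v"]])
  fix n show "norm (norm (term_of v x n)) \<le> lam ^ n * translation_bound v"
    using norm_term_of[of v x n "translation_bound v", OF translation_bound] by simp
qed

lemma summable_term_of: "summable (term_of v x)"
  by (rule summable_norm_cancel) (rule summable_norm_term_of)

lemma norm_code_le:
  assumes "\<And>i. norm (v i) \<le> b"
  shows "norm (code v x) \<le> b / (1 - lam)"
proof -
  have "norm (code v x) \<le> (\<Sum>k. norm (term_of v x k))"
    unfolding code_def by (rule summable_norm[OF summable_norm_term_of])
  also have "\<dots> \<le> (\<Sum>k. lam ^ k * b)"
    by (intro suminf_le norm_term_of summable_norm_term_of summable_geometric_lam assms)
  also have "\<dots> = b / (1 - lam)"
    using lam suminf_mult2[of "\<lambda>k. lam ^ k" b] by (simp add: suminf_geometric summable_geometric)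
  finally show ?thesis .
qed

lemma code_split:
  "code v x = (\<Sum>k<n. term_of v x k) + matrix_word B (map x [0..<n]) *v code v (\<lambda>k. x (n + k))"
proof -
  have "term_of v x (k + n) = matrix_word B (map x [0..<n]) *v term_of v (\<lambda>k. x (n + k)) k" for k
  proof -
    have "map x [0..<n + k] = map x [0..<n] @ map (\<lambda>j. x (n + j)) [0..<k]"
      by (rule nth_equalityI) (auto simp: nth_append)
    then show ?thesis
      by (simp add: term_of_def add.commute[of k n] matrix_word_append matrix_vector_mul_assoc)
  qed
  moreover have "(\<Sum>k. matrix_word B (map x [0..<n]) *v term_of v (\<lambda>k. x (n + k)) k) = matrix_word B (map x [0..<n]) *v code v (\<lambda>k. x (n + k))"
    unfolding code_def
    by (rule bounded_linear.suminf[symmetric]) (rule matrix_vector_mul_bounded_linear summable_term_of)+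
  ultimately show ?thesis
    unfolding code_def using suminf_split_initial_segment[OF summable_term_of, of v x n] by simp
qed

text \<open>The terms of the common prefix cancel, so closeness of two coded points is a question
  about one matrix product applied to the difference of the tails.\<close>

lemma code_diff:
  assumes "\<And>k. k < n \<Longrightarrow> x k = y k"
  shows "code v x - code v y = matrix_word B (map x [0..<n]) *v (code v (\<lambda>k. x (n + k)) - code v (\<lambda>k. y (n + k)))"
proof -
  have e: "map y [0..<k] = map x [0..<k]" if "k \<le> n" for k using assms that by simp
  have "(\<Sum>k<n. term_of v y k) = (\<Sum>k<n. term_of v x k)"
    using assms by (intro sum.cong refl) (simp add: term_of_def e less_imp_le del: map_eq_conv)
  then show ?thesis
    unfolding code_split[of v x n] code_split[of v y n] e[OF order.refl]
    by (simp add: matrix_vector_mult_diff_distrib)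
qed

abbreviation "T v \<equiv> (\<lambda>i x. B i *v x + v i)"

lemma foldr_eq_sum:
  "foldr (\<lambda>k. T v (x k)) [0..<n] z = (\<Sum>k<n. term_of v x k) + matrix_word B (map x [0..<n]) *v z"
  by (induction n arbitrary: z)
     (simp_all add: matrix_word_append matrix_vector_right_distrib term_of_def matrix_vector_mul_assoc algebra_simps)

lemma code_foldr: "code v x = foldr (\<lambda>k. T v (x k)) [0..<n] (code v (\<lambda>k. x (n + k)))"
  unfolding foldr_eq_sum by (rule code_split)

text \<open>The starting point may vary with \<open>n\<close> as long as it stays bounded;
  \<open>attractor_eq\<close> needs this for the successive preimages of a point.\<close>

lemma foldr_tendsto:
  assumes "\<And>n. norm (z n) \<le> b"
  shows "(\<lambda>n. foldr (\<lambda>k. T v (x k)) [0..<n] (z n)) \<longlonglongrightarrow> code v x"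
proof -
  have "(\<lambda>n. matrix_word B (map x [0..<n]) *v z n) \<longlonglongrightarrow> 0"
  proof (rule Lim_null_comparison)
    show "\<forall>\<^sub>F n in sequentially. norm (matrix_word B (map x [0..<n]) *v z n) \<le> lam ^ n * b"
    proof (intro always_eventually allI)
      fix n
      have "norm (matrix_word B (map x [0..<n]) *v z n) \<le> lam ^ n * norm (z n)"
        using norm_matrix_word[of "map x [0..<n]" "z n"] by simp
      also have "\<dots> \<le> lam ^ n * b" using assms lam by (intro mult_left_mono) auto
      finally show "norm (matrix_word B (map x [0..<n]) *v z n) \<le> lam ^ n * b" .
    qed
    show "(\<lambda>n. lam ^ n * b) \<longlonglongrightarrow> 0"
      using tendsto_mult_right[OF LIMSEQ_realpow_zero[of lam], of b] lam by simp
  qed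
  then have "(\<lambda>n. (\<Sum>k<n. term_of v x k) + matrix_word B (map x [0..<n]) *v z n) \<longlonglongrightarrow> code v x + 0"
    unfolding code_def by (intro tendsto_add summable_LIMSEQ[OF summable_term_of])
  then show ?thesis by (simp add: foldr_eq_sum)
qed

lemma coding_map_eq: "coding_map (T v) x = code v x"
  unfolding coding_map_def by (rule limI) (rule foldr_tendsto[of "\<lambda>_. 0" 0], simp)

lemma code_Cons: "code v (case_nat i x) = B i *v code v x + v i"
  using code_foldr[of v "case_nat i x" 1] by simp

lemma code_measurable [measurable]: "code v \<in> borel_measurable word_borel"
proof -
  have "term_of v x k = (\<lambda>w. matrix_word B (butlast w) *v v (last w)) (map x [0..<Suc k])" for x k
    by (simp add: term_of_def butlast_append)
  then have "(\<lambda>x. term_of v x k) \<in> borel_measurable word_borel" for k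
    by (simp only:) (rule measurable_compose[OF measurable_prefix], simp)
  then show ?thesis unfolding code_def[abs_def] by measurable
qed

lemma code_dist_cyl:
  assumes "x \<in> cyl w" "y \<in> cyl w"
  shows "norm (code v x - code v y) \<le> lam ^ length w * (2 * translation_bound v / (1 - lam))"
proof -
  have xy: "map x [0..<length w] = w" "map y [0..<length w] = w" using assms by (simp_all add: cyl_iff)
  have "x k = y k" if "k < length w" for k using assms that by (simp add: cyl_iff_nth)
  from code_diff[of "length w" x y v, OF this]
  have "norm (code v x - code v y) \<le> lam ^ length w * norm (code v (\<lambda>k. x (length w + k)) - code v (\<lambda>k. y (length w + k)))"
    using norm_matrix_word[of w] by (simp add: xy)
  also have "norm (code v (\<lambda>k. x (length w + k)) - code v (\<lambda>k. y (length w + k))) \<le> translation_bound v / (1 - lam) + translation_bound v / (1 - lam)"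
    using norm_triangle_ineq4[of "code v (\<lambda>k. x (length w + k))" "code v (\<lambda>k. y (length w + k))"]
      norm_code_le[of v, OF translation_bound, of "\<lambda>k. x (length w + k)"] norm_code_le[of v, OF translation_bound, of "\<lambda>k. y (length w + k)"]
    by linarith
  finally show ?thesis using lam by simp
qed

lemma small_cyl:
  assumes "0 < e"
  obtains n where "\<And>x y. y \<in> cyl (map x [0..<n]) \<Longrightarrow> norm (code v x - code v y) < e"
proof -
  let ?b = "2 * translation_bound v / (1 - lam)"
  have "(\<lambda>n. lam ^ n * ?b) \<longlonglongrightarrow> 0"
    using tendsto_mult_right[OF LIMSEQ_realpow_zero[of lam], of ?b] lam by simp
  from order_tendstoD(2)[OF this assms] obtain n where n: "lam ^ n * ?b < e"
    by (auto simp: eventually_sequentially)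
  have "norm (code v x - code v y) < e" if "y \<in> cyl (map x [0..<n])" for x y
    using code_dist_cyl[of x "map x [0..<n]" y v] that n by simp
  then show ?thesis by (rule that)
qed

lemma compact_range_code: "compact (range (code v))"
proof -
  have cont: "continuous_map word_topology euclidean (code v)"
    unfolding continuous_map_def
  proof (intro conjI allI impI)
    fix U :: "(real^'n) set" assume "openin euclidean U"
    then have "open U" by simp
    have "\<exists>S. openin word_topology S \<and> x \<in> S \<and> S \<subseteq> code v -` U" if x: "code v x \<in> U" for x
    proof -
      obtain e where e: "0 < e" "ball (code v x) e \<subseteq> U" using \<open>open U\<close> x by (meson open_contains_ball)
      obtain n where n: "\<And>x y. y \<in> cyl (map x [0..<n]) \<Longrightarrow> norm (code v x - code v y) < e"
        using small_cyl[OF e(1)] by blast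
      have "cyl (map x [0..<n]) \<subseteq> code v -` U"
      proof
        fix y assume "y \<in> cyl (map x [0..<n])"
        from n[OF this] have "code v y \<in> ball (code v x) e" by (simp add: dist_norm)
        then show "y \<in> code v -` U" using e(2) by blast
      qed
      then show ?thesis
        by (intro exI[of _ "cyl (map x [0..<n])"]) (simp add: openin_word_cyl)
    qed
    then have "openin word_topology (code v -` U)"
      by (subst openin_subopen) blast
    moreover have "topspace word_topology = (UNIV :: (nat \<Rightarrow> 'i) set)" by (simp add: word_topology_def)
    ultimately show "openin word_topology {x \<in> topspace word_topology. code v x \<in> U}" by (simp add: vimage_def)
  qed simp
  have "compactin word_topology (UNIV :: (nat \<Rightarrow> 'i) set)"
  proof -
    have "compactin word_topology (Pi\<^sub>E UNIV (\<lambda>_::nat. UNIV :: 'i set))"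
      unfolding word_topology_def compactin_PiE by (simp add: compactin_discrete_topology)
    then show ?thesis by simp
  qed
  from image_compactin[OF this cont] show ?thesis by simp
qed

lemma range_code_invariant: "range (code v) = (\<Union>i. T v i ` range (code v))"
proof (intro set_eqI iffI)
  fix z assume "z \<in> range (code v)"
  then obtain x where "z = code v x" by auto
  then have "z = T v (x 0) (code v (\<lambda>k. x (Suc k)))" using code_foldr[of v x 1] by simp
  then show "z \<in> (\<Union>i. T v i ` range (code v))" by blast
next
  fix z assume "z \<in> (\<Union>i. T v i ` range (code v))"
  then obtain i x where "z = B i *v code v x + v i" by auto
  then show "z \<in> range (code v)" using code_Cons[of v i x] by (metis rangeI)
qed

text \<open>For uniqueness: compositions started in \<open>Z\<close> stay in \<open>Z\<close> and
  converge to any given coded point. Conversely a point of \<open>Z\<close> is traced back through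
  preimages in \<open>Z\<close>, whose letters form an address of it.\<close>

lemma attractor_eq: "attractor (T v) = range (code v)"
  unfolding attractor_def
proof (rule the_equality)
  show "range (code v) \<noteq> {} \<and> compact (range (code v)) \<and> range (code v) = (\<Union>i. T v i ` range (code v))"
    using compact_range_code range_code_invariant by blast
  fix Z assume Z: "Z \<noteq> {} \<and> compact Z \<and> Z = (\<Union>i. T v i ` Z)"
  obtain b where b: "\<And>z. z \<in> Z \<Longrightarrow> norm z \<le> b"
    using compact_imp_bounded[of Z] Z by (auto simp: bounded_iff)
  show "Z = range (code v)"
  proof (intro set_eqI iffI)
    fix z assume "z \<in> range (code v)"
    then obtain x where z: "z = code v x" by auto
    obtain z0 where z0: "z0 \<in> Z" using Z by auto
    have T_Z: "T v i y \<in> Z" if "y \<in> Z" for i y using Z that by blast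
    have "foldr (\<lambda>k. T v (x k)) ks z0 \<in> Z" for ks
      by (induction ks) (use z0 T_Z in auto)
    moreover have "(\<lambda>n. foldr (\<lambda>k. T v (x k)) [0..<n] z0) \<longlonglongrightarrow> code v x"
      using b[OF z0] by (rule foldr_tendsto)
    moreover have "closed Z" using Z compact_imp_closed by blast
    ultimately show "z \<in> Z" unfolding z by (rule_tac closed_sequentially) auto
  next
    fix z assume z: "z \<in> Z"
    have "\<forall>y\<in>Z. \<exists>i. \<exists>y'\<in>Z. y = T v i y'" using Z by blast
    then obtain ii yy where iy: "\<And>y. y \<in> Z \<Longrightarrow> yy y \<in> Z \<and> y = T v (ii y) (yy y)" by metis
    define zs where "zs n = (yy ^^ n) z" for n
    have zs: "zs n \<in> Z" for n by (induction n) (use z iy in \<open>auto simp: zs_def\<close>)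
    define x where "x n = ii (zs n)" for n
    have "zs n = T v (x n) (zs (Suc n))" for n using iy[OF zs[of n]] by (simp add: x_def zs_def)
    then have zf: "z = foldr (\<lambda>k. T v (x k)) [0..<n] (zs n)" for n
      by (induction n) (auto simp: zs_def)
    have "(\<lambda>n. foldr (\<lambda>k. T v (x k)) [0..<n] (zs n)) \<longlonglongrightarrow> code v x"
      using b zs by (intro foldr_tendsto) blast
    then have "z = code v x" unfolding zf[symmetric] by (simp add: LIMSEQ_const_iff)
    then show "z \<in> range (code v)" by blast
  qed
qed

lemma iterated_function_system_T: "iterated_function_system (T v)"
  unfolding iterated_function_system_def
proof
  fix i
  have "lam-lipschitz_on UNIV (T v i)"
  proof (rule lipschitz_onI)
    fix x y show "dist (T v i x) (T v i y) \<le> lam * dist x y"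
      using contr[of i "x - y"] by (simp add: dist_norm matrix_vector_mult_diff_distrib)
  qed (use lam in simp)
  then show "\<exists>c<1. c-lipschitz_on UNIV (T v i)" using lam by blast
qed

lemma measure_support_code:
  assumes "prob_space \<mu>" and s: "sets \<mu> = sets word_borel" and pos: "\<And>w. 0 < measure \<mu> (cyl w)"
  shows "measure_support (distr \<mu> borel (code v)) = range (code v)"
proof -
  interpret prob_space \<mu> by fact
  have sp: "space \<mu> = UNIV" using sets_eq_imp_space_eq[OF s] by simp
  have [measurable]: "code v \<in> borel_measurable \<mu>" using code_measurable by (simp add: measurable_cong_sets[OF s refl])
  have em: "emeasure (distr \<mu> borel (code v)) U = emeasure \<mu> (code v -` U)" if "U \<in> sets borel" for U
    using that by (simp add: emeasure_distr sp)
  show ?thesis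
  proof (intro set_eqI iffI)
    fix z assume z: "z \<in> measure_support (distr \<mu> borel (code v))"
    show "z \<in> range (code v)"
    proof (rule ccontr)
      assume "z \<notin> range (code v)"
      moreover have "open (- range (code v))" using compact_imp_closed[OF compact_range_code] by (simp add: open_Compl)
      ultimately have "0 < emeasure (distr \<mu> borel (code v)) (- range (code v))" using z by (auto simp: measure_support_def)
      also have "\<dots> = 0" using \<open>open (- range (code v))\<close> by (subst em) (auto simp: vimage_def)
      finally show False by simp
    qed
  next
    fix z assume "z \<in> range (code v)"
    then obtain x where x: "z = code v x" by auto
    show "z \<in> measure_support (distr \<mu> borel (code v))"
      unfolding measure_support_def
    proof (intro CollectI allI impI)
      fix U assume "open U" "z \<in> U"
      then obtain e where e: "0 < e" "ball (code v x) e \<subseteq> U" unfolding x by (meson open_contains_ball)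
      obtain n where n: "\<And>x y. y \<in> cyl (map x [0..<n]) \<Longrightarrow> norm (code v x - code v y) < e"
        using small_cyl[OF e(1)] by blast
      have "cyl (map x [0..<n]) \<subseteq> code v -` U"
      proof
        fix y assume "y \<in> cyl (map x [0..<n])"
        from n[OF this] have "code v y \<in> ball (code v x) e" by (simp add: dist_norm)
        then show "y \<in> code v -` U" using e(2) by blast
      qed
      then have "emeasure \<mu> (cyl (map x [0..<n])) \<le> emeasure \<mu> (code v -` U)"
        using measurable_sets[of "code v" \<mu> borel U] \<open>open U\<close> sp by (intro emeasure_mono) auto
      moreover have "0 < emeasure \<mu> (cyl (map x [0..<n]))" using pos by (simp add: emeasure_eq_measure)
      ultimately show "0 < emeasure (distr \<mu> borel (code v)) U" using \<open>open U\<close> by (simp add: em)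
    qed
  qed
qed

end

section \<open>Systems with strong separation\<close>

locale separated = contracting B lam for B :: "'i::finite \<Rightarrow> real^'n^'n" and lam +
  fixes v :: "'i \<Rightarrow> real^'n" and R :: real
  assumes R: "0 < R" and inside: "norm (v i) + lam * R \<le> R" and apart: "i \<noteq> j \<Longrightarrow> 2 * lam * R < norm (v i - v j)"
    and inj_B: "inj ((*v) (B i))"
begin

lemma T_cball: "z \<in> cball 0 R \<Longrightarrow> T v i z \<in> cball 0 R"
proof -
  assume "z \<in> cball 0 R"
  then have "norm (B i *v z) \<le> lam * R"
    using lam by (intro order_trans[OF contr[of i z]] mult_left_mono) auto
  then show "T v i z \<in> cball 0 R"
    using norm_triangle_ineq[of "B i *v z" "v i"] inside[of i] by simp
qed

lemma T_disjoint: "i \<noteq> j \<Longrightarrow> T v i ` cball 0 R \<inter> T v j ` cball 0 R = {}"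
proof (rule ccontr)
  assume "i \<noteq> j" "T v i ` cball 0 R \<inter> T v j ` cball 0 R \<noteq> {}"
  then obtain y z where yz: "norm y \<le> R" "norm z \<le> R" "B i *v y + v i = B j *v z + v j" by auto
  have "v i - v j = B j *v z - B i *v y" using yz(3) by (simp add: algebra_simps)
  then have "norm (v i - v j) \<le> norm (B j *v z) + norm (B i *v y)" by (metis norm_triangle_ineq4)
  also have "\<dots> \<le> lam * R + lam * R"
    using contr[of j z] contr[of i y] lam yz mult_left_mono[of "norm z" R lam] mult_left_mono[of "norm y" R lam] by linarith
  finally show False using apart[OF \<open>i \<noteq> j\<close>] by (simp add: algebra_simps)
qed

text \<open>The ball of radius \<open>R\<close> serves as the separating set: its image under
  \<open>T v i\<close> lies in the ball of radius \<open>lam * R\<close> about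
  \<open>v i\<close>.\<close>

lemma strong_separation_T: "strong_separation (T v)"
  unfolding strong_separation_def
proof (intro exI[of _ "cball 0 R"] conjI allI)
  show "disjoint_family (\<lambda>i. T v i ` cball 0 R)"
    using T_disjoint by (simp add: disjoint_family_on_def)
  show "T v i ` cball 0 R \<subseteq> cball 0 R" for i using T_cball by blast
qed (use R in auto)

lemma code_in_cball: "code v x \<in> cball 0 R"
proof -
  have "norm (v i) \<le> (1 - lam) * R" for i using inside[of i] by (simp add: algebra_simps)
  from norm_code_le[of v, OF this] show ?thesis using lam by simp
qed

text \<open>Under separation an address can be read off its point: disjointness of the images
  determines the first letter, and injectivity of \<open>B i\<close> passes on to the tail. The
  induction keeps the sets compact and inside \<open>cball 0 R\<close>, which makes them Borel and
  lets disjointness apply.\<close>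

lemma vimage_code_cyl: "\<exists>E\<in>sets borel. code v -` E = cyl w"
proof -
  have "\<exists>E. compact E \<and> E \<subseteq> cball 0 R \<and> code v -` E = cyl w"
  proof (induction w)
    case Nil
    show ?case using code_in_cball by (intro exI[of _ "cball 0 R"]) auto
  next
    case (Cons i w)
    then obtain E where E: "compact E" "E \<subseteq> cball 0 R" "code v -` E = cyl w" by blast
    have "compact (T v i ` E)"
      using E(1) by (intro compact_continuous_image continuous_intros matrix_vector_mult_linear_continuous_on)
    moreover have "T v i ` E \<subseteq> cball 0 R" using E(2) T_cball by blast
    moreover have "code v x \<in> T v i ` E \<longleftrightarrow> x \<in> cyl (i # w)" for x
    proof -
      let ?y = "\<lambda>k. x (Suc k)"
      have x: "code v x = T v (x 0) (code v ?y)" using code_foldr[of v x 1] by simp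
      have y: "?y \<in> cyl w \<longleftrightarrow> code v ?y \<in> E" using E(3) by blast
      have "x \<in> cyl (i # w) \<longleftrightarrow> x 0 = i \<and> ?y \<in> cyl w"
        using cyl_append[of x "[i]" w] by (simp add: cyl_iff_nth[of x "[i]"])
      also have "\<dots> \<longleftrightarrow> code v x \<in> T v i ` E"
      proof
        assume "x 0 = i \<and> ?y \<in> cyl w" then show "code v x \<in> T v i ` E" using x y by blast
      next
        assume a: "code v x \<in> T v i ` E"
        then have "code v x \<in> T v i ` cball 0 R" using E(2) by blast
        moreover have "code v x \<in> T v (x 0) ` cball 0 R" using x code_in_cball by blast
        ultimately have xi: "x 0 = i" using T_disjoint by blast
        from a obtain z where z: "z \<in> E" "code v x = T v i z" by auto
        then have "B i *v z = B i *v code v ?y" using x xi by simp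
        then have "z = code v ?y" using inj_B by (metis injD)
        then show "x 0 = i \<and> ?y \<in> cyl w" using z xi y by simp
      qed
      finally show ?thesis by blast
    qed
    then have "code v -` (T v i ` E) = cyl (i # w)" by (simp only: set_eq_iff vimage_eq simp_thms)
    ultimately show ?case by (intro exI[of _ "T v i ` E"] conjI)
  qed
  then show ?thesis by (metis borel_compact)
qed

text \<open>Pushing a measure forward by the coding map therefore loses no measurable sets, so
  singularity and almost sure statements pass from words to points.\<close>

lemma vimage_code_word_borel:
  assumes "A \<in> sets word_borel" shows "\<exists>E\<in>sets borel. code v -` E = A"
  using assms unfolding sets_word_borel
proof (induction rule: sigma_sets.induct)
  case (Basic a)
  then show ?case using vimage_code_cyl by auto
next
  case Empty
  then show ?case by (intro bexI[of _ "{}"]) auto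
next
  case (Compl a)
  then obtain E where "E \<in> sets borel" "code v -` E = a" by auto
  then show ?case by (intro bexI[of _ "- E"]) auto
next
  case (Union a)
  then obtain E where "\<And>i. E i \<in> sets borel \<and> code v -` E i = a i" by metis
  then show ?case by (intro bexI[of _ "\<Union>i. E i"]) auto
qed

lemma mutually_singular_code:
  assumes s: "sets \<mu> = sets word_borel" "sets \<nu> = sets word_borel"
    and A: "A \<in> sets word_borel" "emeasure \<mu> A = 0" "emeasure \<nu> (UNIV - A) = 0"
  shows "mutually_singular (distr \<mu> borel (code v)) (distr \<nu> borel (code v))"
proof -
  have sp: "space \<mu> = UNIV" "space \<nu> = UNIV"
    using sets_eq_imp_space_eq[OF s(1)] sets_eq_imp_space_eq[OF s(2)] by simp_all
  have m: "code v \<in> borel_measurable \<mu>" "code v \<in> borel_measurable \<nu>"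
    by (subst measurable_cong_sets[OF s(1) refl] measurable_cong_sets[OF s(2) refl], rule code_measurable)+
  obtain E where E: "E \<in> sets borel" "code v -` E = A" using vimage_code_word_borel[OF A(1)] by blast
  have "emeasure (distr \<mu> borel (code v)) E = 0" using E A m by (simp add: emeasure_distr sp)
  moreover have "emeasure (distr \<nu> borel (code v)) (UNIV - E) = 0"
  proof -
    have "code v -` (UNIV - E) = UNIV - A" using E by auto
    then show ?thesis using E A m by (simp add: emeasure_distr sp)
  qed
  ultimately show ?thesis using E by (auto simp: mutually_singular_def)
qed

end

section \<open>Upper bound on the local dimension\<close>

text \<open>The middle entries \<open>p\<close> and \<open>q\<close> stay unordered: of the two only
  the maximum, the second singular value, matters later.\<close>

lemma kronecker4_frame:
  fixes X Y :: "real^2^2"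
  assumes "det X > 0" "det Y > 0"
  obtains U V p q r where "orthogonal_matrix U" "orthogonal_matrix V"
    "kronecker4 X Y = U ** diag4 (opn X * opn Y) p q r ** V" "0 < r" "r \<le> p" "r \<le> q"
    "max p q = max (opn X * det Y / opn Y) (opn Y * det X / opn X)" "max p q \<le> opn X * opn Y"
proof -
  obtain \<phi> \<psi> a b where X: "X = rot2 \<phi> ** diag2 a b ** rot2 \<psi>" "0 < b" "b \<le> a" using svd2[OF assms(1)] .
  obtain \<phi>' \<psi>' a' b' where Y: "Y = rot2 \<phi>' ** diag2 a' b' ** rot2 \<psi>'" "0 < b'" "b' \<le> a'" using svd2[OF assms(2)] .
  have o: "opn X = a" "opn Y = a'" "det X = a * b" "det Y = a' * b'" using X Y by (simp_all add: opn_svd2 det_mul)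
  show ?thesis
  proof (rule that[OF orthogonal_kronecker4_rot2 orthogonal_kronecker4_rot2])
    show "kronecker4 X Y = kronecker4 (rot2 \<phi>) (rot2 \<phi>') ** diag4 (opn X * opn Y) (a * b') (b * a') (b * b') ** kronecker4 (rot2 \<psi>) (rot2 \<psi>')"
      unfolding o by (rule kronecker4_svd[OF X(1) Y(1)])
    show "max (a * b') (b * a') = max (opn X * det Y / opn Y) (opn Y * det X / opn X)"
      using X(2,3) Y(2,3) by (simp add: o mult.commute)
    show "max (a * b') (b * a') \<le> opn X * opn Y" using X(2,3) Y(2,3) by (simp add: o mult_left_mono mult_right_mono)
  qed (use X Y in \<open>auto simp: mult_right_mono mult_left_mono\<close>)
qed

lemma norm_diag4_le:
  assumes "\<bar>a\<bar> \<le> c" "\<bar>b\<bar> \<le> c" "\<bar>d\<bar> \<le> c" "\<bar>e\<bar> \<le> c"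
  shows "norm (diag4 a b d e *v z) \<le> c * norm z"
proof -
  have c: "0 \<le> c" using assms by linarith
  have "(x * y)\<^sup>2 \<le> (c * y)\<^sup>2" if "\<bar>x\<bar> \<le> c" for x y :: real
    using that c by (simp add: power_mult_distrib mult_right_mono abs_le_square_iff[symmetric])
  then have "norm (diag4 a b d e *v z) \<le> sqrt ((c * z$1)\<^sup>2 + (c * z$2)\<^sup>2 + (c * z$3)\<^sup>2 + (c * z$4)\<^sup>2)"
    unfolding norm_real4 diag4_mult_vec using assms by (intro real_sqrt_le_mono add_mono)
  also have "\<dots> = sqrt (c\<^sup>2 * ((z$1)\<^sup>2 + (z$2)\<^sup>2 + (z$3)\<^sup>2 + (z$4)\<^sup>2))" by (simp add: power_mult_distrib distrib_left)
  also have "\<dots> = c * norm z" using c by (simp add: norm_real4 real_sqrt_mult)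
  finally show ?thesis .
qed

lemma inner_orthogonal_matrix: "orthogonal_matrix (Q :: real^'n^'n) \<Longrightarrow> (Q *v x) \<bullet> (Q *v y) = x \<bullet> y"
  by (metis matrix_of_matrix_vector_mul matrix_vector_mul_linear orthogonal_transformation_def orthogonal_transformation_matrix)

context two_blocks
begin

lemma opn_prod_LB: "opn (LX i) * opn (LY i) = \<alpha>" by (rule opn_LX_LY)

lemma LB_contr: "norm (LB i *v z) \<le> \<alpha> * norm z"
proof -
  obtain U V p q r where *: "orthogonal_matrix U" "orthogonal_matrix V"
    "kronecker4 (LX i) (LY i) = U ** diag4 (opn (LX i) * opn (LY i)) p q r ** V" "0 < r" "r \<le> p" "r \<le> q"
    "max p q \<le> opn (LX i) * opn (LY i)"
    using kronecker4_frame[OF det_L_pos[of i]] by metis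
  have "norm (LB i *v z) = norm (diag4 \<alpha> p q r *v (V *v z))"
    using * by (simp add: LB_def opn_prod_LB norm_orthogonal_matrix flip: matrix_vector_mul_assoc)
  also have "\<dots> \<le> \<alpha> * norm (V *v z)" using * \<alpha>_pos by (intro norm_diag4_le) (auto simp: opn_prod_LB)
  finally show ?thesis using * by (simp add: norm_orthogonal_matrix)
qed

sublocale contracting LB \<alpha>
  by standard (use \<alpha>_pos \<alpha>_less LB_contr in auto)

text \<open>\<open>e\<close> is the direction of the longest axis of the image ellipsoid: the image
  is long along \<open>e\<close> and has width of order \<open>s2 w\<close> across it.\<close>

lemma word_slab:
  obtains e where "\<And>z. \<bar>e \<bullet> (matrix_word LB w *v z)\<bar> \<le> s1 w * norm z"
    "\<And>z. norm (matrix_word LB w *v z - (e \<bullet> (matrix_word LB w *v z)) *\<^sub>R e) \<le> s2 w * norm z" "norm e = 1"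
proof -
  obtain U V p q r where *: "orthogonal_matrix U" "orthogonal_matrix V"
    "kronecker4 (X w) (Y w) = U ** diag4 (opn (X w) * opn (Y w)) p q r ** V" "0 < r" "r \<le> p" "r \<le> q"
    "max p q = max (opn (X w) * det (Y w) / opn (Y w)) (opn (Y w) * det (X w) / opn (X w))"
    "max p q \<le> opn (X w) * opn (Y w)"
    by (rule kronecker4_frame[OF det_pos[of w]]) (rule that)
  have s: "opn (X w) * opn (Y w) = s1 w" "max p q = s2 w" by (simp_all add: s1_def s2_def s2X_def s2Y_def *(7))
  have A: "matrix_word LB w *v z = U *v (diag4 (s1 w) p q r *v (V *v z))" for z
    unfolding matrix_word_LB *(3) s by (simp add: matrix_vector_mul_assoc matrix_mul_assoc)
  define e where "e = U *v axis 1 1"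
  have e: "e \<bullet> (U *v y) = y $ 1" for y
    by (simp add: e_def inner_orthogonal_matrix *(1) inner_axis')
  have d1: "(diag4 (s1 w) p q r *v y) $ 1 = s1 w * y $ 1" for y by (rule diag4_mult_vec)
  have "\<bar>e \<bullet> (matrix_word LB w *v z)\<bar> \<le> s1 w * norm z" for z
  proof -
    have "\<bar>e \<bullet> (matrix_word LB w *v z)\<bar> = s1 w * \<bar>(V *v z) $ 1\<bar>"
      unfolding A e d1 using s_pos(1)[of w] by (simp add: abs_mult)
    also have "\<dots> \<le> s1 w * norm (V *v z)"
      using s_pos(1)[of w] component_le_norm_cart[of "V *v z" 1] by (intro mult_left_mono) auto
    finally show ?thesis using *(2) by (simp add: norm_orthogonal_matrix)
  qed
  moreover have "norm (matrix_word LB w *v z - (e \<bullet> (matrix_word LB w *v z)) *\<^sub>R e) \<le> s2 w * norm z" for z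
  proof -
    have "diag4 (s1 w) p q r *v y - (s1 w * y $ 1) *\<^sub>R axis 1 1 = diag4 0 p q r *v y" for y
      by (simp add: vec_eq_iff forall_4 diag4_mult_vec axis_def)
    then have "matrix_word LB w *v z - (e \<bullet> (matrix_word LB w *v z)) *\<^sub>R e = U *v (diag4 0 p q r *v (V *v z))"
      unfolding A e d1 unfolding e_def
      by (simp flip: matrix_vector_mult_scaleR matrix_vector_mult_diff_distrib)
    then have "norm (matrix_word LB w *v z - (e \<bullet> (matrix_word LB w *v z)) *\<^sub>R e) = norm (diag4 0 p q r *v (V *v z))"
      using *(1) by (simp add: norm_orthogonal_matrix)
    also have "\<dots> \<le> s2 w * norm (V *v z)"
      using * s_pos(4)[of w] by (intro norm_diag4_le) (auto simp: s(2)[symmetric])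
    finally show ?thesis using *(2) by (simp add: norm_orthogonal_matrix)
  qed
  moreover have "norm e = 1" using *(1) by (simp add: e_def norm_orthogonal_matrix)
  ultimately show ?thesis by (rule that)
qed

text \<open>Used in the opposite direction to \<open>word_slab\<close>: a short image forces two
  coordinates of \<open>V *v z\<close> to be small. The index \<open>j\<close> is 2 or 3, whichever
  carries the second singular value.\<close>

lemma word_frame:
  obtains V j where "orthogonal_matrix V" "j \<noteq> 1"
    "\<And>z. s1 w * \<bar>(V *v z) $ 1\<bar> \<le> norm (matrix_word LB w *v z)"
    "\<And>z. s2 w * \<bar>(V *v z) $ j\<bar> \<le> norm (matrix_word LB w *v z)"
proof -
  obtain U V p q r where *: "orthogonal_matrix U" "orthogonal_matrix V"
    "kronecker4 (X w) (Y w) = U ** diag4 (opn (X w) * opn (Y w)) p q r ** V" "0 < r" "r \<le> p" "r \<le> q"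
    "max p q = max (opn (X w) * det (Y w) / opn (Y w)) (opn (Y w) * det (X w) / opn (X w))"
    "max p q \<le> opn (X w) * opn (Y w)"
    by (rule kronecker4_frame[OF det_pos[of w]]) (rule that)
  have s: "opn (X w) * opn (Y w) = s1 w" "max p q = s2 w" by (simp_all add: s1_def s2_def s2X_def s2Y_def *(7))
  have A: "norm (matrix_word LB w *v z) = norm (diag4 (s1 w) p q r *v (V *v z))" for z
  proof -
    have "matrix_word LB w *v z = U *v (diag4 (s1 w) p q r *v (V *v z))"
      unfolding matrix_word_LB *(3) s by (simp add: matrix_vector_mul_assoc matrix_mul_assoc)
    then show ?thesis using *(1) by (simp add: norm_orthogonal_matrix)
  qed
  have comp: "\<bar>(diag4 (s1 w) p q r *v (V *v z)) $ i\<bar> \<le> norm (matrix_word LB w *v z)" for z i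
    unfolding A by (rule component_le_norm_cart)
  have 1: "s1 w * \<bar>(V *v z) $ 1\<bar> \<le> norm (matrix_word LB w *v z)" for z
    using comp[of z 1] s_pos(1)[of w] by (simp add: diag4_mult_vec abs_mult)
  show ?thesis
  proof (cases "q \<le> p")
    case True
    then have "s2 w = p" using s by simp
    then have "s2 w * \<bar>(V *v z) $ 2\<bar> \<le> norm (matrix_word LB w *v z)" for z
      using comp[of z 2] s_pos(4)[of w] by (simp add: diag4_mult_vec abs_mult)
    with *(2) 1 show ?thesis by (intro that[of V 2]) auto
  next
    case False
    then have "s2 w = q" using s by simp
    then have "s2 w * \<bar>(V *v z) $ 3\<bar> \<le> norm (matrix_word LB w *v z)" for z
      using comp[of z 3] s_pos(4)[of w] by (simp add: diag4_mult_vec abs_mult)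
    with *(2) 1 show ?thesis by (intro that[of V 3]) auto
  qed
qed

text \<open>Appending a letter changes one norm by a factor between \<open>\<beta>\<close> and
  \<open>\<alpha>\<close> and leaves the other fixed. The scales \<open>s2\<close> along a word
  therefore have no large gaps, and every small radius is comparable with one of them.\<close>

lemma s2_snoc: "\<beta> * s2 w \<le> s2 (w @ [i])"
proof -
  have dX: "det (X (w @ [i])) = det (X w) * det (LX i)" and dY: "det (Y (w @ [i])) = det (Y w) * det (LY i)"
    by (simp_all add: matrix_word_append det_mul)
  have X': "X (w @ [i]) = X w ** LX i" and Y': "Y (w @ [i]) = Y w ** LY i" by (simp_all add: matrix_word_append)
  note b = less_imp_le[OF \<beta>_less]
  have "\<beta> * s2X w \<le> s2X (w @ [i]) \<and> \<beta> * s2Y w \<le> s2Y (w @ [i])"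
  proof (cases "i = 1 \<or> i = 2")
    case True
    then have L: "LX i = diag2 \<alpha> \<beta>" "LY i = rot2 \<theta>" by (auto simp: LX_def LY_def)
    have oY: "opn (Y (w @ [i])) = opn (Y w)" by (simp add: Y' L opn_mult_rot2)
    have oX: "\<beta> * opn (X w) \<le> opn (X (w @ [i]))" "opn (X (w @ [i])) \<le> \<alpha> * opn (X w)"
      using opn_mult_diag2[OF \<beta>_pos b, of "X w"] by (simp_all add: X' L)
    have "\<beta> * s2X w = (\<beta> * opn (X w)) * det (Y w) / opn (Y w)" by (simp add: s2X_def)
    also have "\<dots> \<le> opn (X (w @ [i])) * det (Y w) / opn (Y w)"
      using oX(1) det_pos[of w] opn_pos[of w] by (intro divide_right_mono mult_right_mono) auto
    also have "\<dots> = s2X (w @ [i])" by (simp add: s2X_def oY dY L)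
    finally have 1: "\<beta> * s2X w \<le> s2X (w @ [i])" .
    have "\<beta> * s2Y w = opn (Y w) * (det (X w) * (\<alpha> * \<beta>)) / (\<alpha> * opn (X w))" using \<alpha>_pos by (simp add: s2Y_def)
    also have "\<dots> \<le> opn (Y w) * (det (X w) * (\<alpha> * \<beta>)) / opn (X (w @ [i]))"
      using oX(2) det_pos[of w] opn_pos[of w] opn_pos[of "w @ [i]"] \<alpha>_pos \<beta>_pos by (intro divide_left_mono) auto
    also have "\<dots> = s2Y (w @ [i])" by (simp add: s2Y_def oY dX L)
    finally show ?thesis using 1 by simp
  next
    case False
    then have L: "LY i = diag2 \<alpha> \<beta>" "LX i = rot2 \<theta>" by (auto simp: LX_def LY_def)
    have oX: "opn (X (w @ [i])) = opn (X w)" by (simp add: X' L opn_mult_rot2)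
    have oY: "\<beta> * opn (Y w) \<le> opn (Y (w @ [i]))" "opn (Y (w @ [i])) \<le> \<alpha> * opn (Y w)"
      using opn_mult_diag2[OF \<beta>_pos b, of "Y w"] by (simp_all add: Y' L)
    have "\<beta> * s2Y w = (\<beta> * opn (Y w)) * det (X w) / opn (X w)" by (simp add: s2Y_def)
    also have "\<dots> \<le> opn (Y (w @ [i])) * det (X w) / opn (X w)"
      using oY(1) det_pos[of w] opn_pos[of w] by (intro divide_right_mono mult_right_mono) auto
    also have "\<dots> = s2Y (w @ [i])" by (simp add: s2Y_def oX dX L)
    finally have 1: "\<beta> * s2Y w \<le> s2Y (w @ [i])" .
    have "\<beta> * s2X w = opn (X w) * (det (Y w) * (\<alpha> * \<beta>)) / (\<alpha> * opn (Y w))" using \<alpha>_pos by (simp add: s2X_def)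
    also have "\<dots> \<le> opn (X w) * (det (Y w) * (\<alpha> * \<beta>)) / opn (Y (w @ [i]))"
      using oY(2) det_pos[of w] opn_pos[of w] opn_pos[of "w @ [i]"] \<alpha>_pos \<beta>_pos by (intro divide_left_mono) auto
    also have "\<dots> = s2X (w @ [i])" by (simp add: s2X_def oX dY L)
    finally show ?thesis using 1 by simp
  qed
  then show ?thesis
    using \<beta>_pos by (simp add: s2_def max_mult_distrib_left less_imp_le) (meson max.coboundedI1 max.coboundedI2)
qed

end

section \<open>Borel-Cantelli along prefixes\<close>

lemma measure_small_pieces:
  assumes "finite_measure \<mu>" and W: "W \<in> sets \<mu>" and J: "finite J"
    and j: "\<And>x. x \<in> W \<Longrightarrow> j x \<in> J" and meas: "\<And>i. {x \<in> W. j x = i} \<in> sets \<mu>" and "0 \<le> t"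
  shows "{x \<in> W. measure \<mu> {y \<in> W. j y = j x} < t} \<in> sets \<mu>"
    "measure \<mu> {x \<in> W. measure \<mu> {y \<in> W. j y = j x} < t} \<le> real (card J) * t"
proof -
  interpret finite_measure \<mu> by fact
  let ?J = "{i \<in> J. measure \<mu> {y \<in> W. j y = i} < t}"
  have e: "{x \<in> W. measure \<mu> {y \<in> W. j y = j x} < t} = (\<Union>i\<in>?J. {x \<in> W. j x = i})"
    using j by auto
  show "{x \<in> W. measure \<mu> {y \<in> W. j y = j x} < t} \<in> sets \<mu>"
    unfolding e using J meas by auto
  have "measure \<mu> (\<Union>i\<in>?J. {x \<in> W. j x = i}) \<le> (\<Sum>i\<in>?J. measure \<mu> {x \<in> W. j x = i})"
    using J meas by (intro finite_measure_subadditive_finite) auto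
  also have "\<dots> \<le> (\<Sum>i\<in>?J. t)" by (intro sum_mono) auto
  also have "\<dots> = real (card ?J) * t" by simp
  also have "\<dots> \<le> real (card J) * t"
    using J \<open>0 \<le> t\<close> by (intro mult_right_mono of_nat_mono card_mono) auto
  finally show "measure \<mu> {x \<in> W. measure \<mu> {y \<in> W. j y = j x} < t} \<le> real (card J) * t" unfolding e .
qed

text \<open>The exceptional set may depend on the prefix; its total mass over all words of length
  \<open>n\<close> is summable in \<open>n\<close>, so Borel-Cantelli applies.\<close>

lemma AE_words_eventually:
  fixes \<mu> :: "(nat \<Rightarrow> 'i::finite) measure"
  assumes "prob_space \<mu>" and s: "sets \<mu> = sets word_borel"
    and A: "\<And>n w. length w = n \<Longrightarrow> A n w \<in> sets word_borel"
    and le: "\<And>n. 1 \<le> n \<Longrightarrow> (\<Sum>w | length w = n. measure \<mu> (cyl w \<inter> A n w)) \<le> C / real n ^ 2"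
  shows "AE x in \<mu>. \<forall>\<^sub>F n in sequentially. x \<notin> A n (map x [0..<n])"
proof -
  interpret prob_space \<mu> by fact
  have sp: "space \<mu> = UNIV" using sets_eq_imp_space_eq[OF s] by simp
  define E where "E n = (\<Union>w\<in>{w. length w = n}. cyl w \<inter> A n w)" for n
  have E: "E n \<in> sets \<mu>" for n unfolding E_def using A s by (intro sets.finite_UN) auto
  have in_E: "x \<in> E n \<longleftrightarrow> x \<in> A n (map x [0..<n])" for x n
  proof
    assume "x \<in> E n"
    then obtain w where "length w = n" "x \<in> cyl w" "x \<in> A n w" by (auto simp: E_def)
    then show "x \<in> A n (map x [0..<n])" by (metis cyl_iff)
  next
    assume "x \<in> A n (map x [0..<n])"
    then show "x \<in> E n" unfolding E_def by (intro UN_I[of "map x [0..<n]"]) auto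
  qed
  have le_sum: "measure \<mu> (E n) \<le> (\<Sum>w | length w = n. measure \<mu> (cyl w \<inter> A n w))" for n
    unfolding E_def using A s by (intro finite_measure_subadditive_finite) auto
  have "summable (\<lambda>n. C * (1 / real n ^ 2))"
    by (intro summable_mult) (use inverse_power_summable[of 2, where 'a = real] in \<open>simp add: inverse_eq_divide\<close>)
  then have "summable (\<lambda>n. measure \<mu> (E n))"
  proof (rule summable_comparison_test'[where N = 1])
    fix n :: nat assume "1 \<le> n"
    from order_trans[OF le_sum le[OF this]] show "norm (measure \<mu> (E n)) \<le> C * (1 / real n ^ 2)" by simp
  qed
  then have "AE x in \<mu>. eventually (\<lambda>n. x \<in> space \<mu> - E n) sequentially"
    using E by (intro borel_cantelli_AE1) (auto simp: emeasure_eq_measure)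
  then show ?thesis by (simp add: in_E sp)
qed

context two_blocks
begin

text \<open>Where \<open>G w\<close> exceeds \<open>n ^ 2 * F w\<close>, the mass of the cylinder is
  at most \<open>C * G w / n ^ 2\<close>, and the sums of \<open>G\<close> over words of length
  \<open>n\<close> are bounded.\<close>

lemma AE_ratio:
  fixes \<mu> :: "(nat \<Rightarrow> 4) measure"
  assumes "prob_space \<mu>" and s: "sets \<mu> = sets word_borel"
    and up: "\<And>w. measure \<mu> (cyl w) \<le> C * F w" and sum: "\<And>n. (\<Sum>w | length w = n. G w) \<le> D"
    and pos: "\<And>w. 0 < F w" "\<And>w. 0 < G w" and "0 < C"
  shows "AE x in \<mu>. \<forall>\<^sub>F n in sequentially. G (map x [0..<n]) \<le> real n ^ 2 * F (map x [0..<n])"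
proof -
  let ?A = "\<lambda>n w. if real n ^ 2 * F w < G w then UNIV else {}"
  have "AE x in \<mu>. \<forall>\<^sub>F n in sequentially. x \<notin> ?A n (map x [0..<n])"
  proof (rule AE_words_eventually[OF assms(1) s, where A = "?A" and C = "C * D"])
    fix n :: nat assume "1 \<le> n"
    have "measure \<mu> (cyl w \<inter> ?A n w) \<le> C * G w / real n ^ 2" for w
    proof (cases "real n ^ 2 * F w < G w")
      case True
      have "measure \<mu> (cyl w) \<le> C * F w" by (rule up)
      also have "\<dots> \<le> C * (G w / real n ^ 2)"
        using True \<open>1 \<le> n\<close> \<open>0 < C\<close> by (intro mult_left_mono) (auto simp: field_simps)
      finally show ?thesis using True by simp
    qed (use pos[of w] \<open>0 < C\<close> in simp)
    then have "(\<Sum>w | length w = n. measure \<mu> (cyl w \<inter> ?A n w)) \<le> (\<Sum>w | length w = n. C * G w / real n ^ 2)"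
      by (intro sum_mono)
    also have "\<dots> = C * (\<Sum>w | length w = n. G w) / real n ^ 2" by (simp add: sum_distrib_left sum_divide_distrib)
    also have "\<dots> \<le> C * D / real n ^ 2" using sum \<open>0 < C\<close> by (intro divide_right_mono mult_left_mono) auto
    finally show "(\<Sum>w | length w = n. measure \<mu> (cyl w \<inter> ?A n w)) \<le> C * D / real n ^ 2" .
  qed (auto simp: sets.top[of word_borel, simplified])
  then show ?thesis by eventually_elim (auto elim!: eventually_mono split: if_splits)
qed

text \<open>The image of a cylinder \<open>w\<close> is cut into about \<open>s1 w / s2 w\<close> slabs of width \<open>s2 w\<close>; the points lying in slabs
  of small measure form a summable part of the cylinder.\<close>

lemma upper_local_dimension:
  assumes "prob_space \<mu>" and s: "sets \<mu> = sets word_borel"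
    and low: "AE x in \<mu>. \<forall>\<^sub>F n in sequentially. c / real n ^ 2 * sv t (map x [0..<n]) \<le> measure \<mu> (cyl (map x [0..<n]))"
    and t: "1 \<le> t" "t \<le> 2" and b: "\<And>x. norm (code v x) \<le> b"
  shows "AE x in \<mu>. \<forall>\<^sub>F n in sequentially. c / real n ^ 4 * s2 (map x [0..<n]) powr t
      \<le> measure \<mu> {y. norm (code v x - code v y) < (2 + 2 * b) * s2 (map x [0..<n])}"
proof -
  interpret prob_space \<mu> by fact
  have sp: "space \<mu> = UNIV" using sets_eq_imp_space_eq[OF s] by simp
  have b0: "0 \<le> b" using b norm_ge_zero order_trans by blast
  have "\<exists>e. (\<forall>z. \<bar>e \<bullet> (matrix_word LB w *v z)\<bar> \<le> s1 w * norm z) \<and>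
    (\<forall>z. norm (matrix_word LB w *v z - (e \<bullet> (matrix_word LB w *v z)) *\<^sub>R e) \<le> s2 w * norm z) \<and> norm e = 1" for w
    by (rule word_slab[of w]) blast
  then obtain e where e: "\<And>w z. \<bar>e w \<bullet> (matrix_word LB w *v z)\<bar> \<le> s1 w * norm z"
    "\<And>w z. norm (matrix_word LB w *v z - (e w \<bullet> (matrix_word LB w *v z)) *\<^sub>R e w) \<le> s2 w * norm z" "\<And>w. norm (e w) = 1"
    by metis
  define p where "p w = (\<Sum>k<length w. matrix_word LB (take k w) *v v (w ! k))" for w
  have code_cyl: "code v x - p w = matrix_word LB w *v code v (\<lambda>k. x (length w + k))" if "x \<in> cyl w" for x w
  proof -
    have w: "map x [0..<length w] = w" using that by (simp add: cyl_iff)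
    have "term_of v x k = matrix_word LB (take k w) *v v (w ! k)" if "k < length w" for k
    proof -
      have "take k w = map x [0..<k]" using arg_cong[OF w, of "take k"] that by (simp add: take_map)
      moreover have "x k = w ! k" using \<open>x \<in> cyl w\<close> that by (simp add: cyl_iff_nth)
      ultimately show ?thesis by (simp add: term_of_def)
    qed
    then show ?thesis unfolding p_def using code_split[of v x "length w"] by (simp add: w)
  qed
  \<comment> \<open>The index of the slab, orthogonal to \<open>e w\<close> and of width
    \<open>s2 w\<close>, that contains the point.\<close>
  define j where "j w x = \<lfloor>(e w \<bullet> (code v x - p w)) / s2 w\<rfloor>" for w x
  have j_near: "norm (code v x - code v y) < (2 + 2 * b) * s2 w" if xy: "x \<in> cyl w" "y \<in> cyl w" "j w x = j w y" for x y w
  proof -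
    let ?x = "code v (\<lambda>k. x (length w + k))" and ?y = "code v (\<lambda>k. y (length w + k))"
    let ?d = "matrix_word LB w *v (?x - ?y)"
    have d: "code v x - code v y = ?d"
      using code_cyl[OF xy(1)] code_cyl[OF xy(2)] by (simp add: matrix_vector_mult_diff_distrib algebra_simps)
    have "\<bar>(e w \<bullet> (code v x - p w)) / s2 w - (e w \<bullet> (code v y - p w)) / s2 w\<bar> < 1"
      using xy(3) unfolding j_def by linarith
    also have "(e w \<bullet> (code v x - p w)) / s2 w - (e w \<bullet> (code v y - p w)) / s2 w = (e w \<bullet> ?d) / s2 w"
      by (simp add: d[symmetric] inner_diff_right diff_divide_distrib)
    finally have 1: "\<bar>e w \<bullet> ?d\<bar> < s2 w" using s_pos(4)[of w] by (simp add: abs_divide)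
    have "norm (?x - ?y) \<le> 2 * b" using norm_triangle_ineq4[of ?x ?y] b[of "\<lambda>k. x (length w + k)"] b[of "\<lambda>k. y (length w + k)"] by linarith
    then have 2: "norm (?d - (e w \<bullet> ?d) *\<^sub>R e w) \<le> s2 w * (2 * b)"
      using s_pos(4)[of w] by (intro order_trans[OF e(2)] mult_left_mono) auto
    have "norm ?d \<le> norm (?d - (e w \<bullet> ?d) *\<^sub>R e w) + norm ((e w \<bullet> ?d) *\<^sub>R e w)"
      using norm_triangle_ineq[of "?d - (e w \<bullet> ?d) *\<^sub>R e w" "(e w \<bullet> ?d) *\<^sub>R e w"] by simp
    also have "\<dots> < s2 w * (2 * b) + s2 w" using 1 2 by (simp add: e(3))
    also have "\<dots> \<le> (2 + 2 * b) * s2 w" using s_pos(4)[of w] by (simp add: algebra_simps)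
    finally show ?thesis by (simp add: d)
  qed
  define J where "J w = {- \<lceil>s1 w * b / s2 w\<rceil> .. \<lceil>s1 w * b / s2 w\<rceil>}" for w
  have jJ: "j w x \<in> J w" if "x \<in> cyl w" for x w
  proof -
    have "\<bar>e w \<bullet> (code v x - p w)\<bar> \<le> s1 w * b"
      unfolding code_cyl[OF that] using s_pos(1)[of w] b by (intro order_trans[OF e(1)] mult_left_mono) auto
    then have "\<bar>(e w \<bullet> (code v x - p w)) / s2 w\<bar> \<le> s1 w * b / s2 w"
      using s_pos(4)[of w] by (simp add: abs_divide divide_right_mono)
    then show ?thesis unfolding j_def J_def by (simp only: atLeastAtMost_iff) linarith
  qed
  \<comment> \<open>There are \<open>2 * \<lceil>b * k\<rceil> + 1\<close> slabs with
    \<open>k = s1 w / s2 w\<close>; as \<open>k \<ge> 1\<close>, the additive constants are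
    absorbed.\<close>
  have card_J: "real (card (J w)) \<le> (2 * b + 3) * (s1 w / s2 w)" for w
  proof -
    define k where "k = s1 w / s2 w"
    have k: "s1 w * b / s2 w = b * k" by (simp add: k_def)
    have "1 \<le> k" using s_pos(4)[of w] s2_bounds(1)[of w] by (simp add: k_def)
    then have "0 \<le> b * k" using b0 by simp
    then have "0 \<le> \<lceil>b * k\<rceil>" by linarith
    then have "real (card (J w)) = 2 * of_int \<lceil>b * k\<rceil> + 1" unfolding J_def k by simp
    also have "\<dots> \<le> 2 * (b * k + 1) + 1"
      by (intro add_right_mono mult_left_mono of_int_ceiling_le_add_one) simp
    also have "\<dots> \<le> (2 * b + 3) * k" using \<open>1 \<le> k\<close> by (simp add: algebra_simps)
    finally show ?thesis by (simp only: k_def)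
  qed
  let ?E = "\<lambda>w x. {y \<in> cyl w. j w y = j w x}"
  have jm: "{x \<in> cyl w. j w x = i} \<in> sets word_borel" for w i
  proof -
    have "{x \<in> space word_borel. j w x = i} \<in> sets word_borel" unfolding j_def by measurable
    then show ?thesis by (simp add: Collect_conj_eq sets.Int)
  qed
  \<comment> \<open>The mass of the cylinder divided evenly among the slabs, up to a constant, and
    then lowered by \<open>n ^ 2\<close> for summability.\<close>
  let ?t = "\<lambda>n w. measure \<mu> (cyl w) * (s2 w / s1 w) / real n ^ 2"
  let ?A = "\<lambda>n w. {x \<in> cyl w. measure \<mu> (?E w x) < ?t n w}"
  have t0: "0 \<le> ?t n w" for n w using s_pos[of w] by simp
  have cyl_Int: "cyl w \<inter> ?A n w = ?A n w" for n w by blast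
  have pieces: "?A n w \<in> sets \<mu>" "measure \<mu> (?A n w) \<le> real (card (J w)) * ?t n w" for w n
  proof -
    have W: "cyl w \<in> sets \<mu>" by (simp add: s)
    have fin: "finite (J w)" by (simp add: J_def)
    have jm': "{x \<in> cyl w. j w x = i} \<in> sets \<mu>" for i unfolding s by (rule jm)
    show "?A n w \<in> sets \<mu>"
      by (rule measure_small_pieces(1)[OF finite_measure_axioms W fin jJ jm' t0, of w n])
    show "measure \<mu> (?A n w) \<le> real (card (J w)) * ?t n w"
      by (rule measure_small_pieces(2)[OF finite_measure_axioms W fin jJ jm' t0, of w n])
  qed
  have "AE x in \<mu>. \<forall>\<^sub>F n in sequentially. x \<notin> ?A n (map x [0..<n])"
  proof (rule AE_words_eventually[OF assms(1) s, where A = "?A" and C = "2 * b + 3"])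
    fix n :: nat and w :: "4 list"
    show "?A n w \<in> sets word_borel"
      using pieces(1)[of w n] by (simp only: s)
  next
    fix n :: nat assume "1 \<le> n"
    have "measure \<mu> (cyl w \<inter> ?A n w) \<le> (2 * b + 3) * measure \<mu> (cyl w) / real n ^ 2" for w
    proof -
      have "measure \<mu> (cyl w \<inter> ?A n w) \<le> real (card (J w)) * ?t n w"
        using pieces(2)[of w n] by (simp only: cyl_Int)
      also have "\<dots> \<le> ((2 * b + 3) * (s1 w / s2 w)) * ?t n w" by (intro mult_right_mono card_J t0)
      also have "\<dots> = (2 * b + 3) * measure \<mu> (cyl w) / real n ^ 2" using s_pos[of w] by simp
      finally show ?thesis .
    qed
    then have "(\<Sum>w | length w = n. measure \<mu> (cyl w \<inter> ?A n w)) \<le> (\<Sum>w | length w = n. (2 * b + 3) * measure \<mu> (cyl w) / real n ^ 2)"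
      by (intro sum_mono)
    also have "\<dots> = (2 * b + 3) * (\<Sum>w | length w = n. measure \<mu> (UNIV \<inter> cyl w)) / real n ^ 2"
      by (simp add: sum_distrib_left sum_divide_distrib)
    also have "(\<Sum>w | length w = n. measure \<mu> (UNIV \<inter> cyl w)) = 1"
      using measure_split_cyl[OF finite_measure_axioms s, of UNIV n] prob_space sets.top[of word_borel] by (simp add: sp)
    finally show "(\<Sum>w | length w = n. measure \<mu> (cyl w \<inter> ?A n w)) \<le> (2 * b + 3) / real n ^ 2" by simp
  qed
  from this low show ?thesis
  proof eventually_elim
    case (elim x)
    from elim(1) elim(2) eventually_ge_at_top[of 1] show ?case
    proof eventually_elim
      case (elim n)
      let ?w = "map x [0..<n]"
      have "?t n ?w \<le> measure \<mu> (?E ?w x)" using elim(1) by simp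
      also have "\<dots> \<le> measure \<mu> {y. norm (code v x - code v y) < (2 + 2 * b) * s2 ?w}"
      proof (rule finite_measure_mono)
        show "?E ?w x \<subseteq> {y. norm (code v x - code v y) < (2 + 2 * b) * s2 ?w}"
          using j_near[of x ?w] by auto
        have "{y \<in> space word_borel. norm (code v x - code v y) < (2 + 2 * b) * s2 ?w} \<in> sets word_borel" by measurable
        then show "{y. norm (code v x - code v y) < (2 + 2 * b) * s2 ?w} \<in> sets \<mu>" by (simp add: s)
      qed
      finally have 1: "?t n ?w \<le> measure \<mu> {y. norm (code v x - code v y) < (2 + 2 * b) * s2 ?w}" .
      \<comment> \<open>\<open>sv t w = s1 w * s2 w powr (t - 1)\<close>, so multiplying by
        \<open>s2 w / s1 w\<close> leaves \<open>s2 w powr t\<close>. One \<open>n ^ 2\<close> comes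
        from the assumption \<open>low\<close>, the other from the threshold
        \<open>?t\<close>.\<close>
      have "c / real n ^ 4 * s2 ?w powr t = (c / real n ^ 2 * sv t ?w) * (s2 ?w / s1 ?w) / real n ^ 2"
      proof -
        have "s2 ?w powr t = s2 ?w powr (t - 1) * s2 ?w" using s_pos(4)[of ?w] by (simp add: powr_diff)
        then show ?thesis using s_pos[of ?w] by (simp add: sv_eq_1_2'[OF t])
      qed
      also have "\<dots> \<le> ?t n ?w" using elim(2) s_pos[of ?w] by (intro divide_right_mono mult_right_mono) auto
      finally show ?case using 1 by simp
    qed
  qed
qed

end

section \<open>Lower bound on the local dimension\<close>

text \<open>The determinant of the inverse \<open>N\<close> is, up to sign, the volume of the image
  of the unit cube. Points of that cube have norm at most 2 in dimension 4 and \<open>N\<close>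
  stretches by at most \<open>1 / \<delta>\<close>, which gives the ball of radius
  \<open>2 / \<delta>\<close>.\<close>

lemma linear_preimage_volume:
  fixes M :: "real^4 \<Rightarrow> real^4" and p q :: "real^4"
  assumes M: "linear M" "\<And>u. \<delta> * norm u \<le> norm (M u)" "0 < \<delta>"
    and S: "S \<in> sets borel" "\<And>u. u \<in> S \<Longrightarrow> M u \<in> cbox p q" and pq: "\<And>i. p $ i \<le> q $ i"
  shows "emeasure lborel S \<le> ennreal (measure lebesgue (cball (0::real^4) (2 / \<delta>)) * (\<Prod>i\<in>UNIV. q $ i - p $ i))"
proof -
  have "inj M"
  proof (rule injI)
    fix x y assume "M x = M y"
    then have "M (x - y) = 0" using M(1) by (simp add: linear_diff)
    then have "\<delta> * norm (x - y) \<le> 0" using M(2)[of "x - y"] by simp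
    then show "x = y" using M(3) by (simp add: mult_le_0_iff)
  qed
  then obtain N where N: "linear N" "\<And>u. N (M u) = u" "\<And>u. M (N u) = u"
    using linear_injective_isomorphism[OF M(1)] by blast
  have N_le: "norm (N z) \<le> norm z / \<delta>" for z
    using M(2)[of "N z"] M(3) by (simp add: N(3) field_simps)
  have det: "\<bar>det (matrix N)\<bar> \<le> measure lebesgue (cball (0::real^4) (2 / \<delta>))"
  proof -
    have "measure lebesgue (cbox 0 1 :: (real^4) set) = 1"
      using content_cbox_cart[of "0 :: real^4" 1] by (simp add: interval_ne_empty_cart)
    then have "\<bar>det (matrix N)\<bar> = measure lebesgue (N ` cbox 0 1)"
      using measure_linear_image[OF N(1), of "cbox 0 1"] by simp
    also have "\<dots> \<le> measure lebesgue (cball (0::real^4) (2 / \<delta>))"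
    proof (rule measure_mono_fmeasurable)
      show "N ` cbox 0 1 \<subseteq> cball 0 (2 / \<delta>)"
      proof
        fix y assume "y \<in> N ` cbox 0 1"
        then obtain z where z: "z \<in> cbox 0 1" "y = N z" by blast
        have "(z $ i)\<^sup>2 \<le> 1" for i
          using z(1) by (simp add: mem_box_cart power_le_one)
        from add_mono[OF add_mono[OF add_mono[OF this[of 1] this[of 2]] this[of 3]] this[of 4]]
        have "norm z \<le> sqrt 4" unfolding norm_real4 by (intro real_sqrt_le_mono) simp
        then have "norm z \<le> 2" by simp
        then have "norm z / \<delta> \<le> 2 / \<delta>" using M(3) by (simp add: divide_right_mono)
        with N_le[of z] z(2) show "y \<in> cball 0 (2 / \<delta>)" by simp
      qed
      show "N ` cbox 0 1 \<in> sets lebesgue"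
        using measurable_linear_image_interval[OF N(1), of 0 1] by (rule fmeasurableD)
    qed simp
    finally show ?thesis .
  qed
  have im: "N ` cbox p q \<in> lmeasurable" by (rule measurable_linear_image_interval[OF N(1)])
  have "S \<subseteq> N ` cbox p q"
  proof
    fix u assume "u \<in> S"
    from imageI[OF S(2)[OF this], of N] show "u \<in> N ` cbox p q" by (simp add: N(2))
  qed
  then have "emeasure lebesgue S \<le> emeasure lebesgue (N ` cbox p q)"
    using im by (intro emeasure_mono) auto
  also have "\<dots> = ennreal (measure lebesgue (N ` cbox p q))"
    using im by (simp add: emeasure_eq_measure2)
  also have "measure lebesgue (N ` cbox p q) = \<bar>det (matrix N)\<bar> * (\<Prod>i\<in>UNIV. q $ i - p $ i)"
    using measure_linear_image[OF N(1), of "cbox p q"] pq by (simp add: content_cbox_cart interval_ne_empty_cart)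
  also have "ennreal \<dots> \<le> ennreal (measure lebesgue (cball (0::real^4) (2 / \<delta>)) * (\<Prod>i\<in>UNIV. q $ i - p $ i))"
    using pq by (intro ennreal_leI mult_right_mono det prod_nonneg) auto
  finally show ?thesis using S(1) by simp
qed

text \<open>For \<open>t\<close> between 1 and 2 the second factor is interpolated:
  \<open>min 1 x \<le> x powr (t - 1)\<close> for \<open>x > 0\<close>. The denominator is
  \<open>sv t w\<close> when \<open>a\<close> and \<open>b\<close> are the first two singular
  values.\<close>

lemma min_mult_min_le:
  fixes a b r t :: real
  assumes "0 < a" "0 < b" "0 < r" "1 \<le> t" "t \<le> 2"
  shows "min 1 (r / a) * min 1 (r / b) \<le> r powr t / (a * b powr (t - 1))"
proof -
  have "min 1 (r / b) \<le> (r / b) powr (t - 1)"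
  proof (cases "r / b \<le> 1")
    case True
    have "r / b = (r / b) powr 1" using assms by simp
    also have "\<dots> \<le> (r / b) powr (t - 1)" using True assms by (intro powr_mono') auto
    finally show ?thesis by simp
  next
    case False
    then have "1 \<le> (r / b) powr (t - 1)" using assms by (intro ge_one_powr_ge_zero) auto
    then show ?thesis by simp
  qed
  then have "min 1 (r / a) * min 1 (r / b) \<le> (r / a) * (r / b) powr (t - 1)"
    using assms by (intro mult_mono) auto
  also have "\<dots> = r powr t / (a * b powr (t - 1))"
    using assms by (simp add: powr_divide powr_diff field_simps)
  finally show ?thesis .
qed

lemma prod_4: "prod f (UNIV :: 4 set) = f 1 * f 2 * f 3 * (f 4 :: real)"
  unfolding UNIV_4 by (simp add: mult.assoc)

context two_blocks
begin

text \<open>In the coordinates of \<open>word_frame\<close> the condition confines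
  \<open>V *v L u\<close> to a box whose sides are at most \<open>4 * \<rho>\<close> times
  \<open>min 1 (r / s1 w)\<close>, \<open>min 1 (r / s2 w)\<close> and, in the other two
  coordinates, 1.\<close>

lemma slab_volume:
  fixes L :: "real^4 \<Rightarrow> real^4"
  assumes L: "linear L" "\<And>u. \<delta> * norm u \<le> norm (L u)" "\<And>u. norm (L u) \<le> 2 * norm u" "0 < \<delta>"
    and \<rho>: "1 \<le> \<rho>" and r: "0 < r" and t: "1 \<le> t" "t \<le> 2"
  shows "emeasure lborel {u. norm u \<le> \<rho> \<and> norm (matrix_word LB w *v (L u + z)) \<le> r}
    \<le> ennreal (measure lebesgue (cball (0::real^4) (2 / \<delta>)) * (4 * \<rho>) ^ 4 * (r powr t / sv t w))"
proof -
  obtain V j where V: "orthogonal_matrix V" "j \<noteq> 1"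
    "\<And>z. s1 w * \<bar>(V *v z) $ 1\<bar> \<le> norm (matrix_word LB w *v z)"
    "\<And>z. s2 w * \<bar>(V *v z) $ j\<bar> \<le> norm (matrix_word LB w *v z)"
    by (rule word_frame) (rule that)
  define h where "h = V *v z"
  define sg where "sg i = (if i = 1 then s1 w else s2 w)" for i :: 4
  have sg: "0 < sg i" for i using s_pos[of w] by (simp add: sg_def)
  \<comment> \<open>A side is cut down to order \<open>r / sg i\<close> only if that is at most 1;
    otherwise the bound coming from \<open>norm u \<le> \<rho>\<close> serves. This is where
    \<open>min 1\<close> comes from.\<close>
  define narrow where "narrow i \<longleftrightarrow> (i = 1 \<or> i = j) \<and> r / sg i \<le> 1" for i
  define p q :: "real^4" where "p = (\<chi> i. if narrow i then - h $ i - r / sg i else - (2 * \<rho>))"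
    and "q = (\<chi> i. if narrow i then - h $ i + r / sg i else 2 * \<rho>)"
  have len: "q $ i - p $ i \<le> (4 * \<rho>) * (if i = 1 \<or> i = j then min 1 (r / sg i) else 1)" for i
  proof (cases "narrow i")
    case True
    have "2 * (r / sg i) \<le> (4 * \<rho>) * (r / sg i)" using sg[of i] r \<rho> by (intro mult_right_mono) auto
    then show ?thesis using True by (simp add: p_def q_def narrow_def)
  next
    case False
    then show ?thesis using \<rho> by (auto simp: p_def q_def narrow_def)
  qed
  have pq: "p $ i \<le> q $ i" for i using sg[of i] r \<rho> by (simp add: p_def q_def)
  let ?S = "{u. norm u \<le> \<rho> \<and> norm (matrix_word LB w *v (L u + z)) \<le> r}"
  have cont_L: "continuous_on UNIV L" using L(1) by (simp add: linear_continuous_on linear_conv_bounded_linear)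
  have "closed ?S"
  proof -
    have "continuous_on UNIV (\<lambda>u. matrix_word LB w *v (L u + z))"
      by (intro continuous_on_compose2[OF matrix_vector_mult_linear_continuous_on] continuous_intros cont_L) auto
    then show ?thesis by (intro closed_Collect_conj closed_Collect_le continuous_intros)
  qed
  then have Sb: "?S \<in> sets borel" by (rule borel_closed)
  have lin: "linear (\<lambda>u. V *v L u)" using L(1) by (intro linear_compose[of L "(*v) V", unfolded o_def]) auto
  have nV: "norm (V *v L u) = norm (L u)" for u using V(1) by (simp add: norm_orthogonal_matrix)
  have "emeasure lborel ?S \<le> ennreal (measure lebesgue (cball (0::real^4) (2 / \<delta>)) * (\<Prod>i\<in>UNIV. q $ i - p $ i))"
  proof (rule linear_preimage_volume[OF lin _ L(4) Sb])
    show "\<delta> * norm u \<le> norm (V *v L u)" for u using L(2) by (simp add: nV)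
    show "p $ i \<le> q $ i" for i by (rule pq)
    fix u assume u: "u \<in> ?S"
    have Vu: "V *v (L u + z) = V *v L u + h" by (simp add: h_def matrix_vector_right_distrib)
    have 1: "\<bar>(V *v L u) $ 1 + h $ 1\<bar> \<le> r / s1 w" 
      using V(3)[of "L u + z"] u s_pos(1)[of w] by (simp add: Vu pos_le_divide_eq mult.commute)
    have 2: "\<bar>(V *v L u) $ j + h $ j\<bar> \<le> r / s2 w" 
      using V(4)[of "L u + z"] u s_pos(4)[of w] by (simp add: Vu pos_le_divide_eq mult.commute)
    have "norm (V *v L u) \<le> 2 * \<rho>" unfolding nV using L(3)[of u] u by simp
    then have 3: "\<bar>(V *v L u) $ i\<bar> \<le> 2 * \<rho>" for i using component_le_norm_cart[of "V *v L u" i] by linarith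
    have "p $ i \<le> (V *v L u) $ i \<and> (V *v L u) $ i \<le> q $ i" for i
    proof (cases "narrow i")
      case True
      then have "\<bar>(V *v L u) $ i + h $ i\<bar> \<le> r / sg i" using 1 2 V(2) by (auto simp: narrow_def sg_def)
      then show ?thesis using True by (auto simp: p_def q_def abs_le_iff)
    next
      case False
      then show ?thesis using 3[of i] by (auto simp: p_def q_def abs_le_iff)
    qed
    then show "V *v L u \<in> cbox p q" by (simp add: mem_box_cart)
  qed
  also have "\<dots> \<le> ennreal (measure lebesgue (cball (0::real^4) (2 / \<delta>)) * ((4 * \<rho>) ^ 4 * (r powr t / sv t w)))"
  proof (intro ennreal_leI mult_left_mono)
    let ?m = "\<lambda>i. if i = 1 \<or> i = j then min 1 (r / sg i) else 1"
    have "(\<Prod>i\<in>UNIV. q $ i - p $ i) \<le> (\<Prod>i\<in>UNIV. (4 * \<rho>) * ?m i)"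
      using len pq by (intro prod_mono) auto
    also have "\<dots> = (4 * \<rho>) ^ 4 * (min 1 (r / s1 w) * min 1 (r / s2 w))"
      using exhaust_4[of j] V(2) unfolding prod_4 sg_def by (auto simp: power4_eq_xxxx)
    also have "\<dots> \<le> (4 * \<rho>) ^ 4 * (r powr t / (s1 w * s2 w powr (t - 1)))"
      using s_pos[of w] r t \<rho> by (intro mult_left_mono min_mult_min_le) auto
    also have "\<dots> = (4 * \<rho>) ^ 4 * (r powr t / sv t w)" using t by (simp add: sv_eq_1_2')
    finally show "(\<Prod>i\<in>UNIV. q $ i - p $ i) \<le> (4 * \<rho>) ^ 4 * (r powr t / sv t w)" .
  qed simp
  finally show ?thesis by (simp add: mult.assoc)
qed

end

section \<open>Dependence of the coding map on one translation\<close>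

context contracting
begin

lemma code_add: "code (\<lambda>i. v i + v' i) x = code v x + code v' x"
  unfolding code_def by (subst suminf_add[OF summable_term_of summable_term_of])
    (simp add: term_of_def[abs_def] matrix_vector_right_distrib)

lemma code_scaleR: "code (\<lambda>i. c *\<^sub>R v i) x = c *\<^sub>R code v x"
  unfolding code_def by (subst suminf_scaleR_right[OF summable_term_of])
    (simp add: term_of_def[abs_def] matrix_vector_mult_scaleR)

text \<open>The coefficient with which the translation of the letter \<open>a\<close> enters the
  linear expression \<open>code v x\<close>.\<close>

definition coef :: "'i \<Rightarrow> (nat \<Rightarrow> 'i) \<Rightarrow> real^'n \<Rightarrow> real^'n" where
  "coef a x u = code (\<lambda>i. if i = a then u else 0) x"

lemma linear_coef: "linear (coef a x)"
proof (rule linearI)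
  fix u u' :: "real^'n" and r :: real
  have "(\<lambda>i. if i = a then u + u' else 0) = (\<lambda>i. (if i = a then u else 0) + (if i = a then u' else 0))" by auto
  then show "coef a x (u + u') = coef a x u + coef a x u'" by (simp only: coef_def code_add)
  have "(\<lambda>i. if i = a then r *\<^sub>R u else 0) = (\<lambda>i. r *\<^sub>R (if i = a then u else 0))" by auto
  then show "coef a x (r *\<^sub>R u) = r *\<^sub>R coef a x u" by (simp only: coef_def code_scaleR)
qed

lemma code_fun_upd: "code (v(a := u)) x = coef a x u + code (v(a := 0)) x"
proof -
  have "v(a := u) = (\<lambda>i. (if i = a then u else 0) + (v(a := 0)) i)" by auto
  then show ?thesis by (simp only: code_add coef_def)
qed

text \<open>Position 0 is left out because an occurrence there contributes the identity exactly; the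
  sum bounds the contribution of the later occurrences of \<open>a\<close>.\<close>

definition tail_weight :: "'i \<Rightarrow> (nat \<Rightarrow> 'i) \<Rightarrow> real" where
  "tail_weight a x = (\<Sum>k. if x (Suc k) = a then lam ^ Suc k else 0)"

lemma summable_tail_weight: "summable (\<lambda>k. if x (Suc k) = a then lam ^ Suc k else 0)"
proof (rule summable_comparison_test')
  show "summable (\<lambda>k. lam ^ k)" using lam by (intro summable_geometric) auto
  fix k :: nat
  have "lam ^ Suc k \<le> lam ^ k" using lam by (intro power_decreasing) auto
  then show "norm (if x (Suc k) = a then lam ^ Suc k else 0) \<le> lam ^ k" using lam by auto
qed

lemma coef_near: "norm (coef a x u - (if x 0 = a then u else 0)) \<le> tail_weight a x * norm u"
proof -
  let ?v = "\<lambda>i. if i = a then u else 0"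
  have 0: "term_of ?v x 0 = (if x 0 = a then u else 0)" by (simp add: term_of_def)
  have "coef a x u - (if x 0 = a then u else 0) = (\<Sum>k. term_of ?v x (Suc k))"
    unfolding coef_def code_def using suminf_split_head[OF summable_term_of, of ?v x] by (simp add: 0)
  also have "norm \<dots> \<le> (\<Sum>k. norm (term_of ?v x (Suc k)))"
    using summable_norm_term_of[of ?v x] summable_Suc_iff[of "\<lambda>k. norm (term_of ?v x k)"]
    by (intro summable_norm) blast
  also have "\<dots> \<le> (\<Sum>k. (if x (Suc k) = a then lam ^ Suc k else 0) * norm u)"
  proof (rule suminf_le)
    show "norm (term_of ?v x (Suc k)) \<le> (if x (Suc k) = a then lam ^ Suc k else 0) * norm u" for k
      using norm_matrix_word[of "map x [0..<Suc k]" u] by (auto simp: term_of_def simp del: upt_Suc)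
    show "summable (\<lambda>k. norm (term_of ?v x (Suc k)))"
      using summable_norm_term_of[of ?v x] summable_Suc_iff[of "\<lambda>k. norm (term_of ?v x k)"] by blast
    show "summable (\<lambda>k. (if x (Suc k) = a then lam ^ Suc k else 0) * norm u)"
      by (intro summable_mult2 summable_tail_weight)
  qed
  also have "\<dots> = tail_weight a x * norm u" unfolding tail_weight_def by (rule suminf_mult2[OF summable_tail_weight, symmetric])
  finally show ?thesis .
qed

text \<open>Different letters occupy different positions, so together they use each term of one
  geometric series at most once.\<close>

lemma tail_weight_add_le:
  assumes "a \<noteq> b" shows "tail_weight a x + tail_weight b x \<le> lam / (1 - lam)"
proof -
  have "tail_weight a x + tail_weight b x = (\<Sum>k. (if x (Suc k) = a then lam ^ Suc k else 0) + (if x (Suc k) = b then lam ^ Suc k else 0))"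
    unfolding tail_weight_def by (rule suminf_add[OF summable_tail_weight summable_tail_weight])
  also have "\<dots> \<le> (\<Sum>k. lam ^ k * lam)"
  proof (rule suminf_le)
    show "(if x (Suc k) = a then lam ^ Suc k else 0) + (if x (Suc k) = b then lam ^ Suc k else 0) \<le> lam ^ k * lam" for k
      using assms lam by auto
    show "summable (\<lambda>k. (if x (Suc k) = a then lam ^ Suc k else 0) + (if x (Suc k) = b then lam ^ Suc k else 0))"
      by (intro summable_add summable_tail_weight)
  qed (rule summable_geometric_lam)
  also have "\<dots> = lam / (1 - lam)"
    using lam suminf_mult2[of "\<lambda>k. lam ^ k" lam] by (simp add: suminf_geometric summable_geometric)
  finally show ?thesis .
qed

text \<open>Of the two letters by which \<open>x\<close> and \<open>y\<close> differ, one has a coefficient close to plus or minus the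
  identity, because the later occurrences of both letters share the total weight \<open>2 lam / (1 - lam)\<close>.\<close>

lemma coef_transversal:
  assumes "x 0 \<noteq> y 0" "lam < 1 / 2"
  obtains d where "\<And>u. (1 - lam / (1 - lam)) * norm u \<le> norm (coef d x u - coef d y u)"
    "\<And>u. norm (coef d x u - coef d y u) \<le> 2 * norm u"
proof -
  define \<kappa> where "\<kappa> = lam / (1 - lam)"
  have \<kappa>: "\<kappa> < 1" using assms(2) lam by (simp add: \<kappa>_def)
  have sum: "(tail_weight (x 0) x + tail_weight (x 0) y) + (tail_weight (y 0) x + tail_weight (y 0) y) \<le> 2 * \<kappa>"
    using tail_weight_add_le[OF assms(1), of x] tail_weight_add_le[OF assms(1), of y] by (simp add: \<kappa>_def)
  have main: "(1 - \<kappa>) * norm u \<le> norm (coef d x u - coef d y u) \<and> norm (coef d x u - coef d y u) \<le> 2 * norm u"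
    if d: "d = x 0 \<or> d = y 0" "tail_weight d x + tail_weight d y \<le> \<kappa>" for d u
  proof -
    define E where "E = (coef d x u - (if x 0 = d then u else 0)) - (coef d y u - (if y 0 = d then u else 0))"
    have "norm E \<le> tail_weight d x * norm u + tail_weight d y * norm u"
      unfolding E_def using norm_triangle_ineq4 coef_near[of d x u] coef_near[of d y u] by (smt (verit))
    also have "\<dots> \<le> \<kappa> * norm u" using d(2) by (simp flip: distrib_right add: mult_right_mono)
    finally have E: "norm E \<le> \<kappa> * norm u" .
    \<comment> \<open>\<open>d\<close> is the first letter of exactly one of \<open>x\<close> and
      \<open>y\<close>, so the leading terms leave plus or minus \<open>u\<close>.\<close>
    have "coef d x u - coef d y u = u + E \<or> coef d x u - coef d y u = E - u"
      using d(1) assms(1) by (auto simp: E_def)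
    then have "norm u - norm E \<le> norm (coef d x u - coef d y u) \<and> norm (coef d x u - coef d y u) \<le> norm u + norm E"
      using norm_diff_ineq[of u E] norm_triangle_ineq[of u E] norm_triangle_ineq4[of E u] norm_triangle_ineq2[of u E]
      by (auto simp: norm_minus_commute)
    moreover have "\<kappa> * norm u \<le> 1 * norm u" using \<kappa> by (intro mult_right_mono) auto
    ultimately show ?thesis using E by (auto simp: algebra_simps)
  qed
  have "tail_weight (x 0) x + tail_weight (x 0) y \<le> \<kappa> \<or> tail_weight (y 0) x + tail_weight (y 0) y \<le> \<kappa>" using sum by linarith
  then show ?thesis
  proof
    assume "tail_weight (x 0) x + tail_weight (x 0) y \<le> \<kappa>"
    then show ?thesis using main[of "x 0"] by (intro that[of "x 0"]) (auto simp: \<kappa>_def)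
  next
    assume "tail_weight (y 0) x + tail_weight (y 0) y \<le> \<kappa>"
    then show ?thesis using main[of "y 0"] by (intro that[of "y 0"]) (auto simp: \<kappa>_def)
  qed
qed

end

section \<open>Random translations and transversality\<close>

context two_blocks
begin

definition random_translation :: "(4 \<Rightarrow> real^4) \<Rightarrow> real \<Rightarrow> 4 \<Rightarrow> (real^4) measure" where
  "random_translation c \<epsilon> i = uniform_measure lborel (cball (c i) \<epsilon>)"

definition random_translations :: "(4 \<Rightarrow> real^4) \<Rightarrow> real \<Rightarrow> (4 \<Rightarrow> real^4) measure" where
  "random_translations c \<epsilon> = PiM UNIV (random_translation c \<epsilon>)"

lemma sets_random_translation [measurable_cong, simp]: "sets (random_translation c \<epsilon> i) = sets borel" "space (random_translation c \<epsilon> i) = UNIV"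
  by (simp_all add: random_translation_def)

lemma space_random_translations [simp]: "space (random_translations c \<epsilon>) = UNIV"
  by (simp add: random_translations_def space_PiM)

lemma emeasure_cball_pos:
  assumes "0 < \<epsilon>"
  obtains V where "0 < V" "\<And>a :: real^4. emeasure lborel (cball a \<epsilon>) = ennreal V"
proof (rule that[of "unit_ball_vol (real DIM(real^4)) * \<epsilon> ^ DIM(real^4)"])
  show "0 < unit_ball_vol (real DIM(real^4)) * \<epsilon> ^ DIM(real^4)" using assms by simp
  show "emeasure lborel (cball a \<epsilon>) = ennreal (unit_ball_vol (real DIM(real^4)) * \<epsilon> ^ DIM(real^4))" for a :: "real^4"
    using assms by (intro emeasure_cball) simp
qed

lemma prob_space_random_translation: "0 < \<epsilon> \<Longrightarrow> prob_space (random_translation c \<epsilon> i)"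
  unfolding random_translation_def by (rule emeasure_cball_pos[of \<epsilon>]) (auto intro!: prob_space_uniform_measure)

lemma prob_space_random_translations: "0 < \<epsilon> \<Longrightarrow> prob_space (random_translations c \<epsilon>)"
  unfolding random_translations_def by (intro prob_space_PiM prob_space_random_translation)

lemma AE_random_translations: 
  assumes "0 < \<epsilon>" shows "AE v in random_translations c \<epsilon>. v i \<in> cball (c i) \<epsilon>"
proof -
  have "AE u in random_translation c \<epsilon> i. u \<in> cball (c i) \<epsilon>"
    unfolding random_translation_def by (rule AE_uniform_measureI) auto
  then show ?thesis
    unfolding random_translations_def using assms by (intro AE_PiM_component prob_space_random_translation) auto
qed

text \<open>A finite prefix takes countably many values, and for a fixed prefix a term is continuous
  in the translations. Joint measurability is what Fubini's theorem needs.\<close>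

lemma measurable_code_pair:
  assumes f: "f \<in> measurable N (random_translations c \<epsilon>)" and g: "g \<in> measurable N word_borel"
  shows "(\<lambda>x. code (f x) (g x)) \<in> borel_measurable N"
proof -
  have "(\<lambda>x. term_of (f x) (g x) k) \<in> borel_measurable N" for k
  proof -
    have comp: "(\<lambda>x. f x i) \<in> borel_measurable N" for i
    proof -
      have "(\<lambda>v. v i) \<in> measurable (random_translations c \<epsilon>) (random_translation c \<epsilon> i)" unfolding random_translations_def by simp
      from measurable_compose[OF f this] show ?thesis by (simp add: measurable_cong_sets[OF refl sets_random_translation(1)])
    qed
    have "(\<lambda>x. (\<lambda>w x. matrix_word LB (butlast w) *v f x (last w)) (map (g x) [0..<Suc k]) x) \<in> borel_measurable N"
    proof (rule measurable_compose_countable[where f = "\<lambda>w x. matrix_word LB (butlast w) *v f x (last w)" and g = "\<lambda>x. map (g x) [0..<Suc k]"])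
      show "(\<lambda>x. map (g x) [0..<Suc k]) \<in> measurable N (count_space UNIV)"
        by (rule measurable_compose[OF g measurable_prefix])
      fix w :: "4 list"
      show "(\<lambda>x. matrix_word LB (butlast w) *v f x (last w)) \<in> borel_measurable N"
        by (rule borel_measurable_continuous_on[OF _ comp]) (rule matrix_vector_mult_linear_continuous_on)
    qed
    then show ?thesis by (simp add: term_of_def butlast_append)
  qed
  then show ?thesis unfolding code_def by measurable
qed

text \<open>By \<open>code_diff\<close> and \<open>coef_transversal\<close> the difference of the
  two points, as a function of the single translation \<open>v d\<close>, has the form treated in
  \<open>slab_volume\<close>, with constants independent of the other translations; so one
  integrates over \<open>v d\<close> first.\<close>

lemma transversality:
  assumes \<epsilon>: "0 < \<epsilon>" and \<alpha>2: "\<alpha> < 1 / 2" and t: "1 \<le> t" "t \<le> 2"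
  obtains K where "0 < K"
    "\<And>x y w r. x \<in> cyl w \<Longrightarrow> y \<in> cyl w \<Longrightarrow> x (length w) \<noteq> y (length w) \<Longrightarrow> 0 < r \<Longrightarrow>
      emeasure (random_translations c \<epsilon>) {v. norm (code v x - code v y) \<le> r} \<le> ennreal (K * (r powr t / sv t w))"
proof -
  define \<delta> where "\<delta> = 1 - \<alpha> / (1 - \<alpha>)"
  have \<delta>: "0 < \<delta>" using \<alpha>2 by (simp add: \<delta>_def)
  \<comment> \<open>Bounds the norm of every admissible translation; the summand 1 ensures
    \<open>1 \<le> \<rho>\<close>.\<close>
  define \<rho> where "\<rho> = 1 + (\<Sum>i\<in>UNIV. norm (c i)) + \<epsilon>"
  have \<rho>: "1 \<le> \<rho>" using \<epsilon> by (simp add: \<rho>_def sum_nonneg)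
  have in_\<rho>: "norm u \<le> \<rho>" if "u \<in> cball (c i) \<epsilon>" for u i
  proof -
    have "norm u \<le> norm (c i) + \<epsilon>" using that norm_triangle_ineq2[of u "c i"] by (simp add: dist_norm norm_minus_commute)
    moreover have "norm (c i) \<le> (\<Sum>i\<in>UNIV. norm (c i))" by (rule member_le_sum) auto
    ultimately show ?thesis by (simp add: \<rho>_def)
  qed
  obtain V where V: "0 < V" "\<And>a :: real^4. emeasure lborel (cball a \<epsilon>) = ennreal V"
    using emeasure_cball_pos[OF \<epsilon>] by blast
  define K0 where "K0 = measure lebesgue (cball (0::real^4) (2 / \<delta>)) * (4 * \<rho>) ^ 4"
  have K0: "0 \<le> K0" using \<rho> by (simp add: K0_def)
  \<comment> \<open>Dividing by the volume \<open>V\<close> normalises the uniform measure; adding 1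
    secures positivity.\<close>
  define K where "K = (K0 + 1) / V"
  have K: "0 < K" using V K0 by (simp add: K_def)
  have "emeasure (random_translations c \<epsilon>) {v. norm (code v x - code v y) \<le> r} \<le> ennreal (K * (r powr t / sv t w))"
    if x: "x \<in> cyl w" and y: "y \<in> cyl w" and ne: "x (length w) \<noteq> y (length w)" and r: "0 < r" for x y w r
  proof -
    let ?n = "length w"
    define x' y' where "x' k = x (?n + k)" and "y' k = y (?n + k)" for k
    have "x' 0 \<noteq> y' 0" using ne by (simp add: x'_def y'_def)
    then obtain d where d: "\<And>u. \<delta> * norm u \<le> norm (coef d x' u - coef d y' u)"
      "\<And>u. norm (coef d x' u - coef d y' u) \<le> 2 * norm u"
      using coef_transversal[of x' y'] \<alpha>2 unfolding \<delta>_def by blast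
    have lin: "linear (\<lambda>u. coef d x' u - coef d y' u)" by (intro linear_compose_sub linear_coef)
    have svp: "0 < sv t w" using t s_pos[of w] by (simp add: sv_eq_1_2')
    have diff: "code v x - code v y = matrix_word LB w *v (code v x' - code v y')" for v
    proof -
      have "x k = y k" if "k < ?n" for k using x y that by (simp add: cyl_iff_nth)
      moreover have "map x [0..<?n] = w" using x by (simp add: cyl_iff)
      ultimately show ?thesis using code_diff[of ?n x y v] by (simp add: x'_def[abs_def] y'_def[abs_def])
    qed
    have inner: "{u. norm (code (vv(d := u)) x - code (vv(d := u)) y) \<le> r} \<in> sets borel \<and>
      emeasure (random_translation c \<epsilon> d) {u. norm (code (vv(d := u)) x - code (vv(d := u)) y) \<le> r} \<le> ennreal (K * (r powr t / sv t w))" for vv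
    proof -
      define z where "z = code (vv(d := 0)) x' - code (vv(d := 0)) y'"
      have eq: "code (vv(d := u)) x - code (vv(d := u)) y = matrix_word LB w *v ((coef d x' u - coef d y' u) + z)" for u
        unfolding diff by (subst (1 2) code_fun_upd) (simp add: z_def algebra_simps)
      let ?S = "{u. norm (matrix_word LB w *v ((coef d x' u - coef d y' u) + z)) \<le> r}"
      have Sb: "?S \<in> sets borel"
      proof -
        have "continuous_on UNIV (coef d x)" for x
          using linear_coef[of d x] by (simp add: linear_continuous_on linear_conv_bounded_linear)
        then have "continuous_on UNIV (\<lambda>u. matrix_word LB w *v ((coef d x' u - coef d y' u) + z))"
          by (intro continuous_on_compose2[OF matrix_vector_mult_linear_continuous_on] continuous_intros) auto
        then have "closed ?S" by (intro closed_Collect_le continuous_intros)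
        then show ?thesis by (rule borel_closed)
      qed
      have "emeasure (random_translation c \<epsilon> d) ?S = emeasure lborel (cball (c d) \<epsilon> \<inter> ?S) / emeasure lborel (cball (c d) \<epsilon>)"
        unfolding random_translation_def using Sb by (intro emeasure_uniform_measure) auto
      also have "\<dots> \<le> ennreal (K0 * (r powr t / sv t w)) / ennreal V"
        unfolding V(2)
      proof (rule divide_right_mono_ennreal)
        have "emeasure lborel (cball (c d) \<epsilon> \<inter> ?S) \<le> emeasure lborel {u. norm u \<le> \<rho> \<and> norm (matrix_word LB w *v ((coef d x' u - coef d y' u) + z)) \<le> r}"
        proof (rule emeasure_mono)
          show "cball (c d) \<epsilon> \<inter> ?S \<subseteq> {u. norm u \<le> \<rho> \<and> norm (matrix_word LB w *v ((coef d x' u - coef d y' u) + z)) \<le> r}"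
            using in_\<rho>[of _ d] by auto
          have "{u. norm u \<le> \<rho> \<and> norm (matrix_word LB w *v ((coef d x' u - coef d y' u) + z)) \<le> r} = cball 0 \<rho> \<inter> ?S" by auto
          then show "{u. norm u \<le> \<rho> \<and> norm (matrix_word LB w *v ((coef d x' u - coef d y' u) + z)) \<le> r} \<in> sets lborel"
            using Sb by simp
        qed
        also have "\<dots> \<le> ennreal (K0 * (r powr t / sv t w))"
          unfolding K0_def by (rule slab_volume[OF lin d \<delta> \<rho> r t])
        finally show "emeasure lborel (cball (c d) \<epsilon> \<inter> ?S) \<le> ennreal (K0 * (r powr t / sv t w))" .
      qed
      also have "\<dots> = ennreal (K0 * (r powr t / sv t w) / V)"
        using V(1) K0 svp by (intro divide_ennreal) auto
      also have "\<dots> \<le> ennreal (K * (r powr t / sv t w))"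
      proof (rule ennreal_leI)
        have "K0 * (r powr t / sv t w) \<le> (K0 + 1) * (r powr t / sv t w)"
          using svp by (intro mult_right_mono) auto
        then have "K0 * (r powr t / sv t w) / V \<le> (K0 + 1) * (r powr t / sv t w) / V"
          using V(1) by (intro divide_right_mono) auto
        then show "K0 * (r powr t / sv t w) / V \<le> K * (r powr t / sv t w)" by (simp add: K_def mult_ac)
      qed
      finally show ?thesis using Sb by (simp only: eq simp_thms)
    qed
    let ?E = "{v. norm (code v x - code v y) \<le> r}"
    have E: "?E \<in> sets (random_translations c \<epsilon>)"
    proof -
      have "(\<lambda>v. code v x) \<in> borel_measurable (random_translations c \<epsilon>)" for x
        by (rule measurable_code_pair[OF measurable_ident_sets]) auto
      then have "(\<lambda>v. norm (code v x - code v y)) \<in> borel_measurable (random_translations c \<epsilon>)" by measurable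
      from measurable_sets[OF this, of "{..r}"] show ?thesis by (simp add: vimage_def)
    qed
    interpret M: prob_space "random_translation c \<epsilon> i" for i by (rule prob_space_random_translation[OF \<epsilon>])
    interpret PS: product_sigma_finite "random_translation c \<epsilon>" by standard
    interpret Q: prob_space "PiM (UNIV - {d}) (random_translation c \<epsilon>)" by (rule prob_space_PiM) (rule M.prob_space_axioms)
    have ins: "insert d (UNIV - {d}) = UNIV" by auto
    have "emeasure (random_translations c \<epsilon>) ?E = (\<integral>\<^sup>+ v. indicator ?E v \<partial>PiM (insert d (UNIV - {d})) (random_translation c \<epsilon>))"
      unfolding ins using E by (simp add: random_translations_def)
    also have "\<dots> = (\<integral>\<^sup>+ vv. (\<integral>\<^sup>+ u. indicator ?E (vv(d := u)) \<partial>random_translation c \<epsilon> d) \<partial>PiM (UNIV - {d}) (random_translation c \<epsilon>))"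
      using E unfolding random_translations_def by (intro PS.product_nn_integral_insert) (auto simp: ins)
    also have "\<dots> \<le> (\<integral>\<^sup>+ vv. ennreal (K * (r powr t / sv t w)) \<partial>PiM (UNIV - {d}) (random_translation c \<epsilon>))"
    proof (rule nn_integral_mono)
      fix vv
      let ?S = "{u. norm (code (vv(d := u)) x - code (vv(d := u)) y) \<le> r}"
      have "(\<integral>\<^sup>+ u. indicator ?E (vv(d := u)) \<partial>random_translation c \<epsilon> d) = (\<integral>\<^sup>+ u. indicator ?S u \<partial>random_translation c \<epsilon> d)"
        by (intro nn_integral_cong) (simp add: indicator_def)
      also have "\<dots> = emeasure (random_translation c \<epsilon> d) ?S" using inner[of vv] by (intro nn_integral_indicator) simp
      also have "\<dots> \<le> ennreal (K * (r powr t / sv t w))" using inner[of vv] by blast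
      finally show "(\<integral>\<^sup>+ u. indicator ?E (vv(d := u)) \<partial>random_translation c \<epsilon> d) \<le> ennreal (K * (r powr t / sv t w))" .
    qed
    also have "\<dots> = ennreal (K * (r powr t / sv t w))" by (simp add: Q.emeasure_space_1)
    finally show ?thesis .
  qed
  with K show ?thesis by (rule that)
qed

end

section \<open>Energy estimate at dyadic scales\<close>

lemma nn_integral_double_sum:
  assumes "\<And>n w. f n w \<in> borel_measurable M" "\<And>w. g w \<in> borel_measurable M"
  shows "(\<integral>\<^sup>+ y. (\<Sum>n\<in>A. \<Sum>w\<in>B n. f n w y) + (\<Sum>w\<in>C. g w y) \<partial>M)
    = (\<Sum>n\<in>A. \<Sum>w\<in>B n. integral\<^sup>N M (f n w)) + (\<Sum>w\<in>C. integral\<^sup>N M (g w))"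
  using assms by (simp add: nn_integral_add nn_integral_sum)

context two_blocks
begin

lemma sv_le_power: "1 \<le> t \<Longrightarrow> t \<le> 2 \<Longrightarrow> sv t w \<le> (\<alpha> ^ length w) powr t"
proof -
  assume t: "1 \<le> t" "t \<le> 2"
  have "sv t w = s1 w * s2 w powr (t - 1)" by (rule sv_eq_1_2'[OF t])
  also have "\<dots> \<le> s1 w * s1 w powr (t - 1)"
    using s_pos[of w] s2_bounds(1)[of w] t by (intro mult_left_mono powr_mono2) auto
  also have "\<dots> = s1 w powr t" using s_pos(1)[of w] by (simp add: powr_diff)
  also have "\<dots> \<le> (\<alpha> ^ length w) powr t"
    using s_pos(1)[of w] s1_bounds(1)[of w] t by (intro powr_mono2) auto
  finally show ?thesis .
qed

text \<open>Let \<open>I k\<close> be the expected mass, for the product of \<open>\<mu>\<close>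
  with itself, of the pairs at distance at most \<open>(1/2) ^ k\<close>. Split the pairs by the
  length \<open>n\<close> of their common prefix \<open>w\<close>: transversality costs
  \<open>1 / sv t w\<close>, and the Gibbs bound
  \<open>measure \<mu> (cyl w) \<le> C * sv t w\<close> for one of the two points cancels it, so
  each \<open>n\<close> contributes at most the same amount. As only \<open>O(k)\<close> lengths
  matter, \<open>I k\<close> is at most of order \<open>(k + 1) * ((1/2) ^ k) powr t\<close>, and a
  weighted sum over \<open>k\<close> finishes by Fubini.\<close>

lemma lower_local_dimension:
  assumes \<epsilon>: "0 < \<epsilon>" and \<alpha>2: "\<alpha> < 1 / 2" and t: "1 \<le> t" "t \<le> 2"
    and "prob_space \<mu>" and s: "sets \<mu> = sets word_borel"
    and up: "\<And>w. measure \<mu> (cyl w) \<le> C * sv t w" and "0 < C"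
  shows "AE v in random_translations c \<epsilon>. AE x in \<mu>. \<exists>S. \<forall>k. measure \<mu> {y. norm (code v x - code v y) \<le> (1/2) ^ k}
    \<le> S * (real k + 1) ^ 3 * ((1/2) ^ k) powr t"
proof -
  interpret prob_space \<mu> by fact
  interpret P: prob_space "random_translations c \<epsilon>" by (rule prob_space_random_translations[OF \<epsilon>])
  have sp: "space \<mu> = UNIV" using sets_eq_imp_space_eq[OF s] by simp
  obtain K where K: "0 < K"
    "\<And>x y w r. x \<in> cyl w \<Longrightarrow> y \<in> cyl w \<Longrightarrow> x (length w) \<noteq> y (length w) \<Longrightarrow> 0 < r \<Longrightarrow>
      emeasure (random_translations c \<epsilon>) {v. norm (code v x - code v y) \<le> r} \<le> ennreal (K * (r powr t / sv t w))"
    by (rule transversality[OF \<epsilon> \<alpha>2 t, of c]) (rule that)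
  have svp: "0 < sv t w" for w using t s_pos[of w] by (simp add: sv_eq_1_2')
  have sum1: "(\<Sum>w | length w = n. measure \<mu> (cyl w)) = 1" for n
    using measure_split_cyl[OF finite_measure_axioms s, of UNIV n] prob_space sets.top[of word_borel] by (simp add: sp)
  define h :: "nat \<Rightarrow> (4 \<Rightarrow> real^4) \<Rightarrow> (nat \<Rightarrow> 4) \<Rightarrow> (nat \<Rightarrow> 4) \<Rightarrow> ennreal" where
    "h k v x y = indicator {z. norm z \<le> (1/2) ^ k} (code v x - code v y)" for k v x y
  have cylm: "cyl w \<in> sets \<mu>" for w by (simp add: s)
  have code_m: "(\<lambda>x. code (f x) (g x)) \<in> borel_measurable N"
    if "f \<in> measurable N (random_translations c \<epsilon>)" "g \<in> measurable N \<mu>" for f g and N :: "'z measure"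
    using that measurable_code_pair[of f N c \<epsilon> g] measurable_cong_sets[OF refl s] by blast
  have ball_m: "{z :: real^4. norm z \<le> r} \<in> sets borel" for r
  proof -
    have "{z :: real^4. norm z \<le> r} = cball 0 r" by auto
    then show ?thesis by simp
  qed
  have h_m: "(\<lambda>x. h k (f x) (g x) (g' x)) \<in> borel_measurable N"
    if "f \<in> measurable N (random_translations c \<epsilon>)" "g \<in> measurable N \<mu>" "g' \<in> measurable N \<mu>" for k f g g' and N :: "'z measure"
    unfolding h_def
    by (rule measurable_compose[OF _ borel_measurable_indicator[OF ball_m]])
       (intro borel_measurable_diff code_m that)
  \<comment> \<open>From length \<open>k * N0\<close> on, \<open>sv t w\<close> is at most
    \<open>((1/2) ^ k) powr t\<close>; the trivial bound 1 on the probability is then good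
    enough.\<close>
  define N0 where "N0 = (SOME n. \<alpha> ^ n \<le> 1/2)"
  have "\<exists>n. \<alpha> ^ n \<le> 1/2" using real_arch_pow_inv[of "1/2" \<alpha>] \<alpha>_less by (auto intro: less_imp_le)
  then have N0: "\<alpha> ^ N0 \<le> 1/2" unfolding N0_def by (rule someI_ex)
  define D where "D = real N0 * K * C + C"
  have D: "0 \<le> D" using K \<open>0 < C\<close> by (simp add: D_def)
  define I where "I k = (\<integral>\<^sup>+ x. \<integral>\<^sup>+ y. emeasure (random_translations c \<epsilon>) {v. norm (code v x - code v y) \<le> (1/2) ^ k} \<partial>\<mu> \<partial>\<mu>)" for k
  have I_le: "I k \<le> ennreal (D * (real k + 1) * ((1/2) ^ k) powr t)" for k
  proof -
    let ?r = "(1/2 :: real) ^ k"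
    let ?N = "k * N0"
    let ?R = "?r powr t"
    let ?i = "\<lambda>w x. indicator (cyl w) x :: ennreal"
    let ?b = "\<lambda>x y. (\<Sum>n<?N. \<Sum>w | length w = n. ennreal (K * (?R / sv t w)) * (?i w x * ?i w y)) + (\<Sum>w | length w = ?N. 1 * (?i w x * ?i w y))"
    have pw: "emeasure (random_translations c \<epsilon>) {v. norm (code v x - code v y) \<le> ?r} \<le> ?b x y" for x y
    proof (cases "\<forall>j<?N. x j = y j")
      case True
      then have "map x [0..<?N] = map y [0..<?N]" by simp
      then have "y \<in> cyl (map x [0..<?N])" by (simp add: cyl_iff)
      then have "1 = 1 * (?i (map x [0..<?N]) x * ?i (map x [0..<?N]) y)" by simp
      also have "\<dots> \<le> (\<Sum>w | length w = ?N. 1 * (?i w x * ?i w y))"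
        by (rule member_le_sum[of _ _ "\<lambda>w. 1 * (?i w x * ?i w y)"]) auto
      finally have "1 \<le> (\<Sum>w | length w = ?N. 1 * (?i w x * ?i w y))" .
      then show ?thesis using P.emeasure_le_1[of "{v. norm (code v x - code v y) \<le> ?r}"] 
        by (meson add_increasing order_trans zero_le)
    next
      case False
      define n where "n = (LEAST j. x j \<noteq> y j)"
      obtain i where i: "i < ?N" "x i \<noteq> y i" using False by blast
      have n1: "x n \<noteq> y n" unfolding n_def by (rule LeastI[of "\<lambda>j. x j \<noteq> y j" i]) (rule i(2))
      have n2: "x j = y j" if "j < n" for j using not_less_Least[of j "\<lambda>j. x j \<noteq> y j"] that by (simp add: n_def)
      have nN: "n < ?N" using Least_le[of "\<lambda>j. x j \<noteq> y j" i, OF i(2)] i(1) by (simp add: n_def)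
      let ?w = "map x [0..<n]"
      have yw: "y \<in> cyl ?w" using n2 by (simp add: cyl_iff_nth)
      have "emeasure (random_translations c \<epsilon>) {v. norm (code v x - code v y) \<le> ?r} \<le> ennreal (K * (?R / sv t ?w))"
        using n1 yw by (intro K(2)) auto
      also have "\<dots> = ennreal (K * (?R / sv t ?w)) * (?i ?w x * ?i ?w y)" using yw by simp
      also have "\<dots> \<le> (\<Sum>w | length w = n. ennreal (K * (?R / sv t w)) * (?i w x * ?i w y))"
        by (rule member_le_sum[of _ _ "\<lambda>w. ennreal (K * (?R / sv t w)) * (?i w x * ?i w y)"]) auto
      also have "\<dots> \<le> (\<Sum>n<?N. \<Sum>w | length w = n. ennreal (K * (?R / sv t w)) * (?i w x * ?i w y))"
        using nN by (intro member_le_sum[of _ _ "\<lambda>n. \<Sum>w | length w = n. ennreal (K * (?R / sv t w)) * (?i w x * ?i w y)"]) auto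
      also have "\<dots> \<le> ?b x y" by (rule add_increasing2) auto
      finally show ?thesis .
    qed
    let ?k = "\<lambda>w. ennreal (K * (?R / sv t w))" and ?m = "\<lambda>w. emeasure \<mu> (cyl w)"
    have im: "(\<lambda>y. q * ?i w y) \<in> borel_measurable \<mu>" for q w
      using cylm[of w] by (intro borel_measurable_times_ennreal borel_measurable_indicator) auto
    have assoc: "q * (?i w x * ?i w y) = (q * ?i w x) * ?i w y" for q w x y by (simp only: mult.assoc)
    have int1: "(\<integral>\<^sup>+ y. q * (?i w x * ?i w y) \<partial>\<mu>) = (q * ?m w) * ?i w x" for q w x
    proof -
      have "(\<integral>\<^sup>+ y. q * (?i w x * ?i w y) \<partial>\<mu>) = (q * ?i w x) * ?m w"
        unfolding assoc by (rule nn_integral_cmult_indicator[OF cylm])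
      then show ?thesis by (simp only: mult.assoc mult.commute[of "?i w x"])
    qed
    have int2: "(\<integral>\<^sup>+ x. (q * ?m w) * ?i w x \<partial>\<mu>) = q * (?m w * ?m w)" for q w
      by (subst nn_integral_cmult_indicator[OF cylm]) (simp only: mult.assoc)
    have inner: "(\<integral>\<^sup>+ y. ?b x y \<partial>\<mu>) = (\<Sum>n<?N. \<Sum>w | length w = n. (?k w * ?m w) * ?i w x) + (\<Sum>w | length w = ?N. (1 * ?m w) * ?i w x)" for x
    proof -
      have "(\<integral>\<^sup>+ y. ?b x y \<partial>\<mu>) = (\<Sum>n<?N. \<Sum>w | length w = n. \<integral>\<^sup>+ y. ?k w * (?i w x * ?i w y) \<partial>\<mu>) + (\<Sum>w | length w = ?N. \<integral>\<^sup>+ y. 1 * (?i w x * ?i w y) \<partial>\<mu>)"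
        unfolding assoc by (rule nn_integral_double_sum; rule im)
      then show ?thesis unfolding int1 .
    qed
    have "I k \<le> (\<integral>\<^sup>+ x. \<integral>\<^sup>+ y. ?b x y \<partial>\<mu> \<partial>\<mu>)"
      unfolding I_def by (intro nn_integral_mono pw)
    also have "\<dots> = (\<Sum>n<?N. \<Sum>w | length w = n. ?k w * (?m w * ?m w)) + (\<Sum>w | length w = ?N. 1 * (?m w * ?m w))"
      unfolding inner by (subst nn_integral_double_sum) (rule im | simp only: int2)+
    \<comment> \<open>One factor \<open>measure \<mu> (cyl w)\<close> is bounded by
      \<open>C * sv t w\<close>; this cancels \<open>1 / sv t w\<close> in the first sum and
      supplies \<open>?R\<close> in the second. The remaining factor sums to 1 over each
      length.\<close>
    also have "\<dots> \<le> (\<Sum>n<?N. \<Sum>w | length w = n. ennreal (K * C * ?R * measure \<mu> (cyl w))) + (\<Sum>w | length w = ?N. ennreal (C * ?R * measure \<mu> (cyl w)))"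
    proof (intro add_mono sum_mono)
      fix w :: "4 list"
      let ?m = "measure \<mu> (cyl w)"
      have "ennreal (K * (?R / sv t w)) * (emeasure \<mu> (cyl w) * emeasure \<mu> (cyl w)) = ennreal (K * (?R / sv t w) * (?m * ?m))"
      proof -
        have q: "0 \<le> K * (?R / sv t w)" using K(1) svp[of w] by simp
        show ?thesis by (simp only: emeasure_eq_measure ennreal_mult'[OF q] ennreal_mult'[OF measure_nonneg])
      qed
      also have "\<dots> \<le> ennreal (K * (?R / sv t w) * ((C * sv t w) * ?m))"
        using K svp[of w] up[of w] by (intro ennreal_leI mult_left_mono mult_right_mono) auto
      also have "K * (?R / sv t w) * ((C * sv t w) * ?m) = K * C * ?R * ?m" using svp[of w] by simp
      finally show "ennreal (K * (?R / sv t w)) * (emeasure \<mu> (cyl w) * emeasure \<mu> (cyl w)) \<le> ennreal (K * C * ?R * ?m)" .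
    next
      fix w :: "4 list" assume w: "w \<in> {w. length w = ?N}"
      let ?m = "measure \<mu> (cyl w)"
      have "?m \<le> C * sv t w" by (rule up)
      also have "\<dots> \<le> C * ?R"
      proof (intro mult_left_mono)
        have "\<alpha> ^ ?N = (\<alpha> ^ N0) ^ k" by (simp add: power_mult mult.commute[of k])
        also have "\<dots> \<le> ?r" using N0 \<alpha>_pos by (intro power_mono) auto
        finally have "(\<alpha> ^ ?N) powr t \<le> ?R" using \<alpha>_pos t by (intro powr_mono2) auto
        then show "sv t w \<le> ?R" using sv_le_power[OF t, of w] w by simp
      qed (use \<open>0 < C\<close> in simp)
      finally have "?m * ?m \<le> C * ?R * ?m" by (intro mult_right_mono) auto
      then show "1 * (emeasure \<mu> (cyl w) * emeasure \<mu> (cyl w)) \<le> ennreal (C * ?R * ?m)"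
        by (simp add: emeasure_eq_measure ennreal_mult[symmetric] ennreal_leI)
    qed
    also have "\<dots> = ennreal ((\<Sum>n<?N. \<Sum>w | length w = n. K * C * ?R * measure \<mu> (cyl w)) + (\<Sum>w | length w = ?N. C * ?R * measure \<mu> (cyl w)))"
      using K \<open>0 < C\<close> by (simp add: sum_ennreal sum_nonneg)
    also have "(\<Sum>n<?N. \<Sum>w | length w = n. K * C * ?R * measure \<mu> (cyl w)) + (\<Sum>w | length w = ?N. C * ?R * measure \<mu> (cyl w))
       = real ?N * (K * C * ?R) + C * ?R"
      by (simp add: sum1 flip: sum_distrib_left)
    also have "\<dots> \<le> D * (real k + 1) * ?R"
    proof -
      have "D * (real k + 1) * ?R - (real ?N * (K * C * ?R) + C * ?R) = (real N0 * K * C + real k * C) * ?R"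
        by (simp add: D_def algebra_simps)
      moreover have "0 \<le> (real N0 * K * C + real k * C) * ?R" using K \<open>0 < C\<close> by simp
      ultimately show ?thesis by linarith
    qed
    finally show ?thesis by (simp add: ennreal_leI)
  qed
  have I_eq: "I k = (\<integral>\<^sup>+ v. \<integral>\<^sup>+ x. \<integral>\<^sup>+ y. h k v x y \<partial>\<mu> \<partial>\<mu> \<partial>random_translations c \<epsilon>)" for k
  proof -
    interpret PP: pair_sigma_finite "random_translations c \<epsilon>" \<mu> by standard
    have "(\<integral>\<^sup>+ v. \<integral>\<^sup>+ x. \<integral>\<^sup>+ y. h k v x y \<partial>\<mu> \<partial>\<mu> \<partial>random_translations c \<epsilon>) = (\<integral>\<^sup>+ x. \<integral>\<^sup>+ v. \<integral>\<^sup>+ y. h k v x y \<partial>\<mu> \<partial>random_translations c \<epsilon> \<partial>\<mu>)"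
    proof (rule PP.Fubini'[symmetric])
      have "(\<lambda>p. \<integral>\<^sup>+ y. h k (fst p) (snd p) y \<partial>\<mu>) \<in> borel_measurable (random_translations c \<epsilon> \<Otimes>\<^sub>M \<mu>)"
      proof (rule borel_measurable_nn_integral)
        show "(\<lambda>(p, y). h k (fst p) (snd p) y) \<in> borel_measurable ((random_translations c \<epsilon> \<Otimes>\<^sub>M \<mu>) \<Otimes>\<^sub>M \<mu>)"
          unfolding case_prod_beta by (intro h_m) measurable
      qed
      then show "(\<lambda>(v, x). \<integral>\<^sup>+ y. h k v x y \<partial>\<mu>) \<in> borel_measurable (random_translations c \<epsilon> \<Otimes>\<^sub>M \<mu>)"
        by (simp add: case_prod_beta)
    qed
    also have "\<dots> = (\<integral>\<^sup>+ x. \<integral>\<^sup>+ y. \<integral>\<^sup>+ v. h k v x y \<partial>random_translations c \<epsilon> \<partial>\<mu> \<partial>\<mu>)"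
    proof (intro nn_integral_cong PP.Fubini'[symmetric])
      fix x assume "x \<in> space \<mu>"
      then show "(\<lambda>(v, y). h k v x y) \<in> borel_measurable (random_translations c \<epsilon> \<Otimes>\<^sub>M \<mu>)"
        unfolding case_prod_beta by (intro h_m) measurable
    qed
    also have "\<dots> = I k"
      unfolding I_def
    proof (intro nn_integral_cong)
      fix x y
      have "{v. norm (code v x - code v y) \<le> (1/2) ^ k} \<in> sets (random_translations c \<epsilon>)"
      proof -
        have "(\<lambda>v. code v x - code v y) \<in> borel_measurable (random_translations c \<epsilon>)"
          by (intro borel_measurable_diff code_m) (auto simp: sp)
        from measurable_sets[OF this ball_m] show ?thesis by (simp add: vimage_def)
      qed
      then have "emeasure (random_translations c \<epsilon>) {v. norm (code v x - code v y) \<le> (1/2) ^ k} = (\<integral>\<^sup>+ v. indicator {v. norm (code v x - code v y) \<le> (1/2) ^ k} v \<partial>random_translations c \<epsilon>)"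
        by simp
      then show "(\<integral>\<^sup>+ v. h k v x y \<partial>random_translations c \<epsilon>) = emeasure (random_translations c \<epsilon>) {v. norm (code v x - code v y) \<le> (1/2) ^ k}"
        by (simp add: h_def indicator_def)
    qed
    finally show ?thesis by simp
  qed
  \<comment> \<open>One power of \<open>k + 1\<close> compensates the factor in \<open>I_le\<close>,
    two more make the series converge; together they give the cube in the conclusion.\<close>
  define a where "a k = 1 / ((real k + 1) ^ 3 * ((1/2) ^ k) powr t)" for k
  have a: "0 < a k" for k by (simp add: a_def)
  define G where "G v x = (\<Sum>k. ennreal (a k) * (\<integral>\<^sup>+ y. h k v x y \<partial>\<mu>))" for v x
  have hx_m: "(\<lambda>p. \<integral>\<^sup>+ y. h k (f p) (g p) y \<partial>\<mu>) \<in> borel_measurable N"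
    if "f \<in> measurable N (random_translations c \<epsilon>)" "g \<in> measurable N \<mu>" for k f g and N :: "'z measure"
  proof (rule borel_measurable_nn_integral)
    show "(\<lambda>(p, y). h k (f p) (g p) y) \<in> borel_measurable (N \<Otimes>\<^sub>M \<mu>)"
      unfolding case_prod_beta
      by (intro h_m measurable_compose[OF measurable_fst that(1)] measurable_compose[OF measurable_fst that(2)] measurable_snd)
  qed
  have hvx: "(\<lambda>x. \<integral>\<^sup>+ y. h k v x y \<partial>\<mu>) \<in> borel_measurable \<mu>" for k v
    by (rule hx_m) auto
  have hv: "(\<lambda>v. \<integral>\<^sup>+ x. \<integral>\<^sup>+ y. h k v x y \<partial>\<mu> \<partial>\<mu>) \<in> borel_measurable (random_translations c \<epsilon>)" for k
  proof (rule borel_measurable_nn_integral)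
    show "(\<lambda>(v, x). \<integral>\<^sup>+ y. h k v x y \<partial>\<mu>) \<in> borel_measurable (random_translations c \<epsilon> \<Otimes>\<^sub>M \<mu>)"
      unfolding case_prod_beta by (rule hx_m) measurable
  qed
  have Gv: "(\<integral>\<^sup>+ x. G v x \<partial>\<mu>) = (\<Sum>k. ennreal (a k) * (\<integral>\<^sup>+ x. \<integral>\<^sup>+ y. h k v x y \<partial>\<mu> \<partial>\<mu>))" for v
    unfolding G_def using hvx by (simp add: nn_integral_suminf nn_integral_cmult)
  have "(\<integral>\<^sup>+ v. \<integral>\<^sup>+ x. G v x \<partial>\<mu> \<partial>random_translations c \<epsilon>) = (\<Sum>k. ennreal (a k) * I k)"
    unfolding Gv using hv by (simp add: nn_integral_suminf nn_integral_cmult I_eq)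
  also have "\<dots> \<le> (\<Sum>k. ennreal (D * (1 / (real (Suc k)) ^ 2)))"
  proof (intro suminf_le summableI)
    fix k
    have "ennreal (a k) * I k \<le> ennreal (a k) * ennreal (D * (real k + 1) * ((1/2) ^ k) powr t)"
      by (intro mult_left_mono I_le) simp
    also have "\<dots> = ennreal (a k * (D * (real k + 1) * ((1/2) ^ k) powr t))"
      using a[of k] D by (intro ennreal_mult[symmetric]) auto
    also have "a k * (D * (real k + 1) * ((1/2) ^ k) powr t) = D * (1 / (real (Suc k)) ^ 2)"
      by (simp add: a_def power3_eq_cube power2_eq_square add.commute)
    finally show "ennreal (a k) * I k \<le> ennreal (D * (1 / (real (Suc k)) ^ 2))" .
  qed
  also have "\<dots> < \<top>"
  proof -
    have "summable (\<lambda>k. D * (1 / (real (Suc k)) ^ 2))"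
    proof (rule summable_mult)
      have "summable (\<lambda>k. inverse (real k ^ 2))" by (rule inverse_power_summable) simp
      then have "summable (\<lambda>k. inverse (real (Suc k) ^ 2))" by (subst summable_Suc_iff)
      then show "summable (\<lambda>k. 1 / (real (Suc k)) ^ 2)" by (simp add: inverse_eq_divide del: of_nat_Suc)
    qed
    then show ?thesis using D by (subst suminf_ennreal2) auto
  qed
  finally have "(\<integral>\<^sup>+ v. \<integral>\<^sup>+ x. G v x \<partial>\<mu> \<partial>random_translations c \<epsilon>) \<noteq> \<infinity>" by simp
  moreover have "(\<lambda>v. \<integral>\<^sup>+ x. G v x \<partial>\<mu>) \<in> borel_measurable (random_translations c \<epsilon>)"
    unfolding Gv by (intro borel_measurable_suminf_order borel_measurable_times_ennreal borel_measurable_const hv)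
  ultimately have "AE v in random_translations c \<epsilon>. (\<integral>\<^sup>+ x. G v x \<partial>\<mu>) \<noteq> \<infinity>"
    by (intro nn_integral_PInf_AE)
  then show ?thesis
  proof eventually_elim
    case (elim v)
    moreover have "(\<lambda>x. G v x) \<in> borel_measurable \<mu>"
      unfolding G_def by (intro borel_measurable_suminf_order borel_measurable_times_ennreal borel_measurable_const hvx)
    ultimately have "AE x in \<mu>. G v x \<noteq> \<infinity>"
      by (intro nn_integral_PInf_AE)
    then show ?case
    proof eventually_elim
      case (elim x)
      define S where "S = enn2real (G v x)"
      have G: "G v x = ennreal S" using elim by (simp add: S_def less_top)
      have "measure \<mu> {y. norm (code v x - code v y) \<le> (1/2) ^ k} \<le> S * (real k + 1) ^ 3 * ((1/2) ^ k) powr t" for k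
      proof -
        let ?B = "{y. norm (code v x - code v y) \<le> (1/2) ^ k}"
        have B: "?B \<in> sets \<mu>"
        proof -
          have "(\<lambda>y. code v x - code v y) \<in> borel_measurable \<mu>"
            by (intro borel_measurable_diff code_m) (auto simp: sp)
          from measurable_sets[OF this ball_m] show ?thesis by (simp add: vimage_def sp)
        qed
        have "ennreal (a k) * emeasure \<mu> ?B = ennreal (a k) * (\<integral>\<^sup>+ y. indicator ?B y \<partial>\<mu>)" using B by simp
        also have "\<dots> = ennreal (a k) * (\<integral>\<^sup>+ y. h k v x y \<partial>\<mu>)" by (simp add: h_def indicator_def)
        also have "\<dots> \<le> G v x" 
          unfolding G_def using sum_le_suminf[of "\<lambda>k. ennreal (a k) * (\<integral>\<^sup>+ y. h k v x y \<partial>\<mu>)" "{k}"] by simp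
        finally have "ennreal (a k * measure \<mu> ?B) \<le> ennreal S"
          using a[of k] by (simp add: G emeasure_eq_measure ennreal_mult less_imp_le)
        then have "a k * measure \<mu> ?B \<le> S" by (simp add: S_def)
        then show ?thesis by (simp add: a_def field_simps)
      qed
      then show ?case by blast
    qed
  qed
qed

end

section \<open>Exact dimensionality\<close>

text \<open>A factor polynomial in \<open>- ln r\<close> contributes only a multiple of
  \<open>ln (- ln r)\<close> to the numerator, negligible against \<open>ln r\<close>.\<close>

lemma log_correction_tendsto:
  fixes b :: real
  assumes "0 < b"
  shows "((\<lambda>r. t + (A + B * ln (1 + (D - ln r) / b)) / ln r) \<longlongrightarrow> t) (at_right 0)"
  using assms by real_asymp

text \<open>Passage from two sequences of scales to all radii. The dyadic scales bound
  \<open>F\<close> from above; the scales \<open>\<kappa> * \<rho> n\<close>, which shrink at most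
  by the factor \<open>\<beta>\<close> from one to the next, bound it from below. The index of a
  scale is at most of order \<open>- ln r\<close>, so the polynomial factors are harmless.\<close>

lemma local_dimension_tendsto:
  fixes F \<rho> :: "_ \<Rightarrow> real"
  assumes mono: "\<And>r r'. 0 < r \<Longrightarrow> r \<le> r' \<Longrightarrow> F r \<le> F r'"
    and up: "\<And>k r. 0 < r \<Longrightarrow> r \<le> (1/2) ^ k \<Longrightarrow> F r \<le> S * (real k + 1) ^ 3 * ((1/2) ^ k) powr t"
    and low: "\<forall>\<^sub>F n in sequentially. c / real n ^ 4 * \<rho> n powr t \<le> F (\<kappa> * \<rho> n)"
    and \<rho>: "\<And>n. 0 < \<rho> n" "\<And>n. \<rho> n \<le> \<alpha> ^ n" "\<And>n. \<beta> * \<rho> n \<le> \<rho> (Suc n)"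
    and pos: "0 < c" "0 < \<kappa>" "0 < \<alpha>" "\<alpha> < 1" "0 < \<beta>" "0 < t"
  shows "((\<lambda>r. ln (F r) / ln r) \<longlongrightarrow> t) (at_right 0)"
proof -
  \<comment> \<open>Nothing is known about the sign of \<open>S\<close>; the logarithm below needs a
    positive constant.\<close>
  define S' where "S' = max S 1"
  have S': "0 < S'" "S \<le> S'" by (simp_all add: S'_def)
  define b where "b = - ln \<alpha>"
  have b: "0 < b" using pos by (simp add: b_def)
  obtain N where N: "\<And>n. N \<le> n \<Longrightarrow> c / real n ^ 4 * \<rho> n powr t \<le> F (\<kappa> * \<rho> n)" "1 \<le> N"
    using low unfolding eventually_sequentially by (metis le_trans nat_le_linear)
  \<comment> \<open>Below \<open>r0\<close> the index chosen for a radius exceeds \<open>N\<close>,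
    so the eventual bound applies; the 1/2 keeps \<open>ln r\<close> negative.\<close>
  define r0 where "r0 = min (1/2) (Min ((\<lambda>n. \<kappa> * \<rho> n) ` {..N}))"
  have r0: "0 < r0" unfolding r0_def using pos \<rho>(1) by (simp add: Min_gr_iff)
  have lower: "0 < F r \<and> ln c - 4 * ln (1 + (ln \<kappa> - ln r) / b) + t * ln (\<beta> / \<kappa>) + t * ln r \<le> ln (F r)"
    if r: "0 < r" "r < r0" for r
  proof -
    have "(\<lambda>n. \<kappa> * \<alpha> ^ n) \<longlonglongrightarrow> \<kappa> * 0" using pos by (intro tendsto_intros LIMSEQ_realpow_zero) auto
    then have "\<forall>\<^sub>F n in sequentially. \<kappa> * \<alpha> ^ n < r" using r by (intro order_tendstoD(2)) auto
    then obtain n1 where n1: "\<kappa> * \<alpha> ^ n1 < r" by (auto simp: eventually_sequentially)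
    have "\<kappa> * \<rho> n1 \<le> \<kappa> * \<alpha> ^ n1" using pos \<rho>(2) by (intro mult_left_mono) auto
    then have ex: "\<kappa> * \<rho> n1 \<le> r" using n1 by simp
    \<comment> \<open>The first scale not above \<open>r\<close>; the preceding one exceeds
      \<open>r\<close>, which bounds \<open>\<rho> n\<close> from below by
      \<open>\<beta> / \<kappa> * r\<close> and \<open>n\<close> from above.\<close>
    define n where "n = (LEAST n. \<kappa> * \<rho> n \<le> r)"
    have n: "\<kappa> * \<rho> n \<le> r" unfolding n_def by (rule LeastI[of _ n1]) (rule ex)
    have "N < n"
    proof (rule ccontr)
      assume "\<not> N < n"
      then have "Min ((\<lambda>n. \<kappa> * \<rho> n) ` {..N}) \<le> \<kappa> * \<rho> n" by (intro Min_le) auto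
      then show False using n r(2) unfolding r0_def by linarith
    qed
    then obtain m where m: "n = Suc m" by (cases n) auto
    have rm: "r < \<kappa> * \<rho> m"
      using not_less_Least[of m "\<lambda>n. \<kappa> * \<rho> n \<le> r"] m by (simp add: n_def not_le)
    have "r < \<kappa> * \<alpha> ^ m" using rm \<rho>(2)[of m] pos by (meson less_le_trans mult_left_mono less_imp_le)
    then have "ln r < ln (\<kappa> * \<alpha> ^ m)" using r pos by (subst ln_less_cancel_iff) auto
    also have "\<dots> = ln \<kappa> - real m * b" using pos by (simp add: ln_mult ln_realpow b_def)
    finally have "real m * b < ln \<kappa> - ln r" by simp
    then have "real m \<le> (ln \<kappa> - ln r) / b" using b by (simp add: pos_le_divide_eq)
    then have n_le: "real n \<le> 1 + (ln \<kappa> - ln r) / b" by (simp add: m)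
    have n0: "0 < real n" by (simp add: m)
    have "r / \<kappa> \<le> \<rho> m" using rm pos by (simp add: pos_divide_le_eq mult.commute)
    then have "\<beta> * (r / \<kappa>) \<le> \<beta> * \<rho> m" using pos by (intro mult_left_mono) auto
    also have "\<dots> \<le> \<rho> n" using \<rho>(3)[of m] by (simp add: m)
    finally have \<rho>n: "\<beta> / \<kappa> * r \<le> \<rho> n" by simp
    have q: "0 < \<beta> / \<kappa> * r" using pos r by simp
    have "c / real n ^ 4 * (\<beta> / \<kappa> * r) powr t \<le> c / real n ^ 4 * \<rho> n powr t"
      using pos q \<rho>n by (intro mult_left_mono powr_mono2) auto
    also have "\<dots> \<le> F (\<kappa> * \<rho> n)" using N(1) \<open>N < n\<close> by simp
    also have "\<dots> \<le> F r" using n \<rho>(1)[of n] pos by (intro mono) auto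
    finally have le: "c / real n ^ 4 * (\<beta> / \<kappa> * r) powr t \<le> F r" .
    have lp: "0 < c / real n ^ 4 * (\<beta> / \<kappa> * r) powr t"
      using pos(1) q n0 by (intro mult_pos_pos divide_pos_pos zero_less_power) auto
    with le have Fp: "0 < F r" by linarith
    have "ln (c / real n ^ 4 * (\<beta> / \<kappa> * r) powr t) = ln (c / real n ^ 4) + ln ((\<beta> / \<kappa> * r) powr t)"
      using pos q n0 by (intro ln_mult_pos) auto
    also have "ln (c / real n ^ 4) = ln c - 4 * ln (real n)" using pos n0 by (simp add: ln_div ln_realpow)
    also have "ln ((\<beta> / \<kappa> * r) powr t) = t * (ln (\<beta> / \<kappa>) + ln r)"
      using q pos r ln_mult_pos[of "\<beta> / \<kappa>" r] by (simp add: ln_powr)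
    finally have "ln (c / real n ^ 4 * (\<beta> / \<kappa> * r) powr t) = ln c - 4 * ln (real n) + t * ln (\<beta> / \<kappa>) + t * ln r"
      by (simp add: distrib_left)
    moreover have "ln (c / real n ^ 4 * (\<beta> / \<kappa> * r) powr t) \<le> ln (F r)" using le lp Fp by (subst ln_le_cancel_iff)
    moreover have "ln (real n) \<le> ln (1 + (ln \<kappa> - ln r) / b)" using n_le n0 by (subst ln_le_cancel_iff) auto
    ultimately show ?thesis using Fp by linarith
  qed
  have upper: "ln (F r) \<le> ln S' + 3 * ln (1 + (0 - ln r) / ln 2) + t * ln 2 + t * ln r"
    if r: "0 < r" "r < r0" for r
  proof -
    have r1: "r < 1" using r by (simp add: r0_def)
    \<comment> \<open>Chosen so that \<open>r \<le> (1/2) ^ k \<le> 2 * r\<close>.\<close>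
    define k where "k = nat \<lfloor>- log 2 r\<rfloor>"
    have lg: "0 \<le> - log 2 r" using r r1 by (simp add: log_def divide_le_0_iff)
    then have k: "real k \<le> - log 2 r" "- log 2 r < real k + 1" unfolding k_def by linarith+
    have p2: "(1/2) ^ k = 2 powr (- real k)" by (simp add: powr_minus powr_realpow power_divide inverse_eq_divide)
    have rlog: "r = 2 powr (log 2 r)" using r by simp
    have "2 powr (log 2 r) \<le> 2 powr (- real k)" using k by (intro powr_mono) auto
    then have rk: "r \<le> (1/2) ^ k" using p2 rlog by simp
    have "2 powr (- real k) \<le> 2 powr (1 + log 2 r)" using k by (intro powr_mono) auto
    also have "\<dots> = 2 * r" using r by (simp add: powr_add)
    finally have kr: "(1/2) ^ k \<le> 2 * r" by (simp add: p2)
    have kl: "real k + 1 \<le> 1 + (0 - ln r) / ln 2" using k(1) by (simp add: log_def)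
    have g: "0 < 1 + (0 - ln r) / ln 2" using kl by linarith
    have g3: "0 \<le> S' * (1 + (0 - ln r) / ln 2) ^ 3" using S'(1) g by (intro mult_nonneg_nonneg zero_le_power) auto
    have "F r \<le> S * (real k + 1) ^ 3 * ((1/2) ^ k) powr t" by (rule up[OF r(1) rk])
    also have "\<dots> \<le> S' * (1 + (0 - ln r) / ln 2) ^ 3 * (2 * r) powr t"
      using S' kl kr pos g3 by (intro mult_mono power_mono powr_mono2) auto
    finally have "F r \<le> S' * (1 + (0 - ln r) / ln 2) ^ 3 * (2 * r) powr t" .
    then have "ln (F r) \<le> ln (S' * (1 + (0 - ln r) / ln 2) ^ 3 * (2 * r) powr t)"
      using lower[OF r] ln_mono by blast
    also have "\<dots> = ln (S' * (1 + (0 - ln r) / ln 2) ^ 3) + ln ((2 * r) powr t)"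
      using S' g r by (intro ln_mult_pos) auto
    also have "ln (S' * (1 + (0 - ln r) / ln 2) ^ 3) = ln S' + ln ((1 + (0 - ln r) / ln 2) ^ 3)"
      using S' g by (intro ln_mult_pos) auto
    also have "ln ((1 + (0 - ln r) / ln 2) ^ 3) = 3 * ln (1 + (0 - ln r) / ln 2)" using g by (simp add: ln_realpow)
    also have "ln ((2 * r) powr t) = t * (ln 2 + ln r)" using r by (simp add: ln_powr ln_mult_pos)
    finally show ?thesis by (simp add: distrib_left)
  qed
  have ev: "\<forall>\<^sub>F r in at_right 0. 0 < r \<and> r < r0"
    using r0 by (auto simp: eventually_at_right_field intro: exI[of _ r0])
  show ?thesis
  proof (rule tendsto_sandwich)
    show "((\<lambda>r. t + ((ln S' + t * ln 2) + 3 * ln (1 + (0 - ln r) / ln 2)) / ln r) \<longlongrightarrow> t) (at_right 0)"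
      by (rule log_correction_tendsto) simp
    show "((\<lambda>r. t + ((ln c + t * ln (\<beta> / \<kappa>)) + (- 4) * ln (1 + (ln \<kappa> - ln r) / b)) / ln r) \<longlongrightarrow> t) (at_right 0)"
      by (rule log_correction_tendsto) (rule b)
    show "\<forall>\<^sub>F r in at_right 0. t + ((ln S' + t * ln 2) + 3 * ln (1 + (0 - ln r) / ln 2)) / ln r \<le> ln (F r) / ln r"
      using ev
    proof eventually_elim
      case (elim r)
      then have "ln r < 0" by (simp add: r0_def)
      moreover have "t + ((ln S' + t * ln 2) + 3 * ln (1 + (0 - ln r) / ln 2)) / ln r
        = (ln S' + 3 * ln (1 + (0 - ln r) / ln 2) + t * ln 2 + t * ln r) / ln r"
        using \<open>ln r < 0\<close> by (simp add: add_divide_distrib)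
      ultimately show ?case using upper[of r] elim by (simp only: divide_right_mono_neg less_imp_le)
    qed
    show "\<forall>\<^sub>F r in at_right 0. ln (F r) / ln r \<le> t + ((ln c + t * ln (\<beta> / \<kappa>)) + (- 4) * ln (1 + (ln \<kappa> - ln r) / b)) / ln r"
      using ev
    proof eventually_elim
      case (elim r)
      then have "ln r < 0" by (simp add: r0_def)
      moreover have "t + ((ln c + t * ln (\<beta> / \<kappa>)) + (- 4) * ln (1 + (ln \<kappa> - ln r) / b)) / ln r
        = (ln c - 4 * ln (1 + (ln \<kappa> - ln r) / b) + t * ln (\<beta> / \<kappa>) + t * ln r) / ln r"
        using \<open>ln r < 0\<close> by (simp add: add_divide_distrib diff_divide_distrib)
      ultimately show ?case using lower[of r] elim by (simp only: divide_right_mono_neg less_imp_le)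
    qed
  qed
qed

context two_blocks
begin

lemma AE_local_dimension:
  assumes "prob_space \<mu>" and s: "sets \<mu> = sets word_borel" and t: "1 \<le> t" "t \<le> 2" and "0 < c"
    and low: "AE x in \<mu>. \<forall>\<^sub>F n in sequentially. c / real n ^ 2 * sv t (map x [0..<n]) \<le> measure \<mu> (cyl (map x [0..<n]))"
    and up: "AE x in \<mu>. \<exists>S. \<forall>k. measure \<mu> {y. norm (code v x - code v y) \<le> (1/2) ^ k}
      \<le> S * (real k + 1) ^ 3 * ((1/2) ^ k) powr t"
  shows "AE x in \<mu>. ((\<lambda>r. ln (measure \<mu> {y. norm (code v x - code v y) < r}) / ln r) \<longlongrightarrow> t) (at_right 0)"
proof -
  interpret prob_space \<mu> by fact
  have m: "{y. norm (code v x - code v y) < r} \<in> sets \<mu>" "{y. norm (code v x - code v y) \<le> r} \<in> sets \<mu>" for x r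
  proof -
    have "{y \<in> space word_borel. norm (code v x - code v y) < r} \<in> sets word_borel"
      "{y \<in> space word_borel. norm (code v x - code v y) \<le> r} \<in> sets word_borel" by measurable
    then show "{y. norm (code v x - code v y) < r} \<in> sets \<mu>" "{y. norm (code v x - code v y) \<le> r} \<in> sets \<mu>"
      by (simp_all add: s)
  qed
  let ?b = "translation_bound v / (1 - \<alpha>)"
  have b: "norm (code v x) \<le> ?b" for x by (rule norm_code_le) (rule translation_bound)
  have b0: "0 \<le> ?b" using translation_bound_nonneg[of v] \<alpha>_less by simp
  have "AE x in \<mu>. \<forall>\<^sub>F n in sequentially. c / real n ^ 4 * s2 (map x [0..<n]) powr t
      \<le> measure \<mu> {y. norm (code v x - code v y) < (2 + 2 * ?b) * s2 (map x [0..<n])}"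
    by (rule upper_local_dimension[OF assms(1) s low t b])
  from this up show ?thesis
  proof eventually_elim
    case (elim x)
    then obtain S where S: "\<And>k. measure \<mu> {y. norm (code v x - code v y) \<le> (1/2) ^ k}
      \<le> S * (real k + 1) ^ 3 * ((1/2) ^ k) powr t" by blast
    show ?case
    proof (rule local_dimension_tendsto[where S = S and c = c and \<rho> = "\<lambda>n. s2 (map x [0..<n])" and \<kappa> = "2 + 2 * ?b" and \<alpha> = \<alpha> and \<beta> = \<beta>])
      show "measure \<mu> {y. norm (code v x - code v y) < r} \<le> measure \<mu> {y. norm (code v x - code v y) < r'}" if "r \<le> r'" for r r'
        using that m by (intro finite_measure_mono) auto
      show "measure \<mu> {y. norm (code v x - code v y) < r} \<le> S * (real k + 1) ^ 3 * ((1/2) ^ k) powr t" if "r \<le> (1/2) ^ k" for k r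
        using that m by (intro order_trans[OF _ S] finite_measure_mono) auto
      show "s2 (map x [0..<n]) \<le> \<alpha> ^ n" for n
        using s2_bounds(1)[of "map x [0..<n]"] s1_bounds(1)[of "map x [0..<n]"] by simp
      show "\<beta> * s2 (map x [0..<n]) \<le> s2 (map x [0..<Suc n])" for n
        using s2_snoc[of "map x [0..<n]" "x n"] by simp
    qed (use elim(1) \<open>0 < c\<close> b0 \<alpha>_pos \<alpha>_less \<beta>_pos t s_pos in auto)
  qed
qed

text \<open>The second measure enters only through its total mass 1, which bounds the sums of
  \<open>G\<close>; \<open>AE_ratio\<close> then makes \<open>F\<close> comparable with
  \<open>sv t\<close>, up to \<open>n ^ 2\<close>, on all long prefixes of almost every
  word.\<close>

lemma AE_lower_Gibbs:
  fixes \<mu> \<nu> :: "(nat \<Rightarrow> 4) measure"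
  assumes "prob_space \<mu>" "sets \<mu> = sets word_borel" and "prob_space \<nu>" "sets \<nu> = sets word_borel" and "0 < c"
    and F: "\<And>w. c * F w \<le> measure \<mu> (cyl w)" "\<And>w. measure \<mu> (cyl w) \<le> C * F w" and G: "\<And>w. c * G w \<le> measure \<nu> (cyl w)"
    and pos: "\<And>w. 0 < F w" "\<And>w. 0 < G w" and sv: "\<And>w. sv t w = max (F w) (G w)"
  shows "AE x in \<mu>. \<forall>\<^sub>F n in sequentially. c / real n ^ 2 * sv t (map x [0..<n]) \<le> measure \<mu> (cyl (map x [0..<n]))"
    and "0 < C" "\<And>w. measure \<mu> (cyl w) \<le> C * sv t w"
proof -
  interpret N: prob_space \<nu> by fact
  have "0 < c * F []" using pos \<open>0 < c\<close> by simp
  also have "\<dots> \<le> C * F []" using F(1)[of "[]"] F(2)[of "[]"] by simp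
  finally show "0 < C" using pos(1)[of "[]"] by (simp add: zero_less_mult_iff)
  show "measure \<mu> (cyl w) \<le> C * sv t w" for w
  proof -
    have "C * F w \<le> C * sv t w" using \<open>0 < C\<close> by (intro mult_left_mono) (auto simp: sv)
    with F(2)[of w] show ?thesis by simp
  qed
  have U: "(UNIV :: (nat \<Rightarrow> 4) set) \<in> sets word_borel" using sets.top[of "word_borel :: (nat \<Rightarrow> 4) measure"] by simp
  have G_sum: "(\<Sum>w | length w = n. G w) \<le> 1 / c" for n
  proof -
    have "c * (\<Sum>w | length w = n. G w) \<le> (\<Sum>w | length w = n. measure \<nu> (UNIV \<inter> cyl w))"
      unfolding sum_distrib_left using G by (intro sum_mono) simp
    also have "\<dots> = measure \<nu> UNIV"
      using measure_split_cyl[OF N.finite_measure_axioms assms(4), of UNIV n] U by simp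
    also have "\<dots> \<le> 1" by simp
    finally show ?thesis using \<open>0 < c\<close> by (simp add: field_simps)
  qed
  have "AE x in \<mu>. \<forall>\<^sub>F n in sequentially. G (map x [0..<n]) \<le> real n ^ 2 * F (map x [0..<n])"
    by (rule AE_ratio[OF assms(1,2) F(2) G_sum pos \<open>0 < C\<close>])
  then show "AE x in \<mu>. \<forall>\<^sub>F n in sequentially. c / real n ^ 2 * sv t (map x [0..<n]) \<le> measure \<mu> (cyl (map x [0..<n]))"
  proof eventually_elim
    case (elim x)
    from elim eventually_ge_at_top[of 1] show ?case
    proof eventually_elim
      case (elim n)
      let ?w = "map x [0..<n]"
      have "1 \<le> real n ^ 2" using elim(2) by simp
      then have "F ?w \<le> real n ^ 2 * F ?w" using pos(1)[of ?w] mult_right_mono[of 1 "real n ^ 2" "F ?w"] by simp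
      then have "sv t ?w \<le> real n ^ 2 * F ?w" using elim(1) by (simp add: sv)
      then have "c / real n ^ 2 * sv t ?w \<le> c / real n ^ 2 * (real n ^ 2 * F ?w)"
        using \<open>0 < c\<close> by (intro mult_left_mono) auto
      also have "\<dots> = c * F ?w" using elim(2) by simp
      finally show ?case using F(1)[of ?w] by simp
    qed
  qed
qed

end

section \<open>Transfer from words to points\<close>

context separated
begin

text \<open>The set where \<open>P\<close> fails may be non-measurable. It is covered by the
  complement of the compact range together with a Borel set whose preimage is a null set of
  words.\<close>

lemma AE_distr_code:
  assumes "prob_space \<mu>" and s: "sets \<mu> = sets word_borel" and P: "AE x in \<mu>. P (code v x)"
  shows "AE z in distr \<mu> borel (code v). P z"
proof -
  have sp: "space \<mu> = UNIV" using sets_eq_imp_space_eq[OF s] by simp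
  have m: "code v \<in> borel_measurable \<mu>" by (subst measurable_cong_sets[OF s refl]) (rule code_measurable)
  obtain N where N: "{x \<in> space \<mu>. \<not> P (code v x)} \<subseteq> N" "emeasure \<mu> N = 0" "N \<in> sets \<mu>"
    using AE_E[OF P] by blast
  obtain E where E: "E \<in> sets borel" "code v -` E = N" using vimage_code_word_borel[of N] N(3) s by auto
  have R: "range (code v) \<in> sets borel" by (intro borel_compact compact_range_code)
  have "E \<union> - range (code v) \<in> null_sets (distr \<mu> borel (code v))"
  proof (rule null_setsI)
    have "code v -` (E \<union> - range (code v)) = N" using E(2) by auto
    then show "emeasure (distr \<mu> borel (code v)) (E \<union> - range (code v)) = 0"
      using E(1) R N(2) by (subst emeasure_distr[OF m]) (auto simp: sp)
  qed (use E R in auto)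
  moreover have "{z \<in> space (distr \<mu> borel (code v)). \<not> P z} \<subseteq> E \<union> - range (code v)"
  proof
    fix z assume z: "z \<in> {z \<in> space (distr \<mu> borel (code v)). \<not> P z}"
    show "z \<in> E \<union> - range (code v)"
    proof (cases "z \<in> range (code v)")
      case True
      then obtain x where "z = code v x" by auto
      with z N(1) E(2) show ?thesis by (auto simp: sp)
    qed simp
  qed
  ultimately show ?thesis by (rule AE_I')
qed

lemma exact_dimensional_code:
  assumes "prob_space \<mu>" and s: "sets \<mu> = sets word_borel"
    and AE: "AE x in \<mu>. ((\<lambda>r. ln (measure \<mu> {y. norm (code v x - code v y) < r}) / ln r) \<longlongrightarrow> t) (at_right 0)"
  shows "exact_dimensional (distr \<mu> borel (code v))" "measure_dimension (distr \<mu> borel (code v)) = t"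
proof -
  let ?m = "distr \<mu> borel (code v)"
  have sp: "space \<mu> = UNIV" using sets_eq_imp_space_eq[OF s] by simp
  have m: "code v \<in> borel_measurable \<mu>" by (subst measurable_cong_sets[OF s refl]) (rule code_measurable)
  interpret m: prob_space ?m by (rule prob_space.prob_space_distr[OF assms(1) m])
  have "measure ?m (ball (code v x) r) = measure \<mu> {y. norm (code v x - code v y) < r}" for x r
    by (subst measure_distr[OF m]) (auto simp: sp vimage_def dist_norm)
  then have "AE x in \<mu>. has_local_dimension ?m (code v x) t"
    using AE by (simp add: has_local_dimension_def)
  then have dim: "AE z in ?m. has_local_dimension ?m z t"
    by (rule AE_distr_code[OF assms(1,2)])
  then show "exact_dimensional ?m" by (auto simp: exact_dimensional_def)
  show "measure_dimension ?m = t"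
    unfolding measure_dimension_def
  proof (rule the_equality)
    show "AE z in ?m. has_local_dimension ?m z t" by (rule dim)
  next
    fix D assume "AE z in ?m. has_local_dimension ?m z D"
    with dim have "AE z in ?m. D = t"
    proof eventually_elim
      case (elim z)
      then show ?case unfolding has_local_dimension_def by (intro tendsto_unique[OF _ elim(2)[unfolded has_local_dimension_def] elim(1)[unfolded has_local_dimension_def]]) simp
    qed
    then show "D = t" by simp
  qed
qed

end

text \<open>Alternate vertices of the cube with coordinates 1 and -1, placed in the hyperplane where
  the fourth coordinate vanishes: a regular tetrahedron with circumradius \<open>sqrt 3\<close> and
  edge \<open>sqrt 8\<close>.\<close>

definition tetrahedron :: "4 \<Rightarrow> real^4" where
  "tetrahedron i = (\<chi> j. if j = 4 then 0 else if i = 4 \<or> i = j then 1 else - 1)"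

lemma norm_tetrahedron: "norm (tetrahedron i) = sqrt 3"
  using exhaust_4[of i] by (auto simp: norm_vec_def L2_set_def sum_4 tetrahedron_def)

lemma norm_tetrahedron_diff: "i \<noteq> j \<Longrightarrow> norm (tetrahedron i - tetrahedron j) = sqrt 8"
  using exhaust_4[of i] exhaust_4[of j] by (auto simp: norm_vec_def L2_set_def sum_4 tetrahedron_def)

lemma less_half:
  fixes \<alpha> :: real
  assumes "\<alpha> < 1 / (1 + sqrt (3/2))"
  shows "\<alpha> < 1/2"
proof -
  have "1 < sqrt (3/2::real)" by (simp add: real_less_rsqrt)
  then have "1 / (1 + sqrt (3/2::real)) < 1 / 2" by (simp add: divide_simps not_less)
  with assms show ?thesis by linarith
qed

text \<open>Scaled to circumradius \<open>1 - \<alpha>\<close> the tetrahedron has edges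
  \<open>sqrt 8 / sqrt 3 * (1 - \<alpha>)\<close>, and these exceed \<open>2 * \<alpha>\<close>
  exactly when \<open>\<alpha> < 1 / (1 + sqrt (3/2))\<close>, because
  \<open>sqrt 8 / sqrt 3 * sqrt (3/2) = 2\<close>. Strictness leaves room for balls of translations
  instead of points.\<close>

lemma separated_centres:
  fixes \<alpha> :: real
  assumes "0 < \<alpha>" "\<alpha> < 1 / (1 + sqrt (3/2))"
  shows "\<exists>(c :: 4 \<Rightarrow> real^4) \<epsilon>. 0 < \<epsilon> \<and> (\<forall>i. \<forall>u\<in>cball (c i) \<epsilon>. norm u + \<alpha> \<le> 1) \<and>
    (\<forall>i j. i \<noteq> j \<longrightarrow> (\<forall>u\<in>cball (c i) \<epsilon>. \<forall>w\<in>cball (c j) \<epsilon>. 2 * \<alpha> < norm (u - w)))"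
proof -
  have q: "sqrt 8 / sqrt 3 * sqrt (3/2) = 2"
    by (simp add: real_sqrt_divide real_sqrt_mult[of 4 2, simplified])
  have q1: "1 < sqrt 8 / sqrt (3::real)" "sqrt 8 / sqrt (3::real) \<le> 2"
    by (auto simp: real_less_rsqrt pos_divide_le_eq real_le_lsqrt simp flip: real_sqrt_divide intro!: real_le_lsqrt)
  have p: "0 < 1 + sqrt (3/2::real)" by (simp add: add_pos_nonneg)
  have "\<alpha> * (1 + sqrt (3/2)) < 1" using assms(2) p by (simp add: pos_less_divide_eq)
  then have a: "\<alpha> * sqrt (3/2) < 1 - \<alpha>" by (simp add: distrib_left)
  have a1: "\<alpha> < 1" using less_half[OF assms(2)] by simp
  define D where "D = sqrt 8 / sqrt 3 * (1 - \<alpha>) - 2 * \<alpha>"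
  have "sqrt 8 / sqrt 3 * (\<alpha> * sqrt (3/2)) < sqrt 8 / sqrt 3 * (1 - \<alpha>)"
    using q1 a by (intro mult_strict_left_mono) auto
  also have "sqrt 8 / sqrt 3 * (\<alpha> * sqrt (3/2)) = \<alpha> * (sqrt 8 / sqrt 3 * sqrt (3/2))" by simp
  finally have D: "0 < D" unfolding q D_def by linarith
  \<comment> \<open>Shrinking the circumradius by \<open>\<epsilon>\<close> costs at most
    \<open>2 * \<epsilon>\<close> of the edge and moving the two centres costs another
    \<open>2 * \<epsilon>\<close>; both fit into \<open>D\<close>. The second bound keeps the
    circumradius positive.\<close>
  define \<epsilon> where "\<epsilon> = min (D / 8) ((1 - \<alpha>) / 2)"
  have \<epsilon>: "0 < \<epsilon>" "8 * \<epsilon> \<le> D" "2 * \<epsilon> \<le> 1 - \<alpha>" using D a1 by (simp_all add: \<epsilon>_def min_def)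
  define c where "c i = ((1 - \<alpha> - \<epsilon>) / sqrt 3) *\<^sub>R tetrahedron i" for i
  have nc: "norm (c i) = 1 - \<alpha> - \<epsilon>" for i using \<epsilon> by (simp add: c_def norm_tetrahedron)
  have nd: "norm (c i - c j) = (1 - \<alpha> - \<epsilon>) * (sqrt 8 / sqrt 3)" if "i \<noteq> j" for i j
  proof -
    have "c i - c j = ((1 - \<alpha> - \<epsilon>) / sqrt 3) *\<^sub>R (tetrahedron i - tetrahedron j)" by (simp add: c_def scaleR_right_diff_distrib)
    then show ?thesis using \<epsilon> that by (simp add: norm_tetrahedron_diff)
  qed
  show ?thesis
  proof (intro exI conjI allI ballI impI)
    show "0 < \<epsilon>" by fact
  next
    fix i u assume u: "u \<in> cball (c i) \<epsilon>"
    have "norm u \<le> norm (c i) + norm (c i - u)" by norm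
    then show "norm u + \<alpha> \<le> 1" using u nc[of i] by (simp add: dist_norm)
  next
    fix i j u w assume ij: "i \<noteq> j" and u: "u \<in> cball (c i) \<epsilon>" and w: "w \<in> cball (c j) \<epsilon>"
    have "norm (c i - c j) \<le> norm (c i - u) + norm (u - w) + norm (c j - w)" by norm
    then have "norm (c i - c j) \<le> norm (u - w) + 2 * \<epsilon>" using u w by (simp add: dist_norm)
    moreover have "norm (c i - c j) = D + 2 * \<alpha> - \<epsilon> * (sqrt 8 / sqrt 3)"
      unfolding nd[OF ij] D_def by (simp only: left_diff_distrib right_diff_distrib mult.commute mult_1_right mult_1)
    moreover have "\<epsilon> * (sqrt 8 / sqrt 3) \<le> \<epsilon> * 2" using \<epsilon> q1 by (intro mult_left_mono) auto
    ultimately show "2 * \<alpha> < norm (u - w)" using \<epsilon> by linarith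
  qed
qed

text \<open>The lower dimension bound holds for almost every choice of translations, for each
  measure separately. One choice serving both exists because two null sets do not exhaust the
  product of the balls, and separation holds throughout that product.\<close>

lemma (in two_blocks) exists_separated_exact_dimensional:
  assumes \<alpha>: "\<alpha> < 1 / (1 + sqrt (3/2))" and \<alpha>\<beta>: "1/16 < \<alpha> * \<beta>"
  defines "s \<equiv> affinity_dimension LB"
  obtains v :: "4 \<Rightarrow> real^4" and \<mu> \<nu> :: "(nat \<Rightarrow> 4) measure" where "separated LB \<alpha> v 1"
    "shift_invariant_prob \<mu>" "shift_invariant_prob \<nu>"
    "\<And>w. 0 < measure \<mu> (cyl w)" "\<And>w. 0 < measure \<nu> (cyl w)"
    "\<exists>A\<in>sets word_borel. emeasure \<mu> A = 0 \<and> emeasure \<nu> (UNIV - A) = 0"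
    "exact_dimensional (distr \<mu> borel (code v))" "measure_dimension (distr \<mu> borel (code v)) = s"
    "exact_dimensional (distr \<nu> borel (code v))" "measure_dimension (distr \<nu> borel (code v)) = s"
proof -
  have \<alpha>2: "\<alpha> < 1/2" by (rule less_half[OF \<alpha>])
  have s: "1 \<le> s" "s \<le> 2" using affinity_dimension_LB[OF \<alpha>\<beta> \<alpha>2] by (simp_all add: s_def)
  obtain \<mu> \<nu> c C where \<mu>: "shift_invariant_prob \<mu>" and \<nu>: "shift_invariant_prob \<nu>" and c: "0 < c"
    and F: "\<And>w. c * pot s (2 - s) 0 (s - 1) w \<le> measure \<mu> (cyl w)" "\<And>w. measure \<mu> (cyl w) \<le> C * pot s (2 - s) 0 (s - 1) w"
    and G: "\<And>w. c * pot (2 - s) s (s - 1) 0 w \<le> measure \<nu> (cyl w)" "\<And>w. measure \<nu> (cyl w) \<le> C * pot (2 - s) s (s - 1) 0 w"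
    and sing: "\<exists>A\<in>sets word_borel. emeasure \<mu> A = 0 \<and> emeasure \<nu> (UNIV - A) = 0"
    unfolding s_def by (rule gibbs_measures[OF \<alpha>\<beta> \<alpha>2]) blast
  have p: "prob_space \<mu>" "sets \<mu> = sets word_borel" "prob_space \<nu>" "sets \<nu> = sets word_borel"
    using \<mu> \<nu> by (auto simp: shift_invariant_prob_def)
  have sv: "sv s w = max (pot s (2 - s) 0 (s - 1) w) (pot (2 - s) s (s - 1) 0 w)" for w
    by (rule sv_eq_1_2[OF s])
  have s2Y: "sv s w = max (pot (2 - s) s (s - 1) 0 w) (pot s (2 - s) 0 (s - 1) w)" for w
    unfolding sv by (rule max.commute)
  note L = AE_lower_Gibbs[where F = "pot s (2 - s) 0 (s - 1)" and G = "pot (2 - s) s (s - 1) 0", OF p c F G(1) pot_pos pot_pos sv]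
    AE_lower_Gibbs[where F = "pot (2 - s) s (s - 1) 0" and G = "pot s (2 - s) 0 (s - 1)", OF p(3,4,1,2) c G F(1) pot_pos pot_pos s2Y]
  obtain ce :: "4 \<Rightarrow> real^4" and \<epsilon> where \<epsilon>: "0 < \<epsilon>" and ce: "\<forall>i. \<forall>u\<in>cball (ce i) \<epsilon>. norm u + \<alpha> \<le> 1"
    "\<forall>i j. i \<noteq> j \<longrightarrow> (\<forall>u\<in>cball (ce i) \<epsilon>. \<forall>w\<in>cball (ce j) \<epsilon>. 2 * \<alpha> < norm (u - w))"
    using separated_centres[OF \<alpha>_pos \<alpha>] by (elim exE conjE) (rule that)
  interpret P: prob_space "random_translations ce \<epsilon>" by (rule prob_space_random_translations[OF \<epsilon>])
  let ?N = "\<lambda>\<mu> v. AE x in \<mu>. \<exists>S. \<forall>k. measure \<mu> {y. norm (code v x - code v y) \<le> (1/2) ^ k} \<le> S * (real k + 1) ^ 3 * ((1/2) ^ k) powr s"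
  have "AE v in random_translations ce \<epsilon>. \<forall>i\<in>UNIV. v i \<in> cball (ce i) \<epsilon>"
    using AE_random_translations[OF \<epsilon>] by (intro AE_finite_allI) auto
  moreover have "AE v in random_translations ce \<epsilon>. ?N \<mu> v" "AE v in random_translations ce \<epsilon>. ?N \<nu> v"
    by (rule lower_local_dimension[OF \<epsilon> \<alpha>2 s p(1,2) L(3,2)], rule lower_local_dimension[OF \<epsilon> \<alpha>2 s p(3,4) L(6,5)])
  ultimately have "AE v in random_translations ce \<epsilon>. (\<forall>i\<in>UNIV. v i \<in> cball (ce i) \<epsilon>) \<and> ?N \<mu> v \<and> ?N \<nu> v" by eventually_elim blast
  then have "\<exists>v. (\<forall>i\<in>UNIV. v i \<in> cball (ce i) \<epsilon>) \<and> ?N \<mu> v \<and> ?N \<nu> v"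
    by (rule eventually_happens'[OF P.ae_filter_bot])
  then obtain v where v: "\<forall>i\<in>UNIV. v i \<in> cball (ce i) \<epsilon>" and N: "?N \<mu> v" "?N \<nu> v" by (elim exE conjE) (rule that)
  have sep: "separated LB \<alpha> v 1"
  proof
    show "norm (v i) + \<alpha> * 1 \<le> 1" for i using ce(1)[rule_format, OF v[rule_format, OF UNIV_I], of i] by simp
    show "2 * \<alpha> * 1 < norm (v i - v j)" if "i \<noteq> j" for i j
      using ce(2)[rule_format, OF that v[rule_format, OF UNIV_I] v[rule_format, OF UNIV_I]] by simp
    show "inj ((*v) (LB i))" for i
    proof (rule inj_matrix_vector_mult)
      show "invertible (LB i)" unfolding LB_def
        using det_L_pos[of i] by (intro invertible_kronecker4) (auto simp: invertible_det_nz)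
    qed
  qed simp
  interpret S: separated LB \<alpha> v 1 by fact
  note dims = AE_local_dimension[OF p(1,2) s c L(1) N(1)] AE_local_dimension[OF p(3,4) s c L(4) N(2)]
  show ?thesis
  proof (rule that[OF sep \<mu> \<nu> _ _ sing])
    show "0 < measure \<mu> (cyl w)" for w by (rule less_le_trans[OF mult_pos_pos[OF c pot_pos] F(1)])
    show "0 < measure \<nu> (cyl w)" for w by (rule less_le_trans[OF mult_pos_pos[OF c pot_pos] G(1)])
  qed (rule S.exact_dimensional_code[OF p(1,2) dims(1)] S.exact_dimensional_code[OF p(3,4) dims(2)])+
qed

theorem theorem2:
  fixes \<alpha>\<^sub>1 \<alpha>\<^sub>2 \<theta> :: real
    and A\<^sub>1 A\<^sub>2 :: "real^4^4"
    and B :: "4 \<Rightarrow> real^4^4"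
  assumes "0 < \<alpha>\<^sub>2" and "\<alpha>\<^sub>2 < \<alpha>\<^sub>1" and "\<alpha>\<^sub>1 < 1 / (1 + sqrt (3/2))"
    and "\<alpha>\<^sub>1 * \<alpha>\<^sub>2 > 1/16"
    and "\<theta> \<notin> range (\<lambda>k::int. pi / 2 * of_int k)"
    and "A\<^sub>1 = kronecker4 (diag2 \<alpha>\<^sub>1 \<alpha>\<^sub>2) (rot2 \<theta>)"
    and "A\<^sub>2 = kronecker4 (rot2 \<theta>) (diag2 \<alpha>\<^sub>1 \<alpha>\<^sub>2)"
    and "B 1 = A\<^sub>1" and "B 2 = A\<^sub>1" and "B 3 = A\<^sub>2" and "B 4 = A\<^sub>2"
  shows "\<exists>(v :: 4 \<Rightarrow> real^4) T.
           T = (\<lambda>i x. B i *v x + v i) \<and>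
           iterated_function_system T \<and>
           strong_separation T \<and>
           1 < affinity_dimension B \<and> affinity_dimension B < 2 \<and>
           (\<exists>\<mu>\<^sub>1 \<mu>\<^sub>2 m\<^sub>1 m\<^sub>2.
              shift_invariant_prob \<mu>\<^sub>1 \<and> shift_invariant_prob \<mu>\<^sub>2 \<and>
              m\<^sub>1 = distr \<mu>\<^sub>1 borel (coding_map T) \<and>
              m\<^sub>2 = distr \<mu>\<^sub>2 borel (coding_map T) \<and>
              mutually_singular m\<^sub>1 m\<^sub>2 \<and>
              exact_dimensional m\<^sub>1 \<and> measure_dimension m\<^sub>1 = affinity_dimension B \<and>
              exact_dimensional m\<^sub>2 \<and> measure_dimension m\<^sub>2 = affinity_dimension B \<and>
              measure_support m\<^sub>1 = attractor T \<and>
              measure_support m\<^sub>2 = attractor T)"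
proof -
  have \<alpha>2: "\<alpha>\<^sub>1 < 1/2" by (rule less_half[OF assms(3)])
  have "sin \<theta> \<noteq> 0"
  proof
    assume "sin \<theta> = 0"
    then obtain i :: int where "\<theta> = of_int i * pi" by (auto simp: sin_zero_iff_int2)
    then have "\<theta> = pi / 2 * of_int (2 * i)" by simp
    with assms(5) show False by blast
  qed
  interpret two_blocks \<alpha>\<^sub>1 \<alpha>\<^sub>2 \<theta> using assms(1,2) \<alpha>2 \<open>sin \<theta> \<noteq> 0\<close> by unfold_locales auto
  have B: "B = LB"
  proof
    show "B i = LB i" for i using exhaust_4[of i] assms by (auto simp: LB_def LX_def LY_def)
  qed
  obtain v and \<mu> \<nu> :: "(nat \<Rightarrow> 4) measure" where sep: "separated LB \<alpha>\<^sub>1 v 1"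
    and inv: "shift_invariant_prob \<mu>" "shift_invariant_prob \<nu>"
    and pos: "\<And>w. 0 < measure \<mu> (cyl w)" "\<And>w. 0 < measure \<nu> (cyl w)"
    and sing: "\<exists>A\<in>sets word_borel. emeasure \<mu> A = 0 \<and> emeasure \<nu> (UNIV - A) = 0"
    and dims: "exact_dimensional (distr \<mu> borel (code v))" "measure_dimension (distr \<mu> borel (code v)) = affinity_dimension LB"
      "exact_dimensional (distr \<nu> borel (code v))" "measure_dimension (distr \<nu> borel (code v)) = affinity_dimension LB"
    by (rule exists_separated_exact_dimensional[OF assms(3,4)]) (rule that)
  interpret S: separated LB \<alpha>\<^sub>1 v 1 by fact
  have p: "prob_space \<mu>" "sets \<mu> = sets word_borel" "prob_space \<nu>" "sets \<nu> = sets word_borel"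
    using inv by (auto simp: shift_invariant_prob_def)
  obtain A where A: "A \<in> sets word_borel" "emeasure \<mu> A = 0" "emeasure \<nu> (UNIV - A) = 0" using sing by blast
  have cm: "coding_map (T v) = code v" by (rule ext) (rule coding_map_eq)
  show ?thesis
    unfolding B
  proof (intro exI conjI)
    show "T v = (\<lambda>i x. LB i *v x + v i)" ..
    show "iterated_function_system (T v)" by (rule iterated_function_system_T)
    show "strong_separation (T v)" by (rule S.strong_separation_T)
    show "1 < affinity_dimension LB" "affinity_dimension LB < 2"
      using affinity_dimension_LB[OF assms(4) \<alpha>2] by auto
    show "shift_invariant_prob \<mu>" "shift_invariant_prob \<nu>" by fact+
    show "distr \<mu> borel (code v) = distr \<mu> borel (coding_map (T v))" "distr \<nu> borel (code v) = distr \<nu> borel (coding_map (T v))"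
      by (simp_all add: cm)
    show "mutually_singular (distr \<mu> borel (code v)) (distr \<nu> borel (code v))"
      by (rule S.mutually_singular_code[OF p(2,4) A])
    show "measure_support (distr \<mu> borel (code v)) = attractor (T v)" "measure_support (distr \<nu> borel (code v)) = attractor (T v)"
      using measure_support_code[OF p(1,2) pos(1)] measure_support_code[OF p(3,4) pos(2)] by (simp_all add: attractor_eq)
  qed (fact dims)+
qed

end
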